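(* Let $R$ be a reduced and indecomposable commutative ring, and let $(\Sigma,i,q)$ be a discrete $R$-twist over an ample Hausdorff groupoid $G$. Let $\mathcal I$ denote the interior of the isotropy of $G$, and suppose that there is a dense set $X\subseteq G^{(0)}$ such that for each $x\in X$, the group $\mathcal I_x=\{\gamma\in\mathcal I:s(\gamma)=x\}$ satisfies the unique product property. Let $A=A_R(G;\Sigma)$ and $B=A_R(G^{(0)};q^{-1}(G^{(0)}))\subseteq A$. Then $(A,B)$ is an algebraic quasi-Cartan pair, and the map $\Phi\colon\Sigma\to\Sigma'$, $\Phi(\sigma)=(\tilde1_YU_{s(\sigma)})^\uparrow$ (with $Y$ any compact open bisection of $\Sigma$ containing $\sigma$), from $\Sigma$ to the twist $\Sigma'$ of ultrafilters of $N(B)$ is an isomorphism of twists.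
   Context: **Rings, groups, groupoids.** A commutative ring $R$ with identity is indecomposable if $0\neq1$ and its only idempotents are $0$ and $1$; reduced if it has no nonzero nilpotents. $R^\times$ is its group of units (discrete topology). A group $H$ has the unique product property if for any finite nonempty $C,D\subseteq H$ some element of $CD$ can be uniquely written as $cd$ with $c\in C,d\in D$ (e.g. right-orderable groups). Groupoids are locally compact topological groupoids with Hausdorff unit space $G^{(0)}$ and range/source maps $r,s$. A bisection is a subset $D$ contained in an open set $O$ such that $r|_O,s|_O$ are homeomorphisms onto open subsets of $G^{(0)}$. $G$ is étale if $r$ is a local homeomorphism, and ample if it is étale with a basis of compact open bisections. The isotropy of $G$ is $\{\gamma:r(\gamma)=s(\gamma)\}$. **Twists.** A discrete $R$-twist $(\Sigma,i,q)$ over an étale groupoid $G$ is a sequence $G^{(0)}\times R^\times\xrightarrow{i}\Sigma\xrightarrow{q}G$, where $G^{(0)}\times R^\times$ is the trivial group bundle, $\Sigma$ is a topological groupoid with $\Sigma^{(0)}=i(G^{(0)}\times\{1\})$ (identified with $G^{(0)}$), and $i,q$ are continuous groupoid homomorphisms restricting to homeomorphisms of unit spaces, such that: (DT1) $i(\{x\}\times R^\times)=q^{-1}(x)$ for $x\in G^{(0)}$, $i$ injective, $q$ surjective; (DT2) each $\alpha\in G$ has an open bisection $B_\alpha\ni\alpha$ and a continuous $P_\alpha\colon B_\alpha\to\Sigma$ with $q\circ P_\alpha=\mathrm{id}$ and $(\beta,t)\mapsto i(r(\beta),t)P_\alpha(\beta)$ a homeomorphism $B_\alpha\times R^\times\to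 q^{-1}(B_\alpha)$; (DT3) $i(r(\sigma),t)\sigma=\sigma i(s(\sigma),t)$. Write $t\cdot\sigma=i(r(\sigma),t)\sigma$. **Twisted Steinberg algebra.** $\operatorname{supp}(f)=\{f\neq0\}$, $\operatorname{supp}_G(f)=q(\operatorname{supp}(f))$. $A_R(G;\Sigma)$ is the set of locally constant $f\colon\Sigma\to R$ with $f(t\cdot\sigma)=t^{-1}f(\sigma)$ for $t\in R^\times$ and $q(\operatorname{supp}(f))$ compact; it is an $R$-algebra under pointwise operations and $(f*g)(\sigma)=\sum_{\alpha\in r^{-1}(r(\sigma))\cap\operatorname{supp}_G(f)}f(S(\alpha))g(S(\alpha)^{-1}\sigma)$, with $S\colon\operatorname{supp}_G(f)\to\operatorname{supp}(f)$ any section for $q$. $A_R(G^{(0)};q^{-1}(G^{(0)}))$ is the commutative subalgebra of those $f$ supported in $q^{-1}(G^{(0)})$. For a compact open bisection $Y\subseteq\Sigma$, $\tilde1_Y$ is the unique element of $A_R(G;\Sigma)$ with support in $R^\times\cdot Y$ and equal to $1$ on $Y$. **Normalisers and pairs.** $I(B)$ is the set of idempotents of $B$, called a set of local units for $A$ if every finite $\{a_1,\dots,a_n\}\subseteq A$ admits $e\in I(B)$ with $ea_i=a_i=a_ie$. $N(B)=\{n\in A:\exists k\in A,\ knk=k,\ nkn=n,\ kBn\cup nBk\subseteq B\}$; $k$ is unique, denoted $n^\dagger$; $n\le m\iff n=nn^\dagger m$. A conditional expectation $P\colon A\to B$ is $R$-linear with $P|_B=\mathrm{id}_B$, $P(bab')=bP(a)b'$;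 it is faithful if for each $a\neq0$ there is $n\in N(B)$ with $P(na)\neq0$, and implemented by idempotents if for each $n\in N(B)$ there is $e\in I(B)$ with $P(n)=ne=en$. $(A,B)$ is an algebraic quasi-Cartan pair if $te=0$ with $t\in R$, $e\in I(B)\setminus\{0\}$ implies $t=0$; $I(B)$ is a set of local units for $A$; $B=\operatorname{span}_RI(B)$; $A=\operatorname{span}_RN(B)$; and there is a faithful conditional expectation $A\to B$ implemented by idempotents. **The twist $\Sigma'$.** $U^\uparrow=\{m\in N(B):n\le m\text{ for some }n\in U\}$. A filter is $U\subseteq N(B)\setminus\{0\}$ with $U=U^\uparrow$ in which any two elements have a common lower bound in $U$; an ultrafilter is a maximal (nonempty) filter. $\Sigma'$ is the set of ultrafilters, with $U^{-1}=\{n^\dagger:n\in U\}$; $(U,V)$ composable iff $mn\ne0$ for all $m\in U,n\in V$, and then $UV=\{mn:m\in U,n\in V\}^\uparrow$; topology with basis $\mathcal V_n=\{U:n\in U\}$, $n\in N(B)$; $tU=\{tm:m\in U\}$ for $t\in R^\times$. $q'\colon\Sigma'\to G'$ is the quotient by $U\simeq W\iff U=tW$ for some $t\in R^\times$ (quotient topology, induced groupoid structure), and $i'(q'(U),t)=tU$ for $U\in\Sigma'^{(0)}$; $(\Sigma',i',q')$ is a discrete $R$-twist over $G'$. For $x\in\Sigma^{(0)}$, $U_x=\{e\in I(B):e(x)=1\}$; $\Phi(\sigma)$ is an ultrafilter independent of the choice of $Y$. That $\Phi$ is an isomorphism of twists means: $\Phi$ is an isomorphism of topological groupoids, and $\Phi_G\colon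 G\to G'$, $\Phi_G(q(\sigma))=q'(\Phi(\sigma))$, is a well-defined isomorphism of topological groupoids with $\Phi\circ i=i'\circ(\Phi_G|_{G^{(0)}}\times\mathrm{id})$. *)

theory Defs
  imports
    "HOL-Analysis.Analysis"
    "HOL-Algebra.Module"
    "HOL-Decision_Procs.Algebra_Aux"
begin

section \<open>Rings and groups\<close>

definition reduced_ring :: "'r::comm_ring_1 itself \<Rightarrow> bool" where
  "reduced_ring _ \<longleftrightarrow> (\<forall>a::'r. \<forall>n::nat. a ^ n = 0 \<longrightarrow> a = 0)"

text \<open>The condition \<open>0 \<noteq> 1\<close> is part of the class \<^class>\<open>comm_ring_1\<close>.\<close>

definition indecomposable_ring :: "'r::comm_ring_1 itself \<Rightarrow> bool" where
  "indecomposable_ring _ \<longleftrightarrow> (\<forall>e::'r. e * e = e \<longrightarrow> e = 0 \<or> e = 1)"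

definition ring_units :: "'r::comm_ring_1 set" where
  "ring_units = {t. t dvd 1}"

definition unit_inverse :: "'r::comm_ring_1 \<Rightarrow> 'r" where
  "unit_inverse t = (THE u. t * u = 1)"

definition unique_product_property :: "('a, 'b) monoid_scheme \<Rightarrow> bool" where
  "unique_product_property H \<longleftrightarrow>
    (\<forall>C D. finite C \<and> C \<noteq> {} \<and> C \<subseteq> carrier H \<and> finite D \<and> D \<noteq> {} \<and> D \<subseteq> carrier H \<longrightarrow>
      (\<exists>h. \<exists>!p. p \<in> C \<times> D \<and> fst p \<otimes>\<^bsub>H\<^esub> snd p = h))"


section \<open>Topological groupoids\<close>

text \<open>A groupoid is given by its space of arrows, the set of composable pairs, the partial
  multiplication and the inversion. Range and source are the derived maps
  \<open>a \<mapsto> a a\<^sup>-\<^sup>1\<close> and \<open>a \<mapsto> a\<^sup>-\<^sup>1 a\<close>, and units are identified with identity arrows.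
  The values of the operations outside the arrows are irrelevant.\<close>

record 'a groupoid =
  arrow_topology :: "'a topology"
  composable :: "('a \<times> 'a) set"
  gmult :: "'a \<Rightarrow> 'a \<Rightarrow> 'a"
  ginv :: "'a \<Rightarrow> 'a"

abbreviation arrows :: "'a groupoid \<Rightarrow> 'a set" where
  "arrows G \<equiv> topspace (arrow_topology G)"

definition rng :: "'a groupoid \<Rightarrow> 'a \<Rightarrow> 'a" where
  "rng G a = gmult G a (ginv G a)"

definition src :: "'a groupoid \<Rightarrow> 'a \<Rightarrow> 'a" where
  "src G a = gmult G (ginv G a) a"

definition units :: "'a groupoid \<Rightarrow> 'a set" where
  "units G = rng G ` arrows G"

abbreviation unit_space :: "'a groupoid \<Rightarrow> 'a topology" where
  "unit_space G \<equiv> subtopology (arrow_topology G) (units G)"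

text \<open>The axioms imply that \<open>(a, b)\<close> is composable if and only if \<open>src G a = rng G b\<close>.\<close>

definition algebraic_groupoid :: "'a groupoid \<Rightarrow> bool" where
  "algebraic_groupoid G \<longleftrightarrow>
    composable G \<subseteq> arrows G \<times> arrows G \<and>
    (\<forall>(a, b) \<in> composable G. gmult G a b \<in> arrows G) \<and>
    (\<forall>a \<in> arrows G. ginv G a \<in> arrows G \<and> ginv G (ginv G a) = a \<and>
       (ginv G a, a) \<in> composable G \<and> (a, ginv G a) \<in> composable G) \<and>
    (\<forall>a b c. (a, b) \<in> composable G \<and> (b, c) \<in> composable G \<longrightarrow>
       (gmult G a b, c) \<in> composable G \<and> (a, gmult G b c) \<in> composable G \<and>
       gmult G (gmult G a b) c = gmult G a (gmult G b c)) \<and>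
    (\<forall>(a, b) \<in> composable G.
       gmult G (ginv G a) (gmult G a b) = b \<and> gmult G (gmult G a b) (ginv G b) = a)"

text \<open>Topological groupoids are assumed throughout to be locally compact with Hausdorff unit space;
  the space of arrows itself need not be Hausdorff.\<close>

definition topological_groupoid :: "'a groupoid \<Rightarrow> bool" where
  "topological_groupoid G \<longleftrightarrow>
    algebraic_groupoid G \<and>
    continuous_map
      (subtopology (prod_topology (arrow_topology G) (arrow_topology G)) (composable G))
      (arrow_topology G) (\<lambda>(a, b). gmult G a b) \<and>
    continuous_map (arrow_topology G) (arrow_topology G) (ginv G) \<and>
    locally_compact_space (arrow_topology G) \<and>
    Hausdorff_space (unit_space G)"

text \<open>\<open>f\<close> restricts to a homeomorphism from the open set \<open>W\<close> onto an open subset of \<open>G\<^sup>(\<^sup>0\<^sup>)\<close>.\<close>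

definition homeo_onto_open_units :: "'a groupoid \<Rightarrow> 'a set \<Rightarrow> ('a \<Rightarrow> 'a) \<Rightarrow> bool" where
  "homeo_onto_open_units G W f \<longleftrightarrow>
    openin (arrow_topology G) W \<and> openin (unit_space G) (f ` W) \<and>
    homeomorphic_map (subtopology (arrow_topology G) W) (subtopology (unit_space G) (f ` W)) f"

definition bisection :: "'a groupoid \<Rightarrow> 'a set \<Rightarrow> bool" where
  "bisection G D \<longleftrightarrow>
    (\<exists>W. D \<subseteq> W \<and> homeo_onto_open_units G W (rng G) \<and> homeo_onto_open_units G W (src G))"

definition compact_open_bisection :: "'a groupoid \<Rightarrow> 'a set \<Rightarrow> bool" where
  "compact_open_bisection G D \<longleftrightarrow>
    compactin (arrow_topology G) D \<and> openin (arrow_topology G) D \<and> bisection G D"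

definition etale_groupoid :: "'a groupoid \<Rightarrow> bool" where
  "etale_groupoid G \<longleftrightarrow> topological_groupoid G \<and>
    (\<forall>a \<in> arrows G. \<exists>W. a \<in> W \<and> homeo_onto_open_units G W (rng G))"

definition ample_groupoid :: "'a groupoid \<Rightarrow> bool" where
  "ample_groupoid G \<longleftrightarrow> etale_groupoid G \<and>
    openin (arrow_topology G) = arbitrary union_of compact_open_bisection G"

definition isotropy :: "'a groupoid \<Rightarrow> 'a set" where
  "isotropy G = {a \<in> arrows G. rng G a = src G a}"

definition interior_isotropy_group :: "'a groupoid \<Rightarrow> 'a \<Rightarrow> 'a monoid" where
  "interior_isotropy_group G x =
    \<lparr>carrier = {a \<in> arrow_topology G interior_of isotropy G. src G a = x},
     mult = gmult G, one = x\<rparr>"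

definition groupoid_hom :: "'a groupoid \<Rightarrow> 'b groupoid \<Rightarrow> ('a \<Rightarrow> 'b) \<Rightarrow> bool" where
  "groupoid_hom G H \<phi> \<longleftrightarrow> \<phi> \<in> arrows G \<rightarrow> arrows H \<and>
    (\<forall>(a, b) \<in> composable G.
       (\<phi> a, \<phi> b) \<in> composable H \<and> \<phi> (gmult G a b) = gmult H (\<phi> a) (\<phi> b))"

definition topological_groupoid_iso :: "'a groupoid \<Rightarrow> 'b groupoid \<Rightarrow> ('a \<Rightarrow> 'b) \<Rightarrow> bool" where
  "topological_groupoid_iso G H \<phi> \<longleftrightarrow>
    homeomorphic_map (arrow_topology G) (arrow_topology H) \<phi> \<and> groupoid_hom G H \<phi> \<and>
    (\<forall>a \<in> arrows G. \<forall>b \<in> arrows G. (\<phi> a, \<phi> b) \<in> composable H \<longrightarrow> (a, b) \<in> composable G)"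


section \<open>Discrete twists\<close>

definition trivial_bundle :: "'g groupoid \<Rightarrow> ('g \<times> 'r::comm_ring_1) groupoid" where
  "trivial_bundle G =
    \<lparr>arrow_topology = prod_topology (unit_space G) (discrete_topology ring_units),
     composable = {((x, t), (y, u)). x = y \<and> x \<in> units G \<and> t \<in> ring_units \<and> u \<in> ring_units},
     gmult = (\<lambda>(x, t) (y, u). (x, t * u)),
     ginv = (\<lambda>(x, t). (x, unit_inverse t))\<rparr>"

text \<open>The unit space of \<open>\<Sigma>\<close> is identified with that of \<open>G\<close> by \<open>q\<close>, whose inverse
  is \<open>x \<mapsto> i (x, 1)\<close>; hence a formula such as \<open>i(r(\<sigma>), t)\<close> is read as \<open>i (q (rng \<Sigma> \<sigma>), t)\<close>.\<close>

definition twist_action ::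
  "'s groupoid \<Rightarrow> ('g \<times> 'r::comm_ring_1 \<Rightarrow> 's) \<Rightarrow> ('s \<Rightarrow> 'g) \<Rightarrow> 'r \<Rightarrow> 's \<Rightarrow> 's" where
  "twist_action \<Sigma> i q t \<sigma> = gmult \<Sigma> (i (q (rng \<Sigma> \<sigma>), t)) \<sigma>"

definition discrete_twist ::
  "'s groupoid \<Rightarrow> ('g \<times> 'r::comm_ring_1 \<Rightarrow> 's) \<Rightarrow> ('s \<Rightarrow> 'g) \<Rightarrow> 'g groupoid \<Rightarrow> bool" where
  "discrete_twist \<Sigma> i q G \<longleftrightarrow>
    etale_groupoid G \<and> topological_groupoid \<Sigma> \<and>
    units \<Sigma> = i ` (units G \<times> {1}) \<and>
    continuous_map (arrow_topology (trivial_bundle G)) (arrow_topology \<Sigma>) i \<and>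
    groupoid_hom (trivial_bundle G) \<Sigma> i \<and>
    homeomorphic_map (unit_space (trivial_bundle G)) (unit_space \<Sigma>) i \<and>
    continuous_map (arrow_topology \<Sigma>) (arrow_topology G) q \<and>
    groupoid_hom \<Sigma> G q \<and>
    homeomorphic_map (unit_space \<Sigma>) (unit_space G) q \<and>
    \<comment> \<open>(DT1)\<close>
    (\<forall>x \<in> units G. i ` ({x} \<times> ring_units) = {\<sigma> \<in> arrows \<Sigma>. q \<sigma> = x}) \<and>
    inj_on i (units G \<times> ring_units) \<and>
    q ` arrows \<Sigma> = arrows G \<and>
    \<comment> \<open>(DT2)\<close>
    (\<forall>\<alpha> \<in> arrows G. \<exists>D P. \<alpha> \<in> D \<and> openin (arrow_topology G) D \<and> bisection G D \<and>
       continuous_map (subtopology (arrow_topology G) D) (arrow_topology \<Sigma>) P \<and>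
       (\<forall>\<beta> \<in> D. q (P \<beta>) = \<beta>) \<and>
       homeomorphic_map
         (prod_topology (subtopology (arrow_topology G) D) (discrete_topology ring_units))
         (subtopology (arrow_topology \<Sigma>) {\<sigma> \<in> arrows \<Sigma>. q \<sigma> \<in> D})
         (\<lambda>(\<beta>, t). gmult \<Sigma> (i (rng G \<beta>, t)) (P \<beta>))) \<and>
    \<comment> \<open>(DT3)\<close>
    (\<forall>\<sigma> \<in> arrows \<Sigma>. \<forall>t \<in> ring_units.
       gmult \<Sigma> (i (q (rng \<Sigma> \<sigma>), t)) \<sigma> = gmult \<Sigma> \<sigma> (i (q (src \<Sigma> \<sigma>), t)))"

definition twist_isomorphism ::
  "'s groupoid \<Rightarrow> ('g \<times> 'r::comm_ring_1 \<Rightarrow> 's) \<Rightarrow> ('s \<Rightarrow> 'g) \<Rightarrow> 'g groupoid \<Rightarrow>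
   't groupoid \<Rightarrow> ('h \<times> 'r \<Rightarrow> 't) \<Rightarrow> ('t \<Rightarrow> 'h) \<Rightarrow> 'h groupoid \<Rightarrow> ('s \<Rightarrow> 't) \<Rightarrow> bool" where
  "twist_isomorphism \<Sigma> i q G \<Sigma>' i' q' G' \<Phi> \<longleftrightarrow>
    discrete_twist \<Sigma> i q G \<and> discrete_twist \<Sigma>' i' q' G' \<and>
    topological_groupoid_iso \<Sigma> \<Sigma>' \<Phi> \<and>
    (\<exists>\<Phi>\<^sub>G. (\<forall>\<sigma> \<in> arrows \<Sigma>. \<Phi>\<^sub>G (q \<sigma>) = q' (\<Phi> \<sigma>)) \<and>
       topological_groupoid_iso G G' \<Phi>\<^sub>G \<and>
       (\<forall>x \<in> units G. \<forall>t \<in> ring_units. \<Phi> (i (x, t)) = i' (\<Phi>\<^sub>G x, t)))"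


section \<open>The twisted Steinberg algebra\<close>

definition function_support :: "('s \<Rightarrow> 'r::zero) \<Rightarrow> 's set" where
  "function_support f = {\<sigma>. f \<sigma> \<noteq> 0}"

text \<open>Functions on \<open>\<Sigma>\<close> are represented by total functions that vanish off the arrows of \<open>\<Sigma>\<close>.\<close>

definition steinberg_functions ::
  "'s groupoid \<Rightarrow> ('g \<times> 'r::comm_ring_1 \<Rightarrow> 's) \<Rightarrow> ('s \<Rightarrow> 'g) \<Rightarrow> 'g groupoid \<Rightarrow> ('s \<Rightarrow> 'r) set" where
  "steinberg_functions \<Sigma> i q G = {f.
    function_support f \<subseteq> arrows \<Sigma> \<and>
    (\<forall>\<sigma> \<in> arrows \<Sigma>. \<exists>W. openin (arrow_topology \<Sigma>) W \<and> \<sigma> \<in> W \<and> (\<forall>\<tau> \<in> W. f \<tau> = f \<sigma>)) \<and>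
    (\<forall>t \<in> ring_units. \<forall>\<sigma> \<in> arrows \<Sigma>. f (twist_action \<Sigma> i q t \<sigma>) = unit_inverse t * f \<sigma>) \<and>
    compactin (arrow_topology G) (q ` function_support f)}"

text \<open>The sum does not depend on the section of \<open>q\<close>, so an arbitrary one is chosen.\<close>

definition convolution ::
  "'s groupoid \<Rightarrow> ('s \<Rightarrow> 'g) \<Rightarrow> 'g groupoid \<Rightarrow> ('s \<Rightarrow> 'r::comm_ring_1) \<Rightarrow> ('s \<Rightarrow> 'r) \<Rightarrow> 's \<Rightarrow> 'r" where
  "convolution \<Sigma> q G f g \<sigma> =
    (if \<sigma> \<in> arrows \<Sigma> then
       let S = (\<lambda>\<alpha>. SOME \<tau>. \<tau> \<in> function_support f \<and> q \<tau> = \<alpha>)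
       in \<Sum>\<alpha> \<in> {\<alpha> \<in> q ` function_support f. rng G \<alpha> = q (rng \<Sigma> \<sigma>)}.
            f (S \<alpha>) * g (gmult \<Sigma> (ginv \<Sigma> (S \<alpha>)) \<sigma>)
     else 0)"

text \<open>An \<open>R\<close>-algebra without unit is an element of the record type \<open>module\<close> whose field
  \<^const>\<open>one\<close> is never used.\<close>

definition steinberg_algebra ::
  "'s groupoid \<Rightarrow> ('g \<times> 'r::comm_ring_1 \<Rightarrow> 's) \<Rightarrow> ('s \<Rightarrow> 'g) \<Rightarrow> 'g groupoid \<Rightarrow>
   ('r, 's \<Rightarrow> 'r) module" where
  "steinberg_algebra \<Sigma> i q G =
    \<lparr>carrier = steinberg_functions \<Sigma> i q G,
     mult = convolution \<Sigma> q G,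
     one = undefined,
     zero = (\<lambda>\<sigma>. 0),
     add = (\<lambda>f g \<sigma>. f \<sigma> + g \<sigma>),
     smult = (\<lambda>t f \<sigma>. t * f \<sigma>)\<rparr>"

definition steinberg_diagonal ::
  "'s groupoid \<Rightarrow> ('g \<times> 'r::comm_ring_1 \<Rightarrow> 's) \<Rightarrow> ('s \<Rightarrow> 'g) \<Rightarrow> 'g groupoid \<Rightarrow> ('s \<Rightarrow> 'r) set" where
  "steinberg_diagonal \<Sigma> i q G =
    {f \<in> steinberg_functions \<Sigma> i q G. function_support f \<subseteq> {\<sigma> \<in> arrows \<Sigma>. q \<sigma> \<in> units G}}"

definition twisted_indicator ::
  "'s groupoid \<Rightarrow> ('g \<times> 'r::comm_ring_1 \<Rightarrow> 's) \<Rightarrow> ('s \<Rightarrow> 'g) \<Rightarrow> 'g groupoid \<Rightarrow> 's set \<Rightarrow> 's \<Rightarrow> 'r" where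
  "twisted_indicator \<Sigma> i q G Y =
    (THE f. f \<in> steinberg_functions \<Sigma> i q G \<and>
       function_support f \<subseteq> {twist_action \<Sigma> i q t \<sigma> | t \<sigma>. t \<in> ring_units \<and> \<sigma> \<in> Y} \<and>
       (\<forall>\<sigma> \<in> Y. f \<sigma> = 1))"


section \<open>Algebraic quasi-Cartan pairs\<close>

definition nonunital_algebra :: "('r::comm_ring_1, 'a) module \<Rightarrow> bool" where
  "nonunital_algebra A \<longleftrightarrow>
    module cring_class_ops A \<and>
    (\<forall>a \<in> carrier A. \<forall>b \<in> carrier A. a \<otimes>\<^bsub>A\<^esub> b \<in> carrier A) \<and>
    (\<forall>a \<in> carrier A. \<forall>b \<in> carrier A. \<forall>c \<in> carrier A.
       (a \<otimes>\<^bsub>A\<^esub> b) \<otimes>\<^bsub>A\<^esub> c = a \<otimes>\<^bsub>A\<^esub> (b \<otimes>\<^bsub>A\<^esub> c) \<and>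
       (a \<oplus>\<^bsub>A\<^esub> b) \<otimes>\<^bsub>A\<^esub> c = a \<otimes>\<^bsub>A\<^esub> c \<oplus>\<^bsub>A\<^esub> b \<otimes>\<^bsub>A\<^esub> c \<and>
       c \<otimes>\<^bsub>A\<^esub> (a \<oplus>\<^bsub>A\<^esub> b) = c \<otimes>\<^bsub>A\<^esub> a \<oplus>\<^bsub>A\<^esub> c \<otimes>\<^bsub>A\<^esub> b) \<and>
    (\<forall>t. \<forall>a \<in> carrier A. \<forall>b \<in> carrier A.
       (t \<odot>\<^bsub>A\<^esub> a) \<otimes>\<^bsub>A\<^esub> b = t \<odot>\<^bsub>A\<^esub> (a \<otimes>\<^bsub>A\<^esub> b) \<and>
       a \<otimes>\<^bsub>A\<^esub> (t \<odot>\<^bsub>A\<^esub> b) = t \<odot>\<^bsub>A\<^esub> (a \<otimes>\<^bsub>A\<^esub> b))"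

definition commutative_subalgebra :: "('r::comm_ring_1, 'a) module \<Rightarrow> 'a set \<Rightarrow> bool" where
  "commutative_subalgebra A B \<longleftrightarrow>
    submodule B cring_class_ops A \<and>
    (\<forall>a \<in> B. \<forall>b \<in> B. a \<otimes>\<^bsub>A\<^esub> b \<in> B \<and> a \<otimes>\<^bsub>A\<^esub> b = b \<otimes>\<^bsub>A\<^esub> a)"

definition module_span :: "('r::comm_ring_1, 'a) module \<Rightarrow> 'a set \<Rightarrow> 'a set" where
  "module_span A S = \<Inter>{H. submodule H cring_class_ops A \<and> S \<subseteq> H}"

definition idempotents :: "('r, 'a) module \<Rightarrow> 'a set \<Rightarrow> 'a set" where
  "idempotents A B = {e \<in> B. e \<otimes>\<^bsub>A\<^esub> e = e}"

definition local_units :: "('r, 'a) module \<Rightarrow> 'a set \<Rightarrow> bool" where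
  "local_units A E \<longleftrightarrow>
    (\<forall>F. finite F \<and> F \<subseteq> carrier A \<longrightarrow> (\<exists>e \<in> E. \<forall>a \<in> F. e \<otimes>\<^bsub>A\<^esub> a = a \<and> a \<otimes>\<^bsub>A\<^esub> e = a))"

definition normaliser_partner :: "('r, 'a) module \<Rightarrow> 'a set \<Rightarrow> 'a \<Rightarrow> 'a \<Rightarrow> bool" where
  "normaliser_partner A B n k \<longleftrightarrow> k \<in> carrier A \<and>
    k \<otimes>\<^bsub>A\<^esub> n \<otimes>\<^bsub>A\<^esub> k = k \<and> n \<otimes>\<^bsub>A\<^esub> k \<otimes>\<^bsub>A\<^esub> n = n \<and>
    (\<forall>b \<in> B. k \<otimes>\<^bsub>A\<^esub> b \<otimes>\<^bsub>A\<^esub> n \<in> B \<and> n \<otimes>\<^bsub>A\<^esub> b \<otimes>\<^bsub>A\<^esub> k \<in> B)"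

definition normalisers :: "('r, 'a) module \<Rightarrow> 'a set \<Rightarrow> 'a set" where
  "normalisers A B = {n \<in> carrier A. \<exists>k. normaliser_partner A B n k}"

definition dagger :: "('r, 'a) module \<Rightarrow> 'a set \<Rightarrow> 'a \<Rightarrow> 'a" where
  "dagger A B n = (THE k. normaliser_partner A B n k)"

definition normaliser_le :: "('r, 'a) module \<Rightarrow> 'a set \<Rightarrow> 'a \<Rightarrow> 'a \<Rightarrow> bool" where
  "normaliser_le A B n m \<longleftrightarrow> n = n \<otimes>\<^bsub>A\<^esub> dagger A B n \<otimes>\<^bsub>A\<^esub> m"

definition conditional_expectation ::
  "('r::comm_ring_1, 'a) module \<Rightarrow> 'a set \<Rightarrow> ('a \<Rightarrow> 'a) \<Rightarrow> bool" where
  "conditional_expectation A B P \<longleftrightarrow>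
    P \<in> carrier A \<rightarrow> B \<and>
    (\<forall>a \<in> carrier A. \<forall>a' \<in> carrier A. P (a \<oplus>\<^bsub>A\<^esub> a') = P a \<oplus>\<^bsub>A\<^esub> P a') \<and>
    (\<forall>t. \<forall>a \<in> carrier A. P (t \<odot>\<^bsub>A\<^esub> a) = t \<odot>\<^bsub>A\<^esub> P a) \<and>
    (\<forall>b \<in> B. P b = b) \<and>
    (\<forall>b \<in> B. \<forall>b' \<in> B. \<forall>a \<in> carrier A. P (b \<otimes>\<^bsub>A\<^esub> a \<otimes>\<^bsub>A\<^esub> b') = b \<otimes>\<^bsub>A\<^esub> P a \<otimes>\<^bsub>A\<^esub> b')"

definition faithful_expectation :: "('r, 'a) module \<Rightarrow> 'a set \<Rightarrow> ('a \<Rightarrow> 'a) \<Rightarrow> bool" where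
  "faithful_expectation A B P \<longleftrightarrow>
    (\<forall>a \<in> carrier A. a \<noteq> \<zero>\<^bsub>A\<^esub> \<longrightarrow> (\<exists>n \<in> normalisers A B. P (n \<otimes>\<^bsub>A\<^esub> a) \<noteq> \<zero>\<^bsub>A\<^esub>))"

definition implemented_by_idempotents :: "('r, 'a) module \<Rightarrow> 'a set \<Rightarrow> ('a \<Rightarrow> 'a) \<Rightarrow> bool" where
  "implemented_by_idempotents A B P \<longleftrightarrow>
    (\<forall>n \<in> normalisers A B. \<exists>e \<in> idempotents A B. P n = n \<otimes>\<^bsub>A\<^esub> e \<and> n \<otimes>\<^bsub>A\<^esub> e = e \<otimes>\<^bsub>A\<^esub> n)"

definition quasi_cartan_pair :: "('r::comm_ring_1, 'a) module \<Rightarrow> 'a set \<Rightarrow> bool" where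
  "quasi_cartan_pair A B \<longleftrightarrow>
    nonunital_algebra A \<and> commutative_subalgebra A B \<and>
    (\<forall>t. \<forall>e \<in> idempotents A B - {\<zero>\<^bsub>A\<^esub>}. t \<odot>\<^bsub>A\<^esub> e = \<zero>\<^bsub>A\<^esub> \<longrightarrow> t = 0) \<and>
    local_units A (idempotents A B) \<and>
    B = module_span A (idempotents A B) \<and>
    carrier A = module_span A (normalisers A B) \<and>
    (\<exists>P. conditional_expectation A B P \<and> faithful_expectation A B P \<and>
         implemented_by_idempotents A B P)"


section \<open>The twist of ultrafilters of normalisers\<close>

definition up_closure :: "('r, 'a) module \<Rightarrow> 'a set \<Rightarrow> 'a set \<Rightarrow> 'a set" where
  "up_closure A B U = {m \<in> normalisers A B. \<exists>n \<in> U. normaliser_le A B n m}"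

definition normaliser_filter :: "('r, 'a) module \<Rightarrow> 'a set \<Rightarrow> 'a set \<Rightarrow> bool" where
  "normaliser_filter A B U \<longleftrightarrow>
    U \<subseteq> normalisers A B - {\<zero>\<^bsub>A\<^esub>} \<and> U = up_closure A B U \<and>
    (\<forall>m \<in> U. \<forall>n \<in> U. \<exists>k \<in> U. normaliser_le A B k m \<and> normaliser_le A B k n)"

definition ultrafilters :: "('r, 'a) module \<Rightarrow> 'a set \<Rightarrow> 'a set set" where
  "ultrafilters A B = {U. normaliser_filter A B U \<and> U \<noteq> {} \<and>
    (\<forall>V. normaliser_filter A B V \<and> U \<subseteq> V \<longrightarrow> V = U)}"

definition ultrafilter_topology :: "('r, 'a) module \<Rightarrow> 'a set \<Rightarrow> 'a set topology" where
  "ultrafilter_topology A B = topology (arbitrary union_of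
    (\<lambda>\<V>. \<exists>n \<in> normalisers A B. \<V> = {U \<in> ultrafilters A B. n \<in> U}))"

lemma openin_ultrafilter_topology:
  "openin (ultrafilter_topology A B) = arbitrary union_of
    (\<lambda>\<V>. \<exists>n \<in> normalisers A B. \<V> = {U \<in> ultrafilters A B. n \<in> U})"
proof -
  let ?V = "\<lambda>n. {U \<in> ultrafilters A B. n \<in> U}"
  let ?P = "\<lambda>\<V>. \<exists>n \<in> normalisers A B. \<V> = ?V n"
  have "(arbitrary union_of ?P) (?V m \<inter> ?V n)"
    if mn: "m \<in> normalisers A B" "n \<in> normalisers A B" for m n
  proof -
    let ?K = "{k \<in> normalisers A B. normaliser_le A B k m \<and> normaliser_le A B k n}"
    have "U \<in> (\<Union>k \<in> ?K. ?V k)" if U: "U \<in> ?V m \<inter> ?V n" for U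
    proof -
      from U have F: "normaliser_filter A B U" by (auto simp: ultrafilters_def)
      with U obtain k where "k \<in> U" "normaliser_le A B k m" "normaliser_le A B k n"
        unfolding normaliser_filter_def by blast
      with U F show ?thesis by (auto simp: normaliser_filter_def)
    qed
    moreover have "U \<in> ?V m \<inter> ?V n" if "U \<in> ?V k" "k \<in> ?K" for U k
    proof -
      from that have "U = up_closure A B U"
        by (auto simp: ultrafilters_def normaliser_filter_def)
      moreover have "m \<in> up_closure A B U" "n \<in> up_closure A B U"
        using that mn by (auto simp: up_closure_def)
      ultimately show ?thesis using that by auto
    qed
    ultimately have "?V m \<inter> ?V n = \<Union> (?V ` ?K)" by blast
    moreover have "?V ` ?K \<subseteq> Collect ?P" by auto
    ultimately show ?thesis by (auto simp: union_of_def arbitrary_def)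
  qed
  then have "istopology (arbitrary union_of ?P)"
    unfolding istopology_base_eq by blast
  then show ?thesis
    by (simp add: ultrafilter_topology_def topology_inverse')
qed

lemma topspace_ultrafilter_topology: "topspace (ultrafilter_topology A B) = ultrafilters A B"
proof (rule antisym)
  show "topspace (ultrafilter_topology A B) \<subseteq> ultrafilters A B"
    using openin_topspace[of "ultrafilter_topology A B"]
    unfolding openin_ultrafilter_topology by (auto simp: union_of_def)
  show "ultrafilters A B \<subseteq> topspace (ultrafilter_topology A B)"
  proof
    fix U assume U: "U \<in> ultrafilters A B"
    then obtain n where n: "n \<in> U" "n \<in> normalisers A B"
      by (auto simp: ultrafilters_def normaliser_filter_def)
    have "openin (ultrafilter_topology A B) {U \<in> ultrafilters A B. n \<in> U}"
      unfolding openin_ultrafilter_topology by (rule union_of_inc) (use n in \<open>auto simp: arbitrary_def\<close>)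
    then show "U \<in> topspace (ultrafilter_topology A B)"
      using U n openin_subset by fastforce
  qed
qed

definition ultrafilter_groupoid :: "('r, 'a) module \<Rightarrow> 'a set \<Rightarrow> 'a set groupoid" where
  "ultrafilter_groupoid A B =
    \<lparr>arrow_topology = ultrafilter_topology A B,
     composable = {(U, V). U \<in> ultrafilters A B \<and> V \<in> ultrafilters A B \<and>
       (\<forall>m \<in> U. \<forall>n \<in> V. m \<otimes>\<^bsub>A\<^esub> n \<noteq> \<zero>\<^bsub>A\<^esub>)},
     gmult = (\<lambda>U V. up_closure A B {m \<otimes>\<^bsub>A\<^esub> n | m n. m \<in> U \<and> n \<in> V}),
     ginv = (\<lambda>U. dagger A B ` U)\<rparr>"

definition scale_set :: "('r, 'a) module \<Rightarrow> 'r \<Rightarrow> 'a set \<Rightarrow> 'a set" where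
  "scale_set A t U = {t \<odot>\<^bsub>A\<^esub> m | m. m \<in> U}"

definition ultrafilter_quotient ::
  "('r::comm_ring_1, 'a) module \<Rightarrow> 'a set \<Rightarrow> 'a set \<Rightarrow> 'a set set" where
  "ultrafilter_quotient A B U = {W \<in> ultrafilters A B. \<exists>t \<in> ring_units. U = scale_set A t W}"

definition quotient_topology :: "'a topology \<Rightarrow> ('a \<Rightarrow> 'b) \<Rightarrow> 'b topology" where
  "quotient_topology X f =
    topology (\<lambda>V. V \<subseteq> f ` topspace X \<and> openin X {x \<in> topspace X. f x \<in> V})"

lemma openin_quotient_topology:
  "openin (quotient_topology X f) V \<longleftrightarrow>
    V \<subseteq> f ` topspace X \<and> openin X {x \<in> topspace X. f x \<in> V}"
proof -
  have "istopology (\<lambda>V. V \<subseteq> f ` topspace X \<and> openin X {x \<in> topspace X. f x \<in> V})"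
    (is "istopology ?L")
    unfolding istopology_def
  proof (intro conjI allI impI)
    fix S T assume S: "?L S" and T: "?L T"
    have "{x \<in> topspace X. f x \<in> S \<inter> T} =
        {x \<in> topspace X. f x \<in> S} \<inter> {x \<in> topspace X. f x \<in> T}" by auto
    with S T show "openin X {x \<in> topspace X. f x \<in> S \<inter> T}" by auto
    show "S \<inter> T \<subseteq> f ` topspace X" using S by auto
  next
    fix \<K> assume K: "\<forall>K \<in> \<K>. ?L K"
    then show "\<Union>\<K> \<subseteq> f ` topspace X" by auto
    have "{x \<in> topspace X. f x \<in> \<Union>\<K>} = (\<Union>K \<in> \<K>. {x \<in> topspace X. f x \<in> K})" by auto
    moreover have "openin X (\<Union>K \<in> \<K>. {x \<in> topspace X. f x \<in> K})"
      using K by (intro openin_Union) auto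
    ultimately show "openin X {x \<in> topspace X. f x \<in> \<Union>\<K>}" by simp
  qed
  then show ?thesis by (simp add: quotient_topology_def topology_inverse')
qed

lemma quotient_map_quotient_topology: "quotient_map X (quotient_topology X f) f"
proof -
  have "{x \<in> topspace X. f x \<in> f ` topspace X} = topspace X" by auto
  then have "openin (quotient_topology X f) (f ` topspace X)"
    by (simp add: openin_quotient_topology)
  then have "topspace (quotient_topology X f) = f ` topspace X"
    using openin_subset openin_quotient_topology by (metis openin_topspace subset_antisym)
  then show ?thesis
    by (auto simp: quotient_map_def openin_quotient_topology)
qed

text \<open>The groupoid structure induced on the image of \<open>f\<close> by that of \<open>S\<close>, computed on chosen
  representatives. For the quotient map of a twist it does not depend on the choice.\<close>

definition quotient_groupoid :: "'a groupoid \<Rightarrow> ('a \<Rightarrow> 'b) \<Rightarrow> 'b groupoid" where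
  "quotient_groupoid S f =
    (let rep = (\<lambda>g. SOME a. a \<in> arrows S \<and> f a = g) in
    \<lparr>arrow_topology = quotient_topology (arrow_topology S) f,
     composable = {(f a, f b) | a b. (a, b) \<in> composable S},
     gmult = (\<lambda>g h. f (gmult S (rep g) (rep h))),
     ginv = (\<lambda>g. f (ginv S (rep g)))\<rparr>)"

definition ultrafilter_base_groupoid ::
  "('r::comm_ring_1, 'a) module \<Rightarrow> 'a set \<Rightarrow> 'a set set groupoid" where
  "ultrafilter_base_groupoid A B =
    quotient_groupoid (ultrafilter_groupoid A B) (ultrafilter_quotient A B)"

definition ultrafilter_inclusion ::
  "('r::comm_ring_1, 'a) module \<Rightarrow> 'a set \<Rightarrow> 'a set set \<times> 'r \<Rightarrow> 'a set" where
  "ultrafilter_inclusion A B = (\<lambda>(g, t). scale_set A t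
    (THE U. U \<in> units (ultrafilter_groupoid A B) \<and> ultrafilter_quotient A B U = g))"

text \<open>\<open>(\<one>\<^sub>Y U\<^sub>x)\<^sup>\<up>\<close> where \<open>\<one>\<^sub>Y\<close> is the twisted indicator of \<open>Y\<close>, \<open>x = s(\<sigma>)\<close> and
  \<open>U\<^sub>x = {e \<in> I(B). e(x) = 1}\<close>.\<close>

definition point_ultrafilter ::
  "'s groupoid \<Rightarrow> ('g \<times> 'r::comm_ring_1 \<Rightarrow> 's) \<Rightarrow> ('s \<Rightarrow> 'g) \<Rightarrow> 'g groupoid \<Rightarrow>
   's set \<Rightarrow> 's \<Rightarrow> ('s \<Rightarrow> 'r) set" where
  "point_ultrafilter \<Sigma> i q G Y \<sigma> =
    (let A = steinberg_algebra \<Sigma> i q G; B = steinberg_diagonal \<Sigma> i q G in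
     up_closure A B
       {twisted_indicator \<Sigma> i q G Y \<otimes>\<^bsub>A\<^esub> e | e. e \<in> idempotents A B \<and> e (src \<Sigma> \<sigma>) = 1})"

definition ultrafilter_map ::
  "'s groupoid \<Rightarrow> ('g \<times> 'r::comm_ring_1 \<Rightarrow> 's) \<Rightarrow> ('s \<Rightarrow> 'g) \<Rightarrow> 'g groupoid \<Rightarrow>
   's \<Rightarrow> ('s \<Rightarrow> 'r) set" where
  "ultrafilter_map \<Sigma> i q G \<sigma> =
    point_ultrafilter \<Sigma> i q G (SOME Y. compact_open_bisection \<Sigma> Y \<and> \<sigma> \<in> Y) \<sigma>"

end

theory Submission
  imports Defs
begin

text \<open>The main point is that every normaliser \<open>n\<close>, with partner \<open>k\<close>, is supported on a bisection and
  takes unit values. Cutting \<open>n k\<close> at a single unit \<open>x\<close> gives elements \<open>n \<delta>\<^sub>x k\<close> of the diagonal whose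
  coefficients are orthogonal idempotents, hence \<open>0\<close> or \<open>1\<close>; so the support \<open>C\<close> of \<open>n\<close> relates ranges
  and sources bijectively, and \<open>C\<^sup>-\<^sup>1 C\<close> is an open set of isotropy. Over a unit in \<open>X\<close> the functions \<open>n\<close>
  and \<open>k\<close> become mutually inverse elements of a twisted group ring with the unique product property over
  a reduced indecomposable ring, so there \<open>n\<close> has a one-point support; density of \<open>X\<close> and the Hausdorff
  property spread this to all units. The normalisers are then the indicators of compact open bisections
  of \<open>\<Sigma>\<close>, ordered by inclusion, and by compactness their ultrafilters are the sets
  \<open>{n. n(\<sigma>) = 1}\<close> for arrows \<open>\<sigma>\<close>.\<close>

section \<open>Topological groupoids\<close>

text \<open>A single unit \<open>x\<close> is rarely an open set, so \<open>n \<delta>_x k\<close>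
  falls outside the algebra. Convolution is therefore built first for equivariant functions with
  finite support on every range fibre (\<open>eqv\<close>, \<open>rfin\<close>), without continuity
  or compactness. At any given arrow \<open>\<delta>_x\<close> may then be replaced by the indicator
  of a small compact open set of units. Over \<open>x\<close> the support of \<open>n\<close> lies
  in a coset of the isotropy group, so \<open>n\<close> and \<open>k\<close> are translated into the
  group along an arrow of the support. This introduces unit scalars from the twist, kept arbitrary
  because only the vanishing of the product off the identity and its value 1 there are used. A
  useful unique product must lie off the identity, where the coefficient is known to vanish;
  reducedness is needed because the induction on supports only shows powers of the wanted products
  to vanish. The axioms of a twist are not checked on filters: the operations on ultrafilters match
  those of \<open>\<Sigma>\<close> under \<open>uf\<close>, and a general transport argument does
  the rest.\<close>

notation gmult (infixl "\<cdot>\<index>" 70)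

section \<open>Algebra of a groupoid given by a partial multiplication\<close>

locale gpd =
  fixes G :: "'a groupoid" (structure)
  assumes algebraic: "algebraic_groupoid G"
begin

abbreviation inv_of where "inv_of a \<equiv> ginv G a"
abbreviation ran where "ran a \<equiv> rng G a"
abbreviation sou where "sou a \<equiv> src G a"

lemma composableD: "(a, b) \<in> composable G \<Longrightarrow> a \<in> arrows G \<and> b \<in> arrows G \<and> a \<cdot> b \<in> arrows G"
  using algebraic unfolding algebraic_groupoid_def by blast

lemma inv_closed [simp]: "a \<in> arrows G \<Longrightarrow> inv_of a \<in> arrows G"
  and inv_inv [simp]: "a \<in> arrows G \<Longrightarrow> inv_of (inv_of a) = a"
  and composable_inv: "a \<in> arrows G \<Longrightarrow> (inv_of a, a) \<in> composable G"
    "a \<in> arrows G \<Longrightarrow> (a, inv_of a) \<in> composable G"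
  using algebraic unfolding algebraic_groupoid_def by blast+

lemma composable_assoc:
  assumes "(a, b) \<in> composable G" "(b, c) \<in> composable G"
  shows "(a \<cdot> b, c) \<in> composable G" "(a, b \<cdot> c) \<in> composable G" "a \<cdot> b \<cdot> c = a \<cdot> (b \<cdot> c)"
  using algebraic assms unfolding algebraic_groupoid_def by blast+

lemma composable_cancel:
  assumes "(a, b) \<in> composable G"
  shows "inv_of a \<cdot> (a \<cdot> b) = b" "a \<cdot> b \<cdot> inv_of b = a"
  using algebraic assms unfolding algebraic_groupoid_def by blast+

lemma composable_iff: "(a, b) \<in> composable G \<longleftrightarrow> a \<in> arrows G \<and> b \<in> arrows G \<and> sou a = ran b"
proof
  assume ab: "(a, b) \<in> composable G"
  then have a: "a \<in> arrows G" and b: "b \<in> arrows G" using composableD by auto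
  have 1: "(inv_of a, a \<cdot> b) \<in> composable G" "(a \<cdot> b, inv_of b) \<in> composable G"
    using composable_assoc composable_inv a b ab by blast+
  have "b \<cdot> inv_of b = inv_of a \<cdot> (a \<cdot> b) \<cdot> inv_of b" using composable_cancel ab by simp
  also have "\<dots> = inv_of a \<cdot> a" using composable_assoc(3)[OF 1] composable_cancel ab by simp
  finally show "a \<in> arrows G \<and> b \<in> arrows G \<and> sou a = ran b"
    using a b by (simp add: rng_def src_def)
next
  assume *: "a \<in> arrows G \<and> b \<in> arrows G \<and> sou a = ran b"
  have "(a, inv_of a \<cdot> a) \<in> composable G"
    using * composable_assoc composable_inv by blast
  then have 1: "(a, b \<cdot> inv_of b) \<in> composable G" using * by (simp add: rng_def src_def)
  have 2: "(b \<cdot> inv_of b, b) \<in> composable G" "b \<cdot> inv_of b \<cdot> b = b"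
    using * composable_assoc[OF composable_inv(2) composable_inv(1), of b]
      composable_cancel(2)[OF composable_inv(2), of b]
    by (simp, metis composable_cancel(2) composable_inv(2) inv_inv inv_closed)
  show "(a, b) \<in> composable G" using composable_assoc(2)[OF 1 2(1)] 2(2) by simp
qed

lemma mul_closed [simp]:
  "a \<in> arrows G \<Longrightarrow> b \<in> arrows G \<Longrightarrow> sou a = ran b \<Longrightarrow> a \<cdot> b \<in> arrows G"
  using composable_iff composableD by blast

lemma ran_inv [simp]: "a \<in> arrows G \<Longrightarrow> ran (inv_of a) = sou a"
  and sou_inv [simp]: "a \<in> arrows G \<Longrightarrow> sou (inv_of a) = ran a"
  by (auto simp: rng_def src_def)

lemma mul_assoc:
  "a \<in> arrows G \<Longrightarrow> b \<in> arrows G \<Longrightarrow> c \<in> arrows G \<Longrightarrow> sou a = ran b \<Longrightarrow> sou b = ran c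
   \<Longrightarrow> a \<cdot> b \<cdot> c = a \<cdot> (b \<cdot> c)"
  using composable_assoc(3) composable_iff by blast

lemma ran_mul [simp]:
  assumes "a \<in> arrows G" "b \<in> arrows G" "sou a = ran b" shows "ran (a \<cdot> b) = ran a"
proof -
  have "(a, b) \<in> composable G" using assms composable_iff by blast
  from composable_assoc(2)[OF composable_inv(1) this] assms(1)
  have "(inv_of a, a \<cdot> b) \<in> composable G" by blast
  then have "sou (inv_of a) = ran (a \<cdot> b)" using composable_iff by blast
  then show ?thesis using assms(1) by simp
qed

lemma sou_mul [simp]:
  assumes "a \<in> arrows G" "b \<in> arrows G" "sou a = ran b" shows "sou (a \<cdot> b) = sou b"
proof -
  have "(a, b) \<in> composable G" using assms composable_iff by blast
  from composable_assoc(1)[OF this composable_inv(2)] assms(2)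
  have "(a \<cdot> b, inv_of b) \<in> composable G" by blast
  then have "sou (a \<cdot> b) = ran (inv_of b)" using composable_iff by blast
  then show ?thesis using assms(2) by simp
qed

lemma inv_mul_cancel [simp]:
  "a \<in> arrows G \<Longrightarrow> b \<in> arrows G \<Longrightarrow> sou a = ran b \<Longrightarrow> inv_of a \<cdot> (a \<cdot> b) = b"
  "a \<in> arrows G \<Longrightarrow> b \<in> arrows G \<Longrightarrow> ran a = ran b \<Longrightarrow> a \<cdot> (inv_of a \<cdot> b) = b"
  using composable_cancel(1) composable_iff inv_inv inv_closed sou_inv by metis+

lemma mul_inv_cancel [simp]:
  "a \<in> arrows G \<Longrightarrow> b \<in> arrows G \<Longrightarrow> sou a = ran b \<Longrightarrow> a \<cdot> b \<cdot> inv_of b = a"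
  "a \<in> arrows G \<Longrightarrow> b \<in> arrows G \<Longrightarrow> sou a = sou b \<Longrightarrow> a \<cdot> inv_of b \<cdot> b = a"
  using composable_cancel(2) composable_iff inv_inv inv_closed ran_inv by metis+

lemma inv_mul_self [simp]: "inv_of a \<cdot> a = sou a" "a \<cdot> inv_of a = ran a"
  by (simp_all add: rng_def src_def)

lemma inv_mul:
  assumes "a \<in> arrows G" "b \<in> arrows G" "sou a = ran b"
  shows "inv_of (a \<cdot> b) = inv_of b \<cdot> inv_of a"
proof -
  have "inv_of (a \<cdot> b) = inv_of (a \<cdot> b) \<cdot> a \<cdot> inv_of a" using assms by simp
  also have "inv_of (a \<cdot> b) \<cdot> a = inv_of (a \<cdot> b) \<cdot> (a \<cdot> b \<cdot> inv_of b)" using assms by simp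
  also have "\<dots> = inv_of b"
    using assms by (intro inv_mul_cancel) auto
  finally show ?thesis .
qed

lemma ran_arrow [simp]: "a \<in> arrows G \<Longrightarrow> ran a \<in> arrows G"
  and sou_arrow [simp]: "a \<in> arrows G \<Longrightarrow> sou a \<in> arrows G"
  unfolding rng_def src_def using composable_inv composableD by blast+

lemma ran_units [simp]: "a \<in> arrows G \<Longrightarrow> ran a \<in> units G"
  by (simp add: units_def)

lemma sou_units [simp]: "a \<in> arrows G \<Longrightarrow> sou a \<in> units G"
  by (metis ran_inv ran_units inv_closed)

lemma units_arrows: "units G \<subseteq> arrows G" and unit_arrow: "x \<in> units G \<Longrightarrow> x \<in> arrows G"
  by (auto simp: units_def)

lemma ran_ran [simp]: "a \<in> arrows G \<Longrightarrow> ran (ran a) = ran a"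
  and sou_ran [simp]: "a \<in> arrows G \<Longrightarrow> sou (ran a) = ran a"
  and inv_ran [simp]: "a \<in> arrows G \<Longrightarrow> inv_of (ran a) = ran a"
proof -
  assume a: "a \<in> arrows G"
  have e: "ran a = a \<cdot> inv_of a" by simp
  show "ran (ran a) = ran a" unfolding e using a by (subst ran_mul) auto
  show "sou (ran a) = ran a" using a unfolding e by (subst sou_mul) auto
  show "inv_of (ran a) = ran a" using a unfolding e by (subst inv_mul) auto
qed

lemma unit_simps [simp]:
  "x \<in> units G \<Longrightarrow> ran x = x" "x \<in> units G \<Longrightarrow> sou x = x" "x \<in> units G \<Longrightarrow> inv_of x = x"
  by (auto simp: units_def)

lemma ran_sou [simp]: "a \<in> arrows G \<Longrightarrow> ran (sou a) = sou a"
  and sou_sou [simp]: "a \<in> arrows G \<Longrightarrow> sou (sou a) = sou a"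
  using sou_units unit_simps by metis+

lemma unit_iff: "x \<in> units G \<longleftrightarrow> x \<in> arrows G \<and> ran x = x"
  by (metis unit_simps(1) unit_arrow ran_units)

lemma mul_unit [simp]:
  assumes "a \<in> arrows G"
  shows "ran a \<cdot> a = a" "a \<cdot> sou a = a"
proof -
  have "ran a = a \<cdot> inv_of a" "sou a = inv_of a \<cdot> a" by simp_all
  then show "ran a \<cdot> a = a" "a \<cdot> sou a = a"
    using mul_inv_cancel(2)[OF assms assms refl] inv_mul_cancel(2)[OF assms assms refl] by simp_all
qed

lemma mul_unit' [simp]:
  "a \<in> arrows G \<Longrightarrow> x = ran a \<Longrightarrow> x \<cdot> a = a" "a \<in> arrows G \<Longrightarrow> x = sou a \<Longrightarrow> a \<cdot> x = a"
  by simp_all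

lemma mul_left_cancel:
  "a \<in> arrows G \<Longrightarrow> b \<in> arrows G \<Longrightarrow> c \<in> arrows G \<Longrightarrow> sou a = ran b \<Longrightarrow> sou a = ran c
   \<Longrightarrow> a \<cdot> b = a \<cdot> c \<Longrightarrow> b = c"
  by (metis inv_mul_cancel(1))

text \<open>A product that is a unit must be the range of \<open>a\<close>, that is
  \<open>a a^-1\<close>, and \<open>a\<close> cancels. This is how inverses are recognised later,
  for homomorphisms and for single terms of convolutions.\<close>

lemma mul_eq_unitD:
  assumes "a \<in> arrows G" "b \<in> arrows G" "sou a = ran b" "a \<cdot> b \<in> units G"
  shows "b = inv_of a"
proof -
  have "a \<cdot> b = ran a" using assms ran_mul unit_simps(1) by metis
  then have "a \<cdot> b = a \<cdot> inv_of a" by simp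
  then show ?thesis using assms mul_left_cancel[of a b "inv_of a"] by auto
qed

end

section \<open>Local homeomorphisms into the unit space\<close>

lemma homeo_onto_open_unitsI:
  assumes "openin (arrow_topology G) W" "continuous_map (arrow_topology G) (unit_space G) f"
    "open_map (arrow_topology G) (unit_space G) f" "inj_on f W"
  shows "homeo_onto_open_units G W f"
  unfolding homeo_onto_open_units_def
proof (intro conjI)
  have W: "W \<subseteq> arrows G" using assms(1) openin_subset by blast
  show "openin (arrow_topology G) W" by fact
  show o: "openin (unit_space G) (f ` W)" using assms(1,3) open_map_def by blast
  show "homeomorphic_map (subtopology (arrow_topology G) W) (subtopology (unit_space G) (f ` W)) f"
  proof (rule bijective_open_imp_homeomorphic_map)
    show "continuous_map (subtopology (arrow_topology G) W) (subtopology (unit_space G) (f ` W)) f"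
      using assms(2) by (auto simp: continuous_map_in_subtopology continuous_map_from_subtopology)
    show "open_map (subtopology (arrow_topology G) W) (subtopology (unit_space G) (f ` W)) f"
      unfolding open_map_def
    proof (intro allI impI)
      fix U assume "openin (subtopology (arrow_topology G) W) U"
      then have U: "openin (arrow_topology G) U" "U \<subseteq> W"
        using openin_open_subtopology[OF assms(1)] by simp_all
      then show "openin (subtopology (unit_space G) (f ` W)) (f ` U)"
        using assms(3) openin_open_subtopology[OF o] unfolding open_map_def by (simp add: image_mono)
    qed
    show "f ` topspace (subtopology (arrow_topology G) W) = topspace (subtopology (unit_space G) (f ` W))"
      using W openin_subset[OF o] by (auto)
    show "inj_on f (topspace (subtopology (arrow_topology G) W))"
      using assms(4) by (rule inj_on_subset) auto
  qed
qed

lemma homeo_onto_open_unitsD: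
  assumes "homeo_onto_open_units G W f"
  shows "openin (arrow_topology G) W" "inj_on f W"
proof -
  show o: "openin (arrow_topology G) W" using assms unfolding homeo_onto_open_units_def by blast
  have "inj_on f (topspace (subtopology (arrow_topology G) W))"
    using assms homeomorphic_imp_injective_map unfolding homeo_onto_open_units_def by blast
  then show "inj_on f W" unfolding topspace_subtopology_subset[OF openin_subset[OF o]] .
qed

locale top_gpd = gpd +
  assumes topological: "topological_groupoid G"
begin

abbreviation T where "T \<equiv> arrow_topology G"

lemma continuous_mul:
  "continuous_map (subtopology (prod_topology T T) (composable G)) T (\<lambda>(a, b). gmult G a b)"
  and continuous_inv: "continuous_map T T (ginv G)"
  and Hausdorff_units: "Hausdorff_space (unit_space G)"
  using topological unfolding topological_groupoid_def by blast+

lemma continuous_mul':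
  assumes "continuous_map X T f" "continuous_map X T g"
    "\<And>x. x \<in> topspace X \<Longrightarrow> sou (f x) = ran (g x)"
  shows "continuous_map X T (\<lambda>x. f x \<cdot> g x)"
proof -
  have "continuous_map X (subtopology (prod_topology T T) (composable G)) (\<lambda>x. (f x, g x))"
    unfolding continuous_map_in_subtopology
  proof
    show "continuous_map X (prod_topology T T) (\<lambda>x. (f x, g x))"
      using assms(1,2) by (rule continuous_map_pairedI)
    show "(\<lambda>x. (f x, g x)) \<in> topspace X \<rightarrow> composable G"
      using assms(3) continuous_map_funspace[OF assms(1)] continuous_map_funspace[OF assms(2)]
      unfolding Pi_iff composable_iff by blast
  qed
  from continuous_map_compose[OF this continuous_mul] show ?thesis by (simp add: o_def)
qed

lemma continuous_ran': "continuous_map T T (rng G)"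
  unfolding rng_def[abs_def]
  by (rule continuous_mul'[OF continuous_map_id[unfolded id_def] continuous_inv]) simp

lemma continuous_ran: "continuous_map T (unit_space G) (rng G)"
  using continuous_ran' by (simp add: continuous_map_in_subtopology Pi_iff)

lemma homeo_inv: "homeomorphic_map T T (ginv G)"
  using homeomorphic_maps_map[of T T "ginv G" "ginv G"] continuous_inv
  by (simp add: homeomorphic_maps_def)

lemma sou_eq: "a \<in> arrows G \<Longrightarrow> sou a = ran (inv_of a)" by simp

lemma continuous_sou: "continuous_map T (unit_space G) (src G)"
proof -
  have "continuous_map T (unit_space G) (rng G \<circ> ginv G)"
    by (rule continuous_map_compose[OF continuous_inv continuous_ran])
  then show ?thesis by (rule continuous_map_eq) (simp)
qed

lemma open_inv: "openin T U \<Longrightarrow> openin T (ginv G ` U)"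
  using homeo_inv homeomorphic_imp_open_map open_map_def by blast

end

section \<open>Etale groupoids: open range map, open unit space, open products\<close>

locale etale_gpd = top_gpd +
  assumes etale: "etale_groupoid G"
begin

lemma ex_homeo_onto_open_units: "a \<in> arrows G \<Longrightarrow> \<exists>W. a \<in> W \<and> homeo_onto_open_units G W (rng G)"
  using etale by (simp add: etale_groupoid_def)

text \<open>Openness is local: around each point of \<open>U\<close> the range map is a
  homeomorphism between open sets.\<close>

lemma open_ran: "open_map T (unit_space G) (rng G)"
  unfolding open_map_def
proof (intro allI impI)
  fix U assume U: "openin T U"
  show "openin (unit_space G) (rng G ` U)"
  proof (subst openin_subopen, intro ballI)
    fix x assume "x \<in> rng G ` U"
    then obtain a where a: "a \<in> U" "x = ran a" by auto
    then have "a \<in> arrows G" using U openin_subset by blast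
    then obtain W where W: "a \<in> W" "homeo_onto_open_units G W (rng G)"
      using ex_homeo_onto_open_units by blast
    then have h: "openin T W" "openin (unit_space G) (rng G ` W)"
      "homeomorphic_map (subtopology T W) (subtopology (unit_space G) (rng G ` W)) (rng G)"
      unfolding homeo_onto_open_units_def by auto
    have "openin (subtopology T W) (U \<inter> W)" using U by (simp add: openin_subtopology_Int)
    then have "openin (subtopology (unit_space G) (rng G ` W)) (rng G ` (U \<inter> W))"
      using homeomorphic_imp_open_map[OF h(3)] open_map_def by blast
    then have "openin (unit_space G) (rng G ` (U \<inter> W))"
      using h(2) openin_trans_full by blast
    then show "\<exists>V. openin (unit_space G) V \<and> x \<in> V \<and> V \<subseteq> rng G ` U"
      using a W by blast
  qed
qed

lemma open_sou: "open_map T (unit_space G) (src G)"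
proof -
  have "open_map T (unit_space G) (rng G \<circ> ginv G)"
    by (rule open_map_compose[OF homeomorphic_imp_open_map[OF homeo_inv] open_ran])
  then show ?thesis by (rule open_map_eq) simp
qed

text \<open>Etaleness speaks only of the range map. The source is the range after inversion, so a
  good neighbourhood of \<open>inv_of a\<close> is inverted and intersected with one of
  \<open>a\<close>.\<close>

lemma locally_injective:
  assumes "a \<in> U" "openin T U"
  obtains W where "a \<in> W" "openin T W" "W \<subseteq> U" "inj_on (rng G) W" "inj_on (src G) W"
proof -
  have inj: "\<exists>W. b \<in> W \<and> openin T W \<and> inj_on (rng G) W" if "b \<in> arrows G" for b
  proof -
    obtain W where W: "b \<in> W" "homeo_onto_open_units G W (rng G)"
      using ex_homeo_onto_open_units[OF \<open>b \<in> arrows G\<close>] by auto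
    with homeo_onto_open_unitsD[OF W(2)] show ?thesis by auto
  qed
  have a: "a \<in> arrows G" using assms openin_subset by blast
  obtain W1 where W1: "a \<in> W1" "openin T W1" "inj_on (rng G) W1" using inj[OF a] by auto
  obtain W2 where W2: "inv_of a \<in> W2" "openin T W2" "inj_on (rng G) W2" using inj[OF inv_closed[OF a]] by auto
  have W2s: "W2 \<subseteq> arrows G" using W2 openin_subset by blast
  have s: "inj_on (src G) (ginv G ` W2)"
  proof (rule inj_onI)
    fix u v assume "u \<in> ginv G ` W2" "v \<in> ginv G ` W2" and e: "sou u = sou v"
    then obtain u' v' where u: "u' \<in> W2" "u = inv_of u'" and v: "v' \<in> W2" "v = inv_of v'" by auto
    have "u' \<in> arrows G" "v' \<in> arrows G" using W2s u v by auto
    then have "ran u' = ran v'" using e u v by simp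
    then have "u' = v'" using inj_onD[OF W2(3) _ u(1) v(1)] by simp
    then show "u = v" using u v by simp
  qed
  have "inv_of (inv_of a) \<in> ginv G ` W2" using W2(1) by (rule imageI)
  then have "a \<in> ginv G ` W2" using a by simp
  then show thesis
    using that[of "U \<inter> W1 \<inter> ginv G ` W2"] assms W1 s open_inv[OF W2(2)]
    by (auto intro: inj_on_subset)
qed

text \<open>If \<open>a\<close> and \<open>ran a\<close> are both close to a unit they lie in a
  common set on which the range map is injective; having the same range, they are equal.\<close>

lemma open_units: "openin T (units G)"
proof (subst openin_subopen, intro ballI)
  fix x assume x: "x \<in> units G"
  then have xT: "x \<in> arrows G" by (rule unit_arrow)
  obtain W where W: "x \<in> W" "openin T W" "W \<subseteq> arrows G" "inj_on (rng G) W" "inj_on (src G) W"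
    by (rule locally_injective[OF xT openin_topspace])
  let ?V = "{a \<in> topspace T. ran a \<in> W} \<inter> W"
  have "openin T ?V"
    using openin_continuous_map_preimage[OF continuous_ran' W(2)] W(2) by blast
  moreover have "x \<in> ?V" using W x xT by auto
  moreover have "?V \<subseteq> units G"
  proof
    fix a assume "a \<in> ?V"
    then have "ran a = a" using inj_onD[OF W(4), of "ran a" a] by auto
    then show "a \<in> units G" using \<open>a \<in> ?V\<close> unit_iff by auto
  qed
  ultimately show "\<exists>V. openin T V \<and> x \<in> V \<and> V \<subseteq> units G" by blast
qed

lemma openin_unit_space: "openin (unit_space G) U \<longleftrightarrow> openin T U \<and> U \<subseteq> units G"
  using open_units openin_open_subtopology by blast

lemma open_ran_image: "openin T U \<Longrightarrow> openin T (rng G ` U)"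
  and open_sou_image: "openin T U \<Longrightarrow> openin T (src G ` U)"
  using open_ran open_sou openin_unit_space open_map_def by blast+

lemma continuous_sou': "continuous_map T T (src G)"
  using continuous_sou continuous_map_in_subtopology by blast

text \<open>Range and source are continuous and open, so injectivity on an open set is all that
  remains of the bisection property. Later arguments use only this form.\<close>

lemma homeo_onto_open_units_iff:
  "homeo_onto_open_units G W (rng G) \<longleftrightarrow> openin T W \<and> inj_on (rng G) W"
  "homeo_onto_open_units G W (src G) \<longleftrightarrow> openin T W \<and> inj_on (src G) W"
proof -
  show "homeo_onto_open_units G W (rng G) \<longleftrightarrow> openin T W \<and> inj_on (rng G) W"
    using homeo_onto_open_unitsI[OF _ continuous_ran open_ran, of W] homeo_onto_open_unitsD[of G W "rng G"] by auto
  show "homeo_onto_open_units G W (src G) \<longleftrightarrow> openin T W \<and> inj_on (src G) W"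
    using homeo_onto_open_unitsI[OF _ continuous_sou open_sou, of W] homeo_onto_open_unitsD[of G W "src G"] by auto
qed

lemma compact_open_bisection_iff:
  "compact_open_bisection G D \<longleftrightarrow>
    compactin T D \<and> openin T D \<and> inj_on (rng G) D \<and> inj_on (src G) D"
  unfolding compact_open_bisection_def bisection_def homeo_onto_open_units_iff
  by (meson inj_on_subset order_refl)

text \<open>For a local section \<open>\<rho>\<close> of the range map through \<open>a\<close>, the arrows \<open>d\<close> close to \<open>a b\<close>
  factor as \<open>\<rho>(r(d)) (\<rho>(r(d))\<^sup>-\<^sup>1 d)\<close>.\<close>

lemma open_product:
  assumes U: "openin T U" and V: "openin T V"
  shows "openin T {a \<cdot> b |a b. a \<in> U \<and> b \<in> V \<and> sou a = ran b}" (is "openin T ?P")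
proof (subst openin_subopen, intro ballI)
  fix c assume "c \<in> ?P"
  then obtain a b where ab: "a \<in> U" "b \<in> V" "sou a = ran b" "c = a \<cdot> b" by auto
  have UV: "U \<subseteq> arrows G" "V \<subseteq> arrows G" using U V openin_subset by auto
  obtain W where W: "a \<in> W" "openin T W" "W \<subseteq> U" "inj_on (rng G) W" "inj_on (src G) W"
    by (rule locally_injective[OF ab(1) U])
  have "homeo_onto_open_units G W (rng G)" using W homeo_onto_open_units_iff(1) by simp
  then have h: "homeomorphic_map (subtopology T W) (subtopology (unit_space G) (rng G ` W)) (rng G)"
    and o: "openin (unit_space G) (rng G ` W)"
    unfolding homeo_onto_open_units_def by auto
  obtain \<rho> where \<rho>: "homeomorphic_maps (subtopology T W) (subtopology (unit_space G) (rng G ` W)) (rng G) \<rho>"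
    using h homeomorphic_map_maps by blast
  let ?D = "{d \<in> topspace T. ran d \<in> rng G ` W}"
  have oD: "openin T ?D"
    by (rule openin_continuous_map_preimage[OF continuous_ran o])
  have topW: "topspace (subtopology T W) = W"
    by (rule topspace_subtopology_subset[OF openin_subset[OF W(2)]])
  have topR: "topspace (subtopology (unit_space G) (rng G ` W)) = rng G ` W"
    by (rule topspace_subtopology_subset[OF openin_subset[OF o]])
  have \<rho>r: "\<rho> x \<in> W \<and> ran (\<rho> x) = x" if "x \<in> rng G ` W" for x
  proof -
    have "continuous_map (subtopology (unit_space G) (rng G ` W)) (subtopology T W) \<rho>"
      using \<rho> by (simp add: homeomorphic_maps_def)
    from continuous_map_funspace[OF this] have "\<rho> x \<in> W" unfolding topW topR using that by auto
    moreover have "\<forall>y \<in> topspace (subtopology (unit_space G) (rng G ` W)). ran (\<rho> y) = y"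
      using \<rho> by (simp add: homeomorphic_maps_def)
    ultimately show ?thesis unfolding topR using that by auto
  qed
  have \<rho>a: "\<rho> (ran a) = a" using \<rho> W topW unfolding homeomorphic_maps_def by blast
  have c1: "continuous_map (subtopology T ?D) T (\<lambda>d. \<rho> (ran d))"
  proof -
    have "continuous_map (subtopology T ?D) (subtopology (unit_space G) (rng G ` W)) (rng G)"
      using continuous_ran by (auto simp: continuous_map_in_subtopology continuous_map_from_subtopology)
    moreover have "continuous_map (subtopology (unit_space G) (rng G ` W)) T \<rho>"
      using \<rho> by (simp add: homeomorphic_maps_def continuous_map_in_subtopology)
    ultimately show ?thesis using continuous_map_compose[of _ _ "rng G" _ \<rho>] by (simp add: o_def)
  qed
  let ?f = "\<lambda>d. inv_of (\<rho> (ran d)) \<cdot> d"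
  have c2: "continuous_map (subtopology T ?D) T ?f"
  proof (rule continuous_mul')
    show "continuous_map (subtopology T ?D) T (\<lambda>d. inv_of (\<rho> (ran d)))"
      using continuous_map_compose[OF c1 continuous_inv] by (simp add: o_def)
    show "continuous_map (subtopology T ?D) T (\<lambda>d. d)" by (simp add: continuous_map_from_subtopology)
    show "sou (inv_of (\<rho> (ran d))) = ran d" if "d \<in> topspace (subtopology T ?D)" for d
    proof -
      have "\<rho> (ran d) \<in> W" "ran (\<rho> (ran d)) = ran d" using \<rho>r that by auto
      then show ?thesis using W UV by auto
    qed
  qed
  let ?N = "{d \<in> topspace (subtopology T ?D). ?f d \<in> V}"
  have "openin (subtopology T ?D) ?N" by (rule openin_continuous_map_preimage[OF c2 V])
  then have oN: "openin T ?N" using oD openin_trans_full by blast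
  have aA: "a \<in> arrows G" "b \<in> arrows G" using ab UV by auto
  have "ran c = ran a" using ab aA by simp
  then have "c \<in> ?N" using ab aA W \<rho>a by auto
  moreover have "?N \<subseteq> ?P"
  proof
    fix d assume d: "d \<in> ?N"
    then have p: "\<rho> (ran d) \<in> W" "ran (\<rho> (ran d)) = ran d" "d \<in> arrows G" using \<rho>r by auto
    then have p': "\<rho> (ran d) \<in> arrows G" using W UV by auto
    have "d = \<rho> (ran d) \<cdot> ?f d" using p p' by simp
    moreover have "sou (\<rho> (ran d)) = ran (?f d)" using p p' by simp
    ultimately show "d \<in> ?P" using p W d by blast
  qed
  ultimately show "\<exists>T'. openin T T' \<and> c \<in> T' \<and> T' \<subseteq> ?P" using oN by blast
qed

end

lemma etale_gpdI: "etale_groupoid G \<Longrightarrow> etale_gpd G"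
  by (auto simp: etale_gpd_def etale_gpd_axioms_def top_gpd_def top_gpd_axioms_def gpd_def
      etale_groupoid_def topological_groupoid_def)

section \<open>Unique products and units of twisted group rings\<close>

text \<open>Strojnowski's trick: if \<open>c\<^sub>0 d\<^sub>0 = 1\<close> were the only unique product of \<open>C D\<close>, then
  \<open>(D\<^sup>-\<^sup>1 c\<^sub>0\<^sup>-\<^sup>1 C) (D c\<^sub>0 C\<^sup>-\<^sup>1)\<close> would have none.\<close>

lemma (in group) nontrivial_unique_product:
  assumes upp: "unique_product_property G"
    and C: "finite C" "C \<subseteq> carrier G" "1 < card C"
    and D: "finite D" "D \<subseteq> carrier G" "D \<noteq> {}"
  shows "\<exists>c\<in>C. \<exists>d\<in>D. c \<otimes> d \<noteq> \<one> \<and> (\<forall>c'\<in>C. \<forall>d'\<in>D. c' \<otimes> d' = c \<otimes> d \<longrightarrow> c' = c \<and> d' = d)"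
proof (rule ccontr)
  let ?U = "\<lambda>c d. \<forall>c'\<in>C. \<forall>d'\<in>D. c' \<otimes> d' = c \<otimes> d \<longrightarrow> c' = c \<and> d' = d"
  have unique: "\<exists>e\<in>E. \<exists>f\<in>F. \<forall>e'\<in>E. \<forall>f'\<in>F. e' \<otimes> f' = e \<otimes> f \<longrightarrow> e' = e \<and> f' = f"
    if EF: "finite E" "E \<noteq> {}" "E \<subseteq> carrier G" "finite F" "F \<noteq> {}" "F \<subseteq> carrier G" for E F
  proof -
    have "\<exists>h. \<exists>!p. p \<in> E \<times> F \<and> fst p \<otimes> snd p = h"
      using upp[unfolded unique_product_property_def, rule_format, of E F] EF by simp
    then obtain h where h: "\<exists>!p. p \<in> E \<times> F \<and> fst p \<otimes> snd p = h" by (rule exE)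
    then obtain p where p: "p \<in> E \<times> F" "fst p \<otimes> snd p = h" by (auto dest: ex1_implies_ex)
    have u: "p' = p" if "p' \<in> E \<times> F" "fst p' \<otimes> snd p' = h" for p'
      using h p that by (rule_tac ex1E[OF h]) (metis (no_types, lifting))
    obtain e f where ef: "p = (e, f)" by (cases p)
    have "e' = e \<and> f' = f" if "e' \<in> E" "f' \<in> F" "e' \<otimes> f' = e \<otimes> f" for e' f'
      using u[of "(e', f')"] that p(2) ef by simp
    then show ?thesis using p(1) ef by (intro bexI[of _ e] bexI[of _ f]) auto
  qed
  assume "\<not> ?thesis"
  then have triv: "c \<otimes> d = \<one>" if "c \<in> C" "d \<in> D" "?U c d" for c d using that by blast
  have "C \<noteq> {}" using C by auto
  then obtain c0 d0 where cd0: "c0 \<in> C" "d0 \<in> D" "?U c0 d0" using unique[of C D] C D by blast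
  have c0: "c0 \<in> carrier G" "d0 \<in> carrier G" using cd0 C D by auto
  have "c0 \<otimes> d0 = \<one>" using triv cd0 by blast
  then have d0: "d0 = inv c0" using c0 inv_equality inv_inv by (metis inv_char l_inv r_inv inv_closed)
  have other: "\<exists>c'\<in>C. \<exists>d'\<in>D. c' \<otimes> d' = c \<otimes> d \<and> (c' \<noteq> c \<or> d' \<noteq> d)"
    if "c \<in> C" "d \<in> D" "c \<noteq> c0 \<or> d \<noteq> d0" for c d
  proof (rule ccontr)
    assume "\<not> ?thesis"
    then have "c \<otimes> d = \<one>" using triv[of c d] that by blast
    then have "c \<otimes> d = c0 \<otimes> d0" using \<open>c0 \<otimes> d0 = \<one>\<close> by simp
    then show False using cd0(3) that by blast
  qed
  \<comment> \<open>In \<open>e d c \<otimes> f d' c'\<close> the product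
    \<open>c \<otimes> d'\<close> stands in the middle, conjugated by \<open>c0\<close>, so another
    factorisation of it can be substituted there.\<close>
  define e where "e = (\<lambda>d c. inv d \<otimes> inv c0 \<otimes> c)"
  define f where "f = (\<lambda>d c. d \<otimes> c0 \<otimes> inv c)"
  have cC: "c \<in> carrier G" if "c \<in> C" for c using that C by auto
  have dD: "d \<in> carrier G" if "d \<in> D" for d using that D by auto
  let ?E = "{e d c |d c. d \<in> D \<and> c \<in> C}" and ?F = "{f d c |d c. d \<in> D \<and> c \<in> C}"
  have fin: "finite ?E" "finite ?F"
  proof -
    have "?E = (\<lambda>(d, c). e d c) ` (D \<times> C)" "?F = (\<lambda>(d, c). f d c) ` (D \<times> C)" by auto
    then show "finite ?E" "finite ?F" using C D by simp_all
  qed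
  have ne: "?E \<noteq> {}" "?F \<noteq> {}" using cd0 by blast+
  have sub: "?E \<subseteq> carrier G" "?F \<subseteq> carrier G" using cC dD c0 unfolding e_def f_def by auto
  obtain x y where xy: "x \<in> ?E" "y \<in> ?F"
    and u: "\<And>x' y'. x' \<in> ?E \<Longrightarrow> y' \<in> ?F \<Longrightarrow> x' \<otimes> y' = x \<otimes> y \<Longrightarrow> x' = x \<and> y' = y"
    using unique[OF fin(1) ne(1) sub(1) fin(2) ne(2) sub(2)] by blast
  obtain d1 c1 where 1: "d1 \<in> D" "c1 \<in> C" "x = e d1 c1" using xy by blast
  obtain d2 c2 where 2: "d2 \<in> D" "c2 \<in> C" "y = f d2 c2" using xy by blast
  have ef: "e d c \<otimes> f d' c' = inv d \<otimes> inv c0 \<otimes> (c \<otimes> d') \<otimes> c0 \<otimes> inv c'"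
    if "d \<in> D" "c \<in> C" "d' \<in> D" "c' \<in> C" for d c d' c'
    using cC[OF that(2)] cC[OF that(4)] dD[OF that(1)] dD[OF that(3)] c0
    by (simp add: e_def f_def m_assoc)
  have einj: "c = c'" if "c \<in> C" "c' \<in> C" "d \<in> D" "e d c = e d c'" for c c' d
    using that cC dD c0 by (simp add: e_def)
  have finj: "d = d'" if "d \<in> D" "d' \<in> D" "c \<in> C" "f d c = f d' c" for d d' c
    using that cC dD c0 by (simp add: f_def)
  \<comment> \<open>A second factorisation of the inner product \<open>c1 \<otimes> d2\<close> would
    give a second factorisation of the unique product \<open>x \<otimes> y\<close>.\<close>
  have c1: "c1 = c0 \<and> d2 = d0"
  proof (rule ccontr)
    assume "\<not> ?thesis"
    then obtain c' d' where o: "c' \<in> C" "d' \<in> D" "c' \<otimes> d' = c1 \<otimes> d2" "c' \<noteq> c1 \<or> d' \<noteq> d2"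
      using other[of c1 d2] 1 2 by blast
    have "e d1 c' \<otimes> f d' c2 = x \<otimes> y" using ef o 1 2 by simp
    moreover have "e d1 c' \<in> ?E" "f d' c2 \<in> ?F" using o 1 2 by auto
    ultimately have "e d1 c' = x" "f d' c2 = y" using u by auto
    then show False using o einj[of c' c1 d1] finj[of d' d2 c2] 1 2 by auto
  qed
  have e0: "e d c0 = inv d" if "d \<in> D" for d
    using that dD c0 by (simp add: e_def m_assoc)
  have f0: "f d0 c = inv c" if "c \<in> C" for c
    using that cC c0 d0 by (simp add: f_def)
  \<comment> \<open>Now \<open>x\<close> and \<open>y\<close> are the inverses of \<open>d1\<close>
    and \<open>c2\<close>, so their product is the inverse of \<open>c2 \<otimes> d1\<close>; a
    second factorisation of the latter again contradicts uniqueness.\<close>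
  have c2: "c2 = c0 \<and> d1 = d0"
  proof (rule ccontr)
    assume "\<not> ?thesis"
    then obtain c' d' where o: "c' \<in> C" "d' \<in> D" "c' \<otimes> d' = c2 \<otimes> d1" "c' \<noteq> c2 \<or> d' \<noteq> d1"
      using other[of c2 d1] 1 2 by blast
    have "e d' c0 \<otimes> f d0 c' = inv (c' \<otimes> d')"
      using e0[OF o(2)] f0[OF o(1)] cC[OF o(1)] dD[OF o(2)] by (simp add: inv_mult_group)
    also have "\<dots> = inv (c2 \<otimes> d1)" using o(3) by simp
    also have "\<dots> = x \<otimes> y" using e0[OF 1(1)] f0[OF 2(2)] 1(3) 2(3) c1 cC[OF 2(2)] dD[OF 1(1)]
      by (simp add: inv_mult_group)
    finally have "e d' c0 = x \<and> f d0 c' = y"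
      using u[of "e d' c0" "f d0 c'"] o cd0 by auto
    then have "inv d' = inv d1" "inv c' = inv c2" using e0 f0 o 1 2 c1 by auto
    then show False using o 1 2 cC dD inv_inv by metis
  qed
  obtain c where c: "c \<in> C" "c \<noteq> c0"
  proof -
    have "\<exists>c\<in>C. c \<noteq> c0"
    proof (rule ccontr)
      assume "\<not> ?thesis"
      then have "C \<subseteq> {c0}" by auto
      then have "card C \<le> 1" using card_mono[of "{c0}" C] by simp
      then show False using C by simp
    qed
    then show thesis using that by blast
  qed
  \<comment> \<open>All four indices are now forced and \<open>x \<otimes> y\<close> is the
    identity. But \<open>e d0 c\<close> and \<open>f d0 c\<close> are inverse to each other for
    every \<open>c\<close> in \<open>C\<close>, so two elements of \<open>C\<close> give two
    factorisations.\<close>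
  have "x = e d0 c0" "y = f d0 c0" using 1 2 c1 c2 by auto
  then have "x \<otimes> y = \<one>" using e0[OF cd0(2)] f0[OF cd0(1)] c0 d0 by simp
  moreover have "e d0 c \<otimes> f d0 c = \<one>" using c cC c0 d0 f0[OF c(1)] by (simp add: e_def)
  ultimately have "e d0 c = x" using u[of "e d0 c" "f d0 c"] c cd0 by auto
  then have "e d0 c = e d0 c0" using \<open>x = e d0 c0\<close> by simp
  then show False using einj c cd0 by blast
qed

text \<open>The hypothesis says that the product of \<open>f\<close> and \<open>g\<close> in the group ring twisted by the units \<open>w\<close>
  is a multiple of the identity. A nontrivial unique product \<open>c d\<close> gives
  \<open>f(c) g(d) = 0\<close>, so the supports of \<open>g(d) f\<close> and of every multiple of \<open>g\<close> by an annihilator of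
  \<open>g(d)\<close> are smaller.\<close>

lemma (in group) unique_product_coefficients:
  fixes f g :: "'a \<Rightarrow> 'r::comm_ring_1" and w :: "'a \<Rightarrow> 'a \<Rightarrow> 'r"
  assumes red: "reduced_ring TYPE('r)" and upp: "unique_product_property G"
    and w: "\<And>z h. z \<in> carrier G \<Longrightarrow> h \<in> carrier G \<Longrightarrow> w z h dvd 1"
  shows "finite C \<Longrightarrow> finite D \<Longrightarrow> C \<subseteq> carrier G \<Longrightarrow> D \<subseteq> carrier G \<Longrightarrow>
    (\<And>h. h \<in> carrier G \<Longrightarrow> h \<notin> C \<Longrightarrow> f h = 0) \<Longrightarrow> (\<And>h. h \<in> carrier G \<Longrightarrow> h \<notin> D \<Longrightarrow> g h = 0) \<Longrightarrow>
    (\<And>z. z \<in> carrier G \<Longrightarrow> z \<noteq> \<one> \<Longrightarrow> (\<Sum>h\<in>C. f h * w z h * g (inv h \<otimes> z)) = 0) \<Longrightarrow>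
    h \<in> carrier G \<Longrightarrow> h' \<in> carrier G \<Longrightarrow> h \<noteq> h' \<Longrightarrow>
    f h * f h' * (\<Sum>h\<in>C. f h * w \<one> h * g (inv h)) = 0"
proof (induction "card C + card D" arbitrary: C D f g rule: less_induct)
  case less
  let ?u = "\<Sum>h\<in>C. f h * w \<one> h * g (inv h)"
  have nil: "a = 0" if "a ^ n = 0" for a :: 'r and n :: nat
    using red that unfolding reduced_ring_def by blast
  show ?case
  proof (cases "1 < card C \<and> D \<noteq> {}")
    \<comment> \<open>Base of the induction: if \<open>C\<close> has at most one element,
      \<open>f\<close> vanishes at \<open>h\<close> or at \<open>h'\<close>; if \<open>D\<close> is
      empty, the coefficient at the identity vanishes.\<close>
    case False
    consider "card C \<le> 1" | "D = {}" using False by linarith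
    then show ?thesis
    proof cases
      case 1
      have "h \<notin> C \<or> h' \<notin> C"
        using 1 less.prems(1,10) card_le_Suc0_iff_eq[of C] by auto
      then show ?thesis using less.prems(5,8,9) by auto
    next
      case 2
      have "?u = 0"
        using 2 less.prems(3,6) by (intro sum.neutral ballI) auto
      then show ?thesis by simp
    qed
  next
    case True
    then obtain c d where cd: "c \<in> C" "d \<in> D" "c \<otimes> d \<noteq> \<one>"
      and u: "\<And>c' d'. c' \<in> C \<Longrightarrow> d' \<in> D \<Longrightarrow> c' \<otimes> d' = c \<otimes> d \<Longrightarrow> c' = c \<and> d' = d"
      using nontrivial_unique_product[OF upp less.prems(1,3) _ less.prems(2,4)] by blast
    have car: "c \<in> carrier G" "d \<in> carrier G" using cd less.prems(3,4) by auto
    have "(\<Sum>h\<in>C. f h * w (c \<otimes> d) h * g (inv h \<otimes> (c \<otimes> d))) = f c * w (c \<otimes> d) c * g (inv c \<otimes> (c \<otimes> d))"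
    proof (rule sum.remove[OF less.prems(1) cd(1), THEN trans], simp, rule sum.neutral, rule ballI)
      fix a assume a: "a \<in> C - {c}"
      then have aC: "a \<in> carrier G" using less.prems(3) by auto
      have "a \<otimes> (inv a \<otimes> (c \<otimes> d)) = c \<otimes> d" using aC car by (simp add: m_assoc[symmetric])
      then have "inv a \<otimes> (c \<otimes> d) \<notin> D" using u[of a "inv a \<otimes> (c \<otimes> d)"] a by auto
      then have "g (inv a \<otimes> (c \<otimes> d)) = 0" using less.prems(6) aC car by simp
      then show "f a * w (c \<otimes> d) a * g (inv a \<otimes> (c \<otimes> d)) = 0" by simp
    qed
    also have "inv c \<otimes> (c \<otimes> d) = d" using car by (simp add: m_assoc[symmetric])
    finally have 0: "f c * w (c \<otimes> d) c * g d = 0" using less.prems(7)[of "c \<otimes> d"] cd car by simp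
    have fg: "f c * g d = 0"
    proof -
      obtain k where k: "1 = w (c \<otimes> d) c * k" using w[of "c \<otimes> d" c] car by (auto elim: dvdE)
      have "f c * g d = f c * w (c \<otimes> d) c * g d * k" using k by (metis mult.assoc mult.commute mult.right_neutral)
      then show ?thesis using 0 by simp
    qed
    let ?x = "f h * f h' * ?u"
    have "(g d * f h) * (g d * f h') * (\<Sum>a\<in>C - {c}. (g d * f a) * w \<one> a * g (inv a)) = 0"
    proof (rule less.hyps[of "C - {c}" D "\<lambda>a. g d * f a" g])
      show "card (C - {c}) + card D < card C + card D"
        using card_Diff1_less[OF less.prems(1) cd(1)] by simp
      show "g d * f a = 0" if "a \<in> carrier G" "a \<notin> C - {c}" for a
        using that less.prems(5) fg by (cases "a = c") (auto simp: mult.commute)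
      show "(\<Sum>a\<in>C - {c}. g d * f a * w z a * g (inv a \<otimes> z)) = 0" if z: "z \<in> carrier G" "z \<noteq> \<one>" for z
      proof -
        have "(\<Sum>a\<in>C - {c}. g d * f a * w z a * g (inv a \<otimes> z)) = (\<Sum>a\<in>C. g d * f a * w z a * g (inv a \<otimes> z))"
          using less.prems(1) fg by (intro sum.mono_neutral_left) (auto simp: mult.commute)
        also have "\<dots> = g d * (\<Sum>a\<in>C. f a * w z a * g (inv a \<otimes> z))"
          by (simp add: sum_distrib_left mult.assoc)
        also have "\<dots> = 0" using less.prems(7)[OF z] by simp
        finally show ?thesis .
      qed
    qed (use less.prems in auto)
    also have "(\<Sum>a\<in>C - {c}. (g d * f a) * w \<one> a * g (inv a)) = (\<Sum>a\<in>C. (g d * f a) * w \<one> a * g (inv a))"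
      using less.prems(1) fg by (intro sum.mono_neutral_left) (auto simp: mult.commute)
    also have "\<dots> = g d * ?u" by (simp add: sum_distrib_left mult.assoc)
    finally have "(g d * ?x) * (g d * g d) = 0" by (simp add: ac_simps)
    \<comment> \<open>The induction hypothesis for \<open>g d\<close> times \<open>f\<close> yields
      the cube of \<open>g d\<close> times \<open>?x\<close>. Multiplying by the square of
      \<open>?x\<close> makes it a full cube, which reducedness cancels.\<close>
    then have "(g d * ?x) * (g d * g d) * (?x * ?x) = 0" by simp
    then have "(g d * ?x) ^ 3 = 0" by (simp add: power3_eq_cube ac_simps)
    then have gx: "g d * ?x = 0" by (rule nil)
    \<comment> \<open>Second use of the induction hypothesis, now for \<open>?x\<close> times
      \<open>g\<close>, whose support misses \<open>d\<close>. Since \<open>?x\<close> is itself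
      \<open>f h * f h'\<close> times the identity coefficient, the conclusion is that the square of
      \<open>?x\<close> vanishes.\<close>
    have "f h * f h' * (\<Sum>a\<in>C. f a * w \<one> a * (?x * g (inv a))) = 0"
    proof (rule less.hyps[of C "D - {d}" f "\<lambda>a. ?x * g a"])
      show "card C + card (D - {d}) < card C + card D"
        using card_Diff1_less[OF less.prems(2) cd(2)] by simp
      show "?x * g a = 0" if "a \<in> carrier G" "a \<notin> D - {d}" for a
        using that less.prems(6) gx by (cases "a = d") (auto simp: mult.commute)
      show "(\<Sum>a\<in>C. f a * w z a * (?x * g (inv a \<otimes> z))) = 0" if z: "z \<in> carrier G" "z \<noteq> \<one>" for z
      proof -
        have "(\<Sum>a\<in>C. f a * w z a * (?x * g (inv a \<otimes> z))) = ?x * (\<Sum>a\<in>C. f a * w z a * g (inv a \<otimes> z))"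
          by (subst sum_distrib_left) (simp add: ac_simps)
        also have "\<dots> = 0" using less.prems(7)[OF z] by simp
        finally show ?thesis .
      qed
    qed (use less.prems in auto)
    also have "(\<Sum>a\<in>C. f a * w \<one> a * (?x * g (inv a))) = ?x * ?u"
      by (subst sum_distrib_left[of ?x]) (simp add: ac_simps)
    finally have "?x ^ 2 = 0" by (simp add: power2_eq_square ac_simps)
    then show ?thesis by (rule nil)
  qed
qed

text \<open>With identity coefficient 1, the values of \<open>f\<close> at distinct elements
  annihilate each other. The summands of that coefficient are then orthogonal with sum 1, hence
  idempotent, and indecomposability makes one of them, at \<open>a\<close>, equal to 1. This summand
  is a multiple of \<open>f a\<close>, so it kills \<open>f b\<close> for \<open>b\<close> different
  from \<open>a\<close>.\<close>

lemma (in group) unique_product_trivial_units: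
  fixes f g :: "'a \<Rightarrow> 'r::comm_ring_1" and w :: "'a \<Rightarrow> 'a \<Rightarrow> 'r"
  assumes red: "reduced_ring TYPE('r)" and ind: "indecomposable_ring TYPE('r)"
    and upp: "unique_product_property G"
    and w: "\<And>z h. z \<in> carrier G \<Longrightarrow> h \<in> carrier G \<Longrightarrow> w z h dvd 1"
    and CD: "finite C" "finite D" "C \<subseteq> carrier G" "D \<subseteq> carrier G"
      "\<And>h. h \<in> carrier G \<Longrightarrow> h \<notin> C \<Longrightarrow> f h = 0" "\<And>h. h \<in> carrier G \<Longrightarrow> h \<notin> D \<Longrightarrow> g h = 0"
    and zero: "\<And>z. z \<in> carrier G \<Longrightarrow> z \<noteq> \<one> \<Longrightarrow> (\<Sum>h\<in>C. f h * w z h * g (inv h \<otimes> z)) = 0"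
    and one: "(\<Sum>h\<in>C. f h * w \<one> h * g (inv h)) = 1"
    and h: "h \<in> carrier G" "h' \<in> carrier G" "f h \<noteq> 0" "f h' \<noteq> 0"
  shows "h = h'"
proof -
  have orth: "f a * f b = 0" if "a \<in> carrier G" "b \<in> carrier G" "a \<noteq> b" for a b
    using unique_product_coefficients[of w C D f g a b, OF red upp w CD zero that] one by simp
  let ?e = "\<lambda>h. f h * w \<one> h * g (inv h)"
  have orth': "?e a * ?e b = 0" if "a \<in> C" "b \<in> C" "a \<noteq> b" for a b
  proof -
    have "?e a * ?e b = f a * f b * (w \<one> a * g (inv a) * (w \<one> b * g (inv b)))" by (simp only: ac_simps)
    moreover have "f a * f b = 0" using orth[of a b] that CD(3) by auto
    ultimately show ?thesis by simp
  qed
  have idem: "?e a * ?e a = ?e a" if "a \<in> C" for a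
  proof -
    have "?e a = (\<Sum>b\<in>C. ?e a * ?e b)" using one by (simp flip: sum_distrib_left)
    also have "\<dots> = ?e a * ?e a + (\<Sum>b\<in>C - {a}. ?e a * ?e b)" by (rule sum.remove[OF CD(1) that])
    also have "(\<Sum>b\<in>C - {a}. ?e a * ?e b) = 0"
      using that by (intro sum.neutral ballI orth') auto
    finally show ?thesis by simp
  qed
  have "\<exists>a\<in>C. ?e a \<noteq> 0"
  proof (rule ccontr)
    assume "\<not> ?thesis"
    then have "(\<Sum>h\<in>C. ?e h) = 0" by (intro sum.neutral) auto
    then show False using one by simp
  qed
  then obtain a where a: "a \<in> C" "?e a \<noteq> 0" by blast
  then have ea: "?e a = 1" using ind idem[OF a(1)] unfolding indecomposable_ring_def by blast
  have "b = a" if b: "b \<in> carrier G" "f b \<noteq> 0" for b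
  proof (rule ccontr)
    assume "b \<noteq> a"
    then have "f b * f a = 0" using orth b a CD(3) by auto
    then have "f b * ?e a = 0" by (simp add: mult.assoc[symmetric])
    then show False using ea b by simp
  qed
  then show ?thesis using h by blast
qed

section \<open>The total space of a twist\<close>

lemma ring_unitsI: "t * u = 1 \<Longrightarrow> t \<in> ring_units"
  unfolding ring_units_def by (auto intro: dvdI[of 1 t u])

lemma ring_units_1 [simp]: "1 \<in> ring_units"
  by (simp add: ring_units_def)

lemma unit_inverse_eq: "t * u = 1 \<Longrightarrow> unit_inverse t = u"
  unfolding unit_inverse_def by (rule the_equality) (auto, metis mult.assoc mult.commute mult.right_neutral)

lemma unit_inverse_right [simp]: "t \<in> ring_units \<Longrightarrow> t * unit_inverse t = 1"
  unfolding ring_units_def using unit_inverse_eq[of t] by (metis dvdE mem_Collect_eq)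

lemma unit_inverse_left [simp]: "t \<in> ring_units \<Longrightarrow> unit_inverse t * t = 1"
  by (simp add: mult.commute)

lemma unit_inverse_cancel [simp]:
  "t \<in> ring_units \<Longrightarrow> t * (unit_inverse t * a) = a" "t \<in> ring_units \<Longrightarrow> unit_inverse t * (t * a) = a"
  by (simp_all flip: mult.assoc)

lemma unit_inverse_units [simp]: "t \<in> ring_units \<Longrightarrow> unit_inverse t \<in> ring_units"
  by (rule ring_unitsI[of _ t]) simp

lemma ring_units_mult [simp]:
  assumes "t \<in> ring_units" "u \<in> ring_units" shows "t * u \<in> ring_units"
  by (rule ring_unitsI[of _ "unit_inverse u * unit_inverse t"])
    (use assms in \<open>simp add: mult.assoc\<close>)

lemma unit_inverse_mult:
  assumes "t \<in> ring_units" "u \<in> ring_units"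
  shows "unit_inverse (t * u) = unit_inverse t * unit_inverse u"
proof (rule unit_inverse_eq)
  have "t * u * (unit_inverse t * unit_inverse u) = (t * unit_inverse t) * (u * unit_inverse u)"
    by (simp only: ac_simps)
  then show "t * u * (unit_inverse t * unit_inverse u) = 1" using assms by simp
qed

lemma unit_inverse_1 [simp]: "unit_inverse 1 = 1"
  by (rule unit_inverse_eq) simp

lemma unit_inverse_inverse [simp]: "t \<in> ring_units \<Longrightarrow> unit_inverse (unit_inverse t) = t"
  by (rule unit_inverse_eq) simp

lemma unit_inverse_eq_0 [simp]: "t \<in> ring_units \<Longrightarrow> unit_inverse t * a = 0 \<longleftrightarrow> a = 0"
  by (metis mult_zero_right unit_inverse_cancel(1))

lemma unit_nonzero: "t \<in> ring_units \<Longrightarrow> t \<noteq> 0"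
  by (auto simp: ring_units_def)

lemma (in gpd) idempotent_unit:
  assumes "a \<in> arrows G" "sou a = ran a" "a \<cdot> a = a" shows "a \<in> units G"
proof -
  have "a = inv_of a \<cdot> (a \<cdot> a)" using inv_mul_cancel(1)[of a a] assms by simp
  then have "a = sou a" using assms(3) by simp
  then show ?thesis using sou_units[OF assms(1)] by simp
qed

text \<open>Only products are preserved by definition. The image of a unit is idempotent, hence a
  unit, and this forces inverses, ranges and sources to be preserved.\<close>

lemma groupoid_hom_inv:
  assumes "gpd G" "gpd H" "groupoid_hom G H \<phi>" "a \<in> arrows G"
  shows "\<phi> (ginv G a) = ginv H (\<phi> a)" "\<phi> (rng G a) = rng H (\<phi> a)" "\<phi> (src G a) = src H (\<phi> a)"
proof -
  interpret G: gpd G by fact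
  interpret H: gpd H by fact
  have hom: "(\<phi> a, \<phi> b) \<in> composable H \<and> \<phi> (gmult G a b) = gmult H (\<phi> a) (\<phi> b)"
    if "(a, b) \<in> composable G" for a b
    using assms(3) that unfolding groupoid_hom_def by blast
  have arr: "\<phi> b \<in> arrows H" if "b \<in> arrows G" for b
    using assms(3) that unfolding groupoid_hom_def by blast
  note 1 = hom[OF G.composable_inv(2)[OF assms(4)]]
  have "(G.ran a, G.ran a) \<in> composable G" using assms(4) by (simp add: G.composable_iff)
  note 2 = hom[OF this]
  have r: "\<phi> (G.ran a) \<in> arrows H" using arr assms(4) by simp
  have "gmult G (G.ran a) (G.ran a) = G.ran a" using assms(4) by simp
  then have "\<phi> (G.ran a) \<in> units H"
    using 2 r by (intro H.idempotent_unit) (auto simp: H.composable_iff)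
  moreover have "\<phi> (G.ran a) = gmult H (\<phi> a) (\<phi> (ginv G a))" using 1 by simp
  ultimately show i: "\<phi> (ginv G a) = ginv H (\<phi> a)"
    using 1 by (intro H.mul_eq_unitD) (auto simp: H.composable_iff)
  show "\<phi> (rng G a) = rng H (\<phi> a)" using 1 i by simp
  show "\<phi> (src G a) = src H (\<phi> a)" using hom[OF G.composable_inv(1)[OF assms(4)]] i by simp
qed

section \<open>Fibres of a twist and the action of the ring units\<close>

locale twist =
  fixes \<Sigma> :: "'s groupoid" (structure) and i :: "'g \<times> 'r::comm_ring_1 \<Rightarrow> 's"
    and q :: "'s \<Rightarrow> 'g" and G :: "'g groupoid"
  assumes twist: "discrete_twist \<Sigma> i q G"
begin

lemma etale_base: "etale_groupoid G" and topological_total: "topological_groupoid \<Sigma>"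
  and units_total: "units \<Sigma> = i ` (units G \<times> {1})"
  and i_continuous: "continuous_map (arrow_topology (trivial_bundle G)) (arrow_topology \<Sigma>) i"
  and i_hom: "groupoid_hom (trivial_bundle G) \<Sigma> i"
  and q_continuous: "continuous_map (arrow_topology \<Sigma>) (arrow_topology G) q"
  and q_hom: "groupoid_hom \<Sigma> G q"
  and q_units: "homeomorphic_map (unit_space \<Sigma>) (unit_space G) q"
  and q_fibre: "x \<in> units G \<Longrightarrow> i ` ({x} \<times> ring_units) = {\<sigma> \<in> arrows \<Sigma>. q \<sigma> = x}"
  and i_inj: "inj_on i (units G \<times> ring_units)"
  and q_surj: "q ` arrows \<Sigma> = arrows G"
  and trivialisation: "\<alpha> \<in> arrows G \<Longrightarrow> \<exists>D P. \<alpha> \<in> D \<and> openin (arrow_topology G) D \<and> bisection G D \<and>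
       continuous_map (subtopology (arrow_topology G) D) (arrow_topology \<Sigma>) P \<and>
       (\<forall>\<beta> \<in> D. q (P \<beta>) = \<beta>) \<and>
       homeomorphic_map
         (prod_topology (subtopology (arrow_topology G) D) (discrete_topology ring_units))
         (subtopology (arrow_topology \<Sigma>) {\<sigma> \<in> arrows \<Sigma>. q \<sigma> \<in> D})
         (\<lambda>(\<beta>, t). gmult \<Sigma> (i (rng G \<beta>, t)) (P \<beta>))"
  and i_central: "\<sigma> \<in> arrows \<Sigma> \<Longrightarrow> t \<in> ring_units \<Longrightarrow>
       gmult \<Sigma> (i (q (rng \<Sigma> \<sigma>), t)) \<sigma> = gmult \<Sigma> \<sigma> (i (q (src \<Sigma> \<sigma>), t))"
  using twist unfolding discrete_twist_def by blast+

end

sublocale twist \<subseteq> G: etale_gpd G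
  by (rule etale_gpdI[OF etale_base])

sublocale twist \<subseteq> S: top_gpd \<Sigma>
  using topological_total by unfold_locales (auto simp: topological_groupoid_def)

context twist
begin

abbreviation act where "act t \<sigma> \<equiv> twist_action \<Sigma> i q t \<sigma>"

lemma q_arrow [simp]: "\<sigma> \<in> arrows \<Sigma> \<Longrightarrow> q \<sigma> \<in> arrows G"
  using q_surj by blast

lemma q_inv [simp]: "\<sigma> \<in> arrows \<Sigma> \<Longrightarrow> q (S.inv_of \<sigma>) = G.inv_of (q \<sigma>)"
  and q_ran [simp]: "\<sigma> \<in> arrows \<Sigma> \<Longrightarrow> q (S.ran \<sigma>) = G.ran (q \<sigma>)"
  and q_sou [simp]: "\<sigma> \<in> arrows \<Sigma> \<Longrightarrow> q (S.sou \<sigma>) = G.sou (q \<sigma>)"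
  using groupoid_hom_inv[OF S.gpd_axioms G.gpd_axioms q_hom] by simp_all

lemma i_fibre:
  assumes "x \<in> units G" "t \<in> ring_units"
  shows i_arrow [simp]: "i (x, t) \<in> arrows \<Sigma>" and q_i [simp]: "q (i (x, t)) = x"
proof -
  have "i (x, t) \<in> i ` ({x} \<times> ring_units)" using assms by (intro imageI) auto
  then show "i (x, t) \<in> arrows \<Sigma>" "q (i (x, t)) = x" unfolding q_fibre[OF assms(1)] by auto
qed

lemma fibre_unit:
  assumes "\<sigma> \<in> arrows \<Sigma>" "q \<sigma> \<in> units G" obtains t where "t \<in> ring_units" "\<sigma> = i (q \<sigma>, t)"
proof -
  have "\<sigma> \<in> i ` ({q \<sigma>} \<times> ring_units)" unfolding q_fibre[OF assms(2)] using assms by simp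
  then show thesis using that by auto
qed

lemma unit_total: "x \<in> units \<Sigma> \<Longrightarrow> q x \<in> units G \<and> x = i (q x, 1)"
  unfolding units_total by auto

lemma i_unit [simp]: "x \<in> units G \<Longrightarrow> i (x, 1) \<in> units \<Sigma>"
  unfolding units_total by auto

lemma ran_eq: "\<sigma> \<in> arrows \<Sigma> \<Longrightarrow> S.ran \<sigma> = i (G.ran (q \<sigma>), 1)"
  and sou_eq: "\<sigma> \<in> arrows \<Sigma> \<Longrightarrow> S.sou \<sigma> = i (G.sou (q \<sigma>), 1)"
  using unit_total[OF S.ran_units] unit_total[OF S.sou_units] by simp_all

lemma i_eq_iff [simp]:
  "x \<in> units G \<Longrightarrow> y \<in> units G \<Longrightarrow> t \<in> ring_units \<Longrightarrow> u \<in> ring_units \<Longrightarrow> i (x, t) = i (y, u) \<longleftrightarrow> x = y \<and> t = u"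
  using inj_on_eq_iff[OF i_inj, of "(x, t)" "(y, u)"] by simp

text \<open>A unit of \<open>\<Sigma>\<close> is determined by its image under \<open>q\<close>, so
  composability in \<open>\<Sigma>\<close> can be tested in \<open>G\<close>.\<close>

lemma composable_eq:
  "\<sigma> \<in> arrows \<Sigma> \<Longrightarrow> \<tau> \<in> arrows \<Sigma> \<Longrightarrow> S.sou \<sigma> = S.ran \<tau> \<longleftrightarrow> G.sou (q \<sigma>) = G.ran (q \<tau>)"
  "\<sigma> \<in> arrows \<Sigma> \<Longrightarrow> \<tau> \<in> arrows \<Sigma> \<Longrightarrow> S.ran \<sigma> = S.ran \<tau> \<longleftrightarrow> G.ran (q \<sigma>) = G.ran (q \<tau>)"
  "\<sigma> \<in> arrows \<Sigma> \<Longrightarrow> \<tau> \<in> arrows \<Sigma> \<Longrightarrow> S.sou \<sigma> = S.sou \<tau> \<longleftrightarrow> G.sou (q \<sigma>) = G.sou (q \<tau>)"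
  by (simp_all add: ran_eq sou_eq)

lemma q_mul [simp]:
  assumes "\<sigma> \<in> arrows \<Sigma>" "\<tau> \<in> arrows \<Sigma>" "G.sou (q \<sigma>) = G.ran (q \<tau>)"
  shows "q (\<sigma> \<cdot> \<tau>) = q \<sigma> \<cdot>\<^bsub>G\<^esub> q \<tau>" "\<sigma> \<cdot> \<tau> \<in> arrows \<Sigma>"
    "S.ran (\<sigma> \<cdot> \<tau>) = S.ran \<sigma>" "S.sou (\<sigma> \<cdot> \<tau>) = S.sou \<tau>"
proof -
  have c: "S.sou \<sigma> = S.ran \<tau>" using assms composable_eq by simp
  then have "(\<sigma>, \<tau>) \<in> composable \<Sigma>" using assms S.composable_iff by blast
  then show "q (\<sigma> \<cdot> \<tau>) = q \<sigma> \<cdot>\<^bsub>G\<^esub> q \<tau>" using q_hom unfolding groupoid_hom_def by blast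
  show "\<sigma> \<cdot> \<tau> \<in> arrows \<Sigma>" "S.ran (\<sigma> \<cdot> \<tau>) = S.ran \<sigma>" "S.sou (\<sigma> \<cdot> \<tau>) = S.sou \<tau>"
    using assms c by simp_all
qed

lemma i_ran [simp]:
  assumes "x \<in> units G" "t \<in> ring_units"
  shows "S.ran (i (x, t)) = i (x, 1)" "S.sou (i (x, t)) = i (x, 1)"
  using assms by (simp_all add: ran_eq sou_eq)

lemma i_mul:
  assumes "x \<in> units G" "t \<in> ring_units" "u \<in> ring_units"
  shows "i (x, t) \<cdot> i (x, u) = i (x, t * u)"
proof -
  have "((x, t), (x, u)) \<in> composable (trivial_bundle G)"
    using assms by (simp add: trivial_bundle_def)
  then have "i (gmult (trivial_bundle G) (x, t) (x, u)) = i (x, t) \<cdot> i (x, u)"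
    using i_hom unfolding groupoid_hom_def by blast
  then show ?thesis by (simp add: trivial_bundle_def)
qed

lemma act_eq: "\<sigma> \<in> arrows \<Sigma> \<Longrightarrow> act t \<sigma> = i (G.ran (q \<sigma>), t) \<cdot> \<sigma>"
  by (simp add: twist_action_def)

lemma act_eq': "\<sigma> \<in> arrows \<Sigma> \<Longrightarrow> t \<in> ring_units \<Longrightarrow> act t \<sigma> = \<sigma> \<cdot> i (G.sou (q \<sigma>), t)"
  using i_central by (simp add: twist_action_def)

lemma act_simps [simp]:
  assumes "\<sigma> \<in> arrows \<Sigma>" "t \<in> ring_units"
  shows "act t \<sigma> \<in> arrows \<Sigma>" "q (act t \<sigma>) = q \<sigma>" "S.ran (act t \<sigma>) = S.ran \<sigma>" "S.sou (act t \<sigma>) = S.sou \<sigma>"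
  using assms by (simp_all add: act_eq composable_eq) (simp_all add: ran_eq)

lemma act_one [simp]: "\<sigma> \<in> arrows \<Sigma> \<Longrightarrow> act 1 \<sigma> = \<sigma>"
  using S.mul_unit(1)[of \<sigma>] by (simp add: act_eq ran_eq)

lemma act_act [simp]:
  assumes "\<sigma> \<in> arrows \<Sigma>" "t \<in> ring_units" "u \<in> ring_units"
  shows "act t (act u \<sigma>) = act (t * u) \<sigma>"
proof -
  have "act t (act u \<sigma>) = i (G.ran (q \<sigma>), t) \<cdot> (i (G.ran (q \<sigma>), u) \<cdot> \<sigma>)"
    using assms by (simp add: act_eq[of "act u \<sigma>"]) (simp add: act_eq)
  also have "\<dots> = i (G.ran (q \<sigma>), t) \<cdot> i (G.ran (q \<sigma>), u) \<cdot> \<sigma>"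
    using assms by (intro S.mul_assoc[symmetric]) (simp_all add: ran_eq)
  finally show ?thesis using assms by (simp add: i_mul act_eq)
qed

text \<open>A scalar on the second factor becomes one on the first by reading it as
  \<open>i (G.sou (q \<sigma>), t)\<close> between the two arrows and applying centrality
  (DT3).\<close>

lemma act_mul [simp]:
  assumes "\<sigma> \<in> arrows \<Sigma>" "\<tau> \<in> arrows \<Sigma>" "t \<in> ring_units" "G.sou (q \<sigma>) = G.ran (q \<tau>)"
  shows "act t \<sigma> \<cdot> \<tau> = act t (\<sigma> \<cdot> \<tau>)" "\<sigma> \<cdot> act t \<tau> = act t (\<sigma> \<cdot> \<tau>)"
proof -
  show 1: "act t \<sigma> \<cdot> \<tau> = act t (\<sigma> \<cdot> \<tau>)"
    using assms by (simp add: act_eq, subst S.mul_assoc) (simp_all add: ran_eq sou_eq)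
  have "\<sigma> \<cdot> act t \<tau> = \<sigma> \<cdot> (i (G.ran (q \<tau>), t) \<cdot> \<tau>)" using assms by (simp add: act_eq)
  also have "\<dots> = \<sigma> \<cdot> i (G.sou (q \<sigma>), t) \<cdot> \<tau>"
    using assms by (subst S.mul_assoc) (simp_all add: ran_eq sou_eq)
  also have "\<dots> = act t \<sigma> \<cdot> \<tau>" using assms by (simp add: act_eq')
  finally show "\<sigma> \<cdot> act t \<tau> = act t (\<sigma> \<cdot> \<tau>)" using 1 by simp
qed

text \<open>The arrow \<open>\<tau> \<cdot> S.inv_of \<sigma>\<close> lies over a unit, so (DT1)
  presents it as a value of \<open>i\<close>.\<close>

lemma fibre_transitive:
  assumes "\<sigma> \<in> arrows \<Sigma>" "\<tau> \<in> arrows \<Sigma>" "q \<sigma> = q \<tau>"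
  obtains t where "t \<in> ring_units" "\<tau> = act t \<sigma>"
proof -
  have m: "\<tau> \<cdot> S.inv_of \<sigma> \<in> arrows \<Sigma>" "q (\<tau> \<cdot> S.inv_of \<sigma>) = G.ran (q \<sigma>)"
    using assms by (simp_all)
  then obtain t where t: "t \<in> ring_units" "\<tau> \<cdot> S.inv_of \<sigma> = i (G.ran (q \<sigma>), t)"
    using fibre_unit[of "\<tau> \<cdot> S.inv_of \<sigma>"] assms by (metis G.ran_units q_arrow)
  have "\<tau> = \<tau> \<cdot> S.inv_of \<sigma> \<cdot> \<sigma>" using assms composable_eq(3) by simp
  then have "\<tau> = act t \<sigma>" using t assms by (simp add: act_eq)
  then show thesis using t that by blast
qed

lemma act_inj:
  assumes "\<sigma> \<in> arrows \<Sigma>" "t \<in> ring_units" "u \<in> ring_units" "act t \<sigma> = act u \<sigma>" shows "t = u"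
proof -
  have "i (G.ran (q \<sigma>), t) \<cdot> \<sigma> \<cdot> S.inv_of \<sigma> = i (G.ran (q \<sigma>), u) \<cdot> \<sigma> \<cdot> S.inv_of \<sigma>"
    using assms by (simp add: act_eq)
  then show ?thesis using assms by (simp add: ran_eq)
qed

lemma act_inv [simp]:
  assumes "\<sigma> \<in> arrows \<Sigma>" "t \<in> ring_units"
  shows "S.inv_of (act t \<sigma>) = act (unit_inverse t) (S.inv_of \<sigma>)"
proof -
  have "act t \<sigma> \<cdot> act (unit_inverse t) (S.inv_of \<sigma>) = S.ran \<sigma>"
    using assms by simp
  then show ?thesis
    using assms by (intro S.mul_eq_unitD[symmetric]) (simp_all add: composable_eq)
qed

lemma act_i [simp]:
  "x \<in> units G \<Longrightarrow> t \<in> ring_units \<Longrightarrow> u \<in> ring_units \<Longrightarrow> act t (i (x, u)) = i (x, t * u)"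
  by (simp add: act_eq i_mul)

section \<open>Equivariant functions and their supports in the base\<close>

definition eqv :: "('s \<Rightarrow> 'r) \<Rightarrow> bool" where
  "eqv f \<longleftrightarrow> function_support f \<subseteq> arrows \<Sigma> \<and>
    (\<forall>t\<in>ring_units. \<forall>\<sigma>\<in>arrows \<Sigma>. f (act t \<sigma>) = unit_inverse t * f \<sigma>)"

lemma eqv_act [simp]: "eqv f \<Longrightarrow> t \<in> ring_units \<Longrightarrow> \<sigma> \<in> arrows \<Sigma> \<Longrightarrow> f (act t \<sigma>) = unit_inverse t * f \<sigma>"
  and eqv_arrow: "eqv f \<Longrightarrow> f \<sigma> \<noteq> 0 \<Longrightarrow> \<sigma> \<in> arrows \<Sigma>"
  and eqv_off: "eqv f \<Longrightarrow> \<sigma> \<notin> arrows \<Sigma> \<Longrightarrow> f \<sigma> = 0"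
  by (auto simp: eqv_def function_support_def)

lemma eqvI:
  "(\<And>\<sigma>. \<sigma> \<notin> arrows \<Sigma> \<Longrightarrow> f \<sigma> = 0) \<Longrightarrow>
   (\<And>t \<sigma>. t \<in> ring_units \<Longrightarrow> \<sigma> \<in> arrows \<Sigma> \<Longrightarrow> f (act t \<sigma>) = unit_inverse t * f \<sigma>) \<Longrightarrow> eqv f"
  by (auto simp: eqv_def function_support_def)

definition supp :: "('s \<Rightarrow> 'r) \<Rightarrow> 'g set" where
  "supp f = q ` function_support f"

lemma supp_arrows: "eqv f \<Longrightarrow> supp f \<subseteq> arrows G"
  by (auto simp: supp_def eqv_def)

lemma suppI: "f \<sigma> \<noteq> 0 \<Longrightarrow> q \<sigma> \<in> supp f"
  by (auto simp: supp_def function_support_def)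

text \<open>Values on one fibre differ by ring units, so whether a function vanishes depends only on
  the image of the arrow in \<open>G\<close>.\<close>

lemma supp_iff: 
  assumes "eqv f" "\<sigma> \<in> arrows \<Sigma>" shows "q \<sigma> \<in> supp f \<longleftrightarrow> f \<sigma> \<noteq> 0"
proof
  assume "q \<sigma> \<in> supp f"
  then obtain \<tau> where t: "f \<tau> \<noteq> 0" "q \<tau> = q \<sigma>" by (auto simp: supp_def function_support_def)
  then have "\<tau> \<in> arrows \<Sigma>" using assms eqv_arrow by blast
  then obtain u where "u \<in> ring_units" "\<sigma> = act u \<tau>" using fibre_transitive[of \<tau> \<sigma>] t assms by metis
  then show "f \<sigma> \<noteq> 0" using t assms \<open>\<tau> \<in> arrows \<Sigma>\<close> by simp
qed (rule suppI)

section \<open>Sections of \<open>q\<close> and the etale structure of the total space\<close>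

definition sec :: "'g \<Rightarrow> 's" where
  "sec \<alpha> = (SOME \<sigma>. \<sigma> \<in> arrows \<Sigma> \<and> q \<sigma> = \<alpha>)"

lemma sec [simp]: "\<alpha> \<in> arrows G \<Longrightarrow> sec \<alpha> \<in> arrows \<Sigma>" "\<alpha> \<in> arrows G \<Longrightarrow> q (sec \<alpha>) = \<alpha>"
proof -
  assume "\<alpha> \<in> arrows G"
  then have "\<alpha> \<in> q ` arrows \<Sigma>" using q_surj by simp
  then have "\<exists>\<sigma>. \<sigma> \<in> arrows \<Sigma> \<and> q \<sigma> = \<alpha>" by auto
  then have "sec \<alpha> \<in> arrows \<Sigma> \<and> q (sec \<alpha>) = \<alpha>" unfolding sec_def by (rule someI_ex)
  then show "sec \<alpha> \<in> arrows \<Sigma>" "q (sec \<alpha>) = \<alpha>" by auto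
qed

lemma supp_sec: "eqv f \<Longrightarrow> \<alpha> \<in> arrows G \<Longrightarrow> \<alpha> \<in> supp f \<longleftrightarrow> f (sec \<alpha>) \<noteq> 0"
  using supp_iff[of f "sec \<alpha>"] by simp

text \<open>This is (DT2) with the scalar frozen at the \<open>t\<close> for which the
  trivialisation hits \<open>\<sigma>\<close>, shrunk so that the values stay in \<open>O'\<close>.
  Images of open sets are open because the scalars are discrete, so \<open>K \<times> {t}\<close> is
  open in the domain of the trivialisation.\<close>

lemma local_section:
  assumes O: "openin (arrow_topology \<Sigma>) O'" and \<sigma>: "\<sigma> \<in> O'"
  obtains D \<psi> where "q \<sigma> \<in> D" "openin (arrow_topology G) D"
    "continuous_map (subtopology (arrow_topology G) D) (arrow_topology \<Sigma>) \<psi>"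
    "\<And>\<beta>. \<beta> \<in> D \<Longrightarrow> \<psi> \<beta> \<in> O' \<and> q (\<psi> \<beta>) = \<beta>" "\<psi> (q \<sigma>) = \<sigma>"
    "\<And>K. openin (arrow_topology G) K \<Longrightarrow> K \<subseteq> D \<Longrightarrow> openin (arrow_topology \<Sigma>) (\<psi> ` K)"
proof -
  have \<sigma>S: "\<sigma> \<in> arrows \<Sigma>" using openin_subset[OF O] \<sigma> by auto
  then have "q \<sigma> \<in> arrows G" by simp
  from trivialisation[OF this] obtain D0 P where D0: "q \<sigma> \<in> D0" "openin (arrow_topology G) D0"
    and P: "continuous_map (subtopology (arrow_topology G) D0) (arrow_topology \<Sigma>) P" "\<forall>\<beta> \<in> D0. q (P \<beta>) = \<beta>"
    and h: "homeomorphic_map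
         (prod_topology (subtopology (arrow_topology G) D0) (discrete_topology ring_units))
         (subtopology (arrow_topology \<Sigma>) {\<sigma> \<in> arrows \<Sigma>. q \<sigma> \<in> D0})
         (\<lambda>(\<beta>, t). gmult \<Sigma> (i (rng G \<beta>, t)) (P \<beta>))"
    by (elim exE conjE)
  let ?h = "\<lambda>(\<beta>, t). gmult \<Sigma> (i (rng G \<beta>, t)) (P \<beta>)"
  let ?X = "prod_topology (subtopology (arrow_topology G) D0) (discrete_topology ring_units)"
  let ?Q = "{\<sigma> \<in> arrows \<Sigma>. q \<sigma> \<in> D0}"
  have D0G: "D0 \<subseteq> arrows G" using D0 openin_subset by blast
  have topD: "topspace (subtopology (arrow_topology G) D0) = D0"
    by (rule topspace_subtopology_subset[OF D0G])
  have oQ: "openin (arrow_topology \<Sigma>) ?Q" by (rule openin_continuous_map_preimage[OF q_continuous D0(2)])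
  have topQ: "topspace (subtopology (arrow_topology \<Sigma>) ?Q) = ?Q"
    by (rule topspace_subtopology_subset) auto
  have topX: "topspace ?X = D0 \<times> ring_units" unfolding topspace_prod_topology topD by simp
  have PS: "P \<beta> \<in> arrows \<Sigma>" if "\<beta> \<in> D0" for \<beta>
    using continuous_map_funspace[OF P(1)] that unfolding topD by auto
  have qh: "q (?h (\<beta>, t)) = \<beta>" if "\<beta> \<in> D0" "t \<in> ring_units" for \<beta> t
  proof -
    have b: "\<beta> \<in> arrows G" using that D0G by auto
    then show ?thesis using that PS P(2) by simp
  qed
  have "?h ` (D0 \<times> ring_units) = ?Q"
    using homeomorphic_imp_surjective_map[OF h] unfolding topX topQ .
  moreover have "\<sigma> \<in> ?Q" using D0 \<sigma>S by simp
  ultimately have "\<sigma> \<in> ?h ` (D0 \<times> ring_units)" by simp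
  then obtain \<beta>0 t where t: "\<beta>0 \<in> D0" "t \<in> ring_units" "\<sigma> = ?h (\<beta>0, t)" by auto
  then have t': "\<beta>0 = q \<sigma>" using qh by simp
  define \<psi> where "\<psi> = (\<lambda>\<beta>. ?h (\<beta>, t))"
  have hc: "continuous_map ?X (arrow_topology \<Sigma>) ?h"
    using homeomorphic_imp_continuous_map[OF h] by (simp add: continuous_map_in_subtopology)
  have \<psi>c: "continuous_map (subtopology (arrow_topology G) D0) (arrow_topology \<Sigma>) \<psi>"
  proof -
    have "continuous_map (subtopology (arrow_topology G) D0) ?X (\<lambda>\<beta>. (\<beta>, t))"
      using t by (intro continuous_map_pairedI) auto
    from continuous_map_compose[OF this hc] show ?thesis by (simp add: \<psi>_def o_def)
  qed
  define D where "D = {\<beta> \<in> D0. \<psi> \<beta> \<in> O'}"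
  have "openin (subtopology (arrow_topology G) D0) {\<beta> \<in> topspace (subtopology (arrow_topology G) D0). \<psi> \<beta> \<in> O'}"
    by (rule openin_continuous_map_preimage[OF \<psi>c O])
  then have oD: "openin (arrow_topology G) D" unfolding topD D_def using D0(2) openin_trans_full by blast
  have \<psi>\<sigma>: "\<psi> (q \<sigma>) = \<sigma>" unfolding \<psi>_def t'[symmetric] by (rule t(3)[symmetric])
  show thesis
  proof (rule that[of D \<psi>])
    show "q \<sigma> \<in> D" using \<psi>\<sigma> D0 \<sigma> by (simp add: D_def)
    show "\<psi> (q \<sigma>) = \<sigma>" by (rule \<psi>\<sigma>)
    show "openin (arrow_topology G) D" by (rule oD)
    show "continuous_map (subtopology (arrow_topology G) D) (arrow_topology \<Sigma>) \<psi>"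
      by (rule continuous_map_from_subtopology_mono[OF \<psi>c]) (auto simp: D_def)
    show "\<psi> \<beta> \<in> O' \<and> q (\<psi> \<beta>) = \<beta>" if "\<beta> \<in> D" for \<beta>
      using that qh t by (simp add: D_def \<psi>_def)
    show "openin (arrow_topology \<Sigma>) (\<psi> ` K)" if K: "openin (arrow_topology G) K" "K \<subseteq> D" for K
    proof -
      have KD: "K \<subseteq> D0" using K by (auto simp: D_def)
      have "openin ?X (K \<times> {t})"
        using K KD t openin_open_subtopology[OF D0(2)] by (simp add: openin_prod_Times_iff)
      then have "openin (subtopology (arrow_topology \<Sigma>) ?Q) (?h ` (K \<times> {t}))"
        using homeomorphic_imp_open_map[OF h] unfolding open_map_def by blast
      moreover have "?h ` (K \<times> {t}) = \<psi> ` K" by (auto simp: \<psi>_def)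
      ultimately show ?thesis using oQ openin_trans_full by metis
    qed
  qed
qed

lemma q_open: "open_map (arrow_topology \<Sigma>) (arrow_topology G) q"
  unfolding open_map_def
proof (intro allI impI)
  fix O' assume O: "openin (arrow_topology \<Sigma>) O'"
  show "openin (arrow_topology G) (q ` O')"
  proof (subst openin_subopen, intro ballI)
    fix \<alpha> assume "\<alpha> \<in> q ` O'"
    then obtain \<sigma> where s: "\<sigma> \<in> O'" "\<alpha> = q \<sigma>" by auto
    obtain D \<psi> where D: "q \<sigma> \<in> D" "openin (arrow_topology G) D" "\<And>\<beta>. \<beta> \<in> D \<Longrightarrow> \<psi> \<beta> \<in> O' \<and> q (\<psi> \<beta>) = \<beta>"
      using local_section[OF O s(1)] by metis
    have "D \<subseteq> q ` O'" using D(3) by (metis image_eqI subsetI)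
    then show "\<exists>T. openin (arrow_topology G) T \<and> \<alpha> \<in> T \<and> T \<subseteq> q ` O'" using D s by auto
  qed
qed

lemma open_q_image: "openin (arrow_topology \<Sigma>) O' \<Longrightarrow> openin (arrow_topology G) (q ` O')"
  using q_open open_map_def by blast

text \<open>On unit spaces \<open>q\<close> is a homeomorphism, so openness may be checked after
  applying \<open>q\<close>, where it follows from openness of \<open>q\<close> and of the range map
  of \<open>G\<close>.\<close>

lemma open_ran_total: "open_map (arrow_topology \<Sigma>) (unit_space \<Sigma>) (rng \<Sigma>)"
  unfolding open_map_def
proof (intro allI impI)
  fix O' assume O: "openin (arrow_topology \<Sigma>) O'"
  have OS: "O' \<subseteq> arrows \<Sigma>" using O openin_subset by blast
  have topu: "topspace (unit_space \<Sigma>) = units \<Sigma>"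
    by (rule topspace_subtopology_subset[OF S.units_arrows])
  have "openin (unit_space G) (rng G ` q ` O')"
    using G.open_ran open_q_image[OF O] unfolding open_map_def by blast
  from openin_continuous_map_preimage[OF homeomorphic_imp_continuous_map[OF q_units] this]
  have "openin (unit_space \<Sigma>) {y \<in> units \<Sigma>. q y \<in> rng G ` q ` O'}" unfolding topu .
  moreover have "{y \<in> units \<Sigma>. q y \<in> rng G ` q ` O'} = rng \<Sigma> ` O'" (is "?L = ?R")
  proof (intro equalityI subsetI)
    fix y assume "y \<in> ?L"
    then obtain \<sigma> where s: "\<sigma> \<in> O'" "q y = G.ran (q \<sigma>)" "y \<in> units \<Sigma>" by auto
    then have "y = S.ran \<sigma>" using unit_total[of y] ran_eq[of \<sigma>] OS by auto
    then show "y \<in> ?R" using s by simp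
  next
    fix y assume "y \<in> ?R"
    then obtain \<sigma> where s: "\<sigma> \<in> O'" "y = S.ran \<sigma>" by auto
    then have "\<sigma> \<in> arrows \<Sigma>" using OS by auto
    then show "y \<in> ?L" using s by simp
  qed
  ultimately show "openin (unit_space \<Sigma>) (rng \<Sigma> ` O')" by simp
qed

text \<open>A local section over a set with injective range map has an open image on which the range
  map of \<open>\<Sigma>\<close> is injective too. All results on etale groupoids thus apply to
  \<open>\<Sigma>\<close>.\<close>

lemma etale_total: "etale_groupoid \<Sigma>"
  unfolding etale_groupoid_def
proof (intro conjI ballI topological_total)
  fix \<sigma> assume \<sigma>: "\<sigma> \<in> arrows \<Sigma>"
  obtain D \<psi> where D: "q \<sigma> \<in> D" "openin (arrow_topology G) D" "\<psi> (q \<sigma>) = \<sigma>"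
    "\<And>\<beta>. \<beta> \<in> D \<Longrightarrow> \<psi> \<beta> \<in> arrows \<Sigma> \<and> q (\<psi> \<beta>) = \<beta>"
    "\<And>K. openin (arrow_topology G) K \<Longrightarrow> K \<subseteq> D \<Longrightarrow> openin (arrow_topology \<Sigma>) (\<psi> ` K)"
    using local_section[OF openin_topspace \<sigma>] by metis
  obtain W where W: "q \<sigma> \<in> W" "openin (arrow_topology G) W" "W \<subseteq> D" "inj_on (rng G) W" "inj_on (src G) W"
    by (rule G.locally_injective[OF D(1,2)])
  have "homeo_onto_open_units \<Sigma> (\<psi> ` W) (rng \<Sigma>)"
  proof (rule homeo_onto_open_unitsI[OF _ S.continuous_ran open_ran_total])
    show "openin (arrow_topology \<Sigma>) (\<psi> ` W)" using D(5) W by blast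
    show "inj_on (rng \<Sigma>) (\<psi> ` W)"
    proof (rule inj_onI)
      fix a b assume "a \<in> \<psi> ` W" "b \<in> \<psi> ` W" and e: "S.ran a = S.ran b"
      then obtain \<beta> \<gamma> where b: "\<beta> \<in> W" "a = \<psi> \<beta>" "\<gamma> \<in> W" "b = \<psi> \<gamma>" by auto
      then have "\<psi> \<beta> \<in> arrows \<Sigma>" "\<psi> \<gamma> \<in> arrows \<Sigma>" "q (\<psi> \<beta>) = \<beta>" "q (\<psi> \<gamma>) = \<gamma>" using D(4) W(3) by blast+
      then have "G.ran \<beta> = G.ran \<gamma>" using composable_eq(2)[of "\<psi> \<beta>" "\<psi> \<gamma>"] e b by simp
      then have "\<beta> = \<gamma>" using inj_onD[OF W(4) _ b(1,3)] by simp
      then show "a = b" using b by simp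
    qed
  qed
  moreover have "\<sigma> \<in> \<psi> ` W" using D(3) W(1) by (metis imageI)
  ultimately show "\<exists>W. \<sigma> \<in> W \<and> homeo_onto_open_units \<Sigma> W (rng \<Sigma>)" by blast
qed

end

sublocale twist \<subseteq> S: etale_gpd \<Sigma>
  by (rule etale_gpdI[OF etale_total])

section \<open>A base of compact open bisections for the total space\<close>

locale ample_twist = twist \<Sigma> i q G
  for \<Sigma> :: "'s groupoid" (structure) and i :: "'g \<times> 'r::comm_ring_1 \<Rightarrow> 's"
    and q :: "'s \<Rightarrow> 'g" and G :: "'g groupoid" +
  assumes ample: "ample_groupoid G" and Hausdorff: "Hausdorff_space (arrow_topology G)"
begin

lemma ample_base:
  assumes "openin (arrow_topology G) U" "\<alpha> \<in> U"
  obtains K where "compact_open_bisection G K" "\<alpha> \<in> K" "K \<subseteq> U"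
proof -
  have "(arbitrary union_of compact_open_bisection G) U"
    using ample assms unfolding ample_groupoid_def by simp
  then show thesis using assms(2) that unfolding union_of_def by blast
qed

text \<open>The base sets are images of local sections over compact open bisections \<open>K\<close>
  of \<open>G\<close>; each is mapped by \<open>q\<close> bijectively back onto its
  \<open>K\<close>.\<close>

lemma total_base:
  assumes O: "openin (arrow_topology \<Sigma>) O'" and \<sigma>: "\<sigma> \<in> O'"
  obtains Y where "compact_open_bisection \<Sigma> Y" "\<sigma> \<in> Y" "Y \<subseteq> O'" "compact_open_bisection G (q ` Y)"
proof -
  obtain D \<psi> where D: "q \<sigma> \<in> D" "openin (arrow_topology G) D" "\<psi> (q \<sigma>) = \<sigma>"
    "\<And>\<beta>. \<beta> \<in> D \<Longrightarrow> \<psi> \<beta> \<in> O' \<and> q (\<psi> \<beta>) = \<beta>"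
    "\<And>K. openin (arrow_topology G) K \<Longrightarrow> K \<subseteq> D \<Longrightarrow> openin (arrow_topology \<Sigma>) (\<psi> ` K)"
    and \<psi>c: "continuous_map (subtopology (arrow_topology G) D) (arrow_topology \<Sigma>) \<psi>"
    using local_section[OF O \<sigma>] by metis
  obtain K where K: "compact_open_bisection G K" "q \<sigma> \<in> K" "K \<subseteq> D"
    using ample_base[OF D(2,1)] by blast
  have K': "compactin (arrow_topology G) K" "openin (arrow_topology G) K" "inj_on (rng G) K" "inj_on (src G) K"
    using K(1) by (simp_all add: G.compact_open_bisection_iff)
  have \<psi>q: "\<psi> \<beta> \<in> arrows \<Sigma> \<and> q (\<psi> \<beta>) = \<beta>" if "\<beta> \<in> K" for \<beta>
    using D(4)[of \<beta>] that K(3) openin_subset[OF O] by blast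
  have inj: "inj_on f (\<psi> ` K)" if f: "inj_on g K" "\<And>\<sigma> \<tau>. \<sigma> \<in> arrows \<Sigma> \<Longrightarrow> \<tau> \<in> arrows \<Sigma> \<Longrightarrow> f \<sigma> = f \<tau> \<Longrightarrow> g (q \<sigma>) = g (q \<tau>)" for f g
  proof (rule inj_onI)
    fix a b assume "a \<in> \<psi> ` K" "b \<in> \<psi> ` K" and e: "f a = f b"
    then obtain \<beta> \<gamma> where b: "\<beta> \<in> K" "a = \<psi> \<beta>" "\<gamma> \<in> K" "b = \<psi> \<gamma>" by auto
    have "g \<beta> = g \<gamma>" using f(2)[of a b] e b \<psi>q[OF b(1)] \<psi>q[OF b(3)] by simp
    then have "\<beta> = \<gamma>" using inj_onD[OF f(1) _ b(1,3)] by simp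
    then show "a = b" using b by simp
  qed
  have "compact_open_bisection \<Sigma> (\<psi> ` K)"
    unfolding S.compact_open_bisection_iff
  proof (intro conjI)
    have "compactin (subtopology (arrow_topology G) D) K"
      using K' K(3) by (simp add: compactin_subtopology)
    then show "compactin (arrow_topology \<Sigma>) (\<psi> ` K)" using image_compactin \<psi>c by blast
    show "openin (arrow_topology \<Sigma>) (\<psi> ` K)" using D(5) K' K(3) by blast
    show "inj_on (rng \<Sigma>) (\<psi> ` K)" by (rule inj[OF K'(3)]) (simp add: composable_eq)
    show "inj_on (src \<Sigma>) (\<psi> ` K)" by (rule inj[OF K'(4)]) (simp add: composable_eq)
  qed
  moreover have "\<sigma> \<in> \<psi> ` K" using D(3) K(2) by (metis imageI)
  moreover have "\<psi> ` K \<subseteq> O'" using D(4) K(3) by auto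
  moreover have "q ` \<psi> ` K = K" using \<psi>q by force
  ultimately show thesis using that[of "\<psi> ` K"] K by simp
qed

end

section \<open>Convolution of equivariant functions\<close>

context twist
begin

abbreviation conv where "conv f g \<equiv> convolution \<Sigma> q G f g"

definition fib :: "('s \<Rightarrow> 'r) \<Rightarrow> 'g \<Rightarrow> 'g set" where
  "fib f y = {\<alpha> \<in> supp f. G.ran \<alpha> = y}"

text \<open>Finiteness on each range fibre makes the convolution sum finite. Unlike membership in
  the algebra, this condition also admits indicators of single units.\<close>

definition rfin :: "('s \<Rightarrow> 'r) \<Rightarrow> bool" where
  "rfin f \<longleftrightarrow> (\<forall>y. finite (fib f y))"

lemma fib_arrows: "eqv f \<Longrightarrow> \<alpha> \<in> fib f y \<Longrightarrow> \<alpha> \<in> arrows G \<and> G.ran \<alpha> = y"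
  using supp_arrows by (auto simp: fib_def)

text \<open>Replacing \<open>\<tau>\<close> by \<open>act t \<tau>\<close> multiplies one factor by
  the inverse of \<open>t\<close> and the other by \<open>t\<close>.\<close>

lemma conv_term:
  assumes "eqv f" "eqv g" "\<tau> \<in> arrows \<Sigma>" "\<tau>' \<in> arrows \<Sigma>" "\<sigma> \<in> arrows \<Sigma>"
    "q \<tau> = q \<tau>'" "G.ran (q \<tau>) = G.ran (q \<sigma>)"
  shows "f \<tau> * g (S.inv_of \<tau> \<cdot> \<sigma>) = f \<tau>' * g (S.inv_of \<tau>' \<cdot> \<sigma>)"
proof -
  obtain t where t: "t \<in> ring_units" "\<tau>' = act t \<tau>"
    using fibre_transitive[OF assms(3,4,6)] by metis
  have "f \<tau>' * g (S.inv_of \<tau>' \<cdot> \<sigma>) = unit_inverse t * f \<tau> * (t * g (S.inv_of \<tau> \<cdot> \<sigma>))"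
    using t assms by simp
  also have "\<dots> = (unit_inverse t * t) * (f \<tau> * g (S.inv_of \<tau> \<cdot> \<sigma>))" by (simp only: ac_simps)
  finally show ?thesis using t by simp
qed

text \<open>Each term is independent of the chosen lift and vanishes off the support. Hence any lift
  \<open>T\<close> and any finite set of arrows with the right range that catches the nonzero terms
  compute the same value. The freedom in \<open>F\<close> and \<open>T\<close> is what later
  single-term and reindexing computations use.\<close>

lemma conv_sum:
  assumes f: "eqv f" "rfin f" and g: "eqv g" and \<sigma>: "\<sigma> \<in> arrows \<Sigma>" and F: "finite F"
    and FG: "\<And>\<alpha>. \<alpha> \<in> F \<Longrightarrow> \<alpha> \<in> arrows G \<and> G.ran \<alpha> = G.ran (q \<sigma>)"
    and T: "\<And>\<alpha>. \<alpha> \<in> F \<Longrightarrow> T \<alpha> \<in> arrows \<Sigma> \<and> q (T \<alpha>) = \<alpha>"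
    and cover: "\<And>\<alpha>. \<alpha> \<in> fib f (G.ran (q \<sigma>)) \<Longrightarrow> g (S.inv_of (sec \<alpha>) \<cdot> \<sigma>) \<noteq> 0 \<Longrightarrow> \<alpha> \<in> F"
  shows "conv f g \<sigma> = (\<Sum>\<alpha>\<in>F. f (T \<alpha>) * g (S.inv_of (T \<alpha>) \<cdot> \<sigma>))"
proof -
  define S' where "S' = (\<lambda>\<alpha>. SOME \<tau>. \<tau> \<in> function_support f \<and> q \<tau> = \<alpha>)"
  have S': "S' \<alpha> \<in> arrows \<Sigma> \<and> q (S' \<alpha>) = \<alpha>" if "\<alpha> \<in> supp f" for \<alpha>
  proof -
    have "\<exists>\<tau>. \<tau> \<in> function_support f \<and> q \<tau> = \<alpha>" using that unfolding supp_def by auto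
    then have "S' \<alpha> \<in> function_support f \<and> q (S' \<alpha>) = \<alpha>" unfolding S'_def by (rule someI_ex)
    then show ?thesis using f unfolding eqv_def by auto
  qed
  have "conv f g \<sigma> = (\<Sum>\<alpha>\<in>fib f (G.ran (q \<sigma>)). f (S' \<alpha>) * g (S.inv_of (S' \<alpha>) \<cdot> \<sigma>))"
    using \<sigma> by (simp add: convolution_def S'_def fib_def supp_def Let_def)
  also have "\<dots> = (\<Sum>\<alpha>\<in>F. f (T \<alpha>) * g (S.inv_of (T \<alpha>) \<cdot> \<sigma>))"
  proof (rule sum.mono_neutral_cong)
    show "finite (fib f (G.ran (q \<sigma>)))" using f by (simp add: rfin_def)
    show "finite F" by fact
    show "f (T \<alpha>) * g (S.inv_of (T \<alpha>) \<cdot> \<sigma>) = 0" if "\<alpha> \<in> F - fib f (G.ran (q \<sigma>))" for \<alpha>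
    proof -
      have "\<alpha> \<notin> supp f" using that FG by (auto simp: fib_def)
      then have "f (T \<alpha>) = 0" using supp_iff[OF f(1), of "T \<alpha>"] T[of \<alpha>] that by auto
      then show ?thesis by simp
    qed
    show "f (S' \<alpha>) * g (S.inv_of (S' \<alpha>) \<cdot> \<sigma>) = 0" if a: "\<alpha> \<in> fib f (G.ran (q \<sigma>)) - F" for \<alpha>
    proof -
      have aG: "\<alpha> \<in> arrows G" "G.ran \<alpha> = G.ran (q \<sigma>)" "\<alpha> \<in> supp f"
        using a fib_arrows[OF f(1), of \<alpha> "G.ran (q \<sigma>)"] by (simp_all add: fib_def)
      have "f (S' \<alpha>) * g (S.inv_of (S' \<alpha>) \<cdot> \<sigma>) = f (sec \<alpha>) * g (S.inv_of (sec \<alpha>) \<cdot> \<sigma>)"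
        using S'[OF aG(3)] aG \<sigma> f g by (intro conv_term) auto
      also have "g (S.inv_of (sec \<alpha>) \<cdot> \<sigma>) = 0" using cover[of \<alpha>] a by blast
      finally show ?thesis by simp
    qed
    show "f (S' \<alpha>) * g (S.inv_of (S' \<alpha>) \<cdot> \<sigma>) = f (T \<alpha>) * g (S.inv_of (T \<alpha>) \<cdot> \<sigma>)"
      if "\<alpha> \<in> fib f (G.ran (q \<sigma>)) \<inter> F" for \<alpha>
    proof -
      have "\<alpha> \<in> F" "\<alpha> \<in> supp f" using that by (auto simp: fib_def)
      then show ?thesis using S'[of \<alpha>] T[of \<alpha>] FG[of \<alpha>] \<sigma> f g by (intro conv_term) auto
    qed
  qed
  finally show ?thesis .
qed

lemma conv_sum_fib:
  assumes "eqv f" "rfin f" "eqv g" "\<sigma> \<in> arrows \<Sigma>"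
  shows "conv f g \<sigma> = (\<Sum>\<alpha>\<in>fib f (G.ran (q \<sigma>)). f (sec \<alpha>) * g (S.inv_of (sec \<alpha>) \<cdot> \<sigma>))"
  using assms fib_arrows[OF assms(1)] by (intro conv_sum) (auto simp: rfin_def)

lemma conv_off: "\<sigma> \<notin> arrows \<Sigma> \<Longrightarrow> conv f g \<sigma> = 0"
  by (simp add: convolution_def)

lemma eqv_conv:
  assumes "eqv f" "rfin f" "eqv g" shows "eqv (conv f g)"
proof (rule eqvI)
  fix t :: 'r and \<sigma> assume t: "t \<in> ring_units" "\<sigma> \<in> arrows \<Sigma>"
  have "conv f g (act t \<sigma>) = (\<Sum>\<alpha>\<in>fib f (G.ran (q \<sigma>)). f (sec \<alpha>) * g (S.inv_of (sec \<alpha>) \<cdot> act t \<sigma>))"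
    using assms t by (subst conv_sum_fib) simp_all
  also have "\<dots> = (\<Sum>\<alpha>\<in>fib f (G.ran (q \<sigma>)). unit_inverse t * (f (sec \<alpha>) * g (S.inv_of (sec \<alpha>) \<cdot> \<sigma>)))"
  proof (rule sum.cong[OF refl])
    fix \<alpha> assume "\<alpha> \<in> fib f (G.ran (q \<sigma>))"
    then have "\<alpha> \<in> arrows G" "G.ran \<alpha> = G.ran (q \<sigma>)" using fib_arrows[OF assms(1)] by blast+
    then show "f (sec \<alpha>) * g (S.inv_of (sec \<alpha>) \<cdot> act t \<sigma>) = unit_inverse t * (f (sec \<alpha>) * g (S.inv_of (sec \<alpha>) \<cdot> \<sigma>))"
      using assms t by (simp add: ac_simps)
  qed
  also have "\<dots> = unit_inverse t * conv f g \<sigma>"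
    using assms t by (simp add: conv_sum_fib sum_distrib_left)
  finally show "conv f g (act t \<sigma>) = unit_inverse t * conv f g \<sigma>" .
qed (rule conv_off)

lemma supp_conv:
  assumes "eqv f" "rfin f" "eqv g" "\<gamma> \<in> supp (conv f g)"
  shows "\<exists>\<alpha>\<in>supp f. \<exists>\<beta>\<in>supp g. G.sou \<alpha> = G.ran \<beta> \<and> \<gamma> = \<alpha> \<cdot>\<^bsub>G\<^esub> \<beta>"
proof -
  obtain \<sigma> where s: "conv f g \<sigma> \<noteq> 0" "\<gamma> = q \<sigma>"
    using assms(4) by (auto simp: supp_def function_support_def)
  then have \<sigma>: "\<sigma> \<in> arrows \<Sigma>" using conv_off by metis
  have "\<exists>\<alpha>\<in>fib f (G.ran (q \<sigma>)). f (sec \<alpha>) * g (S.inv_of (sec \<alpha>) \<cdot> \<sigma>) \<noteq> 0"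
  proof (rule ccontr)
    assume "\<not> ?thesis"
    then have "conv f g \<sigma> = 0" using conv_sum_fib[OF assms(1-3) \<sigma>] by (simp add: sum.neutral)
    then show False using s by simp
  qed
  then obtain \<alpha> where a0: "\<alpha> \<in> fib f (G.ran (q \<sigma>))" "f (sec \<alpha>) * g (S.inv_of (sec \<alpha>) \<cdot> \<sigma>) \<noteq> 0"
    by (elim bexE)
  have a: "\<alpha> \<in> fib f (G.ran (q \<sigma>))" "g (S.inv_of (sec \<alpha>) \<cdot> \<sigma>) \<noteq> 0"
    using a0 by (simp, metis mult_zero_right)
  have aG: "\<alpha> \<in> arrows G" "G.ran \<alpha> = G.ran (q \<sigma>)" using fib_arrows[of f \<alpha>, OF assms(1) a(1)] by simp_all
  have "q (S.inv_of (sec \<alpha>) \<cdot> \<sigma>) \<in> supp g" by (rule suppI[of g, OF a(2)])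
  moreover have "q (S.inv_of (sec \<alpha>) \<cdot> \<sigma>) = G.inv_of \<alpha> \<cdot>\<^bsub>G\<^esub> q \<sigma>" using aG \<sigma> by simp
  moreover have "\<alpha> \<cdot>\<^bsub>G\<^esub> (G.inv_of \<alpha> \<cdot>\<^bsub>G\<^esub> q \<sigma>) = q \<sigma>" "G.ran (G.inv_of \<alpha> \<cdot>\<^bsub>G\<^esub> q \<sigma>) = G.sou \<alpha>"
    using aG \<sigma> by simp_all
  ultimately show ?thesis using a(1) s(2) by (intro bexI[of _ \<alpha>] bexI[of _ "G.inv_of \<alpha> \<cdot>\<^bsub>G\<^esub> q \<sigma>"])
    (auto simp: fib_def)
qed

lemma rfin_conv:
  assumes "eqv f" "rfin f" "eqv g" "rfin g" shows "rfin (conv f g)"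
  unfolding rfin_def
proof
  fix y
  have "fib (conv f g) y \<subseteq> (\<Union>\<alpha>\<in>fib f y. (\<lambda>\<beta>. \<alpha> \<cdot>\<^bsub>G\<^esub> \<beta>) ` fib g (G.sou \<alpha>))"
  proof
    fix \<gamma> assume g: "\<gamma> \<in> fib (conv f g) y"
    then obtain \<alpha> \<beta> where ab: "\<alpha> \<in> supp f" "\<beta> \<in> supp g" "G.sou \<alpha> = G.ran \<beta>" "\<gamma> = \<alpha> \<cdot>\<^bsub>G\<^esub> \<beta>"
      using supp_conv[OF assms(1-3), of \<gamma>] by (auto simp: fib_def)
    then have "\<alpha> \<in> arrows G" "\<beta> \<in> arrows G" using supp_arrows assms by blast+
    then have "\<alpha> \<in> fib f y" "\<beta> \<in> fib g (G.sou \<alpha>)" using ab g by (auto simp: fib_def)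
    then show "\<gamma> \<in> (\<Union>\<alpha>\<in>fib f y. (\<lambda>\<beta>. \<alpha> \<cdot>\<^bsub>G\<^esub> \<beta>) ` fib g (G.sou \<alpha>))"
      unfolding ab(4) by (intro UN_I[of \<alpha>] imageI)
  qed
  moreover have "finite (\<Union>\<alpha>\<in>fib f y. (\<lambda>\<beta>. \<alpha> \<cdot>\<^bsub>G\<^esub> \<beta>) ` fib g (G.sou \<alpha>))"
    using assms by (auto simp: rfin_def)
  ultimately show "finite (fib (conv f g) y)" by (rule finite_subset)
qed

text \<open>Both sides become double sums over the range fibre of \<open>f\<close> and a common
  finite set \<open>\<Gamma>\<close> of products. After swapping the sums, the substitution of
  \<open>\<gamma>\<close> by \<open>\<alpha>^-1 \<gamma>\<close> turns the inner sum into the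
  convolution of \<open>g\<close> and \<open>h\<close>.\<close>

lemma conv_assoc:
  assumes f: "eqv f" "rfin f" and g: "eqv g" "rfin g" and h: "eqv h"
  shows "conv (conv f g) h = conv f (conv g h)"
proof
  fix \<sigma>
  show "conv (conv f g) h \<sigma> = conv f (conv g h) \<sigma>"
  proof (cases "\<sigma> \<in> arrows \<Sigma>")
    case False then show ?thesis by (simp add: conv_off)
  next
    case \<sigma>: True
    define y where "y = G.ran (q \<sigma>)"
    \<comment> \<open>All products of an arrow in the fibre of \<open>f\<close> with a composable
      arrow in the fibre of \<open>g\<close>; the fibre of \<open>conv f g\<close> is contained in
      this set.\<close>
    define \<Gamma> where "\<Gamma> = (\<Union>\<alpha>\<in>fib f y. (\<lambda>\<beta>. \<alpha> \<cdot>\<^bsub>G\<^esub> \<beta>) ` fib g (G.sou \<alpha>))"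
    have fA: "\<alpha> \<in> arrows G" "G.ran \<alpha> = y" if "\<alpha> \<in> fib f y" for \<alpha>
      using fib_arrows[OF f(1) that] by auto
    have gA: "\<beta> \<in> arrows G" "G.ran \<beta> = x" if "\<beta> \<in> fib g x" for \<beta> x
      using fib_arrows[OF g(1) that] by auto
    have fin\<Gamma>: "finite \<Gamma>" using f g unfolding \<Gamma>_def rfin_def by auto
    have \<Gamma>A: "\<gamma> \<in> arrows G \<and> G.ran \<gamma> = y" if "\<gamma> \<in> \<Gamma>" for \<gamma>
      using that fA gA unfolding \<Gamma>_def by force
    have "conv (conv f g) h \<sigma> = (\<Sum>\<gamma>\<in>\<Gamma>. conv f g (sec \<gamma>) * h (S.inv_of (sec \<gamma>) \<cdot> \<sigma>))"
    proof (rule conv_sum[OF eqv_conv[OF f g(1)] rfin_conv[OF f g] h \<sigma> fin\<Gamma>])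
      show "\<gamma> \<in> arrows G \<and> G.ran \<gamma> = G.ran (q \<sigma>)" if "\<gamma> \<in> \<Gamma>" for \<gamma>
        using \<Gamma>A[OF that] by (simp add: y_def)
      show "sec \<gamma> \<in> arrows \<Sigma> \<and> q (sec \<gamma>) = \<gamma>" if "\<gamma> \<in> \<Gamma>" for \<gamma>
        using \<Gamma>A[OF that] by simp
      fix \<gamma> assume c: "\<gamma> \<in> fib (conv f g) (G.ran (q \<sigma>))"
      then obtain \<alpha> \<beta> where ab: "\<alpha> \<in> supp f" "\<beta> \<in> supp g" "G.sou \<alpha> = G.ran \<beta>" "\<gamma> = \<alpha> \<cdot>\<^bsub>G\<^esub> \<beta>"
        using supp_conv[OF f g(1), of \<gamma>] by (auto simp: fib_def)
      have "\<alpha> \<in> arrows G" "\<beta> \<in> arrows G" using ab supp_arrows f g by blast+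
      then have "\<alpha> \<in> fib f y" "\<beta> \<in> fib g (G.sou \<alpha>)" using ab c by (auto simp: fib_def y_def)
      then show "\<gamma> \<in> \<Gamma>" unfolding \<Gamma>_def ab(4) by (intro UN_I[of \<alpha>] imageI)
    qed
    also have "\<dots> = (\<Sum>\<gamma>\<in>\<Gamma>. \<Sum>\<alpha>\<in>fib f y. f (sec \<alpha>) * (g (S.inv_of (sec \<alpha>) \<cdot> sec \<gamma>) * h (S.inv_of (sec \<gamma>) \<cdot> \<sigma>)))"
    proof (rule sum.cong[OF refl])
      fix \<gamma> assume "\<gamma> \<in> \<Gamma>"
      then have "conv f g (sec \<gamma>) = (\<Sum>\<alpha>\<in>fib f y. f (sec \<alpha>) * g (S.inv_of (sec \<alpha>) \<cdot> sec \<gamma>))"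
        using conv_sum_fib[OF f g(1), of "sec \<gamma>"] \<Gamma>A by simp
      then show "conv f g (sec \<gamma>) * h (S.inv_of (sec \<gamma>) \<cdot> \<sigma>) =
        (\<Sum>\<alpha>\<in>fib f y. f (sec \<alpha>) * (g (S.inv_of (sec \<alpha>) \<cdot> sec \<gamma>) * h (S.inv_of (sec \<gamma>) \<cdot> \<sigma>)))"
        by (simp add: sum_distrib_right mult.assoc)
    qed
    also have "\<dots> = (\<Sum>\<alpha>\<in>fib f y. \<Sum>\<gamma>\<in>\<Gamma>. f (sec \<alpha>) * (g (S.inv_of (sec \<alpha>) \<cdot> sec \<gamma>) * h (S.inv_of (sec \<gamma>) \<cdot> \<sigma>)))"
      by (rule sum.swap)
    also have "\<dots> = (\<Sum>\<alpha>\<in>fib f y. f (sec \<alpha>) * conv g h (S.inv_of (sec \<alpha>) \<cdot> \<sigma>))"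
    proof (rule sum.cong[OF refl])
      fix \<alpha> assume a: "\<alpha> \<in> fib f y"
      note aA = fA[OF a]
      let ?F = "(\<lambda>\<gamma>. G.inv_of \<alpha> \<cdot>\<^bsub>G\<^esub> \<gamma>) ` \<Gamma>"
      \<comment> \<open>This lift, rather than \<open>sec \<beta>\<close>, makes the inverse of
        \<open>?T \<beta>\<close> times \<open>?\<rho>\<close> collapse to
        \<open>S.inv_of (sec \<gamma>) \<cdot> \<sigma>\<close>, with no stray scalar.\<close>
      let ?T = "\<lambda>\<beta>. S.inv_of (sec \<alpha>) \<cdot> sec (\<alpha> \<cdot>\<^bsub>G\<^esub> \<beta>)"
      let ?\<rho> = "S.inv_of (sec \<alpha>) \<cdot> \<sigma>"
      have \<rho>: "?\<rho> \<in> arrows \<Sigma>" "q ?\<rho> = G.inv_of \<alpha> \<cdot>\<^bsub>G\<^esub> q \<sigma>" "G.ran (q ?\<rho>) = G.sou \<alpha>"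
        using aA \<sigma> by (simp_all add: y_def)
      have "conv g h ?\<rho> = (\<Sum>\<beta>\<in>?F. g (?T \<beta>) * h (S.inv_of (?T \<beta>) \<cdot> ?\<rho>))"
      proof (rule conv_sum[OF g h \<rho>(1)])
        show "finite ?F" using fin\<Gamma> by simp
        show "\<beta> \<in> arrows G \<and> G.ran \<beta> = G.ran (q ?\<rho>)" if "\<beta> \<in> ?F" for \<beta>
          using that \<Gamma>A aA unfolding \<rho>(3) by auto
        show "?T \<beta> \<in> arrows \<Sigma> \<and> q (?T \<beta>) = \<beta>" if "\<beta> \<in> ?F" for \<beta>
          using that \<Gamma>A aA by auto
        fix \<beta> assume b: "\<beta> \<in> fib g (G.ran (q ?\<rho>))"
        then have b: "\<beta> \<in> fib g (G.sou \<alpha>)" using \<rho>(3) by simp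
        then have "\<alpha> \<cdot>\<^bsub>G\<^esub> \<beta> \<in> \<Gamma>" using a unfolding \<Gamma>_def by auto
        moreover have "\<beta> = G.inv_of \<alpha> \<cdot>\<^bsub>G\<^esub> (\<alpha> \<cdot>\<^bsub>G\<^esub> \<beta>)" using gA[OF b] aA by simp
        ultimately show "\<beta> \<in> ?F" by (metis imageI)
      qed
      also have "\<dots> = (\<Sum>\<gamma>\<in>\<Gamma>. g (?T (G.inv_of \<alpha> \<cdot>\<^bsub>G\<^esub> \<gamma>)) * h (S.inv_of (?T (G.inv_of \<alpha> \<cdot>\<^bsub>G\<^esub> \<gamma>)) \<cdot> ?\<rho>))"
      proof (rule sum.reindex_cong[OF _ refl refl])
        show "inj_on (\<lambda>\<gamma>. G.inv_of \<alpha> \<cdot>\<^bsub>G\<^esub> \<gamma>) \<Gamma>"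
        proof (rule inj_onI)
          fix a b assume ab: "a \<in> \<Gamma>" "b \<in> \<Gamma>" "G.inv_of \<alpha> \<cdot>\<^bsub>G\<^esub> a = G.inv_of \<alpha> \<cdot>\<^bsub>G\<^esub> b"
          then show "a = b" using G.mul_left_cancel[of "G.inv_of \<alpha>" a b] \<Gamma>A[OF ab(1)] \<Gamma>A[OF ab(2)] aA by simp
        qed
      qed
      also have "\<dots> = (\<Sum>\<gamma>\<in>\<Gamma>. g (S.inv_of (sec \<alpha>) \<cdot> sec \<gamma>) * h (S.inv_of (sec \<gamma>) \<cdot> \<sigma>))"
      proof (rule sum.cong[OF refl])
        fix \<gamma> assume "\<gamma> \<in> \<Gamma>"
        note gG = \<Gamma>A[OF this]
        have T: "?T (G.inv_of \<alpha> \<cdot>\<^bsub>G\<^esub> \<gamma>) = S.inv_of (sec \<alpha>) \<cdot> sec \<gamma>" using gG aA by simp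
        have c: "S.ran (sec \<alpha>) = S.ran (sec \<gamma>)" "S.ran (sec \<alpha>) = S.ran \<sigma>" "S.ran (sec \<gamma>) = S.ran \<sigma>"
          using gG aA \<sigma> by (simp_all add: composable_eq y_def)
        have "S.inv_of (S.inv_of (sec \<alpha>) \<cdot> sec \<gamma>) = S.inv_of (sec \<gamma>) \<cdot> sec \<alpha>"
          using gG aA c by (subst S.inv_mul) simp_all
        then have "S.inv_of (?T (G.inv_of \<alpha> \<cdot>\<^bsub>G\<^esub> \<gamma>)) \<cdot> ?\<rho> = S.inv_of (sec \<gamma>) \<cdot> sec \<alpha> \<cdot> (S.inv_of (sec \<alpha>) \<cdot> \<sigma>)"
          unfolding T by simp
        also have "\<dots> = S.inv_of (sec \<gamma>) \<cdot> \<sigma>"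
          using gG aA c \<sigma> by (subst S.mul_assoc) simp_all
        finally show "g (?T (G.inv_of \<alpha> \<cdot>\<^bsub>G\<^esub> \<gamma>)) * h (S.inv_of (?T (G.inv_of \<alpha> \<cdot>\<^bsub>G\<^esub> \<gamma>)) \<cdot> ?\<rho>) =
           g (S.inv_of (sec \<alpha>) \<cdot> sec \<gamma>) * h (S.inv_of (sec \<gamma>) \<cdot> \<sigma>)" unfolding T by simp
      qed
      finally show "(\<Sum>\<gamma>\<in>\<Gamma>. f (sec \<alpha>) * (g (S.inv_of (sec \<alpha>) \<cdot> sec \<gamma>) * h (S.inv_of (sec \<gamma>) \<cdot> \<sigma>))) =
        f (sec \<alpha>) * conv g h ?\<rho>" by (simp add: sum_distrib_left)
    qed
    also have "\<dots> = conv f (conv g h) \<sigma>"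
      using conv_sum_fib[OF f eqv_conv[OF g h] \<sigma>] by (simp add: y_def)
    finally show ?thesis .
  qed
qed

section \<open>Linearity, restriction and functions supported over the units\<close>

lemma eqv_zero [simp]: "eqv (\<lambda>\<sigma>. 0)" and rfin_zero [simp]: "rfin (\<lambda>\<sigma>. 0)"
  by (auto simp: eqv_def rfin_def fib_def supp_def function_support_def)

lemma eqv_add [simp]: "eqv f \<Longrightarrow> eqv g \<Longrightarrow> eqv (\<lambda>\<sigma>. f \<sigma> + g \<sigma>)"
  by (rule eqvI) (auto simp: eqv_off distrib_left)

lemma eqv_smult [simp]: "eqv f \<Longrightarrow> eqv (\<lambda>\<sigma>. c * f \<sigma>)"
  by (rule eqvI) (auto simp: eqv_off ac_simps)

definition res :: "('s \<Rightarrow> 'r) \<Rightarrow> 'g set \<Rightarrow> 's \<Rightarrow> 'r" where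
  "res f K \<sigma> = (if q \<sigma> \<in> K then f \<sigma> else 0)"

lemma eqv_res [simp]: "eqv f \<Longrightarrow> eqv (res f K)"
  by (rule eqvI) (auto simp: eqv_off res_def)

lemma supp_add: "supp (\<lambda>\<sigma>. f \<sigma> + g \<sigma>) \<subseteq> supp f \<union> supp g"
  and supp_smult: "supp (\<lambda>\<sigma>. c * f \<sigma>) \<subseteq> supp f"
  and supp_res: "supp (res f K) = supp f \<inter> K"
  by (auto simp: supp_def function_support_def res_def)

lemma rfin_mono: "rfin f \<Longrightarrow> supp g \<subseteq> supp f \<Longrightarrow> rfin g"
proof -
  assume "rfin f" "supp g \<subseteq> supp f"
  moreover from this have "fib g y \<subseteq> fib f y" for y by (auto simp: fib_def)
  ultimately show "rfin g" unfolding rfin_def by (meson finite_subset)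
qed

lemma rfin_add [simp]: assumes "rfin f" "rfin g" shows "rfin (\<lambda>\<sigma>. f \<sigma> + g \<sigma>)"
proof -
  have "fib (\<lambda>\<sigma>. f \<sigma> + g \<sigma>) y \<subseteq> fib f y \<union> fib g y" for y
    using supp_add[of f g] by (auto simp: fib_def)
  then show ?thesis using assms unfolding rfin_def by (meson finite_UnI finite_subset)
qed

lemma rfin_smult [simp]: "rfin f \<Longrightarrow> rfin (\<lambda>\<sigma>. c * f \<sigma>)"
  by (erule rfin_mono) (rule supp_smult)

lemma rfin_res [simp]: "rfin f \<Longrightarrow> rfin (res f K)"
  by (erule rfin_mono) (simp add: supp_res)

lemma conv_add_left:
  assumes "eqv f" "rfin f" "eqv f'" "rfin f'" "eqv g"
  shows "conv (\<lambda>\<sigma>. f \<sigma> + f' \<sigma>) g = (\<lambda>\<sigma>. conv f g \<sigma> + conv f' g \<sigma>)"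
proof
  fix \<sigma>
  show "conv (\<lambda>\<sigma>. f \<sigma> + f' \<sigma>) g \<sigma> = conv f g \<sigma> + conv f' g \<sigma>"
  proof (cases "\<sigma> \<in> arrows \<Sigma>")
    case False then show ?thesis by (simp add: conv_off)
  next
    case True
    let ?F = "fib f (G.ran (q \<sigma>)) \<union> fib f' (G.ran (q \<sigma>))"
    have F: "finite ?F" "\<And>\<alpha>. \<alpha> \<in> ?F \<Longrightarrow> \<alpha> \<in> arrows G \<and> G.ran \<alpha> = G.ran (q \<sigma>)"
      "\<And>\<alpha>. \<alpha> \<in> ?F \<Longrightarrow> sec \<alpha> \<in> arrows \<Sigma> \<and> q (sec \<alpha>) = \<alpha>"
      using assms supp_arrows[OF assms(1)] supp_arrows[OF assms(3)] by (auto simp: rfin_def fib_def)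
    have "conv (\<lambda>\<sigma>. f \<sigma> + f' \<sigma>) g \<sigma> = (\<Sum>\<alpha>\<in>?F. (f (sec \<alpha>) + f' (sec \<alpha>)) * g (S.inv_of (sec \<alpha>) \<cdot> \<sigma>))"
    proof (rule conv_sum)
      show "\<alpha> \<in> ?F" if "\<alpha> \<in> fib (\<lambda>\<sigma>. f \<sigma> + f' \<sigma>) (G.ran (q \<sigma>))" for \<alpha>
        using that supp_add[of f f'] by (auto simp: fib_def)
      show "eqv (\<lambda>\<sigma>. f \<sigma> + f' \<sigma>)" "rfin (\<lambda>\<sigma>. f \<sigma> + f' \<sigma>)" using assms by simp_all
    qed (rule assms True F; assumption)+
    moreover have "conv f g \<sigma> = (\<Sum>\<alpha>\<in>?F. f (sec \<alpha>) * g (S.inv_of (sec \<alpha>) \<cdot> \<sigma>))"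
      by (rule conv_sum[OF assms(1,2,5) True F]) simp_all
    moreover have "conv f' g \<sigma> = (\<Sum>\<alpha>\<in>?F. f' (sec \<alpha>) * g (S.inv_of (sec \<alpha>) \<cdot> \<sigma>))"
      by (rule conv_sum[OF assms(3,4,5) True F]) simp_all
    ultimately show ?thesis by (simp add: distrib_right sum.distrib)
  qed
qed

lemma conv_add_right:
  assumes "eqv f" "rfin f" "eqv g" "eqv g'"
  shows "conv f (\<lambda>\<sigma>. g \<sigma> + g' \<sigma>) = (\<lambda>\<sigma>. conv f g \<sigma> + conv f g' \<sigma>)"
proof
  fix \<sigma>
  show "conv f (\<lambda>\<sigma>. g \<sigma> + g' \<sigma>) \<sigma> = conv f g \<sigma> + conv f g' \<sigma>"
    using assms by (cases "\<sigma> \<in> arrows \<Sigma>") (simp_all add: conv_off conv_sum_fib distrib_left sum.distrib)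
qed

lemma conv_smult_left:
  assumes "eqv f" "rfin f" "eqv g"
  shows "conv (\<lambda>\<sigma>. c * f \<sigma>) g = (\<lambda>\<sigma>. c * conv f g \<sigma>)"
proof
  fix \<sigma>
  show "conv (\<lambda>\<sigma>. c * f \<sigma>) g \<sigma> = c * conv f g \<sigma>"
  proof (cases "\<sigma> \<in> arrows \<Sigma>")
    case False then show ?thesis by (simp add: conv_off)
  next
    case True
    have "conv (\<lambda>\<sigma>. c * f \<sigma>) g \<sigma> =
      (\<Sum>\<alpha>\<in>fib f (G.ran (q \<sigma>)). c * f (sec \<alpha>) * g (S.inv_of (sec \<alpha>) \<cdot> \<sigma>))"
    proof (rule conv_sum)
      show "\<alpha> \<in> fib f (G.ran (q \<sigma>))" if "\<alpha> \<in> fib (\<lambda>\<sigma>. c * f \<sigma>) (G.ran (q \<sigma>))" for \<alpha>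
        using that supp_smult[of c f] by (auto simp: fib_def)
      show "\<alpha> \<in> arrows G \<and> G.ran \<alpha> = G.ran (q \<sigma>)" if "\<alpha> \<in> fib f (G.ran (q \<sigma>))" for \<alpha>
        using fib_arrows[OF assms(1) that] .
      show "sec \<alpha> \<in> arrows \<Sigma> \<and> q (sec \<alpha>) = \<alpha>" if "\<alpha> \<in> fib f (G.ran (q \<sigma>))" for \<alpha>
        using fib_arrows[OF assms(1) that] by simp
      show "rfin (\<lambda>\<sigma>. c * f \<sigma>)" using assms by simp
    qed (use assms True in \<open>simp_all add: rfin_def[of f]\<close>)
    then show ?thesis using assms True by (simp add: conv_sum_fib sum_distrib_left mult.assoc)
  qed
qed

lemma conv_smult_right:
  assumes "eqv f" "rfin f" "eqv g"
  shows "conv f (\<lambda>\<sigma>. c * g \<sigma>) = (\<lambda>\<sigma>. c * conv f g \<sigma>)"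
proof
  fix \<sigma>
  show "conv f (\<lambda>\<sigma>. c * g \<sigma>) \<sigma> = c * conv f g \<sigma>"
    using assms by (cases "\<sigma> \<in> arrows \<Sigma>") (simp_all add: conv_off conv_sum_fib sum_distrib_left ac_simps)
qed

definition diag :: "('s \<Rightarrow> 'r) \<Rightarrow> bool" where
  "diag d \<longleftrightarrow> eqv d \<and> (\<forall>\<sigma>. d \<sigma> \<noteq> 0 \<longrightarrow> q \<sigma> \<in> units G)"

lemma diag_eqv [simp]: "diag d \<Longrightarrow> eqv d"
  by (simp add: diag_def)

lemma diag_zero: "diag d \<Longrightarrow> q \<sigma> \<notin> units G \<Longrightarrow> d \<sigma> = 0"
  by (auto simp: diag_def)

lemma diag_fib: "diag d \<Longrightarrow> fib d y \<subseteq> {y}"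
  unfolding diag_def fib_def supp_def function_support_def by auto

lemma diag_rfin [simp]: "diag d \<Longrightarrow> rfin d"
  unfolding rfin_def using diag_fib finite_subset by blast

lemma conv_diag_left:
  assumes "diag d" "eqv f" "\<sigma> \<in> arrows \<Sigma>"
  shows "conv d f \<sigma> = d (S.ran \<sigma>) * f \<sigma>"
proof -
  have "conv d f \<sigma> = (\<Sum>\<alpha>\<in>{G.ran (q \<sigma>)}. d (S.ran \<sigma>) * f (S.inv_of (S.ran \<sigma>) \<cdot> \<sigma>))"
    using assms diag_fib[OF assms(1), of "G.ran (q \<sigma>)"] by (intro conv_sum) auto
  then show ?thesis using assms by simp
qed

text \<open>The term at \<open>\<alpha>\<close> is nonzero only if
  \<open>\<alpha>^-1 q(\<sigma>)\<close> is a unit, which means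
  \<open>\<alpha> = q \<sigma>\<close>; that term is computed with the lift \<open>\<sigma>\<close>
  itself.\<close>

lemma conv_diag_right:
  assumes "eqv f" "rfin f" "diag d" "\<sigma> \<in> arrows \<Sigma>"
  shows "conv f d \<sigma> = f \<sigma> * d (S.sou \<sigma>)"
proof -
  have "conv f d \<sigma> = (\<Sum>\<alpha>\<in>{q \<sigma>}. f \<sigma> * d (S.inv_of \<sigma> \<cdot> \<sigma>))"
  proof (rule conv_sum)
    fix \<alpha> assume a: "\<alpha> \<in> fib f (G.ran (q \<sigma>))" "d (S.inv_of (sec \<alpha>) \<cdot> \<sigma>) \<noteq> 0"
    then have aA: "\<alpha> \<in> arrows G" "G.ran \<alpha> = G.ran (q \<sigma>)" using fib_arrows[OF assms(1)] by blast+
    have "q (S.inv_of (sec \<alpha>) \<cdot> \<sigma>) \<in> units G" using a(2) assms(3) unfolding diag_def by blast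
    then have "G.inv_of \<alpha> \<cdot>\<^bsub>G\<^esub> q \<sigma> \<in> units G" using aA assms by simp
    then have "q \<sigma> = G.inv_of (G.inv_of \<alpha>)" using aA assms by (intro G.mul_eq_unitD) auto
    then show "\<alpha> \<in> {q \<sigma>}" using aA by simp
  qed (use assms in auto)
  then show ?thesis by simp
qed

lemma conv_single:
  assumes "eqv f" "rfin f" "eqv g" "\<sigma> \<in> arrows \<Sigma>" "\<tau> \<in> arrows \<Sigma>" "G.ran (q \<tau>) = G.ran (q \<sigma>)"
    "fib f (G.ran (q \<sigma>)) \<subseteq> {q \<tau>}"
  shows "conv f g \<sigma> = f \<tau> * g (S.inv_of \<tau> \<cdot> \<sigma>)"
proof -
  have "conv f g \<sigma> = (\<Sum>\<alpha>\<in>{q \<tau>}. f \<tau> * g (S.inv_of \<tau> \<cdot> \<sigma>))"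
    using assms by (intro conv_sum) auto
  then show ?thesis by simp
qed

lemma eqv_ext:
  assumes "eqv f" "eqv g" "supp f \<subseteq> q ` Y" "supp g \<subseteq> q ` Y" "Y \<subseteq> arrows \<Sigma>" "\<And>y. y \<in> Y \<Longrightarrow> f y = g y"
  shows "f = g"
proof
  fix \<sigma>
  show "f \<sigma> = g \<sigma>"
  proof (cases "\<sigma> \<in> arrows \<Sigma> \<and> q \<sigma> \<in> q ` Y")
    case True
    then obtain y where y: "y \<in> Y" "q y = q \<sigma>" by auto
    then have "y \<in> arrows \<Sigma>" using assms by auto
    then obtain t where "t \<in> ring_units" "\<sigma> = act t y" using fibre_transitive[of y \<sigma>] y True by metis
    then show ?thesis using assms y \<open>y \<in> arrows \<Sigma>\<close> by simp
  next
    case False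
    then have "f \<sigma> = 0" "g \<sigma> = 0" using assms suppI eqv_arrow by blast+
    then show ?thesis by simp
  qed
qed

text \<open>\<open>ind Y\<close> is the paper's \<open>1\<^sub>Y\<close> with a tilde, for a set \<open>Y\<close> on which \<open>q\<close> is injective.\<close>

definition ind :: "'s set \<Rightarrow> 's \<Rightarrow> 'r" where
  "ind Y \<sigma> = (if \<exists>t\<in>ring_units. \<exists>y\<in>Y. \<sigma> = act t y
     then (THE v. \<exists>t\<in>ring_units. \<exists>y\<in>Y. \<sigma> = act t y \<and> v = unit_inverse t) else 0)"

text \<open>The scalar \<open>t\<close> can be recovered from \<open>act t y\<close>: injectivity of
  \<open>q\<close> on \<open>Y\<close> recovers \<open>y\<close>, and the action is free. So the
  definite description in \<open>ind\<close> has a unique solution.\<close>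

lemma ind_act:
  assumes "Y \<subseteq> arrows \<Sigma>" "inj_on q Y" "y \<in> Y" "t \<in> ring_units"
  shows "ind Y (act t y) = unit_inverse t"
proof -
  have "v = unit_inverse t" if "\<exists>t'\<in>ring_units. \<exists>y'\<in>Y. act t y = act t' y' \<and> v = unit_inverse t'" for v
  proof -
    obtain t' y' where h: "t' \<in> ring_units" "y' \<in> Y" "act t y = act t' y'" "v = unit_inverse t'"
      using \<open>\<exists>t'\<in>ring_units. \<exists>y'\<in>Y. act t y = act t' y' \<and> v = unit_inverse t'\<close> by auto
    have yS: "y \<in> arrows \<Sigma>" "y' \<in> arrows \<Sigma>" using assms h by auto
    have "q y = q y'" using act_simps(2)[OF yS(1) assms(4)] act_simps(2)[OF yS(2) h(1)] h(3) by simp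
    then have "y = y'" using inj_onD[OF assms(2) _ assms(3) h(2)] by simp
    then have "t = t'" using act_inj[OF yS(1) assms(4) h(1)] h(3) by simp
    then show ?thesis using h by simp
  qed
  then have "(THE v. \<exists>t'\<in>ring_units. \<exists>y'\<in>Y. act t y = act t' y' \<and> v = unit_inverse t') = unit_inverse t"
    using assms by (intro the_equality) blast+
  then show ?thesis unfolding ind_def using assms by auto
qed

lemma ind_one: "Y \<subseteq> arrows \<Sigma> \<Longrightarrow> inj_on q Y \<Longrightarrow> y \<in> Y \<Longrightarrow> ind Y y = 1"
  using ind_act[of Y y 1] by (auto simp: subset_iff)

lemma eqv_ind:
  assumes "Y \<subseteq> arrows \<Sigma>" "inj_on q Y" shows "eqv (ind Y)"
proof (rule eqvI)
  show "ind Y \<sigma> = 0" if "\<sigma> \<notin> arrows \<Sigma>" for \<sigma>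
    using that assms act_simps(1) unfolding ind_def by (auto simp: subset_iff)
  fix t :: 'r and \<sigma> assume t: "t \<in> ring_units" "\<sigma> \<in> arrows \<Sigma>"
  show "ind Y (act t \<sigma>) = unit_inverse t * ind Y \<sigma>"
  proof (cases "\<exists>u\<in>ring_units. \<exists>y\<in>Y. \<sigma> = act u y")
    case True
    then obtain u y where u: "u \<in> ring_units" "y \<in> Y" "\<sigma> = act u y" by auto
    then have "y \<in> arrows \<Sigma>" using assms by auto
    then have "act t \<sigma> = act (t * u) y" using u t by simp
    then show ?thesis using ind_act[OF assms u(2)] u t by (simp add: unit_inverse_mult)
  next
    case False
    have "\<not> (\<exists>u\<in>ring_units. \<exists>y\<in>Y. act t \<sigma> = act u y)"
    proof
      assume "\<exists>u\<in>ring_units. \<exists>y\<in>Y. act t \<sigma> = act u y"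
      then obtain u y where u: "u \<in> ring_units" "y \<in> Y" "act t \<sigma> = act u y" by auto
      then have "y \<in> arrows \<Sigma>" using assms by auto
      then have "act (unit_inverse t) (act t \<sigma>) = act (unit_inverse t * u) y" using u t by simp
      then have "\<sigma> = act (unit_inverse t * u) y" using t by simp
      then show False using False u t by (metis ring_units_mult unit_inverse_units)
    qed
    then show ?thesis using False by (simp add: ind_def)
  qed
qed

lemma ind_nonzero: "ind Y \<sigma> \<noteq> 0 \<Longrightarrow> \<exists>t\<in>ring_units. \<exists>y\<in>Y. \<sigma> = act t y"
  unfolding ind_def by presburger

lemma supp_ind: "Y \<subseteq> arrows \<Sigma> \<Longrightarrow> inj_on q Y \<Longrightarrow> supp (ind Y) = q ` Y"
proof (intro equalityI subsetI)
  assume Y: "Y \<subseteq> arrows \<Sigma>" "inj_on q Y"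
  fix \<alpha>
  { assume "\<alpha> \<in> supp (ind Y)"
    then obtain \<sigma> where "ind Y \<sigma> \<noteq> 0" "\<alpha> = q \<sigma>" by (auto simp: supp_def function_support_def)
    then obtain t y where "t \<in> ring_units" "y \<in> Y" "\<sigma> = act t y" using ind_nonzero by blast
    then show "\<alpha> \<in> q ` Y" using Y \<open>\<alpha> = q \<sigma>\<close> by auto }
  { assume "\<alpha> \<in> q ` Y"
    then obtain y where "y \<in> Y" "\<alpha> = q y" by auto
    then show "\<alpha> \<in> supp (ind Y)" using suppI[of "ind Y" y] ind_one[OF Y] by simp }
qed

end

section \<open>Compactly supported locally constant functions\<close>

context ample_twist
begin

abbreviation stein where "stein \<equiv> steinberg_functions \<Sigma> i q G"

text \<open>Local constancy is restated as openness of all level sets, which is stable under the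
  unions and preimages used below.\<close>

lemma stein_iff:
  "f \<in> stein \<longleftrightarrow> eqv f \<and> (\<forall>v. openin (arrow_topology \<Sigma>) {\<sigma> \<in> arrows \<Sigma>. f \<sigma> = v}) \<and>
    compactin (arrow_topology G) (supp f)"
proof -
  have "(\<forall>\<sigma> \<in> arrows \<Sigma>. \<exists>W. openin (arrow_topology \<Sigma>) W \<and> \<sigma> \<in> W \<and> (\<forall>\<tau> \<in> W. f \<tau> = f \<sigma>)) \<longleftrightarrow>
    (\<forall>v. openin (arrow_topology \<Sigma>) {\<sigma> \<in> arrows \<Sigma>. f \<sigma> = v})" (is "?L \<longleftrightarrow> ?R")
  proof
    assume L: ?L
    show ?R
    proof
      fix v
      show "openin (arrow_topology \<Sigma>) {\<sigma> \<in> arrows \<Sigma>. f \<sigma> = v}"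
      proof (subst openin_subopen, intro ballI)
        fix \<sigma> assume s: "\<sigma> \<in> {\<sigma> \<in> arrows \<Sigma>. f \<sigma> = v}"
        then obtain W where W: "openin (arrow_topology \<Sigma>) W" "\<sigma> \<in> W" "\<forall>\<tau> \<in> W. f \<tau> = f \<sigma>" using L by blast
        have "W \<subseteq> {\<sigma> \<in> arrows \<Sigma>. f \<sigma> = v}"
        proof
          fix \<tau> assume t: "\<tau> \<in> W"
          then have "f \<tau> = f \<sigma>" "\<tau> \<in> arrows \<Sigma>" using bspec[OF W(3) t] openin_subset[OF W(1)] by blast+
          then show "\<tau> \<in> {\<sigma> \<in> arrows \<Sigma>. f \<sigma> = v}" using s by simp
        qed
        then show "\<exists>T. openin (arrow_topology \<Sigma>) T \<and> \<sigma> \<in> T \<and> T \<subseteq> {\<sigma> \<in> arrows \<Sigma>. f \<sigma> = v}" using W by blast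
      qed
    qed
  next
    assume R: ?R
    show ?L
    proof
      fix \<sigma> assume "\<sigma> \<in> arrows \<Sigma>"
      then show "\<exists>W. openin (arrow_topology \<Sigma>) W \<and> \<sigma> \<in> W \<and> (\<forall>\<tau> \<in> W. f \<tau> = f \<sigma>)"
        using R by (intro exI[of _ "{\<tau> \<in> arrows \<Sigma>. f \<tau> = f \<sigma>}"]) auto
    qed
  qed
  then show ?thesis unfolding steinberg_functions_def eqv_def supp_def by auto
qed

lemma stein_eqv [simp]: "f \<in> stein \<Longrightarrow> eqv f"
  and stein_level: "f \<in> stein \<Longrightarrow> openin (arrow_topology \<Sigma>) {\<sigma> \<in> arrows \<Sigma>. f \<sigma> = v}"
  and stein_compact: "f \<in> stein \<Longrightarrow> compactin (arrow_topology G) (supp f)"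
  by (simp_all add: stein_iff)

text \<open>The support and its complement are both images of open level sets under the open map
  \<open>q\<close>.\<close>

lemma supp_open:
  assumes "eqv f" "\<And>v. openin (arrow_topology \<Sigma>) {\<sigma> \<in> arrows \<Sigma>. f \<sigma> = v}"
  shows "openin (arrow_topology G) (supp f)" "closedin (arrow_topology G) (supp f)"
proof -
  have "supp f = q ` (\<Union>v\<in>-{0}. {\<sigma> \<in> arrows \<Sigma>. f \<sigma> = v})"
    using assms(1) by (auto simp: supp_def function_support_def eqv_def)
  moreover have "openin (arrow_topology \<Sigma>) (\<Union>v\<in>-{0}. {\<sigma> \<in> arrows \<Sigma>. f \<sigma> = v})"
    using assms(2) by blast
  ultimately show "openin (arrow_topology G) (supp f)" using open_q_image by metis
  have "arrows G - supp f = q ` {\<sigma> \<in> arrows \<Sigma>. f \<sigma> = 0}" (is "?L = ?R")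
  proof (intro equalityI subsetI)
    fix \<alpha> assume a: "\<alpha> \<in> ?L"
    then have "f (sec \<alpha>) = 0" using supp_sec[OF assms(1), of \<alpha>] by auto
    then have "sec \<alpha> \<in> {\<sigma> \<in> arrows \<Sigma>. f \<sigma> = 0}" using a by simp
    moreover have "\<alpha> = q (sec \<alpha>)" using a by simp
    ultimately show "\<alpha> \<in> ?R" by (metis imageI)
  next
    fix \<alpha> assume "\<alpha> \<in> ?R"
    then show "\<alpha> \<in> ?L" using supp_iff[OF assms(1)] by auto
  qed
  then have "openin (arrow_topology G) (arrows G - supp f)" using open_q_image[OF assms(2)[of 0]] by simp
  then show "closedin (arrow_topology G) (supp f)" unfolding closedin_def using supp_arrows[OF assms(1)] by simp
qed

lemma stein_supp_open: "f \<in> stein \<Longrightarrow> openin (arrow_topology G) (supp f)"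
  and stein_supp_closed: "f \<in> stein \<Longrightarrow> closedin (arrow_topology G) (supp f)"
  using supp_open by (simp_all add: stein_iff)

lemma stein_of_compact:
  assumes "eqv f" "\<And>v. openin (arrow_topology \<Sigma>) {\<sigma> \<in> arrows \<Sigma>. f \<sigma> = v}"
    "compactin (arrow_topology G) K" "supp f \<subseteq> K"
  shows "f \<in> stein"
  using assms supp_open(2)[OF assms(1,2)] closed_compactin[OF assms(3,4)] by (simp add: stein_iff)

lemma closed_of_compact: "compactin (arrow_topology G) K \<Longrightarrow> closedin (arrow_topology G) K"
  using compactin_imp_closedin[OF Hausdorff] .

lemma continuous_act:
  assumes "t \<in> ring_units"
  shows "continuous_map (arrow_topology \<Sigma>) (arrow_topology \<Sigma>) (act t)"
proof -
  have "continuous_map (arrow_topology \<Sigma>) (unit_space G) (\<lambda>\<sigma>. G.ran (q \<sigma>))"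
    using continuous_map_compose[OF q_continuous G.continuous_ran] by (simp add: o_def)
  then have "continuous_map (arrow_topology \<Sigma>) (arrow_topology (trivial_bundle G)) (\<lambda>\<sigma>. (G.ran (q \<sigma>), t))"
    unfolding trivial_bundle_def using assms by (simp add: continuous_map_pairedI)
  from continuous_map_compose[OF this i_continuous]
  have 1: "continuous_map (arrow_topology \<Sigma>) (arrow_topology \<Sigma>) (\<lambda>\<sigma>. i (G.ran (q \<sigma>), t))"
    by (simp add: o_def)
  have "continuous_map (arrow_topology \<Sigma>) (arrow_topology \<Sigma>) (\<lambda>\<sigma>. i (G.ran (q \<sigma>), t) \<cdot> \<sigma>)"
    by (rule S.continuous_mul'[OF 1]) (use assms in \<open>simp_all add: ran_eq\<close>)
  then show ?thesis by (rule continuous_map_eq) (simp add: act_eq)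
qed

text \<open>This criterion produces the basic elements of the algebra. Over the image of
  \<open>Y\<close> the function is constant on translates of \<open>Y\<close> by ring units, which
  are open; off that image it is zero, and the image is closed because it is compact in a Hausdorff
  space.\<close>

lemma steinI:
  assumes "eqv f" "openin (arrow_topology \<Sigma>) Y" "\<And>y. y \<in> Y \<Longrightarrow> f y = 1"
    "supp f \<subseteq> q ` Y" "compactin (arrow_topology G) (q ` Y)"
  shows "f \<in> stein"
proof (rule stein_of_compact[OF assms(1) _ assms(5,4)])
  fix v
  have YS: "Y \<subseteq> arrows \<Sigma>" by (rule openin_subset[OF assms(2)])
  show "openin (arrow_topology \<Sigma>) {\<sigma> \<in> arrows \<Sigma>. f \<sigma> = v}"
  proof (subst openin_subopen, intro ballI)
    fix \<sigma> assume s: "\<sigma> \<in> {\<sigma> \<in> arrows \<Sigma>. f \<sigma> = v}"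
    show "\<exists>T. openin (arrow_topology \<Sigma>) T \<and> \<sigma> \<in> T \<and> T \<subseteq> {\<sigma> \<in> arrows \<Sigma>. f \<sigma> = v}"
    proof (cases "q \<sigma> \<in> q ` Y")
      case True
      then obtain y where y: "y \<in> Y" "q y = q \<sigma>" by auto
      have yS: "y \<in> arrows \<Sigma>" using y YS by auto
      obtain t where t: "t \<in> ring_units" "\<sigma> = act t y" using fibre_transitive[OF yS] s y by auto
      let ?N = "{\<tau> \<in> arrows \<Sigma>. act (unit_inverse t) \<tau> \<in> Y}"
      have "openin (arrow_topology \<Sigma>) ?N"
        using t by (intro openin_continuous_map_preimage[OF continuous_act assms(2)]) simp
      moreover have "\<sigma> \<in> ?N" using t yS y by simp
      moreover have "f \<tau> = f \<sigma>" if "\<tau> \<in> ?N" for \<tau>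
      proof -
        let ?\<rho> = "act (unit_inverse t) \<tau>"
        have \<rho>: "?\<rho> \<in> Y" "?\<rho> \<in> arrows \<Sigma>" "\<tau> \<in> arrows \<Sigma>" using that YS by auto
        have "\<tau> = act t ?\<rho>" using \<rho> t by simp
        then have "f \<tau> = f (act t ?\<rho>)" by (rule arg_cong)
        also have "\<dots> = unit_inverse t * f ?\<rho>" by (rule eqv_act[OF assms(1) t(1) \<rho>(2)])
        also have "\<dots> = unit_inverse t * f y" using assms(3)[OF \<rho>(1)] assms(3)[OF y(1)] by simp
        also have "\<dots> = f \<sigma>" unfolding t(2) by (rule eqv_act[OF assms(1) t(1) yS, symmetric])
        finally show ?thesis .
      qed
      moreover have "?N \<subseteq> {\<sigma> \<in> arrows \<Sigma>. f \<sigma> = v}"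
      proof
        fix \<tau> assume n: "\<tau> \<in> ?N"
        then have "f \<tau> = f \<sigma>" by fact
        then show "\<tau> \<in> {\<sigma> \<in> arrows \<Sigma>. f \<sigma> = v}" using n s by simp
      qed
      ultimately show ?thesis by blast
    next
      case False
      let ?N = "{\<tau> \<in> arrows \<Sigma>. q \<tau> \<in> arrows G - q ` Y}"
      have "openin (arrow_topology G) (arrows G - q ` Y)"
        using closed_of_compact[OF assms(5)] by (simp add: closedin_def)
      then have "openin (arrow_topology \<Sigma>) ?N" by (rule openin_continuous_map_preimage[OF q_continuous])
      moreover have "f \<tau> = 0" if "q \<tau> \<notin> q ` Y" for \<tau> using that assms(4) suppI[of f \<tau>] by auto
      ultimately show ?thesis using s False by (intro exI[of _ ?N]) auto
    qed
  qed
qed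

lemma stein_zero [simp]: "(\<lambda>\<sigma>. 0) \<in> stein"
  by (rule steinI[of _ "{}"]) (auto simp: supp_def function_support_def)

lemma stein_add [simp]:
  assumes "f \<in> stein" "g \<in> stein" shows "(\<lambda>\<sigma>. f \<sigma> + g \<sigma>) \<in> stein"
proof (rule stein_of_compact)
  show "compactin (arrow_topology G) (supp f \<union> supp g)" using assms by (intro compactin_Un) (simp_all add: stein_compact)
  show "openin (arrow_topology \<Sigma>) {\<sigma> \<in> arrows \<Sigma>. f \<sigma> + g \<sigma> = v}" for v
  proof -
    have "{\<sigma> \<in> arrows \<Sigma>. f \<sigma> + g \<sigma> = v} = (\<Union>w. {\<sigma> \<in> arrows \<Sigma>. f \<sigma> = w} \<inter> {\<sigma> \<in> arrows \<Sigma>. g \<sigma> = v - w})"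
      by (auto simp: algebra_simps)
    moreover have "openin (arrow_topology \<Sigma>) (\<Union>w. {\<sigma> \<in> arrows \<Sigma>. f \<sigma> = w} \<inter> {\<sigma> \<in> arrows \<Sigma>. g \<sigma> = v - w})"
      by (intro openin_Union) (auto intro!: openin_Int stein_level assms)
    ultimately show ?thesis by simp
  qed
qed (use assms supp_add in auto)

lemma stein_smult [simp]:
  assumes "f \<in> stein" shows "(\<lambda>\<sigma>. c * f \<sigma>) \<in> stein"
proof (rule stein_of_compact)
  show "compactin (arrow_topology G) (supp f)" using assms by (simp add: stein_compact)
  show "openin (arrow_topology \<Sigma>) {\<sigma> \<in> arrows \<Sigma>. c * f \<sigma> = v}" for v
  proof -
    have "{\<sigma> \<in> arrows \<Sigma>. c * f \<sigma> = v} = (\<Union>w\<in>{w. c * w = v}. {\<sigma> \<in> arrows \<Sigma>. f \<sigma> = w})" by auto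
    moreover have "openin (arrow_topology \<Sigma>) (\<Union>w\<in>{w. c * w = v}. {\<sigma> \<in> arrows \<Sigma>. f \<sigma> = w})"
      by (intro openin_Union) (auto intro!: stein_level assms)
    ultimately show ?thesis by simp
  qed
qed (use assms supp_smult in auto)

lemma stein_res [simp]:
  assumes "f \<in> stein" "openin (arrow_topology G) K" "closedin (arrow_topology G) K"
  shows "res f K \<in> stein"
proof (rule stein_of_compact)
  show "compactin (arrow_topology G) (supp f)" using assms by (simp add: stein_compact)
  show "openin (arrow_topology \<Sigma>) {\<sigma> \<in> arrows \<Sigma>. res f K \<sigma> = v}" for v
  proof -
    have "{\<sigma> \<in> arrows \<Sigma>. res f K \<sigma> = v} = ({\<sigma> \<in> arrows \<Sigma>. f \<sigma> = v} \<inter> {\<sigma> \<in> arrows \<Sigma>. q \<sigma> \<in> K}) \<union>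
      {\<sigma> \<in> arrows \<Sigma>. q \<sigma> \<in> (if v = 0 then arrows G - K else {})}"
      by (auto simp: res_def)
    moreover have o: "openin (arrow_topology G) (if v = 0 then arrows G - K else {})"
      using assms by (simp add: closedin_def)
    ultimately show ?thesis
      using openin_Un[OF openin_Int[OF stein_level[OF assms(1), of v]
          openin_continuous_map_preimage[OF q_continuous assms(2)]]
          openin_continuous_map_preimage[OF q_continuous o]] by (simp only:)
  qed
qed (use assms in \<open>auto simp: supp_res\<close>)

text \<open>The compact support is covered by finitely many open sets with injective range map, each
  meeting a range fibre in at most one point.\<close>

lemma stein_rfin [simp]:
  assumes "f \<in> stein" shows "rfin f"
  unfolding rfin_def
proof
  fix y
  let ?U = "{W. openin (arrow_topology G) W \<and> inj_on (rng G) W}"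
  have "supp f \<subseteq> \<Union>?U"
  proof
    fix \<alpha> assume "\<alpha> \<in> supp f"
    then have "\<alpha> \<in> arrows G" using supp_arrows[of f] assms by auto
    obtain W where "\<alpha> \<in> W" "openin (arrow_topology G) W" "W \<subseteq> arrows G" "inj_on (rng G) W" "inj_on (src G) W"
      by (rule G.locally_injective[OF \<open>\<alpha> \<in> arrows G\<close> openin_topspace])
    then show "\<alpha> \<in> \<Union>?U" by blast
  qed
  then obtain \<F> where F: "finite \<F>" "\<F> \<subseteq> ?U" "supp f \<subseteq> \<Union>\<F>"
    using compactinD[OF stein_compact[OF assms], of ?U] by auto
  have "fib f y \<subseteq> (\<Union>W\<in>\<F>. {\<alpha>\<in>W. G.ran \<alpha> = y})" using F(3) by (auto simp: fib_def)
  moreover have "finite {\<alpha>\<in>W. G.ran \<alpha> = y}" if "W \<in> \<F>" for W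
  proof -
    have i: "inj_on (rng G) W" using that F(2) by auto
    have "{\<alpha>\<in>W. G.ran \<alpha> = y} \<subseteq> {SOME \<alpha>. \<alpha> \<in> W \<and> G.ran \<alpha> = y}"
    proof
      fix \<alpha> assume a: "\<alpha> \<in> {\<alpha>\<in>W. G.ran \<alpha> = y}"
      then have "(SOME \<alpha>. \<alpha> \<in> W \<and> G.ran \<alpha> = y) \<in> W \<and> G.ran (SOME \<alpha>. \<alpha> \<in> W \<and> G.ran \<alpha> = y) = y"
        by (intro someI[of "\<lambda>\<alpha>. \<alpha> \<in> W \<and> G.ran \<alpha> = y" \<alpha>]) auto
      then show "\<alpha> \<in> {SOME \<alpha>. \<alpha> \<in> W \<and> G.ran \<alpha> = y}" using a inj_onD[OF i] by (metis (mono_tags, lifting) mem_Collect_eq singletonI)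
    qed
    then show ?thesis by (rule finite_subset) simp
  qed
  ultimately show "finite (fib f y)" using F(1) by (meson finite_UN_I finite_subset)
qed

section \<open>Indicators of compact open bisections\<close>

lemma cob_arrows: "compact_open_bisection \<Sigma> Y \<Longrightarrow> Y \<subseteq> arrows \<Sigma>"
  using openin_subset by (auto simp: S.compact_open_bisection_iff)

lemma cob_inj_q: assumes "compact_open_bisection \<Sigma> Y" shows "inj_on q Y"
proof (rule inj_onI)
  fix a b assume ab: "a \<in> Y" "b \<in> Y" "q a = q b"
  then have "a \<in> arrows \<Sigma>" "b \<in> arrows \<Sigma>" using cob_arrows[OF assms] by auto
  then have "S.ran a = S.ran b" using ab composable_eq(2) by simp
  then show "a = b" using assms ab inj_onD unfolding S.compact_open_bisection_iff by metis
qed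

lemma cob_inj: assumes "compact_open_bisection \<Sigma> Y" shows "inj_on (rng G) (q ` Y)" "inj_on (src G) (q ` Y)"
proof -
  show "inj_on (rng G) (q ` Y)"
  proof (rule inj_onI)
    fix a b assume "a \<in> q ` Y" "b \<in> q ` Y" "G.ran a = G.ran b"
    then obtain y z where y: "y \<in> Y" "z \<in> Y" "a = q y" "b = q z" "G.ran (q y) = G.ran (q z)" by auto
    then have "S.ran y = S.ran z" using cob_arrows[OF assms] composable_eq(2)[of y z] by auto
    then have "y = z" using assms y inj_onD unfolding S.compact_open_bisection_iff by metis
    then show "a = b" using y by simp
  qed
  show "inj_on (src G) (q ` Y)"
  proof (rule inj_onI)
    fix a b assume "a \<in> q ` Y" "b \<in> q ` Y" "G.sou a = G.sou b"
    then obtain y z where y: "y \<in> Y" "z \<in> Y" "a = q y" "b = q z" "G.sou (q y) = G.sou (q z)" by auto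
    then have "S.sou y = S.sou z" using cob_arrows[OF assms] composable_eq(3)[of y z] by auto
    then have "y = z" using assms y inj_onD unfolding S.compact_open_bisection_iff by metis
    then show "a = b" using y by simp
  qed
qed

lemma cob_open: "compact_open_bisection \<Sigma> Y \<Longrightarrow> openin (arrow_topology \<Sigma>) Y"
  and cob_compact: "compact_open_bisection \<Sigma> Y \<Longrightarrow> compactin (arrow_topology \<Sigma>) Y"
  by (simp_all add: S.compact_open_bisection_iff)

lemma cob_image: assumes "compact_open_bisection \<Sigma> Y"
  shows "compactin (arrow_topology G) (q ` Y)" "openin (arrow_topology G) (q ` Y)" "closedin (arrow_topology G) (q ` Y)"
proof -
  show "compactin (arrow_topology G) (q ` Y)"
    by (rule image_compactin[OF cob_compact[OF assms] q_continuous])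
  then show "closedin (arrow_topology G) (q ` Y)" by (rule closed_of_compact)
  show "openin (arrow_topology G) (q ` Y)" by (rule open_q_image[OF cob_open[OF assms]])
qed

lemma cob_res:
  assumes "compact_open_bisection \<Sigma> Y" "openin (arrow_topology G) K" "closedin (arrow_topology G) K"
  shows "compact_open_bisection \<Sigma> {y \<in> Y. q y \<in> K}" (is "compact_open_bisection \<Sigma> ?Y")
  unfolding S.compact_open_bisection_iff
proof (intro conjI)
  have e: "?Y = {\<sigma> \<in> arrows \<Sigma>. q \<sigma> \<in> K} \<inter> Y" using cob_arrows[OF assms(1)] by auto
  show "compactin (arrow_topology \<Sigma>) ?Y" unfolding e
    by (rule closed_Int_compactin[OF closedin_continuous_map_preimage[OF q_continuous assms(3)] cob_compact[OF assms(1)]])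
  show "openin (arrow_topology \<Sigma>) ?Y" unfolding e
    by (rule openin_Int[OF openin_continuous_map_preimage[OF q_continuous assms(2)] cob_open[OF assms(1)]])
  show "inj_on (rng \<Sigma>) ?Y" "inj_on (src \<Sigma>) ?Y"
    using assms(1) unfolding S.compact_open_bisection_iff by (auto intro: inj_on_subset)
qed

lemma ind_stein [simp]:
  assumes "compact_open_bisection \<Sigma> Y" shows "ind Y \<in> stein"
  using cob_arrows[OF assms] cob_inj_q[OF assms] cob_open[OF assms] cob_image(1)[OF assms]
  by (intro steinI[of "ind Y" Y]) (simp_all add: eqv_ind ind_one supp_ind)

text \<open>By compactness finitely many sets \<open>q(Y)\<close> cover the support, with
  \<open>f\<close> constant on each \<open>Y\<close>. Peeling them off one at a time writes
  \<open>f\<close> as a finite sum of scaled indicators with disjoint supports. The open set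
  \<open>V\<close> confines the bisections: \<open>V = units \<Sigma>\<close> later yields
  idempotents only.\<close>

lemma stein_induct:
  assumes f: "f \<in> stein" and V: "openin (arrow_topology \<Sigma>) V" "supp f \<subseteq> q ` V"
    and zero: "P (\<lambda>\<sigma>. 0)" and add: "\<And>g h. P g \<Longrightarrow> P h \<Longrightarrow> P (\<lambda>\<sigma>. g \<sigma> + h \<sigma>)"
    and ind: "\<And>c Y. compact_open_bisection \<Sigma> Y \<Longrightarrow> Y \<subseteq> V \<Longrightarrow> P (\<lambda>\<sigma>. c * ind Y \<sigma>)"
  shows "P f"
proof -
  define good where "good K \<longleftrightarrow> compactin (arrow_topology G) K \<and> openin (arrow_topology G) K \<and>
    (\<exists>Y c. compact_open_bisection \<Sigma> Y \<and> Y \<subseteq> V \<and> K = q ` Y \<and> (\<forall>y\<in>Y. f y = c))" for K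
  have goodP: "P (res f (K \<inter> L))" if K: "good K" and L: "openin (arrow_topology G) L" "closedin (arrow_topology G) L" for K L
  proof -
    obtain Y c where Y: "compact_open_bisection \<Sigma> Y" "Y \<subseteq> V" "K = q ` Y" "\<And>y. y\<in>Y \<Longrightarrow> f y = c"
      using K unfolding good_def by blast
    let ?Y = "{y \<in> Y. q y \<in> L}"
    have cY: "compact_open_bisection \<Sigma> ?Y" by (rule cob_res[OF Y(1) L])
    have "res f (K \<inter> L) = (\<lambda>\<sigma>. c * ind ?Y \<sigma>)"
    proof (rule eqv_ext[where Y = ?Y])
      show "eqv (res f (K \<inter> L))" "eqv (\<lambda>\<sigma>. c * ind ?Y \<sigma>)"
        using f eqv_ind[OF cob_arrows[OF cY] cob_inj_q[OF cY]] by simp_all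
      show "supp (res f (K \<inter> L)) \<subseteq> q ` ?Y" using Y(3) by (auto simp: supp_res)
      show "supp (\<lambda>\<sigma>. c * ind ?Y \<sigma>) \<subseteq> q ` ?Y"
        using supp_smult[of c "ind ?Y"] supp_ind[OF cob_arrows[OF cY] cob_inj_q[OF cY]] by simp
      show "?Y \<subseteq> arrows \<Sigma>" by (rule cob_arrows[OF cY])
      show "res f (K \<inter> L) y = c * ind ?Y y" if "y \<in> ?Y" for y
        using ind_one[OF cob_arrows[OF cY] cob_inj_q[OF cY] that] that Y(3,4) by (auto simp: res_def)
    qed
    moreover have "?Y \<subseteq> V" using Y(2) by auto
    ultimately show ?thesis using ind[OF cY] by simp
  qed
  have U: "P (res f (\<Union>\<K> \<inter> L))" if "finite \<K>" "\<And>K. K \<in> \<K> \<Longrightarrow> good K"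
    "openin (arrow_topology G) L" "closedin (arrow_topology G) L" for \<K> L
    using that
  proof (induction \<K> arbitrary: L rule: finite_induct)
    case empty
    have "res f (\<Union>{} \<inter> L) = (\<lambda>\<sigma>. 0)" by (auto simp: res_def)
    then show ?case using zero by simp
  next
    \<comment> \<open>\<open>L\<close> is generalised so that the remaining sets can be cut down to
      \<open>L - K\<close>. This is again clopen, since compact sets are closed in a Hausdorff
      space.\<close>
    case (insert K \<K>)
    have K: "openin (arrow_topology G) K" "closedin (arrow_topology G) K" "good K"
      using insert.prems(1)[of K] closed_of_compact by (auto simp: good_def)
    have "P (res f (K \<inter> L))" by (rule goodP[OF K(3) insert.prems(2,3)])
    moreover have "P (res f (\<Union>\<K> \<inter> (L - K)))"
      by (rule insert.IH) (use insert.prems K in auto)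
    ultimately have "P (\<lambda>\<sigma>. res f (K \<inter> L) \<sigma> + res f (\<Union>\<K> \<inter> (L - K)) \<sigma>)" by (rule add)
    moreover have "(\<lambda>\<sigma>. res f (K \<inter> L) \<sigma> + res f (\<Union>\<K> \<inter> (L - K)) \<sigma>) = res f (\<Union>(insert K \<K>) \<inter> L)"
      by (auto simp: res_def)
    ultimately show ?case by simp
  qed
  have "supp f \<subseteq> \<Union>(Collect good)"
  proof
    fix \<alpha> assume a: "\<alpha> \<in> supp f"
    then obtain \<sigma> where s: "\<sigma> \<in> V" "\<alpha> = q \<sigma>" using V(2) by auto
    have \<sigma>: "\<sigma> \<in> arrows \<Sigma>" using s openin_subset[OF V(1)] by auto
    let ?O = "{\<tau> \<in> arrows \<Sigma>. f \<tau> = f \<sigma>} \<inter> V"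
    have "openin (arrow_topology \<Sigma>) ?O" using stein_level[OF f] V(1) by (rule openin_Int)
    moreover have "\<sigma> \<in> ?O" using s \<sigma> by simp
    ultimately obtain Y where Y: "compact_open_bisection \<Sigma> Y" "\<sigma> \<in> Y" "Y \<subseteq> ?O" "compact_open_bisection G (q ` Y)"
      by (rule total_base)
    have "good (q ` Y)" unfolding good_def
      using Y cob_image[OF Y(1)] by (intro conjI exI[of _ Y] exI[of _ "f \<sigma>"]) auto
    then show "\<alpha> \<in> \<Union>(Collect good)" using Y(2) s(2) by auto
  qed
  moreover have "\<And>K. K \<in> Collect good \<Longrightarrow> openin (arrow_topology G) K" by (simp add: good_def)
  ultimately obtain \<F> where F: "finite \<F>" "\<F> \<subseteq> Collect good" "supp f \<subseteq> \<Union>\<F>"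
    using compactinD[OF stein_compact[OF f], of "Collect good"] by auto
  have "res f (\<Union>\<F> \<inter> arrows G) = f"
    using F(3) suppI[of f] supp_arrows[OF stein_eqv[OF f]] by (fastforce simp: res_def)
  moreover have "P (res f (\<Union>\<F> \<inter> arrows G))" using F by (intro U) auto
  ultimately show ?thesis by simp
qed

lemma stein_induct':
  assumes "f \<in> stein" "P (\<lambda>\<sigma>. 0)" "\<And>g h. P g \<Longrightarrow> P h \<Longrightarrow> P (\<lambda>\<sigma>. g \<sigma> + h \<sigma>)"
    "\<And>c Y. compact_open_bisection \<Sigma> Y \<Longrightarrow> P (\<lambda>\<sigma>. c * ind Y \<sigma>)"
  shows "P f"
  using assms supp_arrows[of f] q_surj by (intro stein_induct[of f "arrows \<Sigma>" P]) auto

section \<open>Closure of the algebra under convolution\<close>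

lemma compact_product:
  assumes "compactin (arrow_topology G) K" "compactin (arrow_topology G) L"
  shows "compactin (arrow_topology G) {a \<cdot>\<^bsub>G\<^esub> b |a b. a \<in> K \<and> b \<in> L \<and> G.sou a = G.ran b}"
proof -
  let ?P = "prod_topology (arrow_topology G) (arrow_topology G)"
  have KG: "K \<subseteq> arrows G" "L \<subseteq> arrows G" using assms compactin_subset_topspace by auto
  \<comment> \<open>Composable pairs are closed because the unit space is Hausdorff; they cut a
    compact set out of \<open>K \<times> L\<close>.\<close>
  have "closedin ?P {p \<in> topspace ?P. G.sou (fst p) = G.ran (snd p)}"
  proof (rule closedin_continuous_maps_eq[OF G.Hausdorff_units])
    show "continuous_map ?P (unit_space G) (\<lambda>p. G.sou (fst p))"
      using continuous_map_compose[OF continuous_map_fst G.continuous_sou] by (simp add: o_def)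
    show "continuous_map ?P (unit_space G) (\<lambda>p. G.ran (snd p))"
      using continuous_map_compose[OF continuous_map_snd G.continuous_ran] by (simp add: o_def)
  qed
  moreover have "compactin ?P (K \<times> L)" using assms by (simp add: compactin_Times)
  ultimately have c: "compactin ?P ({p \<in> topspace ?P. G.sou (fst p) = G.ran (snd p)} \<inter> K \<times> L)" (is "compactin ?P ?C")
    by (rule closed_Int_compactin)
  have C: "?C \<subseteq> composable G" using KG by (auto simp: G.composable_iff)
  then have "compactin (subtopology ?P (composable G)) ?C" using c by (simp add: compactin_subtopology)
  then have "compactin (arrow_topology G) ((\<lambda>(a, b). a \<cdot>\<^bsub>G\<^esub> b) ` ?C)"
    by (rule image_compactin[OF _ G.continuous_mul])
  moreover have "(\<lambda>(a, b). a \<cdot>\<^bsub>G\<^esub> b) ` ?C = {a \<cdot>\<^bsub>G\<^esub> b |a b. a \<in> K \<and> b \<in> L \<and> G.sou a = G.ran b}"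
    using KG by (auto simp: image_iff) (metis subsetD)
  ultimately show ?thesis by simp
qed

text \<open>The product equals 1 on the set of products of \<open>Y\<close> and \<open>Z\<close>,
  which is open and has compact image, so \<open>steinI\<close> applies. Bilinearity extends this to
  all elements.\<close>

lemma conv_ind_stein:
  assumes Y: "compact_open_bisection \<Sigma> Y" and Z: "compact_open_bisection \<Sigma> Z"
  shows "conv (ind Y) (ind Z) \<in> stein"
proof (rule steinI)
  let ?YZ = "{a \<cdot> b |a b. a \<in> Y \<and> b \<in> Z \<and> S.sou a = S.ran b}"
  note YS = cob_arrows[OF Y] cob_arrows[OF Z]
  show "eqv (conv (ind Y) (ind Z))" using Y Z by (simp add: eqv_conv)
  show "openin (arrow_topology \<Sigma>) ?YZ" by (rule S.open_product[OF cob_open[OF Y] cob_open[OF Z]])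
  have qYZ: "q ` ?YZ = {a \<cdot>\<^bsub>G\<^esub> b |a b. a \<in> q ` Y \<and> b \<in> q ` Z \<and> G.sou a = G.ran b}" (is "?L = ?R")
  proof (intro equalityI subsetI)
    fix x assume "x \<in> ?L"
    then obtain a b where ab: "a \<in> Y" "b \<in> Z" "S.sou a = S.ran b" "x = q (a \<cdot> b)" by auto
    then have "a \<in> arrows \<Sigma>" "b \<in> arrows \<Sigma>" using YS by auto
    then show "x \<in> ?R" using ab composable_eq(1)[of a b] by auto
  next
    fix x assume "x \<in> ?R"
    then obtain a b where ab: "a \<in> Y" "b \<in> Z" "G.sou (q a) = G.ran (q b)" "x = q a \<cdot>\<^bsub>G\<^esub> q b" by auto
    then have "a \<in> arrows \<Sigma>" "b \<in> arrows \<Sigma>" using YS by auto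
    then have "x = q (a \<cdot> b)" "S.sou a = S.ran b" using ab composable_eq(1)[of a b] by simp_all
    then show "x \<in> ?L" using ab by blast
  qed
  show "compactin (arrow_topology G) (q ` ?YZ)"
    unfolding qYZ by (rule compact_product[OF cob_image(1)[OF Y] cob_image(1)[OF Z]])
  show "supp (conv (ind Y) (ind Z)) \<subseteq> q ` ?YZ"
  proof
    fix \<gamma> assume "\<gamma> \<in> supp (conv (ind Y) (ind Z))"
    then have "\<exists>\<alpha>\<in>supp (ind Y). \<exists>\<beta>\<in>supp (ind Z). G.sou \<alpha> = G.ran \<beta> \<and> \<gamma> = \<alpha> \<cdot>\<^bsub>G\<^esub> \<beta>"
      using Y Z by (intro supp_conv) simp_all
    then show "\<gamma> \<in> q ` ?YZ" unfolding qYZ supp_ind[OF YS(1) cob_inj_q[OF Y]] supp_ind[OF YS(2) cob_inj_q[OF Z]] by blast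
  qed
  fix y assume "y \<in> ?YZ"
  then obtain a b where ab: "a \<in> Y" "b \<in> Z" "S.sou a = S.ran b" "y = a \<cdot> b" by auto
  then have abS: "a \<in> arrows \<Sigma>" "b \<in> arrows \<Sigma>" using YS by auto
  have c: "G.sou (q a) = G.ran (q b)" using ab abS composable_eq(1) by simp
  have "conv (ind Y) (ind Z) y = ind Y a * ind Z (S.inv_of a \<cdot> y)"
  proof (rule conv_single)
    show "fib (ind Y) (G.ran (q y)) \<subseteq> {q a}"
    proof
      fix \<alpha> assume "\<alpha> \<in> fib (ind Y) (G.ran (q y))"
      then have "\<alpha> \<in> q ` Y" "G.ran \<alpha> = G.ran (q a)"
        using ab abS c by (auto simp: fib_def supp_ind[OF YS(1) cob_inj_q[OF Y]])
      then show "\<alpha> \<in> {q a}" using inj_onD[OF cob_inj(1)[OF Y]] ab(1) by blast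
    qed
  qed (use Y Z ab abS c in simp_all)
  also have "\<dots> = 1"
    using ab abS ind_one[OF YS(1) cob_inj_q[OF Y]] ind_one[OF YS(2) cob_inj_q[OF Z]] by simp
  finally show "conv (ind Y) (ind Z) y = 1" .
qed

lemma conv_stein [simp]:
  assumes "f \<in> stein" "g \<in> stein" shows "conv f g \<in> stein"
proof -
  have 1: "conv (ind Y) g \<in> stein" if Y: "compact_open_bisection \<Sigma> Y" for Y
  proof -
    have "g \<in> stein \<and> conv (ind Y) g \<in> stein"
    proof (rule stein_induct'[OF assms(2), where P = "\<lambda>g. g \<in> stein \<and> conv (ind Y) g \<in> stein"])
      show "(\<lambda>\<sigma>. 0) \<in> stein \<and> conv (ind Y) (\<lambda>\<sigma>. 0) \<in> stein"
        using conv_smult_right[of "ind Y" "\<lambda>\<sigma>. 0" 0] Y by simp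
      show "(\<lambda>\<sigma>. g \<sigma> + h \<sigma>) \<in> stein \<and> conv (ind Y) (\<lambda>\<sigma>. g \<sigma> + h \<sigma>) \<in> stein"
        if "g \<in> stein \<and> conv (ind Y) g \<in> stein" "h \<in> stein \<and> conv (ind Y) h \<in> stein" for g h
        using that Y by (simp add: conv_add_right)
      show "(\<lambda>\<sigma>. c * ind Z \<sigma>) \<in> stein \<and> conv (ind Y) (\<lambda>\<sigma>. c * ind Z \<sigma>) \<in> stein" if "compact_open_bisection \<Sigma> Z" for c Z
        using that Y conv_ind_stein by (simp add: conv_smult_right)
    qed
    then show ?thesis by simp
  qed
  have "f \<in> stein \<and> conv f g \<in> stein"
  proof (rule stein_induct'[OF assms(1), where P = "\<lambda>f. f \<in> stein \<and> conv f g \<in> stein"])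
    show "(\<lambda>\<sigma>. 0) \<in> stein \<and> conv (\<lambda>\<sigma>. 0) g \<in> stein"
      using conv_smult_left[of "\<lambda>\<sigma>. 0" g 0] assms by simp
    show "(\<lambda>\<sigma>. f \<sigma> + h \<sigma>) \<in> stein \<and> conv (\<lambda>\<sigma>. f \<sigma> + h \<sigma>) g \<in> stein"
      if "f \<in> stein \<and> conv f g \<in> stein" "h \<in> stein \<and> conv h g \<in> stein" for f h
      using that assms by (simp add: conv_add_left)
    show "(\<lambda>\<sigma>. c * ind Z \<sigma>) \<in> stein \<and> conv (\<lambda>\<sigma>. c * ind Z \<sigma>) g \<in> stein" if "compact_open_bisection \<Sigma> Z" for c Z
      using that 1 assms by (simp add: conv_smult_left)
  qed
  then show ?thesis by simp
qed

text \<open>An equivariant function supported over \<open>q(Y)\<close> is determined by its values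
  on \<open>Y\<close>, so the definite description picks out \<open>ind Y\<close>.\<close>

lemma twisted_indicator_eq:
  assumes Y: "compact_open_bisection \<Sigma> Y" shows "twisted_indicator \<Sigma> i q G Y = ind Y"
  unfolding twisted_indicator_def
proof (rule the_equality)
  note YS = cob_arrows[OF Y]
  show "ind Y \<in> stein \<and> function_support (ind Y) \<subseteq> {act t \<sigma> |t \<sigma>. t \<in> ring_units \<and> \<sigma> \<in> Y} \<and> (\<forall>\<sigma>\<in>Y. ind Y \<sigma> = 1)"
    using ind_nonzero[of Y] Y ind_one[OF YS cob_inj_q[OF Y]] unfolding function_support_def by fastforce
  fix f assume f: "f \<in> stein \<and> function_support f \<subseteq> {act t \<sigma> |t \<sigma>. t \<in> ring_units \<and> \<sigma> \<in> Y} \<and> (\<forall>\<sigma>\<in>Y. f \<sigma> = 1)"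
  show "f = ind Y"
  proof (rule eqv_ext[where Y = Y])
    show "supp f \<subseteq> q ` Y"
    proof
      fix \<alpha> assume "\<alpha> \<in> supp f"
      then obtain t y where "t \<in> ring_units" "y \<in> Y" "\<alpha> = q (act t y)" using f unfolding supp_def by blast
      then show "\<alpha> \<in> q ` Y" using YS by auto
    qed
  qed (use f Y YS ind_one[OF YS cob_inj_q[OF Y]] supp_ind[OF YS cob_inj_q[OF Y]] in simp_all)
qed

end

section \<open>The algebra and its bisection normalisers\<close>

context ample_twist
begin

section \<open>The algebra as a module with multiplication\<close>

abbreviation alg where "alg \<equiv> steinberg_algebra \<Sigma> i q G"
abbreviation dia where "dia \<equiv> steinberg_diagonal \<Sigma> i q G"

lemma alg_simps [simp]:
  "carrier alg = stein" "f \<otimes>\<^bsub>alg\<^esub> g = conv f g" "\<zero>\<^bsub>alg\<^esub> = (\<lambda>\<sigma>. 0)"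
  "f \<oplus>\<^bsub>alg\<^esub> g = (\<lambda>\<sigma>. f \<sigma> + g \<sigma>)" "t \<odot>\<^bsub>alg\<^esub> f = (\<lambda>\<sigma>. t * f \<sigma>)"
  by (simp_all add: steinberg_algebra_def)

lemma dia_iff: "f \<in> dia \<longleftrightarrow> f \<in> stein \<and> diag f"
proof
  assume f: "f \<in> dia"
  then have "f \<in> stein" "function_support f \<subseteq> {\<sigma> \<in> arrows \<Sigma>. q \<sigma> \<in> units G}"
    by (simp_all add: steinberg_diagonal_def)
  then show "f \<in> stein \<and> diag f" by (auto simp: diag_def function_support_def)
next
  assume "f \<in> stein \<and> diag f"
  then show "f \<in> dia" using eqv_arrow by (auto simp: diag_def steinberg_diagonal_def function_support_def)
qed

lemma diaI: "f \<in> stein \<Longrightarrow> diag f \<Longrightarrow> f \<in> dia"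
  by (simp only: dia_iff)

lemma dia_stein [simp]: "f \<in> dia \<Longrightarrow> f \<in> stein" and dia_diag [simp]: "f \<in> dia \<Longrightarrow> diag f"
  by (simp_all only: dia_iff)

lemma abelian_group_alg: "abelian_group alg"
proof (rule abelian_groupI)
  fix f assume f: "f \<in> carrier alg"
  show "\<exists>y\<in>carrier alg. y \<oplus>\<^bsub>alg\<^esub> f = \<zero>\<^bsub>alg\<^esub>"
    using f stein_smult[of f "-1"] by (intro bexI[of _ "\<lambda>\<sigma>. -1 * f \<sigma>"]) auto
qed (auto simp: add.assoc add.commute)

lemma module_alg: "module cring_class_ops alg"
  by (rule moduleI) (auto simp: cring_class abelian_group_alg class_simps carrier_class algebra_simps)

lemma nonunital_algebra_alg: "nonunital_algebra alg"
  unfolding nonunital_algebra_def using module_alg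
  by (simp add: conv_assoc conv_add_left conv_add_right conv_smult_left conv_smult_right)

lemma submodule_algI:
  assumes "H \<subseteq> stein" "(\<lambda>\<sigma>. 0) \<in> H" "\<And>f g. f \<in> H \<Longrightarrow> g \<in> H \<Longrightarrow> (\<lambda>\<sigma>. f \<sigma> + g \<sigma>) \<in> H"
    "\<And>c f. f \<in> H \<Longrightarrow> (\<lambda>\<sigma>. c * f \<sigma>) \<in> H"
  shows "submodule H cring_class_ops alg"
proof (rule module.submoduleI[OF module_alg])
  fix f assume f: "f \<in> H"
  have "\<ominus>\<^bsub>alg\<^esub> f = (\<lambda>\<sigma>. -1 * f \<sigma>)"
  proof (rule abelian_group.minus_equality[OF abelian_group_alg])
    show "f \<in> carrier alg" using f assms(1) by auto
    then show "(\<lambda>\<sigma>. -1 * f \<sigma>) \<in> carrier alg" using stein_smult[of f "-1"] by simp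
  qed simp
  then show "\<ominus>\<^bsub>alg\<^esub> f \<in> H" using assms(4)[OF f, of "-1"] by simp
qed (use assms in simp_all)

lemma submodule_algD:
  assumes "submodule H cring_class_ops alg"
  shows "H \<subseteq> stein" "(\<lambda>\<sigma>. 0) \<in> H" "\<And>f g. f \<in> H \<Longrightarrow> g \<in> H \<Longrightarrow> (\<lambda>\<sigma>. f \<sigma> + g \<sigma>) \<in> H"
    "\<And>c f. f \<in> H \<Longrightarrow> (\<lambda>\<sigma>. c * f \<sigma>) \<in> H"
proof -
  have s: "subgroup H (add_monoid alg)" using assms by (rule submodule.axioms(1))
  show "H \<subseteq> stein" using subgroup.subset[OF s] by simp
  show "(\<lambda>\<sigma>. 0) \<in> H" using subgroup.one_closed[OF s] by simp
  show "(\<lambda>\<sigma>. f \<sigma> + g \<sigma>) \<in> H" if "f \<in> H" "g \<in> H" for f g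
    using subgroup.m_closed[OF s that] by simp
  show "(\<lambda>\<sigma>. c * f \<sigma>) \<in> H" if "f \<in> H" for c f
    using submodule.smult_closed[OF assms _ that, of c] by (simp add: carrier_class)
qed

section \<open>The diagonal subalgebra and its idempotents\<close>

lemma diag_ext:
  assumes "diag f" "diag g" "\<And>x. x \<in> units G \<Longrightarrow> f (i (x, 1)) = g (i (x, 1))" shows "f = g"
proof (rule eqv_ext[where Y = "units \<Sigma>"])
  have *: "supp h \<subseteq> q ` units \<Sigma>" if "diag h" for h
  proof
    fix x assume "x \<in> supp h"
    then have x: "x \<in> units G" using that by (auto simp: diag_def supp_def function_support_def)
    then have "x = q (i (x, 1))" by simp
    then show "x \<in> q ` units \<Sigma>" using i_unit[OF x] by (rule image_eqI)
  qed
  show "supp f \<subseteq> q ` units \<Sigma>" "supp g \<subseteq> q ` units \<Sigma>" using * assms by auto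
  show "f y = g y" if "y \<in> units \<Sigma>" for y
    using unit_total[OF that] assms(3)[of "q y"] by auto
qed (use assms S.units_arrows in auto)

lemma diag_conv:
  assumes "diag f" "diag g" shows "diag (conv f g)" "x \<in> units G \<Longrightarrow> conv f g (i (x, 1)) = f (i (x, 1)) * g (i (x, 1))"
proof -
  show "diag (conv f g)" unfolding diag_def
  proof (intro conjI allI impI)
    show "eqv (conv f g)" using assms by (simp add: eqv_conv)
    fix \<sigma> assume n: "conv f g \<sigma> \<noteq> 0"
    then have "\<sigma> \<in> arrows \<Sigma>" using conv_off by metis
    then have "g \<sigma> \<noteq> 0" using n assms by (simp add: conv_diag_left) (metis mult_zero_right)
    then show "q \<sigma> \<in> units G" using assms by (simp add: diag_def)
  qed
  show "x \<in> units G \<Longrightarrow> conv f g (i (x, 1)) = f (i (x, 1)) * g (i (x, 1))"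
    using assms by (simp add: conv_diag_left)
qed

lemma conv_dia_commute:
  assumes "diag f" "diag g" shows "conv f g = conv g f"
  using assms by (intro diag_ext diag_conv(1)) (simp_all add: diag_conv(2) mult.commute)

lemma diag_closed:
  shows diag_0: "diag (\<lambda>\<sigma>. 0)" and diag_add: "diag f \<Longrightarrow> diag g \<Longrightarrow> diag (\<lambda>\<sigma>. f \<sigma> + g \<sigma>)"
    and diag_smult: "diag f \<Longrightarrow> diag (\<lambda>\<sigma>. c * f \<sigma>)"
proof -
  show "diag (\<lambda>\<sigma>. 0)" by (simp add: diag_def)
  show "diag (\<lambda>\<sigma>. f \<sigma> + g \<sigma>)" if "diag f" "diag g"
  proof -
    have "f \<sigma> + g \<sigma> = 0" if "q \<sigma> \<notin> units G" for \<sigma>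
      using diag_zero[OF \<open>diag f\<close> that] diag_zero[OF \<open>diag g\<close> that] by simp
    then show ?thesis using eqv_add[OF diag_eqv[OF that(1)] diag_eqv[OF that(2)]] unfolding diag_def by blast
  qed
  show "diag (\<lambda>\<sigma>. c * f \<sigma>)" if "diag f"
  proof -
    have "c * f \<sigma> = 0" if "q \<sigma> \<notin> units G" for \<sigma>
      using diag_zero[OF \<open>diag f\<close> that] by simp
    then show ?thesis using eqv_smult[OF diag_eqv[OF that]] unfolding diag_def by blast
  qed
qed

lemma submodule_dia: "submodule dia cring_class_ops alg"
proof (rule submodule_algI)
  show "(\<lambda>\<sigma>. 0) \<in> dia" by (rule diaI[OF stein_zero diag_0])
  show "(\<lambda>\<sigma>. f \<sigma> + g \<sigma>) \<in> dia" if "f \<in> dia" "g \<in> dia" for f g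
    by (rule diaI[OF stein_add[OF dia_stein dia_stein] diag_add[OF dia_diag dia_diag]]) (fact that)+
  show "(\<lambda>\<sigma>. c * f \<sigma>) \<in> dia" if "f \<in> dia" for c f
    by (rule diaI[OF stein_smult[OF dia_stein] diag_smult[OF dia_diag]]) (fact that)+
qed auto

lemma commutative_subalgebra_dia: "commutative_subalgebra alg dia"
  unfolding commutative_subalgebra_def
proof (intro conjI ballI submodule_dia)
  fix a b assume ab: "a \<in> dia" "b \<in> dia"
  show "a \<otimes>\<^bsub>alg\<^esub> b \<in> dia" unfolding alg_simps
    by (rule diaI[OF conv_stein[OF dia_stein dia_stein] diag_conv(1)[OF dia_diag dia_diag]]) (fact ab)+
  show "a \<otimes>\<^bsub>alg\<^esub> b = b \<otimes>\<^bsub>alg\<^esub> a" using ab by (simp add: conv_dia_commute)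
qed

lemma idempotents_iff: "e \<in> idempotents alg dia \<longleftrightarrow> e \<in> dia \<and> (\<forall>x\<in>units G. e (i (x, 1)) * e (i (x, 1)) = e (i (x, 1)))"
proof -
  have "conv e e = e \<longleftrightarrow> (\<forall>x\<in>units G. e (i (x, 1)) * e (i (x, 1)) = e (i (x, 1)))" if "e \<in> dia"
  proof
    assume "conv e e = e"
    then show "\<forall>x\<in>units G. e (i (x, 1)) * e (i (x, 1)) = e (i (x, 1))" using that diag_conv(2)[of e e] by simp
  next
    assume "\<forall>x\<in>units G. e (i (x, 1)) * e (i (x, 1)) = e (i (x, 1))"
    then show "conv e e = e" using that by (intro diag_ext) (simp_all add: diag_conv)
  qed
  then show ?thesis by (auto simp: idempotents_def)
qed

definition ev :: "'g set \<Rightarrow> 's \<Rightarrow> 'r" where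
  "ev V = ind {x \<in> units \<Sigma>. q x \<in> V}"

lemma cob_units:
  assumes "Y \<subseteq> units \<Sigma>" "openin (arrow_topology \<Sigma>) Y" "compactin (arrow_topology \<Sigma>) Y"
  shows "compact_open_bisection \<Sigma> Y"
  unfolding S.compact_open_bisection_iff
proof (intro conjI assms(2,3) inj_onI)
  fix x y assume "x \<in> Y" "y \<in> Y"
  then have "x \<in> units \<Sigma>" "y \<in> units \<Sigma>" using assms(1) by auto
  then show "S.ran x = S.ran y \<Longrightarrow> x = y" "S.sou x = S.sou y \<Longrightarrow> x = y" by simp_all
qed

context
  fixes V assumes V: "openin (arrow_topology G) V" "compactin (arrow_topology G) V" "V \<subseteq> units G"
begin

lemma cob_ev: "compact_open_bisection \<Sigma> {x \<in> units \<Sigma>. q x \<in> V}"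
proof (rule cob_units)
  have e: "{x \<in> units \<Sigma>. q x \<in> V} = units \<Sigma> \<inter> {\<sigma> \<in> arrows \<Sigma>. q \<sigma> \<in> V}" using S.units_arrows by auto
  show "openin (arrow_topology \<Sigma>) {x \<in> units \<Sigma>. q x \<in> V}" unfolding e
    by (rule openin_Int[OF S.open_units openin_continuous_map_preimage[OF q_continuous V(1)]])
  have top: "topspace (unit_space G) = units G" "topspace (unit_space \<Sigma>) = units \<Sigma>"
    using topspace_subtopology_subset[OF G.units_arrows] topspace_subtopology_subset[OF S.units_arrows] by simp_all
  \<comment> \<open>Compactness is carried from \<open>V\<close> up to \<open>\<Sigma>\<close> by
    the inverse of the homeomorphism \<open>q\<close> between unit spaces.\<close>
  obtain j where j: "homeomorphic_maps (unit_space \<Sigma>) (unit_space G) q j"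
    using q_units unfolding homeomorphic_map_maps by (rule exE)
  have "compactin (unit_space G) V" using V by (simp add: compactin_subtopology)
  moreover have "continuous_map (unit_space G) (unit_space \<Sigma>) j" using j by (simp add: homeomorphic_maps_def)
  ultimately have "compactin (unit_space \<Sigma>) (j ` V)" by (rule image_compactin)
  then have "compactin (arrow_topology \<Sigma>) (j ` V)" by (simp add: compactin_subtopology)
  moreover have "j ` V = {x \<in> units \<Sigma>. q x \<in> V}" (is "?L = ?R")
  proof (intro equalityI subsetI)
    fix y assume "y \<in> ?L"
    then obtain x where x: "x \<in> V" "y = j x" by auto
    then have "x \<in> topspace (unit_space G)" using V unfolding top by auto
    then have "q (j x) = x" "j x \<in> topspace (unit_space \<Sigma>)"
      using j continuous_map_funspace[of "unit_space G" "unit_space \<Sigma>" j] unfolding homeomorphic_maps_def by blast+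
    then show "y \<in> ?R" using x unfolding top by simp
  next
    fix y assume y: "y \<in> ?R"
    then have "j (q y) = y" using j unfolding homeomorphic_maps_def top by blast
    then show "y \<in> ?L" using y by (metis (no_types, lifting) image_eqI mem_Collect_eq)
  qed
  ultimately show "compactin (arrow_topology \<Sigma>) {x \<in> units \<Sigma>. q x \<in> V}" by simp
qed auto

lemma ev_val: assumes "x \<in> units G" shows "ev V (i (x, 1)) = (if x \<in> V then 1 else 0)"
proof (cases "x \<in> V")
  case True
  then have "i (x, 1) \<in> {x \<in> units \<Sigma>. q x \<in> V}" using assms by simp
  then show ?thesis using ind_one[OF cob_arrows[OF cob_ev] cob_inj_q[OF cob_ev]] True by (simp add: ev_def)
next
  case False
  have "ev V (i (x, 1)) = 0"
  proof (rule ccontr)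
    assume "ev V (i (x, 1)) \<noteq> 0"
    then obtain t y where ty: "t \<in> ring_units" "y \<in> units \<Sigma>" "q y \<in> V" "i (x, 1) = act t y"
      using ind_nonzero[of "{x \<in> units \<Sigma>. q x \<in> V}" "i (x, 1)"] unfolding ev_def by blast
    have "q (i (x, 1)) = q y" unfolding ty(4) using ty S.unit_arrow by simp
    then show False using ty(3) False assms by simp
  qed
  then show ?thesis using False by simp
qed

lemma ev_dia: "ev V \<in> dia"
  unfolding dia_iff diag_def
proof (intro conjI allI impI)
  show s: "ev V \<in> stein" unfolding ev_def by (rule ind_stein[OF cob_ev])
  show "eqv (ev V)" using s by simp
  fix \<sigma> assume "ev V \<sigma> \<noteq> 0"
  then obtain t y where ty: "t \<in> ring_units" "y \<in> units \<Sigma>" "q y \<in> V" "\<sigma> = act t y"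
    using ind_nonzero[of "{x \<in> units \<Sigma>. q x \<in> V}" \<sigma>] unfolding ev_def by blast
  have "q \<sigma> = q y" unfolding ty(4) using ty S.unit_arrow by simp
  then show "q \<sigma> \<in> units G" using ty V by auto
qed

lemma ev_idempotent: "ev V \<in> idempotents alg dia"
  unfolding idempotents_iff using ev_dia ev_val by simp

lemma ev_ran: "\<sigma> \<in> arrows \<Sigma> \<Longrightarrow> ev V (S.ran \<sigma>) = (if G.ran (q \<sigma>) \<in> V then 1 else 0)"
  and ev_sou: "\<sigma> \<in> arrows \<Sigma> \<Longrightarrow> ev V (S.sou \<sigma>) = (if G.sou (q \<sigma>) \<in> V then 1 else 0)"
  by (simp_all add: ran_eq sou_eq ev_val)

end

text \<open>The ranges and sources of finitely many supports form a compact open set of units, and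
  its indicator acts as an identity from both sides.\<close>

lemma local_units_alg: "local_units alg (idempotents alg dia)"
  unfolding local_units_def
proof (intro allI impI)
  fix F :: "('s \<Rightarrow> 'r) set" assume F: "finite F \<and> F \<subseteq> carrier alg"
  let ?V = "\<Union>f\<in>F. rng G ` supp f \<union> src G ` supp f"
  have Fs: "f \<in> stein" if "f \<in> F" for f using F that by auto
  have V: "openin (arrow_topology G) ?V" "compactin (arrow_topology G) ?V" "?V \<subseteq> units G"
  proof -
    show "openin (arrow_topology G) ?V"
      using Fs by (intro openin_Union) (auto intro!: openin_Un G.open_ran_image G.open_sou_image stein_supp_open)
    show "compactin (arrow_topology G) ?V"
      using F Fs by (intro compactin_Union)
        (auto intro!: compactin_Un image_compactin[OF _ G.continuous_ran'] image_compactin[OF _ G.continuous_sou'] stein_compact)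
    show "?V \<subseteq> units G" using Fs supp_arrows[OF stein_eqv] by fastforce
  qed
  show "\<exists>e\<in>idempotents alg dia. \<forall>a\<in>F. e \<otimes>\<^bsub>alg\<^esub> a = a \<and> a \<otimes>\<^bsub>alg\<^esub> e = a"
  proof (intro bexI[OF _ ev_idempotent[OF V]] ballI conjI)
    fix f assume f: "f \<in> F"
    have *: "G.ran (q \<sigma>) \<in> ?V \<and> G.sou (q \<sigma>) \<in> ?V" if "f \<sigma> \<noteq> 0" for \<sigma>
      using suppI[of f \<sigma>] that f by auto
    have s: "f \<in> stein" by (rule Fs[OF f])
    have d: "diag (ev ?V)" using ev_dia[OF V] by simp
    show "ev ?V \<otimes>\<^bsub>alg\<^esub> f = f"
    proof
      fix \<sigma> show "(ev ?V \<otimes>\<^bsub>alg\<^esub> f) \<sigma> = f \<sigma>"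
      proof (cases "\<sigma> \<in> arrows \<Sigma>")
        case True
        then have "(ev ?V \<otimes>\<^bsub>alg\<^esub> f) \<sigma> = ev ?V (S.ran \<sigma>) * f \<sigma>" using conv_diag_left[OF d] s by simp
        then show ?thesis using ev_ran[OF V True] *[of \<sigma>] by (cases "f \<sigma> = 0") simp_all
      qed (use s eqv_off in \<open>simp add: conv_off\<close>)
    qed
    show "f \<otimes>\<^bsub>alg\<^esub> ev ?V = f"
    proof
      fix \<sigma> show "(f \<otimes>\<^bsub>alg\<^esub> ev ?V) \<sigma> = f \<sigma>"
      proof (cases "\<sigma> \<in> arrows \<Sigma>")
        case True
        then have "(f \<otimes>\<^bsub>alg\<^esub> ev ?V) \<sigma> = f \<sigma> * ev ?V (S.sou \<sigma>)" using conv_diag_right[OF _ _ d] s by simp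
        then show ?thesis using ev_sou[OF V True] *[of \<sigma>] by (cases "f \<sigma> = 0") simp_all
      qed (use s eqv_off in \<open>simp add: conv_off\<close>)
    qed
  qed
qed

text \<open>Apply the hypothesis to a local unit \<open>e\<close> with
  \<open>n e = n\<close>.\<close>

lemma conv_dia_closed:
  assumes n: "n \<in> stein" "k \<in> stein" "\<forall>b\<in>dia. conv (conv n b) k \<in> dia"
  shows "conv n k \<in> dia"
proof -
  obtain e where e: "e \<in> idempotents alg dia" "conv n e = n"
    using local_units_alg n(1) unfolding local_units_def by (metis alg_simps(1,2) empty_subsetI finite.emptyI finite_insert insert_subset insertI1)
  then have "e \<in> dia" by (simp add: idempotents_def)
  then show ?thesis using n(3) e(2) by metis
qed

lemma partner_iff:
  "normaliser_partner alg dia n k \<longleftrightarrow> k \<in> stein \<and> conv (conv k n) k = k \<and> conv (conv n k) n = n \<and>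
    (\<forall>b\<in>dia. conv (conv k b) n \<in> dia \<and> conv (conv n b) k \<in> dia)"
  by (simp add: normaliser_partner_def)

text \<open>This is uniqueness of inverses in an inverse semigroup: the products of \<open>n\<close>
  with its partners are diagonal, so they commute.\<close>

lemma partner_unique:
  assumes n: "n \<in> stein" and k: "normaliser_partner alg dia n k" and k': "normaliser_partner alg dia n k'"
  shows "k = k'"
proof -
  note k = k[unfolded partner_iff] and k' = k'[unfolded partner_iff]
  have kS: "k \<in> stein" "k' \<in> stein" using k k' by auto
  note assoc = conv_assoc[OF stein_eqv stein_rfin stein_eqv stein_rfin stein_eqv]
  have d: "diag (conv k n)" "diag (conv n k)" "diag (conv k' n)" "diag (conv n k')"
    using conv_dia_closed[of k n] conv_dia_closed[of n k] conv_dia_closed[of k' n] conv_dia_closed[of n k'] n k k' by auto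
  have "k = conv (conv k n) k" using k by simp
  also have "\<dots> = conv (conv k (conv (conv n k') n)) k" using k' by simp
  also have "\<dots> = conv (conv (conv k n) (conv k' n)) k" using n kS by (simp add: assoc)
  also have "\<dots> = conv (conv (conv k' n) (conv k n)) k" using conv_dia_commute d by metis
  also have "\<dots> = conv (conv k' n) (conv (conv k n) k)" using n kS by (simp add: assoc)
  also have "\<dots> = conv (conv k' n) k" using k by simp
  finally have 1: "k = conv (conv k' n) k" .
  have "k' = conv (conv k' n) k'" using k' by simp
  also have "\<dots> = conv (conv k' (conv (conv n k) n)) k'" using k by simp
  also have "\<dots> = conv k' (conv (conv n k) (conv n k'))" using n kS by (simp add: assoc)
  also have "\<dots> = conv k' (conv (conv n k') (conv n k))" using conv_dia_commute d by metis
  also have "\<dots> = conv (conv (conv k' n) k') (conv n k)" using n kS by (simp add: assoc)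
  also have "\<dots> = conv k' (conv n k)" using k' by simp
  also have "\<dots> = conv (conv k' n) k" using n kS by (simp add: assoc)
  finally show ?thesis using 1 by simp
qed

section \<open>Normalisers carried by bisections\<close>

definition nbis :: "('s \<Rightarrow> 'r) \<Rightarrow> bool" where
  "nbis n \<longleftrightarrow> n \<in> stein \<and> inj_on (rng G) (supp n) \<and> inj_on (src G) (supp n) \<and>
    (\<forall>\<sigma>. n \<sigma> \<noteq> 0 \<longrightarrow> n \<sigma> \<in> ring_units)"

lemma nbis_stein [simp]: "nbis n \<Longrightarrow> n \<in> stein"
  and nbis_unit: "nbis n \<Longrightarrow> n \<sigma> \<noteq> 0 \<Longrightarrow> n \<sigma> \<in> ring_units"
  by (auto simp: nbis_def)

lemma nbis_ran: assumes "nbis n" "n \<sigma> \<noteq> 0" "n \<tau> \<noteq> 0" "G.ran (q \<sigma>) = G.ran (q \<tau>)" shows "q \<sigma> = q \<tau>"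
  using assms inj_onD[of "rng G" "supp n" "q \<sigma>" "q \<tau>"] suppI[of n] by (simp add: nbis_def)

lemma nbis_sou: assumes "nbis n" "n \<sigma> \<noteq> 0" "n \<tau> \<noteq> 0" "G.sou (q \<sigma>) = G.sou (q \<tau>)" shows "q \<sigma> = q \<tau>"
  using assms inj_onD[of "src G" "supp n" "q \<sigma>" "q \<tau>"] suppI[of n] by (simp add: nbis_def)

lemma nbis_arrow: "nbis n \<Longrightarrow> n \<sigma> \<noteq> 0 \<Longrightarrow> \<sigma> \<in> arrows \<Sigma>"
  using eqv_arrow[of n \<sigma>] by simp

lemma nbisI:
  assumes "n \<in> stein"
    "\<And>\<sigma> \<tau>. n \<sigma> \<noteq> 0 \<Longrightarrow> n \<tau> \<noteq> 0 \<Longrightarrow> G.ran (q \<sigma>) = G.ran (q \<tau>) \<Longrightarrow> q \<sigma> = q \<tau>"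
    "\<And>\<sigma> \<tau>. n \<sigma> \<noteq> 0 \<Longrightarrow> n \<tau> \<noteq> 0 \<Longrightarrow> G.sou (q \<sigma>) = G.sou (q \<tau>) \<Longrightarrow> q \<sigma> = q \<tau>"
    "\<And>\<sigma>. n \<sigma> \<noteq> 0 \<Longrightarrow> n \<sigma> \<in> ring_units"
  shows "nbis n"
  unfolding nbis_def
proof (intro conjI allI impI inj_onI)
  fix a b assume "a \<in> supp n" "b \<in> supp n"
  then obtain \<sigma> \<tau> where "n \<sigma> \<noteq> 0" "a = q \<sigma>" "n \<tau> \<noteq> 0" "b = q \<tau>"
    by (auto simp: supp_def function_support_def)
  then show "G.ran a = G.ran b \<Longrightarrow> a = b" "G.sou a = G.sou b \<Longrightarrow> a = b"
    using assms(2,3)[of \<sigma> \<tau>] by auto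
qed (use assms in auto)

lemma nbis_ind: assumes Y: "compact_open_bisection \<Sigma> Y" shows "nbis (ind Y)"
  unfolding nbis_def
proof (intro conjI allI impI)
  note YS = cob_arrows[OF Y] cob_inj_q[OF Y]
  show "ind Y \<in> stein" using Y by simp
  show "inj_on (rng G) (supp (ind Y))" "inj_on (src G) (supp (ind Y))"
    unfolding supp_ind[OF YS] using cob_inj[OF Y] by auto
  fix \<sigma> assume "ind Y \<sigma> \<noteq> 0"
  then obtain t y where "t \<in> ring_units" "y \<in> Y" "\<sigma> = act t y" using ind_nonzero by blast
  then show "ind Y \<sigma> \<in> ring_units" using ind_act[OF YS] by simp
qed

lemma nbis_smult: assumes "nbis n" "t \<in> ring_units" shows "nbis (\<lambda>\<sigma>. t * n \<sigma>)"
proof (rule nbisI)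
  have nz: "n \<sigma> \<noteq> 0" if "t * n \<sigma> \<noteq> 0" for \<sigma> using that by auto
  show "q \<sigma> = q \<tau>" if "t * n \<sigma> \<noteq> 0" "t * n \<tau> \<noteq> 0" "G.ran (q \<sigma>) = G.ran (q \<tau>)" for \<sigma> \<tau>
    using nbis_ran[OF assms(1)] that nz by blast
  show "q \<sigma> = q \<tau>" if "t * n \<sigma> \<noteq> 0" "t * n \<tau> \<noteq> 0" "G.sou (q \<sigma>) = G.sou (q \<tau>)" for \<sigma> \<tau>
    using nbis_sou[OF assms(1)] that nz by blast
  show "t * n \<sigma> \<in> ring_units" if "t * n \<sigma> \<noteq> 0" for \<sigma>
    using nz[OF that] nbis_unit[OF assms(1)] assms(2) by simp
qed (use assms in simp)

text \<open>Injectivity of the range map on the support leaves one term in the convolution, for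
  which any lift may be used.\<close>

lemma nbis_conv:
  assumes "nbis n" "eqv g" "\<sigma> \<in> arrows \<Sigma>" "n \<tau> \<noteq> 0" "G.ran (q \<tau>) = G.ran (q \<sigma>)"
  shows "conv n g \<sigma> = n \<tau> * g (S.inv_of \<tau> \<cdot> \<sigma>)"
proof (rule conv_single)
  show "fib n (G.ran (q \<sigma>)) \<subseteq> {q \<tau>}"
  proof
    fix \<alpha> assume "\<alpha> \<in> fib n (G.ran (q \<sigma>))"
    then obtain \<rho> where "n \<rho> \<noteq> 0" "\<alpha> = q \<rho>" "G.ran (q \<rho>) = G.ran (q \<sigma>)"
      by (auto simp: fib_def supp_def function_support_def)
    then show "\<alpha> \<in> {q \<tau>}" using nbis_ran[OF assms(1), of \<rho> \<tau>] assms by simp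
  qed
qed (use assms nbis_arrow in auto)

lemma nbis_conv_mul:
  assumes "nbis n" "eqv g" "n \<tau> \<noteq> 0" "\<rho> \<in> arrows \<Sigma>" "G.sou (q \<tau>) = G.ran (q \<rho>)"
  shows "conv n g (\<tau> \<cdot> \<rho>) = n \<tau> * g \<rho>"
proof -
  have t: "\<tau> \<in> arrows \<Sigma>" by (rule nbis_arrow[OF assms(1,3)])
  have "conv n g (\<tau> \<cdot> \<rho>) = n \<tau> * g (S.inv_of \<tau> \<cdot> (\<tau> \<cdot> \<rho>))"
    using assms t by (intro nbis_conv) simp_all
  then show ?thesis using assms t by (simp add: composable_eq)
qed

lemma nbis_conv_nonzero:
  assumes "nbis n" "eqv g" "conv n g \<sigma> \<noteq> 0"
  obtains \<tau> \<rho> where "n \<tau> \<noteq> 0" "g \<rho> \<noteq> 0" "\<tau> \<in> arrows \<Sigma>" "\<rho> \<in> arrows \<Sigma>" "G.sou (q \<tau>) = G.ran (q \<rho>)"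
    "\<sigma> = \<tau> \<cdot> \<rho>" "conv n g \<sigma> = n \<tau> * g \<rho>"
proof -
  have \<sigma>: "\<sigma> \<in> arrows \<Sigma>" using assms(3) conv_off by metis
  have "fib n (G.ran (q \<sigma>)) \<noteq> {}"
  proof
    assume "fib n (G.ran (q \<sigma>)) = {}"
    then have "conv n g \<sigma> = 0" using conv_sum_fib[of n g \<sigma>] assms \<sigma> by simp
    then show False using assms by simp
  qed
  then obtain \<tau> where t: "n \<tau> \<noteq> 0" "G.ran (q \<tau>) = G.ran (q \<sigma>)"
    by (auto simp: fib_def supp_def function_support_def)
  have tS: "\<tau> \<in> arrows \<Sigma>" by (rule nbis_arrow[OF assms(1) t(1)])
  have e: "conv n g \<sigma> = n \<tau> * g (S.inv_of \<tau> \<cdot> \<sigma>)" by (rule nbis_conv[OF assms(1,2) \<sigma> t])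
  have "S.ran \<tau> = S.ran \<sigma>" using t tS \<sigma> composable_eq by simp
  then have "\<sigma> = \<tau> \<cdot> (S.inv_of \<tau> \<cdot> \<sigma>)" using tS \<sigma> by simp
  moreover have "g (S.inv_of \<tau> \<cdot> \<sigma>) \<noteq> 0" using e assms(3) by auto
  ultimately show thesis using that[of \<tau> "S.inv_of \<tau> \<cdot> \<sigma>"] t tS \<sigma> e by simp
qed

lemma nbis_mult: assumes n: "nbis n" and m: "nbis m" shows "nbis (conv n m)"
proof (rule nbisI)
  show "conv n m \<in> stein" using assms by simp
  have em: "eqv m" using m by simp
  fix \<sigma> assume s: "conv n m \<sigma> \<noteq> 0"
  obtain \<tau> \<rho> where 1: "n \<tau> \<noteq> 0" "m \<rho> \<noteq> 0" "\<tau> \<in> arrows \<Sigma>" "\<rho> \<in> arrows \<Sigma>" "G.sou (q \<tau>) = G.ran (q \<rho>)"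
    "\<sigma> = \<tau> \<cdot> \<rho>" "conv n m \<sigma> = n \<tau> * m \<rho>" by (rule nbis_conv_nonzero[OF n em s])
  show "conv n m \<sigma> \<in> ring_units" using 1 nbis_unit n m by simp
  fix \<sigma>' assume s': "conv n m \<sigma>' \<noteq> 0"
  obtain \<tau>' \<rho>' where 2: "n \<tau>' \<noteq> 0" "m \<rho>' \<noteq> 0" "\<tau>' \<in> arrows \<Sigma>" "\<rho>' \<in> arrows \<Sigma>" "G.sou (q \<tau>') = G.ran (q \<rho>')"
    "\<sigma>' = \<tau>' \<cdot> \<rho>'" "conv n m \<sigma>' = n \<tau>' * m \<rho>'" by (rule nbis_conv_nonzero[OF n em s'])
  have e: "q \<sigma> = q \<tau> \<cdot>\<^bsub>G\<^esub> q \<rho>" "q \<sigma>' = q \<tau>' \<cdot>\<^bsub>G\<^esub> q \<rho>'" unfolding 1(6) 2(6) using 1(3-5) 2(3-5) by simp_all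
  { assume "G.ran (q \<sigma>) = G.ran (q \<sigma>')"
    then have "q \<tau> = q \<tau>'" using nbis_ran[OF n 1(1) 2(1)] e 1(3-5) 2(3-5) by simp
    moreover from this have "q \<rho> = q \<rho>'" using nbis_ran[OF m 1(2) 2(2)] 1(5) 2(5) by simp
    ultimately show "q \<sigma> = q \<sigma>'" using e by simp }
  { assume "G.sou (q \<sigma>) = G.sou (q \<sigma>')"
    then have "q \<rho> = q \<rho>'" using nbis_sou[OF m 1(2) 2(2)] e 1(3-5) 2(3-5) by simp
    moreover from this have "q \<tau> = q \<tau>'" using nbis_sou[OF n 1(1) 2(1)] 1(5) 2(5) by simp
    ultimately show "q \<sigma> = q \<sigma>'" using e by simp }
qed

text \<open>An explicit candidate for the partner: values are inverted at inverse arrows. The test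
  for arrows keeps the total function zero off \<open>\<Sigma>\<close>.\<close>

definition dag :: "('s \<Rightarrow> 'r) \<Rightarrow> 's \<Rightarrow> 'r" where
  "dag n \<sigma> = (if \<sigma> \<in> arrows \<Sigma> \<and> n (S.inv_of \<sigma>) \<noteq> 0 then unit_inverse (n (S.inv_of \<sigma>)) else 0)"

lemma dag_nonzero: "nbis n \<Longrightarrow> dag n \<sigma> \<noteq> 0 \<longleftrightarrow> \<sigma> \<in> arrows \<Sigma> \<and> n (S.inv_of \<sigma>) \<noteq> 0"
  using nbis_unit[of n "S.inv_of \<sigma>"] unit_nonzero[of "unit_inverse (n (S.inv_of \<sigma>))"]
  by (auto simp: dag_def)

lemma dag_inv [simp]: "\<sigma> \<in> arrows \<Sigma> \<Longrightarrow> n \<sigma> \<noteq> 0 \<Longrightarrow> dag n (S.inv_of \<sigma>) = unit_inverse (n \<sigma>)"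
  by (simp add: dag_def)

text \<open>Acting on \<open>\<sigma>\<close> with the unit \<open>n \<sigma>\<close> moves it
  within its fibre to an arrow where \<open>n\<close> is 1. So the support is the image of an open
  set on which \<open>n\<close> is 1, the form needed for \<open>steinI\<close>.\<close>

lemma nbis_level: assumes "nbis n" shows "supp n = q ` {\<sigma> \<in> arrows \<Sigma>. n \<sigma> = 1}"
proof (intro equalityI subsetI)
  fix \<alpha> assume "\<alpha> \<in> supp n"
  then obtain \<sigma> where s: "n \<sigma> \<noteq> 0" "\<alpha> = q \<sigma>" by (auto simp: supp_def function_support_def)
  have \<sigma>: "\<sigma> \<in> arrows \<Sigma>" "n \<sigma> \<in> ring_units" using nbis_arrow nbis_unit assms s by auto
  then have "act (n \<sigma>) \<sigma> \<in> {\<sigma> \<in> arrows \<Sigma>. n \<sigma> = 1}" using assms by simp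
  moreover have "\<alpha> = q (act (n \<sigma>) \<sigma>)" using s \<sigma> by simp
  ultimately show "\<alpha> \<in> q ` {\<sigma> \<in> arrows \<Sigma>. n \<sigma> = 1}" by (metis imageI)
next
  fix \<alpha> assume "\<alpha> \<in> q ` {\<sigma> \<in> arrows \<Sigma>. n \<sigma> = 1}"
  then show "\<alpha> \<in> supp n" using suppI[of n] by auto
qed

lemma nbis_dag: assumes n: "nbis n" shows "nbis (dag n)"
proof (rule nbisI)
  let ?Y = "S.inv_of ` {\<sigma> \<in> arrows \<Sigma>. n \<sigma> = 1}"
  show "dag n \<in> stein"
  proof (rule steinI)
    show "eqv (dag n)"
    proof (rule eqvI)
      show "dag n \<sigma> = 0" if "\<sigma> \<notin> arrows \<Sigma>" for \<sigma> using that by (simp add: dag_def)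
      fix t :: 'r and \<sigma> assume t: "t \<in> ring_units" "\<sigma> \<in> arrows \<Sigma>"
      show "dag n (act t \<sigma>) = unit_inverse t * dag n \<sigma>"
      proof (cases "n (S.inv_of \<sigma>) = 0")
        case True then show ?thesis using t n by (simp add: dag_def)
      next
        case False
        then have "n (S.inv_of (act t \<sigma>)) = t * n (S.inv_of \<sigma>)" using t n by simp
        moreover have "n (S.inv_of \<sigma>) \<in> ring_units" by (rule nbis_unit[OF n False])
        moreover from this have "t * n (S.inv_of \<sigma>) \<noteq> 0" using t unit_nonzero[of "t * n (S.inv_of \<sigma>)"] by simp
        ultimately show ?thesis using t False unfolding dag_def by (simp add: unit_inverse_mult del: act_inv)
      qed
    qed
    show "openin (arrow_topology \<Sigma>) ?Y" using S.open_inv[OF stein_level[of n 1]] n by simp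
    show "dag n y = 1" if "y \<in> ?Y" for y using that by auto
    have q: "q ` ?Y = G.inv_of ` supp n" unfolding nbis_level[OF n] image_image by (rule image_cong) auto
    show "compactin (arrow_topology G) (q ` ?Y)" unfolding q
      using image_compactin[OF stein_compact G.continuous_inv] n by simp
    show "supp (dag n) \<subseteq> q ` ?Y"
    proof
      fix \<alpha> assume "\<alpha> \<in> supp (dag n)"
      then obtain \<sigma> where s: "dag n \<sigma> \<noteq> 0" "\<alpha> = q \<sigma>" by (auto simp: supp_def function_support_def)
      then have s': "\<sigma> \<in> arrows \<Sigma>" "n (S.inv_of \<sigma>) \<noteq> 0" using dag_nonzero[OF n] by auto
      then have "G.inv_of \<alpha> \<in> supp n" using suppI[of n, OF s'(2)] s by simp
      moreover have "\<alpha> = G.inv_of (G.inv_of \<alpha>)" using s s' by simp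
      ultimately show "\<alpha> \<in> q ` ?Y" unfolding q by (metis imageI)
    qed
  qed
  fix \<sigma> assume s: "dag n \<sigma> \<noteq> 0"
  then have 1: "\<sigma> \<in> arrows \<Sigma>" "n (S.inv_of \<sigma>) \<noteq> 0" using dag_nonzero[OF n] by auto
  then show "dag n \<sigma> \<in> ring_units" using nbis_unit[OF n] by (simp add: dag_def)
  fix \<tau> assume "dag n \<tau> \<noteq> 0"
  then have 2: "\<tau> \<in> arrows \<Sigma>" "n (S.inv_of \<tau>) \<noteq> 0" using dag_nonzero[OF n] by auto
  have *: "q (S.inv_of \<sigma>) = q (S.inv_of \<tau>) \<Longrightarrow> q \<sigma> = q \<tau>" using 1(1) 2(1) by (metis G.inv_inv q_arrow q_inv)
  { assume "G.ran (q \<sigma>) = G.ran (q \<tau>)"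
    then have "G.sou (q (S.inv_of \<sigma>)) = G.sou (q (S.inv_of \<tau>))" using 1(1) 2(1) by simp
    then show "q \<sigma> = q \<tau>" by (intro * nbis_sou[OF n 1(2) 2(2)]) }
  { assume "G.sou (q \<sigma>) = G.sou (q \<tau>)"
    then have "G.ran (q (S.inv_of \<sigma>)) = G.ran (q (S.inv_of \<tau>))" using 1(1) 2(1) by simp
    then show "q \<sigma> = q \<tau>" by (intro * nbis_ran[OF n 1(2) 2(2)]) }
qed

lemma dag_dag: assumes "nbis n" shows "dag (dag n) = n"
proof
  fix \<sigma>
  show "dag (dag n) \<sigma> = n \<sigma>"
  proof (cases "n \<sigma> = 0")
    case True then show ?thesis using dag_nonzero[OF nbis_dag[OF assms], of \<sigma>] dag_nonzero[OF assms, of "S.inv_of \<sigma>"]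
      by (metis S.inv_inv)
  next
    case False
    then have s: "\<sigma> \<in> arrows \<Sigma>" using nbis_arrow assms by blast
    then have "dag n (S.inv_of \<sigma>) = unit_inverse (n \<sigma>)" "n \<sigma> \<in> ring_units" using False nbis_unit assms by auto
    then show ?thesis using s unit_nonzero[of "unit_inverse (n \<sigma>)"] by (simp add: dag_def[of "dag n"])
  qed
qed

text \<open>A nonzero value comes from arrows \<open>\<rho>\<close> and \<open>\<tau>\<close> such
  that \<open>n\<close> is nonzero at \<open>\<rho>\<close> and at the inverse of
  \<open>\<tau>\<close>, and these two have the same source. Injectivity of the source map on the
  support makes their images in \<open>G\<close> equal, so the product lies over a unit.\<close>

lemma nbis_conj_diag:
  assumes n: "nbis n" and b: "b \<in> dia" shows "conv (conv n b) (dag n) \<in> dia"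
proof -
  have s: "conv (conv n b) (dag n) \<in> stein" using assms nbis_dag by simp
  moreover have "diag (conv (conv n b) (dag n))" unfolding diag_def
  proof (intro conjI allI impI)
    show "eqv (conv (conv n b) (dag n))" using s by simp
    fix \<sigma> assume "conv (conv n b) (dag n) \<sigma> \<noteq> 0"
    then have "q \<sigma> \<in> supp (conv (conv n b) (dag n))" by (rule suppI)
    then have "\<exists>\<alpha>\<in>supp (conv n b). \<exists>\<beta>\<in>supp (dag n). G.sou \<alpha> = G.ran \<beta> \<and> q \<sigma> = \<alpha> \<cdot>\<^bsub>G\<^esub> \<beta>"
      using assms nbis_dag by (intro supp_conv) simp_all
    then obtain \<rho> \<tau> where r: "conv n b \<rho> \<noteq> 0" "dag n \<tau> \<noteq> 0" "G.sou (q \<rho>) = G.ran (q \<tau>)" "q \<sigma> = q \<rho> \<cdot>\<^bsub>G\<^esub> q \<tau>"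
      by (auto simp: supp_def function_support_def)
    have \<rho>: "\<rho> \<in> arrows \<Sigma>" using r(1) conv_off by metis
    then have "n \<rho> \<noteq> 0" using r(1) n b by (auto simp: conv_diag_right)
    moreover have \<tau>: "\<tau> \<in> arrows \<Sigma>" "n (S.inv_of \<tau>) \<noteq> 0" using r dag_nonzero[OF n] by auto
    moreover have "G.sou (q \<rho>) = G.sou (q (S.inv_of \<tau>))" using r(3) \<tau>(1) by simp
    ultimately have "q \<rho> = q (S.inv_of \<tau>)" by (intro nbis_sou[OF n])
    then show "q \<sigma> \<in> units G" using r(4) \<tau> by simp
  qed
  ultimately show ?thesis by (rule diaI)
qed

text \<open>Over the range of an arrow \<open>\<tau>\<close> of the support, the only term is
  \<open>n \<tau>\<close> times its inverse. Thus \<open>n\<close> times its partner is the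
  indicator of the ranges of the support.\<close>

lemma conv_dag: assumes n: "nbis n" and "x \<in> units G"
  shows "conv n (dag n) (i (x, 1)) = (if \<exists>\<tau>. n \<tau> \<noteq> 0 \<and> G.ran (q \<tau>) = x then 1 else 0)"
proof (cases "\<exists>\<tau>. n \<tau> \<noteq> 0 \<and> G.ran (q \<tau>) = x")
  case True
  then obtain \<tau> where t: "n \<tau> \<noteq> 0" "G.ran (q \<tau>) = x" by auto
  have tS: "\<tau> \<in> arrows \<Sigma>" "n \<tau> \<in> ring_units" using nbis_arrow nbis_unit n t by auto
  have "S.ran \<tau> = i (x, 1)" using ran_eq[OF tS(1)] t by simp
  then have "i (x, 1) = \<tau> \<cdot> S.inv_of \<tau>" by simp
  then have "conv n (dag n) (i (x, 1)) = n \<tau> * dag n (S.inv_of \<tau>)"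
    using nbis_conv_mul[OF n _ t(1), of "dag n" "S.inv_of \<tau>"] nbis_dag[OF n] tS by simp
  also have "\<dots> = 1" using tS t by simp
  finally show ?thesis using True by simp
next
  case False
  have "conv n (dag n) (i (x, 1)) = 0"
  proof (rule ccontr)
    assume nz: "conv n (dag n) (i (x, 1)) \<noteq> 0"
    have ed: "eqv (dag n)" using nbis_dag[OF n] by simp
    obtain \<tau> \<rho> where t: "n \<tau> \<noteq> 0" "dag n \<rho> \<noteq> 0" "\<tau> \<in> arrows \<Sigma>" "\<rho> \<in> arrows \<Sigma>" "G.sou (q \<tau>) = G.ran (q \<rho>)"
      "i (x, 1) = \<tau> \<cdot> \<rho>" "conv n (dag n) (i (x, 1)) = n \<tau> * dag n \<rho>" by (rule nbis_conv_nonzero[OF n ed nz])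
    have "S.ran (\<tau> \<cdot> \<rho>) = S.ran \<tau>" using t(3-5) by simp
    then have "S.ran (i (x, 1)) = i (G.ran (q \<tau>), 1)" unfolding t(6) ran_eq[OF t(3)] .
    then have "x = G.ran (q \<tau>)" using t(3) assms(2) by simp
    then show False using False t by auto
  qed
  then show ?thesis using False by simp
qed

lemma conv_dag_dia: "nbis n \<Longrightarrow> conv n (dag n) \<in> dia"
  using conv_dia_closed[of n "dag n"] nbis_conj_diag nbis_dag by simp

lemma conv_conv_dag:
  assumes n: "nbis n" and m: "eqv m" and "\<sigma> \<in> arrows \<Sigma>"
  shows "conv (conv n (dag n)) m \<sigma> = (if \<exists>\<tau>. n \<tau> \<noteq> 0 \<and> G.ran (q \<tau>) = G.ran (q \<sigma>) then m \<sigma> else 0)"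
  unfolding conv_diag_left[OF dia_diag[OF conv_dag_dia[OF n]] m assms(3)] ran_eq[OF assms(3)]
    conv_dag[OF n G.ran_units[OF q_arrow[OF assms(3)]]] by auto

lemma conv_dag_self: assumes "nbis n" shows "conv (conv n (dag n)) n = n"
proof
  fix \<sigma>
  show "conv (conv n (dag n)) n \<sigma> = n \<sigma>"
  proof (cases "\<sigma> \<in> arrows \<Sigma>")
    case True then show ?thesis using conv_conv_dag[OF assms, of n \<sigma>] assms by (auto)
  next
    case False then show ?thesis using eqv_off[of n] assms by (simp add: conv_off)
  qed
qed

lemma nbis_partner: assumes "nbis n" shows "normaliser_partner alg dia n (dag n)"
  unfolding partner_iff
  using conv_dag_self[OF assms] conv_dag_self[OF nbis_dag[OF assms]] nbis_dag[OF assms] dag_dag[OF assms]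
    nbis_conj_diag[OF assms] nbis_conj_diag[OF nbis_dag[OF assms]] by simp

lemma nbis_normaliser: "nbis n \<Longrightarrow> n \<in> normalisers alg dia"
  unfolding normalisers_def using nbis_partner by auto

lemma dagger_eq: assumes "nbis n" shows "dagger alg dia n = dag n"
  unfolding dagger_def
proof (rule the_equality)
  show "normaliser_partner alg dia n (dag n)" by (rule nbis_partner[OF assms])
  show "k = dag n" if "normaliser_partner alg dia n k" for k
    by (rule partner_unique[OF nbis_stein[OF assms] that nbis_partner[OF assms]])
qed

text \<open>Multiplication by \<open>n\<close> and its partner restricts \<open>m\<close> to the
  ranges of the support of \<open>n\<close>, so the order asks \<open>m\<close> to agree with
  \<open>n\<close> there, zeros included. Extra nonzero values of \<open>m\<close> over such a range
  are excluded by injectivity of the range map on the support of \<open>m\<close>.\<close>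

lemma nbis_le_iff: assumes n: "nbis n" and m: "nbis m"
  shows "normaliser_le alg dia n m \<longleftrightarrow> (\<forall>\<sigma>. n \<sigma> \<noteq> 0 \<longrightarrow> m \<sigma> = n \<sigma>)"
proof -
  have em: "eqv m" using m by simp
  have "normaliser_le alg dia n m \<longleftrightarrow> n = conv (conv n (dag n)) m"
    unfolding normaliser_le_def using dagger_eq[OF n] by simp
  also have "\<dots> \<longleftrightarrow> (\<forall>\<sigma>. n \<sigma> \<noteq> 0 \<longrightarrow> m \<sigma> = n \<sigma>)"
  proof
    assume e: "n = conv (conv n (dag n)) m"
    show "\<forall>\<sigma>. n \<sigma> \<noteq> 0 \<longrightarrow> m \<sigma> = n \<sigma>"
    proof (intro allI impI)
      fix \<sigma> assume s: "n \<sigma> \<noteq> 0"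
      have "n \<sigma> = conv (conv n (dag n)) m \<sigma>" using fun_cong[OF e] .
      also have "\<dots> = m \<sigma>" using conv_conv_dag[OF n em nbis_arrow[OF n s]] s by auto
      finally show "m \<sigma> = n \<sigma>" by simp
    qed
  next
    assume r: "\<forall>\<sigma>. n \<sigma> \<noteq> 0 \<longrightarrow> m \<sigma> = n \<sigma>"
    show "n = conv (conv n (dag n)) m"
    proof
      fix \<sigma>
      show "n \<sigma> = conv (conv n (dag n)) m \<sigma>"
      proof (cases "\<sigma> \<in> arrows \<Sigma>")
        case False then show ?thesis using eqv_off[of n] n by (simp add: conv_off)
      next
        case \<sigma>: True
        note c = conv_conv_dag[OF n em \<sigma>]
        show ?thesis
        proof (cases "\<exists>\<tau>. n \<tau> \<noteq> 0 \<and> G.ran (q \<tau>) = G.ran (q \<sigma>)")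
          case False
          then have "n \<sigma> = 0" by auto
          then show ?thesis using c False by simp
        next
          case True
          then obtain \<tau> where t: "n \<tau> \<noteq> 0" "G.ran (q \<tau>) = G.ran (q \<sigma>)" by auto
          have "n \<sigma> = m \<sigma>"
          proof (cases "m \<sigma> = 0")
            case True then show ?thesis using r by metis
          next
            case False
            have "m \<tau> \<noteq> 0" using r t by metis
            then have "q \<tau> = q \<sigma>" using nbis_ran[OF m _ False] t by simp
            then have "q \<sigma> \<in> supp n" using suppI[of n \<tau>] t by simp
            then have "n \<sigma> \<noteq> 0" using supp_iff[of n \<sigma>] n \<sigma> by simp
            then show ?thesis using r by simp
          qed
          then show ?thesis using c True by simp
        qed
      qed
    qed
  qed
  finally show ?thesis .
qed

text \<open>A diagonal element is decomposed with all bisections inside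
  \<open>units \<Sigma>\<close>; the indicator of such a bisection takes only the values 0 and 1 on
  units, so it is idempotent.\<close>

lemma dia_eq_span: "dia = module_span alg (idempotents alg dia)"
proof (intro equalityI subsetI)
  fix f assume f: "f \<in> dia"
  show "f \<in> module_span alg (idempotents alg dia)"
    unfolding module_span_def
  proof (intro InterI, clarify)
    fix H assume H: "submodule H cring_class_ops alg" "idempotents alg dia \<subseteq> H"
    note HD = submodule_algD[OF H(1)]
    show "f \<in> H"
    proof (rule stein_induct[of f "units \<Sigma>" "\<lambda>f. f \<in> H"])
      show "f \<in> stein" using f by simp
      show "openin (arrow_topology \<Sigma>) (units \<Sigma>)" by (rule S.open_units)
      show "supp f \<subseteq> q ` units \<Sigma>"
      proof
        fix x assume "x \<in> supp f"
        then have x: "x \<in> units G" using dia_diag[OF f] by (auto simp: diag_def supp_def function_support_def)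
        then have "x = q (i (x, 1))" by simp
        then show "x \<in> q ` units \<Sigma>" using i_unit[OF x] by (rule image_eqI)
      qed
      fix c Y assume Y: "compact_open_bisection \<Sigma> Y" "Y \<subseteq> units \<Sigma>"
      note YS = cob_arrows[OF Y(1)] cob_inj_q[OF Y(1)]
      have "diag (ind Y)" unfolding diag_def
      proof (intro conjI allI impI)
        show "eqv (ind Y)" by (rule eqv_ind[OF YS])
        fix \<sigma> assume "ind Y \<sigma> \<noteq> 0"
        then obtain t y where t: "t \<in> ring_units" "y \<in> Y" "\<sigma> = act t y" using ind_nonzero by blast
        then have "y \<in> units \<Sigma>" "y \<in> arrows \<Sigma>" using YS(1) Y(2) by auto
        then show "q \<sigma> \<in> units G" using unit_total[of y] t by simp
      qed
      then have d: "ind Y \<in> dia" by (rule diaI[OF ind_stein[OF Y(1)]])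
      have "ind Y (i (x, 1)) * ind Y (i (x, 1)) = ind Y (i (x, 1))" if x: "x \<in> units G" for x
      proof (cases "ind Y (i (x, 1)) = 0")
        case False
        then obtain t y where t: "t \<in> ring_units" "y \<in> Y" "i (x, 1) = act t y" using ind_nonzero by blast
        have "S.ran (i (x, 1)) = S.ran y" unfolding t(3) using t YS by auto
        then have "i (x, 1) = y" using x t(2) Y(2) by auto
        then show ?thesis using ind_one[OF YS t(2)] by simp
      qed simp
      then have "ind Y \<in> H" using d H(2) idempotents_iff by blast
      then show "(\<lambda>\<sigma>. c * ind Y \<sigma>) \<in> H" by (rule HD(4))
    qed (use HD in auto)
  qed
next
  fix f assume "f \<in> module_span alg (idempotents alg dia)"
  moreover have "idempotents alg dia \<subseteq> dia" by (auto simp: idempotents_def)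
  ultimately show "f \<in> dia" using submodule_dia unfolding module_span_def by blast
qed

text \<open>Scaled indicators of compact open bisections build every element, and each such
  indicator is a normaliser.\<close>

lemma alg_eq_span: "carrier alg = module_span alg (normalisers alg dia)"
proof (intro equalityI subsetI)
  fix f assume f: "f \<in> carrier alg"
  show "f \<in> module_span alg (normalisers alg dia)"
    unfolding module_span_def
  proof (intro InterI, clarify)
    fix H assume H: "submodule H cring_class_ops alg" "normalisers alg dia \<subseteq> H"
    note HD = submodule_algD[OF H(1)]
    show "f \<in> H"
    proof (rule stein_induct'[of f "\<lambda>f. f \<in> H"])
      show "(\<lambda>\<sigma>. c * ind Y \<sigma>) \<in> H" if "compact_open_bisection \<Sigma> Y" for c Y
        using HD(4) H(2) nbis_normaliser[OF nbis_ind[OF that]] by blast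
    qed (use HD f in auto)
  qed
next
  fix f assume "f \<in> module_span alg (normalisers alg dia)"
  moreover have "submodule stein cring_class_ops alg" by (rule submodule_algI) auto
  moreover have "normalisers alg dia \<subseteq> stein" by (auto simp: normalisers_def)
  ultimately show "f \<in> carrier alg" unfolding module_span_def by auto
qed

section \<open>The expectation given by restriction to the units\<close>

lemma units_clopen: "openin (arrow_topology G) (units G)" "closedin (arrow_topology G) (units G)"
proof -
  show "openin (arrow_topology G) (units G)" by (rule G.open_units)
  have "closedin (arrow_topology G) {a \<in> arrows G. G.ran a = a}"
    by (rule closedin_continuous_maps_eq[OF Hausdorff G.continuous_ran']) simp
  moreover have "{a \<in> arrows G. G.ran a = a} = units G" using G.unit_iff by auto
  ultimately show "closedin (arrow_topology G) (units G)" by simp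
qed

lemma res_units_dia: "f \<in> stein \<Longrightarrow> res f (units G) \<in> dia"
  using stein_res[OF _ units_clopen] by (intro diaI) (auto simp: diag_def res_def)

lemma res_units_expectation: "conditional_expectation alg dia (\<lambda>f. res f (units G))"
  unfolding conditional_expectation_def
proof (intro conjI ballI allI)
  show "(\<lambda>f. res f (units G)) \<in> carrier alg \<rightarrow> dia" using res_units_dia by simp
  show "res b (units G) = b" if "b \<in> dia" for b
    using diag_zero[OF dia_diag[OF that]] by (auto simp: res_def fun_eq_iff)
  fix b b' f assume b: "b \<in> dia" "b' \<in> dia" and f: "f \<in> carrier alg"
  have d: "diag b" "diag b'" "diag (res f (units G))" "f \<in> stein" using b f res_units_dia by auto
  have *: "res (conv (conv b f) b') (units G) \<sigma> = conv (conv b (res f (units G))) b' \<sigma>" for \<sigma>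
  proof (cases "\<sigma> \<in> arrows \<Sigma>")
    case True
    have *: "conv (conv b g) b' \<sigma> = b (S.ran \<sigma>) * g \<sigma> * b' (S.sou \<sigma>)" if "g \<in> stein" for g
      using that d b True by (simp add: conv_diag_right conv_diag_left)
    show ?thesis using *[of f] *[of "res f (units G)"] d f res_units_dia[of f] by (simp add: res_def)
  qed (simp add: res_def conv_off)
  show "res (b \<otimes>\<^bsub>alg\<^esub> f \<otimes>\<^bsub>alg\<^esub> b') (units G) = b \<otimes>\<^bsub>alg\<^esub> res f (units G) \<otimes>\<^bsub>alg\<^esub> b'"
    unfolding alg_simps by (rule ext) (rule *)
qed (auto simp: res_def)

text \<open>If \<open>f\<close> is nonzero at \<open>\<sigma>\<close>, the indicator of a bisection
  through the inverse of \<open>\<sigma>\<close> shifts this value to the unit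
  \<open>S.sou \<sigma>\<close>, where the restriction sees it.\<close>

lemma res_units_faithful: "faithful_expectation alg dia (\<lambda>f. res f (units G))"
  unfolding faithful_expectation_def
proof (intro ballI impI)
  fix f assume f: "f \<in> carrier alg" "f \<noteq> \<zero>\<^bsub>alg\<^esub>"
  then obtain \<sigma> where s: "f \<sigma> \<noteq> 0" by (auto simp: fun_eq_iff)
  have \<sigma>: "\<sigma> \<in> arrows \<Sigma>" using f s eqv_arrow[of f \<sigma>] by simp
  obtain Y where Y: "compact_open_bisection \<Sigma> Y" "S.inv_of \<sigma> \<in> Y" "Y \<subseteq> arrows \<Sigma>" "compact_open_bisection G (q ` Y)"
    by (rule total_base[OF openin_topspace S.inv_closed[OF \<sigma>]])
  have n: "nbis (ind Y)" "ind Y (S.inv_of \<sigma>) = 1"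
    using nbis_ind[OF Y(1)] ind_one[OF cob_arrows[OF Y(1)] cob_inj_q[OF Y(1)] Y(2)] by auto
  have "conv (ind Y) f (S.inv_of \<sigma> \<cdot> \<sigma>) = ind Y (S.inv_of \<sigma>) * f \<sigma>"
    using n f \<sigma> by (intro nbis_conv_mul) simp_all
  then have "conv (ind Y) f (S.sou \<sigma>) = f \<sigma>" using n by simp
  then have "res (conv (ind Y) f) (units G) (S.sou \<sigma>) \<noteq> 0" using s \<sigma> by (simp add: res_def)
  then have "res (ind Y \<otimes>\<^bsub>alg\<^esub> f) (units G) \<noteq> \<zero>\<^bsub>alg\<^esub>" by (auto simp: fun_eq_iff)
  then show "\<exists>n\<in>normalisers alg dia. res (n \<otimes>\<^bsub>alg\<^esub> f) (units G) \<noteq> \<zero>\<^bsub>alg\<^esub>"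
    using nbis_normaliser[OF n(1)] by blast
qed

text \<open>The idempotent is the indicator of the units in the support of \<open>n\<close>. An
  arrow of the support whose range or source is such a unit must be that unit, so multiplication
  from either side is restriction to the units.\<close>

lemma res_units_implemented:
  assumes n: "nbis n"
  shows "\<exists>e \<in> idempotents alg dia. res n (units G) = n \<otimes>\<^bsub>alg\<^esub> e \<and> n \<otimes>\<^bsub>alg\<^esub> e = e \<otimes>\<^bsub>alg\<^esub> n"
proof -
  let ?V = "supp n \<inter> units G"
  have V: "openin (arrow_topology G) ?V" "compactin (arrow_topology G) ?V" "?V \<subseteq> units G"
    using openin_Int[OF stein_supp_open[OF nbis_stein[OF n]] units_clopen(1)]
      closed_Int_compactin[OF units_clopen(2) stein_compact[OF nbis_stein[OF n]]]
    by (simp_all add: Int_commute)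
  have d: "diag (ev ?V)" using ev_dia[OF V] by simp
  have 0: "q \<sigma> \<in> units G" if "n \<sigma> \<noteq> 0" "G.ran (q \<sigma>) \<in> ?V \<or> G.sou (q \<sigma>) \<in> ?V" for \<sigma>
  proof -
    have \<sigma>: "\<sigma> \<in> arrows \<Sigma>" by (rule nbis_arrow[OF n that(1)])
    from that(2) consider "G.ran (q \<sigma>) \<in> ?V" | "G.sou (q \<sigma>) \<in> ?V" by blast
    then show ?thesis
    proof cases
      case 1
      then obtain \<tau> where "n \<tau> \<noteq> 0" "q \<tau> = G.ran (q \<sigma>)" by (auto simp: supp_def function_support_def)
      then have "q \<sigma> = q \<tau>" using nbis_ran[OF n that(1), of \<tau>] \<sigma> by simp
      moreover have "q \<tau> \<in> units G" using \<open>q \<tau> = G.ran (q \<sigma>)\<close> \<sigma> by simp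
      ultimately show ?thesis by (simp only:)
    next
      case 2
      then obtain \<tau> where "n \<tau> \<noteq> 0" "q \<tau> = G.sou (q \<sigma>)" by (auto simp: supp_def function_support_def)
      then have "q \<sigma> = q \<tau>" using nbis_sou[OF n that(1), of \<tau>] \<sigma> by simp
      moreover have "q \<tau> \<in> units G" using \<open>q \<tau> = G.sou (q \<sigma>)\<close> \<sigma> by simp
      ultimately show ?thesis by (simp only:)
    qed
  qed
  have V': "q \<sigma> \<in> ?V" if "n \<sigma> \<noteq> 0" "q \<sigma> \<in> units G" for \<sigma> using that suppI[of n \<sigma>] by auto
  have "res n (units G) \<sigma> = conv n (ev ?V) \<sigma> \<and> conv n (ev ?V) \<sigma> = conv (ev ?V) n \<sigma>" for \<sigma>
  proof (cases "n \<sigma> = 0")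
    case True then show ?thesis
      using n d by (cases "\<sigma> \<in> arrows \<Sigma>") (simp_all add: res_def conv_off conv_diag_left conv_diag_right)
  next
    case False
    have \<sigma>: "\<sigma> \<in> arrows \<Sigma>" by (rule nbis_arrow[OF n False])
    have e: "conv n (ev ?V) \<sigma> = n \<sigma> * (if G.sou (q \<sigma>) \<in> ?V then 1 else 0)"
      "conv (ev ?V) n \<sigma> = (if G.ran (q \<sigma>) \<in> ?V then 1 else 0) * n \<sigma>"
      using n d \<sigma> ev_ran[OF V \<sigma>] ev_sou[OF V \<sigma>] by (simp_all add: conv_diag_left conv_diag_right)
    have "G.ran (q \<sigma>) \<in> ?V \<longleftrightarrow> q \<sigma> \<in> units G"
      using 0[OF False] V'[OF False] G.unit_simps(1)[of "q \<sigma>"] by metis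
    moreover have "G.sou (q \<sigma>) \<in> ?V \<longleftrightarrow> q \<sigma> \<in> units G"
      using 0[OF False] V'[OF False] G.unit_simps(2)[of "q \<sigma>"] by metis
    ultimately show ?thesis unfolding e res_def by simp
  qed
  then show ?thesis using ev_idempotent[OF V] by (intro bexI[of _ "ev ?V"]) (auto simp: fun_eq_iff)
qed

text \<open>A nonzero idempotent is nonzero at some unit, and by indecomposability its value there
  is 1.\<close>

lemma torsion_free_idempotents:
  assumes ind: "indecomposable_ring TYPE('r)"
    and e: "e \<in> idempotents alg dia - {\<zero>\<^bsub>alg\<^esub>}" "t \<odot>\<^bsub>alg\<^esub> e = \<zero>\<^bsub>alg\<^esub>"
  shows "t = 0"
proof -
  have "\<exists>x\<in>units G. e (i (x, 1)) \<noteq> 0"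
  proof (rule ccontr)
    assume "\<not> ?thesis"
    then have "e = (\<lambda>\<sigma>. 0)" using e(1) by (intro diag_ext diag_0) (auto simp: idempotents_iff)
    then show False using e(1) by simp
  qed
  then obtain x where x: "x \<in> units G" "e (i (x, 1)) \<noteq> 0" by blast
  then have "e (i (x, 1)) * e (i (x, 1)) = e (i (x, 1))" using e(1) by (simp add: idempotents_iff)
  then have "e (i (x, 1)) = 1" using ind[unfolded indecomposable_ring_def, rule_format] x(2) by blast
  then show ?thesis using fun_cong[of "\<lambda>\<sigma>. t * e \<sigma>" "\<lambda>\<sigma>. 0" "i (x, 1)"] e(2) by simp
qed

lemma quasi_cartan_pair_alg:
  assumes "indecomposable_ring TYPE('r)" "\<And>n. n \<in> normalisers alg dia \<Longrightarrow> nbis n"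
  shows "quasi_cartan_pair alg dia"
  unfolding quasi_cartan_pair_def
proof (intro conjI allI ballI impI)
  show "\<exists>P. conditional_expectation alg dia P \<and> faithful_expectation alg dia P \<and> implemented_by_idempotents alg dia P"
    using res_units_expectation res_units_faithful res_units_implemented assms(2)
    unfolding implemented_by_idempotents_def by blast
qed (use nonunital_algebra_alg commutative_subalgebra_dia local_units_alg dia_eq_span alg_eq_span
    torsion_free_idempotents[OF assms(1)] in auto)

end

section \<open>Normalisers are supported on bisections\<close>

context ample_twist
begin

section \<open>Isotropy groups and indicators of single units\<close>

abbreviation iso_interior where "iso_interior \<equiv> arrow_topology G interior_of isotropy G"

lemma iso_interior_isotropy: "a \<in> iso_interior \<Longrightarrow> a \<in> arrows G \<and> G.ran a = G.sou a"
  using interior_of_subset[of "arrow_topology G" "isotropy G"] by (auto simp: isotropy_def)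

lemma iso_interiorI:
  assumes "openin (arrow_topology G) U" "\<And>a. a \<in> U \<Longrightarrow> G.ran a = G.sou a" "a \<in> U"
  shows "a \<in> iso_interior"
proof -
  have "U \<subseteq> isotropy G" using assms(2) openin_subset[OF assms(1)] by (auto simp: isotropy_def)
  then show ?thesis using interior_of_maximal[OF _ assms(1)] assms(3) by blast
qed

text \<open>Inverses and products of open sets are open, and those of isotropy arrows are isotropy,
  so the interior of the isotropy is closed under both operations.\<close>

lemma group_interior_isotropy:
  assumes x: "x \<in> units G"
  shows "group (interior_isotropy_group G x)"
    and "h \<in> carrier (interior_isotropy_group G x) \<Longrightarrow> m_inv (interior_isotropy_group G x) h = G.inv_of h"
proof -
  let ?H = "interior_isotropy_group G x"
  have car: "a \<in> carrier ?H \<longleftrightarrow> a \<in> iso_interior \<and> G.sou a = x" for a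
    by (simp add: interior_isotropy_group_def)
  have H: "a \<in> arrows G \<and> G.ran a = x \<and> G.sou a = x" if "a \<in> carrier ?H" for a
    using that iso_interior_isotropy[of a] unfolding car by auto
  have mult: "a \<otimes>\<^bsub>?H\<^esub> b = a \<cdot>\<^bsub>G\<^esub> b" "\<one>\<^bsub>?H\<^esub> = x" for a b by (simp_all add: interior_isotropy_group_def)
  have o: "openin (arrow_topology G) iso_interior" by (rule openin_interior_of)
  have inv: "G.inv_of a \<in> carrier ?H" if a: "a \<in> carrier ?H" for a
  proof -
    have "G.inv_of a \<in> iso_interior"
    proof (rule iso_interiorI[OF G.open_inv[OF o]])
      show "G.ran b = G.sou b" if "b \<in> G.inv_of ` iso_interior" for b
        using that iso_interior_isotropy by auto
      show "G.inv_of a \<in> G.inv_of ` iso_interior" using a car by auto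
    qed
    then show ?thesis using H[OF a] by (simp add: car)
  qed
  show g: "group ?H"
  proof (rule groupI)
    fix a b assume ab: "a \<in> carrier ?H" "b \<in> carrier ?H"
    have "a \<cdot>\<^bsub>G\<^esub> b \<in> iso_interior"
    proof (rule iso_interiorI[OF G.open_product[OF o o]])
      fix d assume "d \<in> {a \<cdot>\<^bsub>G\<^esub> b |a b. a \<in> iso_interior \<and> b \<in> iso_interior \<and> G.sou a = G.ran b}"
      then obtain a b where d: "d = a \<cdot>\<^bsub>G\<^esub> b" "a \<in> iso_interior" "b \<in> iso_interior" "G.sou a = G.ran b" by auto
      then show "G.ran d = G.sou d" using iso_interior_isotropy[OF d(2)] iso_interior_isotropy[OF d(3)] by simp
    next
      show "a \<cdot>\<^bsub>G\<^esub> b \<in> {a \<cdot>\<^bsub>G\<^esub> b |a b. a \<in> iso_interior \<and> b \<in> iso_interior \<and> G.sou a = G.ran b}"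
        using ab H[OF ab(1)] H[OF ab(2)] by (intro CollectI exI[of _ a] exI[of _ b]) (simp add: car)
    qed
    then show "a \<otimes>\<^bsub>?H\<^esub> b \<in> carrier ?H" using H[OF ab(1)] H[OF ab(2)] by (simp add: car mult)
    fix c assume c: "c \<in> carrier ?H"
    show "a \<otimes>\<^bsub>?H\<^esub> b \<otimes>\<^bsub>?H\<^esub> c = a \<otimes>\<^bsub>?H\<^esub> (b \<otimes>\<^bsub>?H\<^esub> c)"
      using H[OF ab(1)] H[OF ab(2)] H[OF c] by (simp add: mult G.mul_assoc)
  next
    have "x \<in> iso_interior" by (rule iso_interiorI[OF G.open_units _ x]) simp
    then show "\<one>\<^bsub>?H\<^esub> \<in> carrier ?H" using x by (simp add: car mult)
  next
    fix a assume a: "a \<in> carrier ?H"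
    show "\<one>\<^bsub>?H\<^esub> \<otimes>\<^bsub>?H\<^esub> a = a" using H[OF a] by (simp add: mult)
    show "\<exists>b\<in>carrier ?H. b \<otimes>\<^bsub>?H\<^esub> a = \<one>\<^bsub>?H\<^esub>"
      using H[OF a] by (intro bexI[OF _ inv[OF a]]) (simp add: mult)
  qed
  show "m_inv ?H h = G.inv_of h" if h: "h \<in> carrier ?H"
    using H[OF h] by (intro group.inv_equality[OF g _ h inv[OF h]]) (simp add: mult)
qed

text \<open>A convolution at \<open>\<sigma>\<close> sees its left factor on one range fibre only.
  This allows \<open>del x\<close> to be exchanged for the indicator of an open set, one arrow at a
  time.\<close>

lemma conv_cong:
  assumes "eqv f" "rfin f" "eqv f'" "rfin f'" "eqv g" "\<sigma> \<in> arrows \<Sigma>"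
    "\<And>\<tau>. \<tau> \<in> arrows \<Sigma> \<Longrightarrow> G.ran (q \<tau>) = G.ran (q \<sigma>) \<Longrightarrow> f \<tau> = f' \<tau>"
  shows "conv f g \<sigma> = conv f' g \<sigma>"
proof -
  have "\<alpha> \<in> supp f \<longleftrightarrow> \<alpha> \<in> supp f'" if "\<alpha> \<in> arrows G" "G.ran \<alpha> = G.ran (q \<sigma>)" for \<alpha>
    using supp_sec[OF assms(1) that(1)] supp_sec[OF assms(3) that(1)] assms(7)[of "sec \<alpha>"] that by simp
  then have "fib f (G.ran (q \<sigma>)) = fib f' (G.ran (q \<sigma>))"
    using supp_arrows[OF assms(1)] supp_arrows[OF assms(3)] unfolding fib_def by blast
  moreover have "f (sec \<alpha>) = f' (sec \<alpha>)" if "\<alpha> \<in> fib f' (G.ran (q \<sigma>))" for \<alpha>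
    using fib_arrows[OF assms(3) that] assms(7)[of "sec \<alpha>"] by simp
  ultimately show ?thesis using assms(1-6) by (simp add: conv_sum_fib)
qed

text \<open>The function written \<open>\<delta>_x\<close> in the overview. It is equivariant and
  finite on range fibres, but locally constant only if \<open>x\<close> is an isolated unit.\<close>

definition del :: "'g \<Rightarrow> 's \<Rightarrow> 'r" where
  "del x = ind {i (x, 1)}"

lemma del_diag: assumes "x \<in> units G" shows "diag (del x)"
  unfolding diag_def
proof (intro conjI allI impI)
  show "eqv (del x)" unfolding del_def using assms by (intro eqv_ind) auto
  fix \<sigma> assume "del x \<sigma> \<noteq> 0"
  then obtain t where "t \<in> ring_units" "\<sigma> = act t (i (x, 1))" using ind_nonzero[of "{i (x, 1)}" \<sigma>] unfolding del_def by auto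
  then show "q \<sigma> \<in> units G" using assms by simp
qed

lemma del_val: assumes "x \<in> units G" "y \<in> units G" shows "del x (i (y, 1)) = (if y = x then 1 else 0)"
proof (cases "y = x")
  case True then show ?thesis using ind_one[of "{i (x, 1)}" "i (x, 1)"] assms by (simp add: del_def)
next
  case False
  have "del x (i (y, 1)) = 0"
  proof (rule ccontr)
    assume "del x (i (y, 1)) \<noteq> 0"
    then obtain t where t: "t \<in> ring_units" "i (y, 1) = act t (i (x, 1))"
      using ind_nonzero[of "{i (x, 1)}" "i (y, 1)"] unfolding del_def by auto
    have "q (i (y, 1)) = q (i (x, 1))" unfolding t(2) using assms t(1) by simp
    then show False using False assms by simp
  qed
  then show ?thesis using False by simp
qed

lemma del_mult: assumes "x \<in> units G" "y \<in> units G"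
  shows "conv (del x) (del y) = (if x = y then del x else (\<lambda>\<sigma>. 0))"
proof (rule diag_ext)
  show "diag (conv (del x) (del y))" using assms by (intro diag_conv(1) del_diag)
  show "diag (if x = y then del x else (\<lambda>\<sigma>. 0))" using assms del_diag diag_0 by simp
  fix z assume z: "z \<in> units G"
  show "conv (del x) (del y) (i (z, 1)) = (if x = y then del x else (\<lambda>\<sigma>. 0)) (i (z, 1))"
    using diag_conv(2)[OF del_diag[OF assms(1)] del_diag[OF assms(2)] z] del_val[OF assms(1) z] del_val[OF assms(2) z]
    by auto
qed

lemma unit_neighbourhood:
  assumes "x \<in> units G" "finite E"
  obtains V where "openin (arrow_topology G) V" "compactin (arrow_topology G) V" "V \<subseteq> units G" "x \<in> V" "V \<inter> E \<subseteq> {x}"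
proof -
  have "closedin (arrow_topology G) (arrows G \<inter> (E - {x}))"
    by (rule compactin_imp_closedin[OF Hausdorff finite_imp_compactin]) (use assms in auto)
  then have "openin (arrow_topology G) (units G - arrows G \<inter> (E - {x}))"
    using openin_diff[OF units_clopen(1)] by blast
  then obtain K where K: "compact_open_bisection G K" "x \<in> K" "K \<subseteq> units G - arrows G \<inter> (E - {x})"
    by (rule ample_base) (use assms in auto)
  have "K \<inter> E \<subseteq> {x}" using K(3) G.units_arrows by blast
  then show thesis using that[of K] K by (auto simp: G.compact_open_bisection_iff)
qed

text \<open>At a fixed \<open>\<sigma>\<close> only finitely many sources of the support of
  \<open>n\<close> matter. A compact open set of units containing \<open>x\<close> and none of the
  other sources gives the same value as \<open>del x\<close>, and for it the normaliser condition
  applies.\<close>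

lemma del_conj:
  assumes n: "n \<in> stein" "k \<in> stein" "\<forall>b\<in>dia. conv (conv n b) k \<in> dia" and x: "x \<in> units G"
  shows "diag (conv (conv n (del x)) k)"
  unfolding diag_def
proof (intro conjI allI impI)
  have d: "diag (del x)" by (rule del_diag[OF x])
  have nd: "eqv (conv n (del x))" "rfin (conv n (del x))"
    using n d by (simp_all add: eqv_conv rfin_conv)
  show "eqv (conv (conv n (del x)) k)" using nd n by (simp add: eqv_conv)
  fix \<sigma> assume nz: "conv (conv n (del x)) k \<sigma> \<noteq> 0"
  then have \<sigma>: "\<sigma> \<in> arrows \<Sigma>" using conv_off by metis
  let ?E = "src G ` fib n (G.ran (q \<sigma>))"
  have "finite ?E" using stein_rfin[OF n(1)] by (simp add: rfin_def)
  then obtain V where V: "openin (arrow_topology G) V" "compactin (arrow_topology G) V" "V \<subseteq> units G" "x \<in> V" "V \<inter> ?E \<subseteq> {x}"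
    using unit_neighbourhood[OF x] by metis
  have b: "ev V \<in> dia" by (rule ev_dia[OF V(1-3)])
  have "conv (conv n (del x)) k \<sigma> = conv (conv n (ev V)) k \<sigma>"
  proof (rule conv_cong[OF nd])
    show "eqv (conv n (ev V))" "rfin (conv n (ev V))" using n b by (simp_all add: eqv_conv rfin_conv)
    show "eqv k" "\<sigma> \<in> arrows \<Sigma>" using n \<sigma> by auto
    fix \<tau> assume t: "\<tau> \<in> arrows \<Sigma>" "G.ran (q \<tau>) = G.ran (q \<sigma>)"
    have e: "conv n (del x) \<tau> = n \<tau> * del x (S.sou \<tau>)" "conv n (ev V) \<tau> = n \<tau> * ev V (S.sou \<tau>)"
      using n d b t by (simp_all add: conv_diag_right)
    show "conv n (del x) \<tau> = conv n (ev V) \<tau>"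
    proof (cases "n \<tau> = 0")
      case False
      then have "G.sou (q \<tau>) \<in> ?E" using suppI[of n \<tau>] t by (auto simp: fib_def)
      then have "G.sou (q \<tau>) \<in> V \<longleftrightarrow> G.sou (q \<tau>) = x" using V by blast
      then have "del x (S.sou \<tau>) = ev V (S.sou \<tau>)"
        unfolding ev_sou[OF V(1-3) t(1)] unfolding sou_eq[OF t(1)] using x t(1) by (simp add: del_val)
      then show ?thesis using e by simp
    qed (simp add: e)
  qed
  then have "conv (conv n (ev V)) k \<sigma> \<noteq> 0" using nz by simp
  moreover have "diag (conv (conv n (ev V)) k)" by (rule dia_diag[OF bspec[OF n(3) b]])
  ultimately show "q \<sigma> \<in> units G" by (auto simp: diag_def)
qed

section \<open>Coefficients of a normaliser and its partner\<close>

definition npair :: "('s \<Rightarrow> 'r) \<Rightarrow> ('s \<Rightarrow> 'r) \<Rightarrow> bool" where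
  "npair n k \<longleftrightarrow> n \<in> stein \<and> normaliser_partner alg dia n k"

lemma npair_sym: "npair n k \<Longrightarrow> npair k n"
  unfolding npair_def partner_iff by blast

text \<open>\<open>npc n k y x\<close> is the coefficient at the unit \<open>y\<close> of \<open>n \<delta>\<^sub>x k\<close>, where \<open>\<delta>\<^sub>x\<close> is the indicator
  of the single unit \<open>x\<close>. For fixed \<open>y\<close> these coefficients are orthogonal idempotents.\<close>

definition npc :: "('s \<Rightarrow> 'r) \<Rightarrow> ('s \<Rightarrow> 'r) \<Rightarrow> 'g \<Rightarrow> 'g \<Rightarrow> 'r" where
  "npc n k y x = conv (conv n (del x)) k (i (y, 1))"

context
  fixes n k assumes nk: "npair n k"
begin

lemma np: "n \<in> stein" "k \<in> stein" "conv (conv k n) k = k" "conv (conv n k) n = n"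
  "\<forall>b\<in>dia. conv (conv k b) n \<in> dia" "\<forall>b\<in>dia. conv (conv n b) k \<in> dia"
  using nk unfolding npair_def partner_iff by blast+

lemma np_diag: "diag (conv k n)" "diag (conv n k)"
  using conv_dia_closed[OF np(2,1,5)] conv_dia_closed[OF np(1,2,6)] by simp_all

lemma np_conj: "x \<in> units G \<Longrightarrow> diag (conv (conv n (del x)) k)"
  by (rule del_conj[OF np(1,2,6)])

lemma np_reg: "eqv n" "rfin n" "eqv k" "rfin k"
  using np(1,2) by simp_all

text \<open>The product \<open>k n\<close> is diagonal, so it commutes with \<open>del x\<close>;
  then \<open>n k n = n\<close> absorbs it. The mirror image below uses
  \<open>k n k = k\<close>.\<close>

lemma np_left: assumes x: "x \<in> units G"
  shows "conv (conv (conv n (del x)) k) n = conv n (del x)"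
proof -
  have d: "diag (del x)" by (rule del_diag[OF x])
  note r = np_reg d eqv_conv rfin_conv
  have "conv (conv (conv n (del x)) k) n = conv n (conv (del x) (conv k n))"
    using r by (simp add: conv_assoc)
  also have "\<dots> = conv n (conv (conv k n) (del x))" using conv_dia_commute[OF d np_diag(1)] by simp
  also have "\<dots> = conv (conv (conv n k) n) (del x)" using r by (simp add: conv_assoc)
  finally show ?thesis using np(4) by simp
qed

lemma np_right: assumes x: "x \<in> units G"
  shows "conv k (conv (conv n (del x)) k) = conv (del x) k"
proof -
  have d: "diag (del x)" by (rule del_diag[OF x])
  note r = np_reg d eqv_conv rfin_conv
  have "conv k (conv (conv n (del x)) k) = conv (conv (conv k n) (del x)) k"
    using r by (simp add: conv_assoc)
  also have "\<dots> = conv (conv (del x) (conv k n)) k" using conv_dia_commute[OF d np_diag(1)] by simp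
  also have "\<dots> = conv (del x) (conv (conv k n) k)" using r by (simp add: conv_assoc)
  finally show ?thesis using np(3) by simp
qed

text \<open>The product of \<open>n \<delta>_x k\<close> and \<open>n \<delta>_x' k\<close> reduces
  to \<open>n \<delta>_x \<delta>_x' k\<close>, and indicators of single units are orthogonal
  idempotents.\<close>

lemma npc_mult:
  assumes x: "x \<in> units G" "x' \<in> units G" "y \<in> units G"
  shows "npc n k y x * npc n k y x' = (if x = x' then npc n k y x else 0)"
proof -
  have d: "diag (del x)" "diag (del x')" using x by (auto intro: del_diag)
  note r = np_reg d eqv_conv rfin_conv
  have "npc n k y x * npc n k y x' = conv (conv (conv n (del x)) k) (conv (conv n (del x')) k) (i (y, 1))"
    unfolding npc_def by (rule diag_conv(2)[OF np_conj[OF x(1)] np_conj[OF x(2)] x(3), symmetric])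
  also have "conv (conv (conv n (del x)) k) (conv (conv n (del x')) k) = conv (conv n (del x)) (conv k (conv (conv n (del x')) k))"
    using r by (simp add: conv_assoc)
  also have "\<dots> = conv (conv n (conv (del x) (del x'))) k"
    unfolding np_right[OF x(2)] using r by (simp add: conv_assoc)
  also have "\<dots> = (if x = x' then conv (conv n (del x)) k else (\<lambda>\<sigma>. 0))"
    unfolding del_mult[OF x(1,2)]
    using conv_smult_right[OF np_reg(1,2) eqv_zero, of 0] conv_smult_left[OF eqv_zero rfin_zero np_reg(3), of 0] by simp
  finally show ?thesis by (simp add: npc_def)
qed

text \<open>Evaluating \<open>np_left\<close> at \<open>\<sigma>\<close> shows that the coefficient
  from its source to its range fixes \<open>n \<sigma>\<close>.\<close>

lemma npc_source:
  assumes "n \<sigma> \<noteq> 0"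
  shows "npc n k (G.ran (q \<sigma>)) (G.sou (q \<sigma>)) * n \<sigma> = n \<sigma>"
proof -
  have \<sigma>: "\<sigma> \<in> arrows \<Sigma>" using assms eqv_arrow np_reg by blast
  let ?x = "G.sou (q \<sigma>)"
  have x: "?x \<in> units G" using \<sigma> by simp
  have "npc n k (G.ran (q \<sigma>)) ?x * n \<sigma> = conv (conv (conv n (del ?x)) k) n \<sigma>"
    using conv_diag_left[OF np_conj[OF x] np_reg(1) \<sigma>] by (simp add: npc_def ran_eq[OF \<sigma>])
  also have "\<dots> = n \<sigma> * del ?x (S.sou \<sigma>)"
    unfolding np_left[OF x] by (rule conv_diag_right[OF np_reg(1,2) del_diag[OF x] \<sigma>])
  also have "\<dots> = n \<sigma>" unfolding sou_eq[OF \<sigma>] using del_val[OF x x] by simp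
  finally show ?thesis .
qed

lemma npc_target:
  assumes "k \<tau> \<noteq> 0"
  shows "npc n k (G.sou (q \<tau>)) (G.ran (q \<tau>)) * k \<tau> = k \<tau>"
proof -
  have \<tau>: "\<tau> \<in> arrows \<Sigma>" using assms eqv_arrow np_reg by blast
  let ?x = "G.ran (q \<tau>)"
  have x: "?x \<in> units G" using \<tau> by simp
  have "k \<tau> * npc n k (G.sou (q \<tau>)) ?x = conv k (conv (conv n (del ?x)) k) \<tau>"
    using conv_diag_right[OF np_reg(3,4) np_conj[OF x] \<tau>] by (simp add: npc_def sou_eq[OF \<tau>])
  also have "\<dots> = del ?x (S.ran \<tau>) * k \<tau>"
    unfolding np_right[OF x] by (rule conv_diag_left[OF del_diag[OF x] np_reg(3) \<tau>])
  also have "\<dots> = k \<tau>" unfolding ran_eq[OF \<tau>] using del_val[OF x x] by simp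
  finally show ?thesis by (simp add: mult.commute)
qed

end

end

section \<open>Consequences of indecomposability and of the unique product property\<close>

locale upp_twist = ample_twist \<Sigma> i q G
  for \<Sigma> :: "'s groupoid" (structure) and i :: "'g \<times> 'r::comm_ring_1 \<Rightarrow> 's"
    and q :: "'s \<Rightarrow> 'g" and G :: "'g groupoid" +
  fixes X :: "'g set"
  assumes reduced: "reduced_ring TYPE('r)" and indecomposable: "indecomposable_ring TYPE('r)"
    and X_units: "X \<subseteq> units G" and X_dense: "unit_space G closure_of X = units G"
    and X_upp: "\<And>x. x \<in> X \<Longrightarrow> unique_product_property (interior_isotropy_group G x)"
begin

lemma idempotent_cases: "(a::'r) * a = a \<Longrightarrow> a = 0 \<or> a = 1"
  using indecomposable unfolding indecomposable_ring_def by blast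

text \<open>These coefficients are idempotent, hence 0 or 1, and they fix a nonzero value.\<close>

lemma npc_one:
  assumes nk: "npair n k"
  shows "n \<sigma> \<noteq> 0 \<Longrightarrow> npc n k (G.ran (q \<sigma>)) (G.sou (q \<sigma>)) = 1"
    and "k \<tau> \<noteq> 0 \<Longrightarrow> npc n k (G.sou (q \<tau>)) (G.ran (q \<tau>)) = 1"
proof -
  have S: "n \<sigma> \<noteq> 0 \<Longrightarrow> \<sigma> \<in> arrows \<Sigma>" "k \<tau> \<noteq> 0 \<Longrightarrow> \<tau> \<in> arrows \<Sigma>"
    using eqv_arrow np_reg[OF nk] by blast+
  have idem: "npc n k y x = 0 \<or> npc n k y x = 1" if "x \<in> units G" "y \<in> units G" for x y
    using npc_mult[OF nk that(1,1,2)] idempotent_cases by simp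
  show "npc n k (G.ran (q \<sigma>)) (G.sou (q \<sigma>)) = 1" if s: "n \<sigma> \<noteq> 0"
    using idem[of "G.sou (q \<sigma>)" "G.ran (q \<sigma>)"] npc_source[OF nk s] s S(1)[OF s] by auto
  show "npc n k (G.sou (q \<tau>)) (G.ran (q \<tau>)) = 1" if t: "k \<tau> \<noteq> 0"
    using idem[of "G.ran (q \<tau>)" "G.sou (q \<tau>)"] npc_target[OF nk t] t S(2)[OF t] by auto
qed

text \<open>Two different sources over one range would give two orthogonal coefficients both equal
  to 1.\<close>

lemma npair_same_range:
  assumes nk: "npair n k" and s: "n \<sigma> \<noteq> 0" "n \<tau> \<noteq> 0" "G.ran (q \<sigma>) = G.ran (q \<tau>)"
  shows "G.sou (q \<sigma>) = G.sou (q \<tau>)"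
proof (rule ccontr)
  assume ne: "\<not> ?thesis"
  have "\<sigma> \<in> arrows \<Sigma>" "\<tau> \<in> arrows \<Sigma>" using eqv_arrow np_reg(1)[OF nk] s by blast+
  then have u: "G.sou (q \<sigma>) \<in> units G" "G.sou (q \<tau>) \<in> units G" "G.ran (q \<tau>) \<in> units G" by simp_all
  show False using npc_mult[OF nk u] npc_one(1)[OF nk s(1)] npc_one(1)[OF nk s(2)] s(3) ne by simp
qed

text \<open>The same argument with the roles of \<open>n\<close> and \<open>k\<close> exchanged,
  using the second half of \<open>npc_one\<close>.\<close>

lemma npair_same_source:
  assumes nk: "npair n k" and s: "n \<sigma> \<noteq> 0" "n \<tau> \<noteq> 0" "G.sou (q \<sigma>) = G.sou (q \<tau>)"
  shows "G.ran (q \<sigma>) = G.ran (q \<tau>)"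
proof (rule ccontr)
  assume ne: "\<not> ?thesis"
  note kn = npair_sym[OF nk]
  have "\<sigma> \<in> arrows \<Sigma>" "\<tau> \<in> arrows \<Sigma>" using eqv_arrow np_reg(1)[OF nk] s by blast+
  then have u: "G.ran (q \<sigma>) \<in> units G" "G.ran (q \<tau>) \<in> units G" "G.sou (q \<tau>) \<in> units G" by simp_all
  show False using npc_mult[OF kn u] npc_one(2)[OF kn s(1)] npc_one(2)[OF kn s(2)] s(3) ne by simp
qed

text \<open>The set of all products of an inverse support arrow with a support arrow is open, and it
  consists of isotropy because equal ranges force equal sources.\<close>

lemma npair_isotropy:
  assumes nk: "npair n k" and s: "n \<sigma> \<noteq> 0" "n \<tau> \<noteq> 0" "G.ran (q \<sigma>) = G.ran (q \<tau>)"
  shows "G.inv_of (q \<sigma>) \<cdot>\<^bsub>G\<^esub> q \<tau> \<in> iso_interior"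
proof -
  have o: "openin (arrow_topology G) (supp n)" by (rule stein_supp_open[OF np(1)[OF nk]])
  have S: "\<And>\<sigma>. n \<sigma> \<noteq> 0 \<Longrightarrow> \<sigma> \<in> arrows \<Sigma>" using eqv_arrow np_reg(1)[OF nk] by blast
  let ?P = "{a \<cdot>\<^bsub>G\<^esub> b |a b. a \<in> G.inv_of ` supp n \<and> b \<in> supp n \<and> G.sou a = G.ran b}"
  show ?thesis
  proof (rule iso_interiorI[OF G.open_product[OF G.open_inv[OF o] o]])
    fix d assume "d \<in> ?P"
    then obtain \<rho> \<rho>' where r: "n \<rho> \<noteq> 0" "n \<rho>' \<noteq> 0" "d = G.inv_of (q \<rho>) \<cdot>\<^bsub>G\<^esub> q \<rho>'" "G.sou (G.inv_of (q \<rho>)) = G.ran (q \<rho>')"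
      by (auto simp: supp_def function_support_def)
    have rS: "\<rho> \<in> arrows \<Sigma>" "\<rho>' \<in> arrows \<Sigma>" using S r by auto
    then have e: "G.ran (q \<rho>) = G.ran (q \<rho>')" using r(4) by simp
    show "G.ran d = G.sou d" unfolding r(3) using npair_same_range[OF nk r(1,2) e] e rS by simp
  next
    show "G.inv_of (q \<sigma>) \<cdot>\<^bsub>G\<^esub> q \<tau> \<in> ?P"
      using suppI[of n \<sigma>] suppI[of n \<tau>] s S[OF s(1)]
      by (intro CollectI exI[of _ "G.inv_of (q \<sigma>)"] exI[of _ "q \<tau>"]) simp
  qed
qed

text \<open>Translation by \<open>\<alpha> = q \<sigma>\<close> turns \<open>n\<close> and
  \<open>k\<close> near \<open>x\<close> into functions \<open>f\<close> and \<open>g\<close> on the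
  isotropy group at \<open>x\<close>. Since \<open>n \<delta>_x k\<close> is diagonal with value 1
  at \<open>y\<close>, the twisted product of \<open>f\<close> and \<open>g\<close> is the identity,
  and \<open>unique_product_trivial_units\<close> leaves \<open>f\<close> a single point of
  support.\<close>

lemma npair_unique_on_X:
  assumes nk: "npair n k" and s: "n \<sigma> \<noteq> 0" "n \<tau> \<noteq> 0" "G.sou (q \<sigma>) \<in> X" "G.sou (q \<tau>) = G.sou (q \<sigma>)"
  shows "q \<tau> = q \<sigma>"
proof -
  define \<alpha> x y where "\<alpha> = q \<sigma>" and "x = G.sou \<alpha>" and "y = G.ran \<alpha>"
  note reg = np_reg[OF nk]
  have S: "\<sigma> \<in> arrows \<Sigma>" "\<tau> \<in> arrows \<Sigma>" using eqv_arrow reg(1) s by blast+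
  have \<alpha>: "\<alpha> \<in> arrows G" "G.sou \<alpha> = x" "G.ran \<alpha> = y" "\<alpha> \<in> supp n"
    using S s suppI[of n \<sigma>] by (simp_all add: \<alpha>_def x_def y_def)
  have x: "x \<in> X" "x \<in> units G" and y: "y \<in> units G" using s(3) X_units \<alpha> by (auto simp: \<alpha>_def x_def y_def)
  let ?H = "interior_isotropy_group G x"
  interpret H: group ?H by (rule group_interior_isotropy(1)[OF x(2)])
  have Hinv: "m_inv ?H h = G.inv_of h" if "h \<in> carrier ?H" for h
    by (rule group_interior_isotropy(2)[OF x(2) that])
  have Hm: "a \<otimes>\<^bsub>?H\<^esub> b = a \<cdot>\<^bsub>G\<^esub> b" "\<one>\<^bsub>?H\<^esub> = x" for a b by (simp_all add: interior_isotropy_group_def)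
  have H: "h \<in> arrows G" "G.ran h = x" "G.sou h = x" if "h \<in> carrier ?H" for h
    using that iso_interior_isotropy[of h] by (auto simp: interior_isotropy_group_def)
  \<comment> \<open>A group element \<open>h\<close> stands for the arrow \<open>\<alpha> h\<close>
    in the support of \<open>n\<close>, and for \<open>h \<alpha>^-1\<close> on the side of
    \<open>k\<close>.\<close>
  define f where "f = (\<lambda>h. n (sec (\<alpha> \<cdot>\<^bsub>G\<^esub> h)))"
  define g where "g = (\<lambda>h. k (sec (h \<cdot>\<^bsub>G\<^esub> G.inv_of \<alpha>)))"
  \<comment> \<open>A lift of \<open>\<alpha> z \<alpha>^-1\<close>. At the identity
    \<open>x\<close> the actual unit of \<open>\<Sigma>\<close> is taken, so that the identity
    coefficient is exactly 1 and not merely a unit.\<close>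
  define \<rho> where "\<rho> = (\<lambda>z. if z = x then i (y, 1) else sec (\<alpha> \<cdot>\<^bsub>G\<^esub> z \<cdot>\<^bsub>G\<^esub> G.inv_of \<alpha>))"
  define C where "C = {h \<in> carrier ?H. f h \<noteq> 0}"
  define D where "D = {h \<in> carrier ?H. g h \<noteq> 0}"
  have \<alpha>h: "\<alpha> \<cdot>\<^bsub>G\<^esub> h \<in> arrows G" "G.ran (\<alpha> \<cdot>\<^bsub>G\<^esub> h) = y" "G.sou (\<alpha> \<cdot>\<^bsub>G\<^esub> h) = x" if "h \<in> carrier ?H" for h
    using H[OF that] \<alpha> by simp_all
  have h\<alpha>: "h \<cdot>\<^bsub>G\<^esub> G.inv_of \<alpha> \<in> arrows G" "G.ran (h \<cdot>\<^bsub>G\<^esub> G.inv_of \<alpha>) = x" "G.sou (h \<cdot>\<^bsub>G\<^esub> G.inv_of \<alpha>) = y" if "h \<in> carrier ?H" for h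
    using H[OF that] \<alpha> by simp_all
  have injC: "inj_on (\<lambda>h. \<alpha> \<cdot>\<^bsub>G\<^esub> h) (carrier ?H)"
  proof (rule inj_onI)
    fix a b assume "a \<in> carrier ?H" "b \<in> carrier ?H" "\<alpha> \<cdot>\<^bsub>G\<^esub> a = \<alpha> \<cdot>\<^bsub>G\<^esub> b"
    then show "a = b" using G.mul_left_cancel[of \<alpha> a b] H[of a] H[of b] \<alpha> by simp
  qed
  have finC: "finite C"
  proof (rule finite_imageD)
    have "(\<lambda>h. \<alpha> \<cdot>\<^bsub>G\<^esub> h) ` C \<subseteq> fib n y"
      using supp_sec[OF reg(1)] \<alpha>h by (auto simp: C_def f_def fib_def)
    then show "finite ((\<lambda>h. \<alpha> \<cdot>\<^bsub>G\<^esub> h) ` C)" using reg(2) finite_subset unfolding rfin_def by blast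
    show "inj_on (\<lambda>h. \<alpha> \<cdot>\<^bsub>G\<^esub> h) C" using injC by (rule inj_on_subset) (auto simp: C_def)
  qed
  have finD: "finite D"
  proof (rule finite_imageD)
    have "(\<lambda>h. h \<cdot>\<^bsub>G\<^esub> G.inv_of \<alpha>) ` D \<subseteq> fib k x"
      using supp_sec[OF reg(3)] h\<alpha> by (auto simp: D_def g_def fib_def)
    then show "finite ((\<lambda>h. h \<cdot>\<^bsub>G\<^esub> G.inv_of \<alpha>) ` D)" using reg(4) finite_subset unfolding rfin_def by blast
    show "inj_on (\<lambda>h. h \<cdot>\<^bsub>G\<^esub> G.inv_of \<alpha>) D"
    proof (rule inj_onI)
      fix a b assume ab: "a \<in> D" "b \<in> D" "a \<cdot>\<^bsub>G\<^esub> G.inv_of \<alpha> = b \<cdot>\<^bsub>G\<^esub> G.inv_of \<alpha>"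
      then have "a \<in> carrier ?H" "b \<in> carrier ?H" by (auto simp: D_def)
      note HH = H[OF this(1)] H[OF this(2)]
      have "a = a \<cdot>\<^bsub>G\<^esub> G.inv_of \<alpha> \<cdot>\<^bsub>G\<^esub> \<alpha>" using HH \<alpha> by simp
      also have "\<dots> = b" unfolding ab(3) using HH \<alpha> by simp
      finally show "a = b" .
    qed
  qed
  have \<rho>: "\<rho> z \<in> arrows \<Sigma>" "q (\<rho> z) = \<alpha> \<cdot>\<^bsub>G\<^esub> z \<cdot>\<^bsub>G\<^esub> G.inv_of \<alpha>" if z: "z \<in> carrier ?H" for z
  proof -
    have a: "\<alpha> \<cdot>\<^bsub>G\<^esub> z \<cdot>\<^bsub>G\<^esub> G.inv_of \<alpha> \<in> arrows G" using \<alpha>h[OF z] \<alpha> by simp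
    have "\<alpha> \<cdot>\<^bsub>G\<^esub> x \<cdot>\<^bsub>G\<^esub> G.inv_of \<alpha> = y" using \<alpha> by simp
    then show "\<rho> z \<in> arrows \<Sigma>" "q (\<rho> z) = \<alpha> \<cdot>\<^bsub>G\<^esub> z \<cdot>\<^bsub>G\<^esub> G.inv_of \<alpha>" using a y by (auto simp: \<rho>_def)
  qed
  let ?k = "\<lambda>z h. k (S.inv_of (sec (\<alpha> \<cdot>\<^bsub>G\<^esub> h)) \<cdot> \<rho> z)"
  \<comment> \<open>The product formed in \<open>\<Sigma>\<close> and the chosen lift of
    \<open>h^-1 z \<alpha>^-1\<close> lie in the same fibre, so they differ by a ring unit. These
    units become the scalars \<open>w z h\<close>.\<close>
  have "\<exists>u. u \<in> ring_units \<and> ?k z h = u * g (G.inv_of h \<cdot>\<^bsub>G\<^esub> z)" if z: "z \<in> carrier ?H" and h: "h \<in> carrier ?H" for z h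
  proof -
    note hs = H[OF z] H[OF h] \<alpha>h[OF h] \<alpha>h[OF z] \<alpha> \<rho>[OF z]
    have rr: "G.ran (q (\<rho> z)) = y" using hs by simp
    have a: "S.inv_of (sec (\<alpha> \<cdot>\<^bsub>G\<^esub> h)) \<cdot> \<rho> z \<in> arrows \<Sigma>"
      "q (S.inv_of (sec (\<alpha> \<cdot>\<^bsub>G\<^esub> h)) \<cdot> \<rho> z) = G.inv_of (\<alpha> \<cdot>\<^bsub>G\<^esub> h) \<cdot>\<^bsub>G\<^esub> q (\<rho> z)"
      using hs(7-9) \<rho>(1)[OF z] rr by simp_all
    have "G.inv_of (\<alpha> \<cdot>\<^bsub>G\<^esub> h) \<cdot>\<^bsub>G\<^esub> q (\<rho> z) = G.inv_of h \<cdot>\<^bsub>G\<^esub> G.inv_of \<alpha> \<cdot>\<^bsub>G\<^esub> (\<alpha> \<cdot>\<^bsub>G\<^esub> (z \<cdot>\<^bsub>G\<^esub> G.inv_of \<alpha>))"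
      unfolding \<rho>(2)[OF z] using hs(1-6) \<alpha> by (simp add: G.inv_mul G.mul_assoc)
    also have "\<dots> = G.inv_of h \<cdot>\<^bsub>G\<^esub> z \<cdot>\<^bsub>G\<^esub> G.inv_of \<alpha>" using hs(1-6) \<alpha> by (simp add: G.mul_assoc)
    finally have qe: "q (S.inv_of (sec (\<alpha> \<cdot>\<^bsub>G\<^esub> h)) \<cdot> \<rho> z) = G.inv_of h \<cdot>\<^bsub>G\<^esub> z \<cdot>\<^bsub>G\<^esub> G.inv_of \<alpha>" using a(2) by simp
    let ?\<beta> = "G.inv_of h \<cdot>\<^bsub>G\<^esub> z \<cdot>\<^bsub>G\<^esub> G.inv_of \<alpha>"
    have b: "?\<beta> \<in> arrows G" using hs(1-6) \<alpha> by simp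
    obtain t where t: "t \<in> ring_units" "S.inv_of (sec (\<alpha> \<cdot>\<^bsub>G\<^esub> h)) \<cdot> \<rho> z = act t (sec ?\<beta>)"
      using fibre_transitive[OF sec(1)[OF b] a(1)] qe sec(2)[OF b] by metis
    have "?k z h = unit_inverse t * g (G.inv_of h \<cdot>\<^bsub>G\<^esub> z)"
      unfolding t(2) g_def using t(1) reg(3) b by simp
    then show ?thesis using t(1) by (intro exI[of _ "unit_inverse t"]) simp
  qed
  then obtain w where w: "\<And>z h. z \<in> carrier ?H \<Longrightarrow> h \<in> carrier ?H \<Longrightarrow> w z h \<in> ring_units \<and> ?k z h = w z h * g (G.inv_of h \<cdot>\<^bsub>G\<^esub> z)"
    by metis
  have d: "diag (del x)" by (rule del_diag[OF x(2)])
  have nd: "eqv (conv n (del x))" "rfin (conv n (del x))" using reg d by (simp_all add: eqv_conv rfin_conv)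
  have sum: "conv (conv n (del x)) k (\<rho> z) = (\<Sum>h\<in>C. f h * w z h * g (m_inv ?H h \<otimes>\<^bsub>?H\<^esub> z))" if z: "z \<in> carrier ?H" for z
  proof -
    have rr: "G.ran (q (\<rho> z)) = y" using \<rho>(2)[OF z] \<alpha>h[OF z] \<alpha> by simp
    have CH: "h \<in> carrier ?H" if "h \<in> C" for h using that by (simp add: C_def)
    let ?F = "(\<lambda>h. \<alpha> \<cdot>\<^bsub>G\<^esub> h) ` C"
    have nd_val: "conv n (del x) (sec \<beta>) = (if G.sou \<beta> = x then n (sec \<beta>) else 0)" if b: "\<beta> \<in> arrows G" for \<beta>
    proof -
      have "conv n (del x) (sec \<beta>) = n (sec \<beta>) * del x (S.sou (sec \<beta>))" using reg d b by (simp add: conv_diag_right)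
      then show ?thesis using b x(2) by (simp add: sou_eq del_val)
    qed
    have "conv (conv n (del x)) k (\<rho> z) = (\<Sum>\<beta>\<in>?F. conv n (del x) (sec \<beta>) * k (S.inv_of (sec \<beta>) \<cdot> \<rho> z))"
    proof (rule conv_sum[OF nd reg(3) \<rho>(1)[OF z]])
      show "finite ?F" using finC by simp
      show "\<beta> \<in> arrows G \<and> G.ran \<beta> = G.ran (q (\<rho> z))" if "\<beta> \<in> ?F" for \<beta>
        using that \<alpha>h CH unfolding rr by auto
      show "sec \<beta> \<in> arrows \<Sigma> \<and> q (sec \<beta>) = \<beta>" if "\<beta> \<in> ?F" for \<beta>
        using that \<alpha>h CH by auto
      fix \<beta> assume b: "\<beta> \<in> fib (conv n (del x)) (G.ran (q (\<rho> z)))"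
      then have bG: "\<beta> \<in> arrows G" "G.ran \<beta> = y" "conv n (del x) (sec \<beta>) \<noteq> 0"
        using fib_arrows[OF nd(1) b] supp_sec[OF nd(1)] rr by (auto simp: fib_def)
      then have bn: "n (sec \<beta>) \<noteq> 0" "G.sou \<beta> = x" using nd_val[OF bG(1)] by (auto split: if_splits)
      \<comment> \<open>Every contributing \<open>\<beta>\<close> has range \<open>y\<close> and
        source \<open>x\<close>, so it lies in the coset of \<open>\<alpha>\<close> and is covered
        by \<open>C\<close>.\<close>
      have "G.inv_of \<alpha> \<cdot>\<^bsub>G\<^esub> \<beta> \<in> iso_interior"
        using npair_isotropy[OF nk s(1) bn(1)] bG \<alpha> by (simp add: \<alpha>_def)
      then have "G.inv_of \<alpha> \<cdot>\<^bsub>G\<^esub> \<beta> \<in> carrier ?H" using bG bn \<alpha> by (simp add: interior_isotropy_group_def)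
      moreover have e: "\<alpha> \<cdot>\<^bsub>G\<^esub> (G.inv_of \<alpha> \<cdot>\<^bsub>G\<^esub> \<beta>) = \<beta>" using bG \<alpha> by simp
      ultimately have "G.inv_of \<alpha> \<cdot>\<^bsub>G\<^esub> \<beta> \<in> C" using bn by (simp add: C_def f_def)
      then show "\<beta> \<in> ?F" using e by (metis imageI)
    qed
    also have "\<dots> = (\<Sum>h\<in>C. conv n (del x) (sec (\<alpha> \<cdot>\<^bsub>G\<^esub> h)) * ?k z h)"
      by (rule sum.reindex_cong[OF _ refl refl]) (use injC CH in \<open>auto intro: inj_on_subset\<close>)
    also have "\<dots> = (\<Sum>h\<in>C. f h * w z h * g (m_inv ?H h \<otimes>\<^bsub>?H\<^esub> z))"
    proof (rule sum.cong[OF refl])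
      fix h assume "h \<in> C"
      then have h: "h \<in> carrier ?H" by (rule CH)
      show "conv n (del x) (sec (\<alpha> \<cdot>\<^bsub>G\<^esub> h)) * ?k z h = f h * w z h * g (m_inv ?H h \<otimes>\<^bsub>?H\<^esub> z)"
        using nd_val[OF \<alpha>h(1)[OF h]] \<alpha>h(3)[OF h] w[OF z h] Hinv[OF h] by (simp add: f_def Hm mult.assoc)
    qed
    finally show ?thesis .
  qed
  have xH: "x \<in> carrier ?H" using H.one_closed Hm by simp
  have "x = G.inv_of \<alpha> \<cdot>\<^bsub>G\<^esub> q \<tau>"
  proof (rule H.unique_product_trivial_units[where w = w and f = f and g = g,
        OF reduced indecomposable X_upp[OF x(1)] _ finC finD])
    show "w z h dvd 1" if "z \<in> carrier ?H" "h \<in> carrier ?H" for z h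
      using w[OF that] by (simp add: ring_units_def)
    show "C \<subseteq> carrier ?H" "D \<subseteq> carrier ?H" by (auto simp: C_def D_def)
    show "f h = 0" if "h \<in> carrier ?H" "h \<notin> C" for h using that by (simp add: C_def)
    show "g h = 0" if "h \<in> carrier ?H" "h \<notin> D" for h using that by (simp add: D_def)
    show "(\<Sum>h\<in>C. f h * w z h * g (m_inv ?H h \<otimes>\<^bsub>?H\<^esub> z)) = 0" if z: "z \<in> carrier ?H" "z \<noteq> \<one>\<^bsub>?H\<^esub>" for z
    proof -
      \<comment> \<open>Conjugating a non-identity element by \<open>\<alpha>\<close> does not give
        a unit, and the function \<open>n \<delta>_x k\<close> vanishes off the units.\<close>
      have "q (\<rho> z) \<notin> units G"
      proof
        assume "q (\<rho> z) \<in> units G"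
        then have "\<alpha> \<cdot>\<^bsub>G\<^esub> z \<cdot>\<^bsub>G\<^esub> G.inv_of \<alpha> \<in> units G" using \<rho>(2)[OF z(1)] by simp
        then have "G.inv_of \<alpha> = G.inv_of (\<alpha> \<cdot>\<^bsub>G\<^esub> z)"
          using \<alpha>h[OF z(1)] \<alpha> by (intro G.mul_eq_unitD) simp_all
        then have "\<alpha> = \<alpha> \<cdot>\<^bsub>G\<^esub> z" using \<alpha>h[OF z(1)] \<alpha> by (metis G.inv_inv)
        then have "\<alpha> \<cdot>\<^bsub>G\<^esub> x = \<alpha> \<cdot>\<^bsub>G\<^esub> z" using \<alpha> by simp
        then have "x = z" using inj_onD[OF injC _ xH z(1)] by blast
        then show False using z(2) Hm by simp
      qed
      then have "conv (conv n (del x)) k (\<rho> z) = 0" using np_conj[OF nk x(2)] diag_zero by blast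
      then show ?thesis using sum[OF z(1)] by simp
    qed
    \<comment> \<open>By the choice of \<open>\<rho>\<close> this is literally the coefficient
      \<open>npc n k y x\<close>, known to be 1 because \<open>n\<close> is nonzero at
      \<open>\<sigma>\<close>.\<close>
    have "conv (conv n (del x)) k (\<rho> x) = 1"
      using npc_one(1)[OF nk s(1)] by (simp add: \<rho>_def npc_def \<alpha>_def x_def y_def)
    then have "(\<Sum>h\<in>C. f h * w x h * g (m_inv ?H h \<otimes>\<^bsub>?H\<^esub> x)) = 1" using sum[OF xH] by simp
    moreover have "m_inv ?H h \<otimes>\<^bsub>?H\<^esub> x = m_inv ?H h" if "h \<in> C" for h
      using H.r_one[OF H.inv_closed, of h] that unfolding Hm(2) by (simp add: C_def)
    ultimately show "(\<Sum>h\<in>C. f h * w \<one>\<^bsub>?H\<^esub> h * g (m_inv ?H h)) = 1" unfolding Hm(2) by simp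
    show "x \<in> carrier ?H" by (rule xH)
    have rr: "G.ran (q \<tau>) = G.ran (q \<sigma>)" by (rule npair_same_source[OF nk s(2,1,4)])
    have "G.inv_of (q \<sigma>) \<cdot>\<^bsub>G\<^esub> q \<tau> \<in> iso_interior" by (rule npair_isotropy[OF nk s(1,2) rr[symmetric]])
    then show "G.inv_of \<alpha> \<cdot>\<^bsub>G\<^esub> q \<tau> \<in> carrier ?H"
      using S s(4) rr by (simp add: interior_isotropy_group_def \<alpha>_def x_def)
    have "f x = n (sec \<alpha>)" using \<alpha> by (simp add: f_def)
    then show "f x \<noteq> 0" using supp_sec[OF reg(1) \<alpha>(1)] \<alpha>(4) by simp
    have "f (G.inv_of \<alpha> \<cdot>\<^bsub>G\<^esub> q \<tau>) = n (sec (q \<tau>))" using \<alpha> S rr by (simp add: f_def \<alpha>_def)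
    then show "f (G.inv_of \<alpha> \<cdot>\<^bsub>G\<^esub> q \<tau>) \<noteq> 0" using supp_sec[OF reg(1), of "q \<tau>"] suppI[of n \<tau>] s(2) S by simp
  qed
  then have "\<alpha> \<cdot>\<^bsub>G\<^esub> x = \<alpha> \<cdot>\<^bsub>G\<^esub> (G.inv_of \<alpha> \<cdot>\<^bsub>G\<^esub> q \<tau>)" by simp
  moreover have "\<alpha> \<cdot>\<^bsub>G\<^esub> (G.inv_of \<alpha> \<cdot>\<^bsub>G\<^esub> q \<tau>) = q \<tau>"
    using \<alpha> S npair_same_source[OF nk s(2,1,4)] by (simp add: \<alpha>_def)
  ultimately show ?thesis using \<alpha> by (simp add: \<alpha>_def)
qed

text \<open>Since \<open>X\<close> is dense and \<open>G\<close> is Hausdorff, injectivity of the source map on the support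
  passes from \<open>X\<close> to all units.\<close>

lemma npair_unique:
  assumes nk: "npair n k" and s: "n \<sigma> \<noteq> 0" "n \<tau> \<noteq> 0" "G.sou (q \<sigma>) = G.sou (q \<tau>)"
  shows "q \<sigma> = q \<tau>"
proof (rule ccontr)
  assume ne: "q \<sigma> \<noteq> q \<tau>"
  have S: "\<And>\<sigma>. n \<sigma> \<noteq> 0 \<Longrightarrow> \<sigma> \<in> arrows \<Sigma>" using eqv_arrow np_reg(1)[OF nk] by blast
  have "q \<sigma> \<in> arrows G" "q \<tau> \<in> arrows G" using S s by auto
  then obtain A B where AB: "openin (arrow_topology G) A" "openin (arrow_topology G) B" "q \<sigma> \<in> A" "q \<tau> \<in> B" "disjnt A B"
    using Hausdorff ne unfolding Hausdorff_space_def by blast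
  have o: "openin (arrow_topology G) (supp n)" by (rule stein_supp_open[OF np(1)[OF nk]])
  \<comment> \<open>Units that are sources of support arrows from both disjoint sets; this is open
    because the source map is open, so it meets \<open>X\<close> as soon as it is nonempty.\<close>
  let ?W = "src G ` (A \<inter> supp n) \<inter> src G ` (B \<inter> supp n)"
  have "openin (arrow_topology G) ?W"
    by (intro openin_Int G.open_sou_image AB o)
  moreover have "?W \<subseteq> units G" using openin_subset[OF AB(1)] G.sou_units by blast
  ultimately have oW: "openin (unit_space G) ?W" by (simp add: G.openin_unit_space)
  have zW: "G.sou (q \<sigma>) \<in> ?W"
  proof
    show "G.sou (q \<sigma>) \<in> src G ` (A \<inter> supp n)" using AB(3) suppI[of n, OF s(1)] by blast
    show "G.sou (q \<sigma>) \<in> src G ` (B \<inter> supp n)" unfolding s(3) using AB(4) suppI[of n, OF s(2)] by blast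
  qed
  have "G.sou (q \<sigma>) \<in> unit_space G closure_of X" unfolding X_dense using S s by simp
  then have "\<forall>T. G.sou (q \<sigma>) \<in> T \<and> openin (unit_space G) T \<longrightarrow> (\<exists>y. y \<in> X \<and> y \<in> T)"
    unfolding in_closure_of by (rule conjunct2)
  from this[rule_format, OF conjI[OF zW oW]] obtain x where x: "x \<in> X" "x \<in> ?W" by (elim exE conjE)
  then obtain a b where ab: "a \<in> A" "a \<in> supp n" "b \<in> B" "b \<in> supp n" "x = G.sou a" "x = G.sou b" by blast
  then obtain \<rho> \<rho>' where r: "n \<rho> \<noteq> 0" "a = q \<rho>" "n \<rho>' \<noteq> 0" "b = q \<rho>'" by (auto simp: supp_def function_support_def)
  have "b = a" using npair_unique_on_X[OF nk r(1,3)] x(1) ab(5,6) r by simp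
  then show False using ab AB(5) by (auto simp: disjnt_def)
qed

text \<open>Equal ranges force equal sources, so injectivity of the source map on the support gives
  that of the range map. Then the coefficient \<open>npc\<close>, which is 1, consists of one term
  with factor \<open>n \<sigma>\<close>, so \<open>n \<sigma>\<close> is invertible.\<close>

lemma normaliser_nbis:
  assumes "n \<in> normalisers alg dia" shows "nbis n"
proof -
  obtain k where nk: "npair n k" using assms unfolding normalisers_def npair_def by auto
  note reg = np_reg[OF nk]
  show ?thesis
  proof (rule nbisI)
    show "n \<in> stein" by (rule np(1)[OF nk])
    show u: "q \<sigma> = q \<tau>" if "n \<sigma> \<noteq> 0" "n \<tau> \<noteq> 0" "G.sou (q \<sigma>) = G.sou (q \<tau>)" for \<sigma> \<tau>
      using npair_unique[OF nk that] .
    show u': "q \<sigma> = q \<tau>" if "n \<sigma> \<noteq> 0" "n \<tau> \<noteq> 0" "G.ran (q \<sigma>) = G.ran (q \<tau>)" for \<sigma> \<tau>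
      by (rule u[OF that(1,2) npair_same_range[OF nk that]])
    fix \<sigma> assume s: "n \<sigma> \<noteq> 0"
    have \<sigma>: "\<sigma> \<in> arrows \<Sigma>" using eqv_arrow reg(1) s by blast
    let ?x = "G.sou (q \<sigma>)" and ?y = "G.ran (q \<sigma>)"
    have d: "diag (del ?x)" using \<sigma> by (intro del_diag) simp
    have "conv (conv n (del ?x)) k (i (?y, 1)) = conv n (del ?x) \<sigma> * k (S.inv_of \<sigma> \<cdot> i (?y, 1))"
    proof (rule conv_single)
      show "eqv (conv n (del ?x))" "rfin (conv n (del ?x))" "eqv k" using reg d by (simp_all add: eqv_conv rfin_conv)
      show "i (?y, 1) \<in> arrows \<Sigma>" "\<sigma> \<in> arrows \<Sigma>" "G.ran (q \<sigma>) = G.ran (q (i (?y, 1)))" using \<sigma> by simp_all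
      show "fib (conv n (del ?x)) (G.ran (q (i (?y, 1)))) \<subseteq> {q \<sigma>}"
      proof
        fix \<alpha> assume "\<alpha> \<in> fib (conv n (del ?x)) (G.ran (q (i (?y, 1))))"
        then obtain \<tau> where t: "conv n (del ?x) \<tau> \<noteq> 0" "\<alpha> = q \<tau>" "G.ran (q \<tau>) = ?y"
          using \<sigma> by (auto simp: fib_def supp_def function_support_def)
        have "\<tau> \<in> arrows \<Sigma>" using t(1) conv_off by metis
        then have "n \<tau> \<noteq> 0" using t(1) reg d by (auto simp: conv_diag_right)
        then show "\<alpha> \<in> {q \<sigma>}" using u'[OF _ s t(3)] t(2) by simp
      qed
    qed
    also have "conv n (del ?x) \<sigma> = n \<sigma> * del ?x (S.sou \<sigma>)" using reg d \<sigma> by (simp add: conv_diag_right)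
    finally have "1 = n \<sigma> * (del ?x (S.sou \<sigma>) * k (S.inv_of \<sigma> \<cdot> i (?y, 1)))"
      using npc_one(1)[OF nk s] by (simp add: npc_def mult.assoc)
    then show "n \<sigma> \<in> ring_units" by (intro ring_unitsI) (rule sym)
  qed
qed

lemma normalisers_eq: "n \<in> normalisers alg dia \<longleftrightarrow> nbis n"
  using normaliser_nbis nbis_normaliser by blast

end

section \<open>Ultrafilters of normalisers\<close>

context upp_twist
begin

section \<open>Arrows as ultrafilters\<close>

definition uf :: "'s \<Rightarrow> ('s \<Rightarrow> 'r) set" where
  "uf \<sigma> = {n. nbis n \<and> n \<sigma> = 1}"

lemma up_closure_eq: "up_closure alg dia U = {m. nbis m \<and> (\<exists>n\<in>U. normaliser_le alg dia n m)}"
  by (simp add: up_closure_def normalisers_eq)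

lemma le_self: "nbis n \<Longrightarrow> normaliser_le alg dia n n"
  by (simp add: nbis_le_iff)

lemma le_value: "nbis n \<Longrightarrow> nbis m \<Longrightarrow> normaliser_le alg dia n m \<Longrightarrow> n \<sigma> \<noteq> 0 \<Longrightarrow> m \<sigma> = n \<sigma>"
  by (simp add: nbis_le_iff)

lemma ind_le:
  assumes Y: "compact_open_bisection \<Sigma> Y" and m: "nbis m" "\<And>y. y \<in> Y \<Longrightarrow> m y = 1"
  shows "normaliser_le alg dia (ind Y) m"
  unfolding nbis_le_iff[OF nbis_ind[OF Y] m(1)]
proof (intro allI impI)
  note YS = cob_arrows[OF Y] cob_inj_q[OF Y]
  fix \<sigma> assume "ind Y \<sigma> \<noteq> 0"
  then obtain t y where t: "t \<in> ring_units" "y \<in> Y" "\<sigma> = act t y" using ind_nonzero by blast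
  have "y \<in> arrows \<Sigma>" using t YS by auto
  then show "m \<sigma> = ind Y \<sigma>" using t ind_act[OF YS t(2,1)] m by simp
qed

lemma uf_base:
  assumes "openin (arrow_topology \<Sigma>) O'" "\<sigma> \<in> O'"
  obtains Y where "compact_open_bisection \<Sigma> Y" "\<sigma> \<in> Y" "Y \<subseteq> O'" "ind Y \<in> uf \<sigma>"
proof -
  obtain Y where Y: "compact_open_bisection \<Sigma> Y" "\<sigma> \<in> Y" "Y \<subseteq> O'" "compact_open_bisection G (q ` Y)"
    by (rule total_base[OF assms])
  have "ind Y \<in> uf \<sigma>" using nbis_ind[OF Y(1)] ind_one[OF cob_arrows[OF Y(1)] cob_inj_q[OF Y(1)] Y(2)] by (simp add: uf_def)
  then show thesis using that Y by blast
qed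

lemma uf_nonempty: assumes "\<sigma> \<in> arrows \<Sigma>" shows "\<exists>n. n \<in> uf \<sigma>"
  using uf_base[OF openin_topspace assms] by metis

text \<open>A common lower bound of two members is the indicator of a compact open bisection through
  \<open>\<sigma>\<close> inside the set where both equal 1.\<close>

lemma uf_filter: assumes \<sigma>: "\<sigma> \<in> arrows \<Sigma>" shows "normaliser_filter alg dia (uf \<sigma>)"
  unfolding normaliser_filter_def
proof (intro conjI ballI)
  show "uf \<sigma> \<subseteq> normalisers alg dia - {\<zero>\<^bsub>alg\<^esub>}" by (auto simp: uf_def normalisers_eq)
  show "uf \<sigma> = up_closure alg dia (uf \<sigma>)"
  proof (intro equalityI subsetI)
    fix n assume "n \<in> uf \<sigma>"
    then show "n \<in> up_closure alg dia (uf \<sigma>)" using le_self by (auto simp: up_closure_eq uf_def)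
  next
    fix m assume "m \<in> up_closure alg dia (uf \<sigma>)"
    then obtain n where "nbis m" "n \<in> uf \<sigma>" "normaliser_le alg dia n m" by (auto simp: up_closure_eq)
    then show "m \<in> uf \<sigma>" using le_value[of n m \<sigma>] by (simp add: uf_def)
  qed
  fix m n assume mn: "m \<in> uf \<sigma>" "n \<in> uf \<sigma>"
  then have b: "nbis m" "nbis n" "m \<sigma> = 1" "n \<sigma> = 1" by (simp_all add: uf_def)
  let ?O = "{\<sigma> \<in> arrows \<Sigma>. m \<sigma> = 1} \<inter> {\<sigma> \<in> arrows \<Sigma>. n \<sigma> = 1}"
  have "openin (arrow_topology \<Sigma>) ?O" using b by (intro openin_Int stein_level) simp_all
  moreover have "\<sigma> \<in> ?O" using b \<sigma> by simp
  ultimately obtain Y where Y: "compact_open_bisection \<Sigma> Y" "\<sigma> \<in> Y" "Y \<subseteq> ?O" "ind Y \<in> uf \<sigma>" by (rule uf_base)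
  have "normaliser_le alg dia (ind Y) m" "normaliser_le alg dia (ind Y) n"
    using Y(3) by (auto intro!: ind_le[OF Y(1)] b)
  then show "\<exists>k\<in>uf \<sigma>. normaliser_le alg dia k m \<and> normaliser_le alg dia k n" using Y(4) by blast
qed

text \<open>The supports of the elements of a filter are compact and have the finite intersection
  property, so every filter converges to an arrow of \<open>\<Sigma>\<close>.\<close>

lemma filter_subset_uf:
  assumes F: "normaliser_filter alg dia F" "F \<noteq> {}"
  obtains \<sigma> where "\<sigma> \<in> arrows \<Sigma>" "F \<subseteq> uf \<sigma>"
proof -
  obtain n0 where n0: "n0 \<in> F" using F by auto
  have Fb: "nbis n \<and> n \<noteq> (\<lambda>\<sigma>. 0)" if "n \<in> F" for n
    using F(1) that normalisers_eq unfolding normaliser_filter_def by auto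
  have low: "\<exists>k\<in>F. normaliser_le alg dia k m \<and> normaliser_le alg dia k n" if "m \<in> F" "n \<in> F" for m n
    using F(1) that unfolding normaliser_filter_def by blast
  have supp_le: "supp k \<subseteq> supp n" if "k \<in> F" "n \<in> F" "normaliser_le alg dia k n" for k n
  proof
    fix \<alpha> assume "\<alpha> \<in> supp k"
    then obtain \<sigma> where "k \<sigma> \<noteq> 0" "\<alpha> = q \<sigma>" by (auto simp: supp_def function_support_def)
    then show "\<alpha> \<in> supp n" using le_value[of k n \<sigma>] that Fb suppI[of n \<sigma>] by simp
  qed
  have fin: "\<exists>k\<in>F. supp k \<subseteq> supp n0 \<inter> \<Inter>(supp ` \<N>)" if "finite \<N>" "\<N> \<subseteq> F" for \<N>
    using that
  proof (induction \<N> rule: finite_induct)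
    case empty then show ?case using n0 by (intro bexI[of _ n0]) auto
  next
    case (insert n \<N>)
    then obtain k where k: "k \<in> F" "supp k \<subseteq> supp n0 \<inter> \<Inter>(supp ` \<N>)" by auto
    obtain k' where k': "k' \<in> F" "normaliser_le alg dia k' k" "normaliser_le alg dia k' n"
      using low[of k n] k insert by auto
    have "supp k' \<subseteq> supp k" "supp k' \<subseteq> supp n" using supp_le k' k insert by auto
    then show ?case using k k' by (intro bexI[of _ k']) auto
  qed
  have "supp n0 \<inter> \<Inter>(supp ` F) \<noteq> {}"
  proof (rule compactin_fip[THEN iffD1, THEN conjunct2, rule_format])
    show "compactin (arrow_topology G) (supp n0)" using Fb[OF n0] by (simp add: stein_compact)
    show "(\<forall>C\<in>supp ` F. closedin (arrow_topology G) C) \<and>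
      (\<forall>\<F>. finite \<F> \<and> \<F> \<subseteq> supp ` F \<longrightarrow> supp n0 \<inter> \<Inter>\<F> \<noteq> {})"
    proof (intro conjI ballI allI impI)
      show "closedin (arrow_topology G) C" if "C \<in> supp ` F" for C
        using that Fb stein_supp_closed by auto
      fix \<F> assume "finite \<F> \<and> \<F> \<subseteq> supp ` F"
      then obtain \<N> where N: "finite \<N>" "\<N> \<subseteq> F" "\<F> = supp ` \<N>" using finite_subset_image by metis
      obtain k where k: "k \<in> F" "supp k \<subseteq> supp n0 \<inter> \<Inter>\<F>" using fin[OF N(1,2)] N(3) by auto
      obtain \<sigma> where "k \<sigma> \<noteq> 0" using Fb[OF k(1)] by (auto simp: fun_eq_iff)
      then have "q \<sigma> \<in> supp n0 \<inter> \<Inter>\<F>" using suppI[of k \<sigma>] k(2) by blast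
      then show "supp n0 \<inter> \<Inter>\<F> \<noteq> {}" by blast
    qed
  qed
  then obtain \<alpha> where a: "\<alpha> \<in> supp n0" "\<And>n. n \<in> F \<Longrightarrow> \<alpha> \<in> supp n" by auto
  \<comment> \<open>The intersection of the supports only yields an arrow of \<open>G\<close>. The
    normalisation \<open>n0 \<sigma> = 1\<close> selects the right lift in its fibre.\<close>
  then obtain \<sigma> where s: "\<sigma> \<in> arrows \<Sigma>" "n0 \<sigma> = 1" "\<alpha> = q \<sigma>"
    using nbis_level[of n0] Fb[OF n0] by auto
  have "F \<subseteq> uf \<sigma>"
  proof
    fix n assume n: "n \<in> F"
    \<comment> \<open>\<open>k\<close> is nonzero at \<open>\<sigma>\<close> and is a restriction of
      both \<open>n0\<close> and \<open>n\<close>, so all three take the value 1 there.\<close>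
    obtain k where k: "k \<in> F" "normaliser_le alg dia k n0" "normaliser_le alg dia k n" using low[OF n0 n] by auto
    have "k \<sigma> \<noteq> 0" using a(2)[OF k(1)] supp_iff[of k \<sigma>] s Fb[OF k(1)] by simp
    then have "n0 \<sigma> = k \<sigma>" "n \<sigma> = k \<sigma>" using le_value[of k] k Fb n n0 by blast+
    then show "n \<in> uf \<sigma>" using s(2) Fb[OF n] by (simp add: uf_def)
  qed
  then show thesis using that s by blast
qed

text \<open>Arrows over different points of \<open>G\<close> are separated by an indicator supported
  over a small neighbourhood. On one fibre, equivariance makes the scalar between the two arrows
  equal to 1.\<close>

lemma uf_subset:
  assumes \<sigma>: "\<sigma> \<in> arrows \<Sigma>" and \<tau>: "\<tau> \<in> arrows \<Sigma>" and sub: "uf \<sigma> \<subseteq> uf \<tau>"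
  shows "\<sigma> = \<tau>"
proof -
  have "q \<sigma> = q \<tau>"
  proof (rule ccontr)
    assume ne: "q \<sigma> \<noteq> q \<tau>"
    have "q \<sigma> \<in> arrows G" "q \<tau> \<in> arrows G" using \<sigma> \<tau> by auto
    then obtain A B where AB: "openin (arrow_topology G) A" "openin (arrow_topology G) B" "q \<sigma> \<in> A" "q \<tau> \<in> B" "disjnt A B"
      using Hausdorff ne unfolding Hausdorff_space_def by blast
    have "openin (arrow_topology \<Sigma>) {\<rho> \<in> arrows \<Sigma>. q \<rho> \<in> A}"
      by (rule openin_continuous_map_preimage[OF q_continuous AB(1)])
    moreover have "\<sigma> \<in> {\<rho> \<in> arrows \<Sigma>. q \<rho> \<in> A}" using \<sigma> AB by simp
    ultimately obtain Y where Y: "compact_open_bisection \<Sigma> Y" "\<sigma> \<in> Y" "Y \<subseteq> {\<rho> \<in> arrows \<Sigma>. q \<rho> \<in> A}" "ind Y \<in> uf \<sigma>"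
      by (rule uf_base)
    then have "ind Y \<tau> \<noteq> 0" using sub by (auto simp: uf_def)
    then obtain t y where t: "t \<in> ring_units" "y \<in> Y" "\<tau> = act t y" using ind_nonzero by blast
    then have "q \<tau> \<in> A" using Y(3) by auto
    then show False using AB by (auto simp: disjnt_def)
  qed
  then obtain t where t: "t \<in> ring_units" "\<tau> = act t \<sigma>" using fibre_transitive[OF \<sigma> \<tau>] by metis
  obtain n where n: "n \<in> uf \<sigma>" using uf_nonempty[OF \<sigma>] by auto
  then have "n \<in> uf \<tau>" using sub by auto
  moreover have "n (act t \<sigma>) = unit_inverse t * n \<sigma>"
    using n t(1) \<sigma> by (intro eqv_act) (simp_all add: uf_def)
  ultimately have "unit_inverse t = 1" using n t(2) by (simp add: uf_def)
  then have "t = 1" using unit_inverse_right[OF t(1)] by simp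
  then show ?thesis using t \<sigma> by simp
qed

lemma uf_inj: "inj_on uf (arrows \<Sigma>)"
  by (rule inj_onI) (rule uf_subset, auto)

text \<open>Every nonempty filter lies in some \<open>uf \<sigma>\<close>, and no inclusion between
  two of these is proper; so they are exactly the maximal filters.\<close>

lemma ultrafilters_eq: "ultrafilters alg dia = uf ` arrows \<Sigma>"
proof (intro equalityI subsetI)
  fix U assume "U \<in> ultrafilters alg dia"
  then have U: "normaliser_filter alg dia U" "U \<noteq> {}" "\<And>V. normaliser_filter alg dia V \<Longrightarrow> U \<subseteq> V \<Longrightarrow> V = U"
    by (auto simp: ultrafilters_def)
  obtain \<sigma> where "\<sigma> \<in> arrows \<Sigma>" "U \<subseteq> uf \<sigma>" by (rule filter_subset_uf[OF U(1,2)])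
  then show "U \<in> uf ` arrows \<Sigma>" using U(3)[OF uf_filter] by blast
next
  fix U assume "U \<in> uf ` arrows \<Sigma>"
  then obtain \<sigma> where s: "\<sigma> \<in> arrows \<Sigma>" "U = uf \<sigma>" by auto
  have "V = U" if V: "normaliser_filter alg dia V" "U \<subseteq> V" for V
  proof -
    have "V \<noteq> {}" using uf_nonempty[OF s(1)] V(2) s(2) by auto
    then obtain \<tau> where t: "\<tau> \<in> arrows \<Sigma>" "V \<subseteq> uf \<tau>" by (rule filter_subset_uf[OF V(1)])
    then have "\<sigma> = \<tau>" using uf_subset[OF s(1) t(1)] V(2) s(2) by auto
    then show ?thesis using V(2) t(2) s(2) by auto
  qed
  then show "U \<in> ultrafilters alg dia"
    using uf_filter[OF s(1)] uf_nonempty[OF s(1)] s(2) unfolding ultrafilters_def by auto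
qed

lemma idempotent_nbis: assumes e: "e \<in> idempotents alg dia" shows "nbis e"
proof -
  have d: "e \<in> dia" and v: "\<And>x. x \<in> units G \<Longrightarrow> e (i (x, 1)) = 0 \<or> e (i (x, 1)) = 1"
    using e idempotent_cases unfolding idempotents_iff by blast+
  have u: "q \<sigma> \<in> units G" if "e \<sigma> \<noteq> 0" for \<sigma> using dia_diag[OF d] that by (auto simp: diag_def)
  show ?thesis
  proof (rule nbisI)
    show "e \<in> stein" using d by simp
    show "q \<sigma> = q \<tau>" if "e \<sigma> \<noteq> 0" "e \<tau> \<noteq> 0" "G.ran (q \<sigma>) = G.ran (q \<tau>)" for \<sigma> \<tau>
      using u[OF that(1)] u[OF that(2)] that(3) by simp
    show "q \<sigma> = q \<tau>" if "e \<sigma> \<noteq> 0" "e \<tau> \<noteq> 0" "G.sou (q \<sigma>) = G.sou (q \<tau>)" for \<sigma> \<tau>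
      using u[OF that(1)] u[OF that(2)] that(3) by simp
    fix \<sigma> assume s: "e \<sigma> \<noteq> 0"
    have \<sigma>: "\<sigma> \<in> arrows \<Sigma>" using s d eqv_arrow[of e \<sigma>] by simp
    obtain t where t: "t \<in> ring_units" "\<sigma> = i (q \<sigma>, t)" by (rule fibre_unit[OF \<sigma> u[OF s]])
    then have a: "\<sigma> = act t (i (q \<sigma>, 1))" using u[OF s] by simp
    have "e \<sigma> = e (act t (i (q \<sigma>, 1)))" by (rule arg_cong[OF a])
    also have "\<dots> = unit_inverse t * e (i (q \<sigma>, 1))" using t(1) u[OF s] d by (intro eqv_act) simp_all
    finally have "e \<sigma> = unit_inverse t * e (i (q \<sigma>, 1))" .
    then show "e \<sigma> \<in> ring_units" using v[OF u[OF s]] s t(1) by auto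
  qed
qed

text \<open>Members of the right-hand side need not dominate the indicator of \<open>Y\<close>
  itself, only its restriction near \<open>\<sigma>\<close>. Multiplying by an idempotent that is 1
  at the source of \<open>\<sigma>\<close> performs this restriction, and the outcome does not
  depend on \<open>Y\<close>.\<close>

lemma point_ultrafilter_eq:
  assumes Y: "compact_open_bisection \<Sigma> Y" "\<sigma> \<in> Y"
  shows "point_ultrafilter \<Sigma> i q G Y \<sigma> = uf \<sigma>"
proof -
  note YS = cob_arrows[OF Y(1)] cob_inj_q[OF Y(1)]
  have \<sigma>: "\<sigma> \<in> arrows \<Sigma>" using Y YS by auto
  note n = nbis_ind[OF Y(1)]
  have n1: "ind Y \<sigma> = 1" by (rule ind_one[OF YS Y(2)])
  have val: "conv (ind Y) e \<tau> = ind Y \<tau> * e (S.sou \<tau>)" if "e \<in> dia" "\<tau> \<in> arrows \<Sigma>" for e \<tau>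
    using n that by (simp add: conv_diag_right)
  have "point_ultrafilter \<Sigma> i q G Y \<sigma> =
    {k. nbis k \<and> (\<exists>e. e \<in> idempotents alg dia \<and> e (S.sou \<sigma>) = 1 \<and> normaliser_le alg dia (conv (ind Y) e) k)}"
    unfolding point_ultrafilter_def Let_def up_closure_eq twisted_indicator_eq[OF Y(1)] alg_simps by blast
  also have "\<dots> = uf \<sigma>"
  proof (intro equalityI subsetI)
    fix k assume "k \<in> {k. nbis k \<and> (\<exists>e. e \<in> idempotents alg dia \<and> e (S.sou \<sigma>) = 1 \<and> normaliser_le alg dia (conv (ind Y) e) k)}"
    then obtain e where k: "nbis k" "e \<in> idempotents alg dia" "e (S.sou \<sigma>) = 1" "normaliser_le alg dia (conv (ind Y) e) k" by auto
    have e: "e \<in> dia" using k(2) by (simp add: idempotents_iff)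
    have "conv (ind Y) e \<sigma> = 1" using val[OF e \<sigma>] n1 k(3) by simp
    then show "k \<in> uf \<sigma>" using le_value[OF nbis_mult[OF n idempotent_nbis[OF k(2)]] k(1,4), of \<sigma>] k(1) by (simp add: uf_def)
  next
    fix k assume "k \<in> uf \<sigma>"
    then have k: "nbis k" "k \<sigma> = 1" by (simp_all add: uf_def)
    let ?O = "Y \<inter> {\<sigma> \<in> arrows \<Sigma>. k \<sigma> = 1}"
    have "openin (arrow_topology \<Sigma>) ?O" using k by (intro openin_Int stein_level cob_open[OF Y(1)]) simp
    moreover have "\<sigma> \<in> ?O" using Y k \<sigma> by simp
    ultimately obtain Y' where Y': "compact_open_bisection \<Sigma> Y'" "\<sigma> \<in> Y'" "Y' \<subseteq> ?O" "ind Y' \<in> uf \<sigma>"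
      by (rule uf_base)
    \<comment> \<open>Sources of a bisection \<open>Y'\<close> inside \<open>Y\<close> on which
      \<open>k\<close> equals 1. Injectivity of the source map on \<open>Y\<close> confines the
      restricted indicator to the fibres over \<open>Y'\<close>.\<close>
    let ?V = "src G ` q ` Y'"
    have V: "openin (arrow_topology G) ?V" "compactin (arrow_topology G) ?V" "?V \<subseteq> units G"
    proof -
      show "openin (arrow_topology G) ?V" by (rule G.open_sou_image[OF cob_image(2)[OF Y'(1)]])
      show "compactin (arrow_topology G) ?V" by (rule image_compactin[OF cob_image(1)[OF Y'(1)] G.continuous_sou'])
      show "?V \<subseteq> units G" using cob_arrows[OF Y'(1)] by auto
    qed
    have e: "ev ?V \<in> idempotents alg dia" by (rule ev_idempotent[OF V])
    have ed: "ev ?V \<in> dia" by (rule ev_dia[OF V])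
    have m: "nbis (conv (ind Y) (ev ?V))" by (rule nbis_mult[OF n idempotent_nbis[OF e]])
    have "normaliser_le alg dia (conv (ind Y) (ev ?V)) k"
      unfolding nbis_le_iff[OF m k(1)]
    proof (intro allI impI)
      fix \<tau> assume nz: "conv (ind Y) (ev ?V) \<tau> \<noteq> 0"
      have \<tau>: "\<tau> \<in> arrows \<Sigma>" by (rule nbis_arrow[OF m nz])
      note v = val[OF ed \<tau>] ev_sou[OF V \<tau>]
      have "ind Y \<tau> \<noteq> 0" and in_V: "G.sou (q \<tau>) \<in> ?V" using nz v by (auto split: if_splits)
      then obtain y where y: "y \<in> Y'" "G.sou (q \<tau>) = G.sou (q y)" by auto
      then have yY: "y \<in> Y" "k y = 1" "y \<in> arrows \<Sigma>" using Y'(3) by auto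
      have iy: "ind Y y = 1" by (rule ind_one[OF YS yY(1)])
      have "q y = q \<tau>" using nbis_sou[OF n _ \<open>ind Y \<tau> \<noteq> 0\<close>, of y] y iy by simp
      then obtain t where t: "t \<in> ring_units" "\<tau> = act t y" using fibre_transitive[OF yY(3) \<tau>] by metis
      have "ind Y \<tau> = unit_inverse t" "k \<tau> = unit_inverse t" using t yY iy n k(1) by simp_all
      then show "k \<tau> = conv (ind Y) (ev ?V) \<tau>" using v in_V by simp
    qed
    moreover have "ev ?V (S.sou \<sigma>) = 1" using ev_sou[OF V \<sigma>] Y'(2) by simp
    ultimately show "k \<in> {k. nbis k \<and> (\<exists>e. e \<in> idempotents alg dia \<and> e (S.sou \<sigma>) = 1 \<and> normaliser_le alg dia (conv (ind Y) e) k)}"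
      using k(1) e by blast
  qed
  finally show ?thesis .
qed

lemma ultrafilter_map_eq: assumes "\<sigma> \<in> arrows \<Sigma>" shows "ultrafilter_map \<Sigma> i q G \<sigma> = uf \<sigma>"
proof -
  have "\<exists>Y. compact_open_bisection \<Sigma> Y \<and> \<sigma> \<in> Y" using uf_base[OF openin_topspace assms] by metis
  then have "compact_open_bisection \<Sigma> (SOME Y. compact_open_bisection \<Sigma> Y \<and> \<sigma> \<in> Y) \<and>
    \<sigma> \<in> (SOME Y. compact_open_bisection \<Sigma> Y \<and> \<sigma> \<in> Y)" by (rule someI_ex)
  then show ?thesis unfolding ultrafilter_map_def using point_ultrafilter_eq by blast
qed

text \<open>A basic open set of ultrafilters pulls back to the level set \<open>n = 1\<close>.
  Conversely, the basic set of the indicator of \<open>Y\<close> is the image of \<open>Y\<close>,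
  because inside a fibre meeting \<open>Y\<close> only the point of \<open>Y\<close> has value
  1.\<close>

lemma uf_homeomorphic: "homeomorphic_map (arrow_topology \<Sigma>) (ultrafilter_topology alg dia) uf"
proof (rule bijective_open_imp_homeomorphic_map)
  have top: "topspace (ultrafilter_topology alg dia) = uf ` arrows \<Sigma>"
    by (simp add: topspace_ultrafilter_topology ultrafilters_eq)
  show "uf ` arrows \<Sigma> = topspace (ultrafilter_topology alg dia)" by (simp add: top)
  show "inj_on uf (arrows \<Sigma>)" by (rule uf_inj)
  have base: "openin (ultrafilter_topology alg dia) {U \<in> ultrafilters alg dia. n \<in> U}" if "nbis n" for n
    unfolding openin_ultrafilter_topology using that normalisers_eq
    by (intro union_of_inc) (auto simp: arbitrary_def)
  show "continuous_map (arrow_topology \<Sigma>) (ultrafilter_topology alg dia) uf"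
    unfolding continuous_map_def
  proof (intro conjI allI impI)
    show "uf \<in> arrows \<Sigma> \<rightarrow> topspace (ultrafilter_topology alg dia)" unfolding top by auto
    fix V assume "openin (ultrafilter_topology alg dia) V"
    then obtain \<V> where V: "V = \<Union>\<V>" "\<And>W. W \<in> \<V> \<Longrightarrow> \<exists>n\<in>normalisers alg dia. W = {U \<in> ultrafilters alg dia. n \<in> U}"
      unfolding openin_ultrafilter_topology union_of_def by auto
    have "openin (arrow_topology \<Sigma>) {\<sigma> \<in> arrows \<Sigma>. uf \<sigma> \<in> W}" if WV: "W \<in> \<V>" for W
    proof -
      obtain n where n: "nbis n" "W = {U \<in> ultrafilters alg dia. n \<in> U}" using V(2)[OF WV] normalisers_eq by auto
      have "{\<sigma> \<in> arrows \<Sigma>. uf \<sigma> \<in> W} = {\<sigma> \<in> arrows \<Sigma>. n \<sigma> = 1}"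
        using n by (auto simp: ultrafilters_eq uf_def)
      then show ?thesis using stein_level n by simp
    qed
    moreover have "{\<sigma> \<in> arrows \<Sigma>. uf \<sigma> \<in> V} = (\<Union>W\<in>\<V>. {\<sigma> \<in> arrows \<Sigma>. uf \<sigma> \<in> W})" using V(1) by auto
    ultimately show "openin (arrow_topology \<Sigma>) {\<sigma> \<in> arrows \<Sigma>. uf \<sigma> \<in> V}" by (auto intro!: openin_Union)
  qed
  show "open_map (arrow_topology \<Sigma>) (ultrafilter_topology alg dia) uf"
    unfolding open_map_def
  proof (intro allI impI)
    fix O' assume O: "openin (arrow_topology \<Sigma>) O'"
    show "openin (ultrafilter_topology alg dia) (uf ` O')"
    proof (subst openin_subopen, intro ballI)
      fix U assume "U \<in> uf ` O'"
      then obtain \<sigma> where s: "\<sigma> \<in> O'" "U = uf \<sigma>" by auto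
      obtain Y where Y: "compact_open_bisection \<Sigma> Y" "\<sigma> \<in> Y" "Y \<subseteq> O'" "ind Y \<in> uf \<sigma>" by (rule uf_base[OF O s(1)])
      note YS = cob_arrows[OF Y(1)] cob_inj_q[OF Y(1)]
      have "{U \<in> ultrafilters alg dia. ind Y \<in> U} \<subseteq> uf ` O'"
      proof
        fix W assume "W \<in> {U \<in> ultrafilters alg dia. ind Y \<in> U}"
        then obtain \<tau> where t: "\<tau> \<in> arrows \<Sigma>" "W = uf \<tau>" "ind Y \<tau> = 1" by (auto simp: ultrafilters_eq uf_def)
        then obtain u y where u: "u \<in> ring_units" "y \<in> Y" "\<tau> = act u y" using ind_nonzero[of Y \<tau>] by auto
        have "unit_inverse u = 1" using ind_act[OF YS u(2,1)] u t by simp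
        then have "u = 1" using unit_inverse_right[OF u(1)] by simp
        then have "\<tau> = y" using u YS by auto
        then show "W \<in> uf ` O'" using u Y t by auto
      qed
      moreover have "U \<in> {U \<in> ultrafilters alg dia. ind Y \<in> U}"
        using s Y openin_subset[OF O] by (auto simp: ultrafilters_eq)
      ultimately show "\<exists>T. openin (ultrafilter_topology alg dia) T \<and> U \<in> T \<and> T \<subseteq> uf ` O'"
        using base[OF nbis_ind[OF Y(1)]] by blast
    qed
  qed
qed

section \<open>Groupoid operations, scalars and quotient on ultrafilters\<close>

abbreviation ufg where "ufg \<equiv> ultrafilter_groupoid alg dia"

lemma ufg_simps [simp]: "arrow_topology ufg = ultrafilter_topology alg dia"
  "gmult ufg U V = up_closure alg dia {m \<otimes>\<^bsub>alg\<^esub> n | m n. m \<in> U \<and> n \<in> V}"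
  "ginv ufg U = dagger alg dia ` U"
  by (simp_all add: ultrafilter_groupoid_def)

text \<open>If the source of \<open>q \<sigma>\<close> and the range of \<open>q \<tau>\<close>
  differ, disjoint neighbourhoods of them give indicators near \<open>\<sigma>\<close> and
  \<open>\<tau>\<close> with zero product. If they agree, the product at
  \<open>\<sigma> \<cdot> \<tau>\<close> is 1.\<close>

lemma uf_composable:
  assumes \<sigma>: "\<sigma> \<in> arrows \<Sigma>" and \<tau>: "\<tau> \<in> arrows \<Sigma>"
  shows "(\<forall>m\<in>uf \<sigma>. \<forall>n\<in>uf \<tau>. conv m n \<noteq> (\<lambda>\<sigma>. 0)) \<longleftrightarrow> G.sou (q \<sigma>) = G.ran (q \<tau>)"
proof
  assume c: "G.sou (q \<sigma>) = G.ran (q \<tau>)"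
  show "\<forall>m\<in>uf \<sigma>. \<forall>n\<in>uf \<tau>. conv m n \<noteq> (\<lambda>\<sigma>. 0)"
  proof (intro ballI notI)
    fix m n assume mn: "m \<in> uf \<sigma>" "n \<in> uf \<tau>" and z: "conv m n = (\<lambda>\<sigma>. 0)"
    have "conv m n (\<sigma> \<cdot> \<tau>) = m \<sigma> * n \<tau>" using mn c \<tau> by (intro nbis_conv_mul) (auto simp: uf_def)
    then show False using z mn by (simp add: uf_def)
  qed
next
  assume nz: "\<forall>m\<in>uf \<sigma>. \<forall>n\<in>uf \<tau>. conv m n \<noteq> (\<lambda>\<sigma>. 0)"
  show "G.sou (q \<sigma>) = G.ran (q \<tau>)"
  proof (rule ccontr)
    assume ne: "G.sou (q \<sigma>) \<noteq> G.ran (q \<tau>)"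
    have "G.sou (q \<sigma>) \<in> arrows G" "G.ran (q \<tau>) \<in> arrows G" using \<sigma> \<tau> by auto
    then obtain A B where AB: "openin (arrow_topology G) A" "openin (arrow_topology G) B" "G.sou (q \<sigma>) \<in> A" "G.ran (q \<tau>) \<in> B" "disjnt A B"
      using Hausdorff ne unfolding Hausdorff_space_def by blast
    have c: "continuous_map (arrow_topology \<Sigma>) (arrow_topology G) (\<lambda>\<sigma>. G.sou (q \<sigma>))"
      "continuous_map (arrow_topology \<Sigma>) (arrow_topology G) (\<lambda>\<sigma>. G.ran (q \<sigma>))"
      using continuous_map_compose[OF q_continuous G.continuous_sou'] continuous_map_compose[OF q_continuous G.continuous_ran']
      by (simp_all add: o_def)
    have "\<sigma> \<in> {\<rho> \<in> arrows \<Sigma>. G.sou (q \<rho>) \<in> A}" using \<sigma> AB by simp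
    then obtain Y where Y: "compact_open_bisection \<Sigma> Y" "\<sigma> \<in> Y" "Y \<subseteq> {\<rho> \<in> arrows \<Sigma>. G.sou (q \<rho>) \<in> A}" "ind Y \<in> uf \<sigma>"
      by (rule uf_base[OF openin_continuous_map_preimage[OF c(1) AB(1)]])
    have "\<tau> \<in> {\<rho> \<in> arrows \<Sigma>. G.ran (q \<rho>) \<in> B}" using \<tau> AB by simp
    then obtain Z where Z: "compact_open_bisection \<Sigma> Z" "\<tau> \<in> Z" "Z \<subseteq> {\<rho> \<in> arrows \<Sigma>. G.ran (q \<rho>) \<in> B}" "ind Z \<in> uf \<tau>"
      by (rule uf_base[OF openin_continuous_map_preimage[OF c(2) AB(2)]])
    have "conv (ind Y) (ind Z) \<noteq> (\<lambda>\<sigma>. 0)" using nz Y(4) Z(4) by blast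
    then obtain \<rho> where r: "conv (ind Y) (ind Z) \<rho> \<noteq> 0" by (auto simp: fun_eq_iff)
    have eZ: "eqv (ind Z)" using Z(1) by simp
    obtain a b where ab: "ind Y a \<noteq> 0" "ind Z b \<noteq> 0" "a \<in> arrows \<Sigma>" "b \<in> arrows \<Sigma>" "G.sou (q a) = G.ran (q b)"
      "\<rho> = a \<cdot> b" "conv (ind Y) (ind Z) \<rho> = ind Y a * ind Z b" by (rule nbis_conv_nonzero[OF nbis_ind[OF Y(1)] eZ r])
    obtain t y where y: "t \<in> ring_units" "y \<in> Y" "a = act t y" using ind_nonzero[OF ab(1)] by blast
    obtain u z where z: "u \<in> ring_units" "z \<in> Z" "b = act u z" using ind_nonzero[OF ab(2)] by blast
    have "G.sou (q a) \<in> A" using y Y(3) by auto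
    moreover have "G.ran (q b) \<in> B" using z Z(3) by auto
    ultimately show False using ab(5) AB(5) by (auto simp: disjnt_def)
  qed
qed

lemma ufg_composable: "composable ufg = (\<lambda>(\<sigma>, \<tau>). (uf \<sigma>, uf \<tau>)) ` composable \<Sigma>"
proof (intro equalityI subsetI)
  fix p assume "p \<in> composable ufg"
  then obtain U V where p: "p = (U, V)" "U \<in> ultrafilters alg dia" "V \<in> ultrafilters alg dia"
    "\<forall>m \<in> U. \<forall>n \<in> V. conv m n \<noteq> (\<lambda>\<sigma>. 0)" by (auto simp: ultrafilter_groupoid_def)
  then obtain \<sigma> \<tau> where s: "\<sigma> \<in> arrows \<Sigma>" "\<tau> \<in> arrows \<Sigma>" "U = uf \<sigma>" "V = uf \<tau>" by (auto simp: ultrafilters_eq)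
  then have "(\<sigma>, \<tau>) \<in> composable \<Sigma>" using uf_composable[OF s(1,2)] p(4) by (simp add: S.composable_iff composable_eq)
  then show "p \<in> (\<lambda>(\<sigma>, \<tau>). (uf \<sigma>, uf \<tau>)) ` composable \<Sigma>" using p s by force
next
  fix p assume "p \<in> (\<lambda>(\<sigma>, \<tau>). (uf \<sigma>, uf \<tau>)) ` composable \<Sigma>"
  then obtain \<sigma> \<tau> where s: "(\<sigma>, \<tau>) \<in> composable \<Sigma>" "p = (uf \<sigma>, uf \<tau>)" by auto
  then have S: "\<sigma> \<in> arrows \<Sigma>" "\<tau> \<in> arrows \<Sigma>" "G.sou (q \<sigma>) = G.ran (q \<tau>)"
    by (auto simp: S.composable_iff composable_eq)
  then have "\<forall>m\<in>uf \<sigma>. \<forall>n\<in>uf \<tau>. conv m n \<noteq> (\<lambda>\<sigma>. 0)" using uf_composable by blast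
  then show "p \<in> composable ufg" using s(2) S by (auto simp: ultrafilter_groupoid_def ultrafilters_eq)
qed

text \<open>For \<open>k\<close> in \<open>uf (\<sigma> \<cdot> \<tau>)\<close> take any
  \<open>m\<close> in \<open>uf \<sigma>\<close> and divide: \<open>dag m\<close> times
  \<open>k\<close> lies in \<open>uf \<tau>\<close>, and multiplying it by \<open>m\<close> gives
  the restriction of \<open>k\<close> to the ranges of the support of \<open>m\<close>, which lies
  below \<open>k\<close>.\<close>

lemma ufg_mult:
  assumes "(\<sigma>, \<tau>) \<in> composable \<Sigma>" shows "gmult ufg (uf \<sigma>) (uf \<tau>) = uf (\<sigma> \<cdot> \<tau>)"
proof -
  have S: "\<sigma> \<in> arrows \<Sigma>" "\<tau> \<in> arrows \<Sigma>" "S.sou \<sigma> = S.ran \<tau>" "G.sou (q \<sigma>) = G.ran (q \<tau>)"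
    using assms by (auto simp: S.composable_iff composable_eq)
  have mult: "conv m n (\<sigma> \<cdot> \<tau>) = 1" if "m \<in> uf \<sigma>" "n \<in> uf \<tau>" for m n
    using nbis_conv_mul[of m n \<sigma> \<tau>] that S by (simp add: uf_def)
  have "up_closure alg dia {conv m n | m n. m \<in> uf \<sigma> \<and> n \<in> uf \<tau>} = uf (\<sigma> \<cdot> \<tau>)"
  proof (intro equalityI subsetI)
    fix k assume "k \<in> up_closure alg dia {conv m n | m n. m \<in> uf \<sigma> \<and> n \<in> uf \<tau>}"
    then obtain m n where k: "nbis k" "m \<in> uf \<sigma>" "n \<in> uf \<tau>" "normaliser_le alg dia (conv m n) k"
      by (auto simp: up_closure_eq)
    then have "nbis (conv m n)" by (auto simp: uf_def intro: nbis_mult)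
    then show "k \<in> uf (\<sigma> \<cdot> \<tau>)" using le_value[OF _ k(1,4), of "\<sigma> \<cdot> \<tau>"] mult[OF k(2,3)] k(1) by (simp add: uf_def)
  next
    fix k assume "k \<in> uf (\<sigma> \<cdot> \<tau>)"
    then have k: "nbis k" "k (\<sigma> \<cdot> \<tau>) = 1" by (simp_all add: uf_def)
    obtain m where m: "m \<in> uf \<sigma>" using uf_nonempty[OF S(1)] by auto
    then have mb: "nbis m" "m \<sigma> = 1" by (simp_all add: uf_def)
    note d = nbis_dag[OF mb(1)]
    have "conv (dag m) k (S.inv_of \<sigma> \<cdot> (\<sigma> \<cdot> \<tau>)) = dag m (S.inv_of \<sigma>) * k (\<sigma> \<cdot> \<tau>)"
      using d k S mb by (intro nbis_conv_mul) simp_all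
    then have "conv (dag m) k \<tau> = 1" using S mb k by simp
    then have n: "conv (dag m) k \<in> uf \<tau>" using nbis_mult[OF d k(1)] by (simp add: uf_def)
    have "normaliser_le alg dia (conv m (conv (dag m) k)) k"
      unfolding nbis_le_iff[OF nbis_mult[OF mb(1) nbis_mult[OF d k(1)]] k(1)]
    proof (intro allI impI)
      fix \<rho> assume nz: "conv m (conv (dag m) k) \<rho> \<noteq> 0"
      have \<rho>: "\<rho> \<in> arrows \<Sigma>" using nz conv_off by metis
      have "conv m (conv (dag m) k) = conv (conv m (dag m)) k" using mb d k by (simp add: conv_assoc)
      then have "conv m (conv (dag m) k) \<rho> = (if \<exists>\<tau>. m \<tau> \<noteq> 0 \<and> G.ran (q \<tau>) = G.ran (q \<rho>) then k \<rho> else 0)"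
        using conv_conv_dag[OF mb(1) _ \<rho>, of k] k by simp
      then show "k \<rho> = conv m (conv (dag m) k) \<rho>" using nz by presburger
    qed
    then show "k \<in> up_closure alg dia {conv m n | m n. m \<in> uf \<sigma> \<and> n \<in> uf \<tau>}"
      unfolding up_closure_eq using k(1) m n by blast
  qed
  then show ?thesis by simp
qed

lemma ufg_inv: assumes \<sigma>: "\<sigma> \<in> arrows \<Sigma>" shows "ginv ufg (uf \<sigma>) = uf (S.inv_of \<sigma>)"
proof -
  have 1: "dag n \<in> uf (S.inv_of \<sigma>)" if "n \<in> uf \<sigma>" "\<sigma> \<in> arrows \<Sigma>" for n \<sigma>
    using that nbis_dag by (simp add: uf_def)
  have "dagger alg dia ` uf \<sigma> = uf (S.inv_of \<sigma>)"
  proof (intro equalityI subsetI)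
    fix m assume "m \<in> dagger alg dia ` uf \<sigma>"
    then obtain n where "n \<in> uf \<sigma>" "m = dagger alg dia n" by auto
    then show "m \<in> uf (S.inv_of \<sigma>)" using 1[OF _ \<sigma>] dagger_eq by (auto simp: uf_def)
  next
    fix m assume m: "m \<in> uf (S.inv_of \<sigma>)"
    then have b: "nbis m" by (simp add: uf_def)
    have "dag m \<in> uf \<sigma>" using 1[OF m] \<sigma> by simp
    moreover have "m = dagger alg dia (dag m)" using dagger_eq[OF nbis_dag[OF b]] dag_dag[OF b] by simp
    ultimately show "m \<in> dagger alg dia ` uf \<sigma>" by blast
  qed
  then show ?thesis by simp
qed

text \<open>Moving the arrow by \<open>t\<close> multiplies values by the inverse of
  \<open>t\<close>, which scaling the normaliser by \<open>t\<close> compensates.\<close>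

lemma scale_uf: assumes \<sigma>: "\<sigma> \<in> arrows \<Sigma>" and t: "t \<in> ring_units"
  shows "scale_set alg t (uf \<sigma>) = uf (act t \<sigma>)"
proof (intro equalityI subsetI)
  fix n assume "n \<in> scale_set alg t (uf \<sigma>)"
  then obtain m where m: "nbis m" "m \<sigma> = 1" "n = (\<lambda>\<sigma>. t * m \<sigma>)" by (auto simp: scale_set_def uf_def)
  then show "n \<in> uf (act t \<sigma>)" using nbis_smult[OF m(1) t] \<sigma> t by (simp add: uf_def)
next
  fix n assume "n \<in> uf (act t \<sigma>)"
  then have n: "nbis n" "n (act t \<sigma>) = 1" by (simp_all add: uf_def)
  let ?m = "\<lambda>\<sigma>. unit_inverse t * n \<sigma>"
  have "nbis ?m" using nbis_smult[OF n(1)] t by simp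
  moreover have "?m \<sigma> = 1" using n \<sigma> t by simp
  moreover have "n = (\<lambda>\<sigma>. t * ?m \<sigma>)" using t by simp
  ultimately show "n \<in> scale_set alg t (uf \<sigma>)" 
    unfolding scale_set_def uf_def alg_simps by (intro CollectI exI[of _ ?m]) simp
qed

abbreviation ufq where "ufq \<equiv> ultrafilter_quotient alg dia"

lemma ufq_uf: assumes \<sigma>: "\<sigma> \<in> arrows \<Sigma>"
  shows "ufq (uf \<sigma>) = uf ` {\<tau> \<in> arrows \<Sigma>. q \<tau> = q \<sigma>}"
proof (intro equalityI subsetI)
  fix W assume "W \<in> ufq (uf \<sigma>)"
  then obtain \<tau> t where t: "\<tau> \<in> arrows \<Sigma>" "W = uf \<tau>" "t \<in> ring_units" "uf \<sigma> = scale_set alg t (uf \<tau>)"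
    by (auto simp: ultrafilter_quotient_def ultrafilters_eq)
  then have "uf \<sigma> = uf (act t \<tau>)" using scale_uf by simp
  then have "\<sigma> = act t \<tau>" using inj_onD[OF uf_inj] \<sigma> t by simp
  then show "W \<in> uf ` {\<tau> \<in> arrows \<Sigma>. q \<tau> = q \<sigma>}" using t by auto
next
  fix W assume "W \<in> uf ` {\<tau> \<in> arrows \<Sigma>. q \<tau> = q \<sigma>}"
  then obtain \<tau> where t: "\<tau> \<in> arrows \<Sigma>" "q \<tau> = q \<sigma>" "W = uf \<tau>" by auto
  obtain u where u: "u \<in> ring_units" "\<sigma> = act u \<tau>" using fibre_transitive[OF t(1) \<sigma> t(2)] by metis
  then have "uf \<sigma> = scale_set alg u (uf \<tau>)" using scale_uf t by simp
  then show "W \<in> ufq (uf \<sigma>)" using t u by (auto simp: ultrafilter_quotient_def ultrafilters_eq)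
qed

lemma ufq_eq_iff: "\<sigma> \<in> arrows \<Sigma> \<Longrightarrow> \<tau> \<in> arrows \<Sigma> \<Longrightarrow> ufq (uf \<sigma>) = ufq (uf \<tau>) \<longleftrightarrow> q \<sigma> = q \<tau>"
proof
  assume a: "\<sigma> \<in> arrows \<Sigma>" "\<tau> \<in> arrows \<Sigma>" "ufq (uf \<sigma>) = ufq (uf \<tau>)"
  then have "uf \<sigma> \<in> uf ` {\<rho> \<in> arrows \<Sigma>. q \<rho> = q \<tau>}" using ufq_uf by blast
  then obtain \<rho> where "\<rho> \<in> arrows \<Sigma>" "q \<rho> = q \<tau>" "uf \<sigma> = uf \<rho>" by auto
  then show "q \<sigma> = q \<tau>" using inj_onD[OF uf_inj] a by metis
qed (simp add: ufq_uf)

end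

section \<open>Isomorphisms of groupoids and twists\<close>

text \<open>The target is not assumed to be a groupoid, since its axioms are to be transported. The
  clauses about the source are those that ranges, sources and units need in order to be carried
  along; they can be read off directly for the trivial bundle.\<close>

definition groupoid_isomorphism :: "'a groupoid \<Rightarrow> 'b groupoid \<Rightarrow> ('a \<Rightarrow> 'b) \<Rightarrow> bool" where
  "groupoid_isomorphism \<Gamma> \<Gamma>' \<phi> \<longleftrightarrow> homeomorphic_map (arrow_topology \<Gamma>) (arrow_topology \<Gamma>') \<phi> \<and>
    composable \<Gamma> \<subseteq> arrows \<Gamma> \<times> arrows \<Gamma> \<and>
    (\<forall>a \<in> arrows \<Gamma>. (a, ginv \<Gamma> a) \<in> composable \<Gamma> \<and> (ginv \<Gamma> a, a) \<in> composable \<Gamma> \<and> ginv \<Gamma> (ginv \<Gamma> a) = a) \<and>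
    composable \<Gamma>' = (\<lambda>(a, b). (\<phi> a, \<phi> b)) ` composable \<Gamma> \<and>
    (\<forall>a b. (a, b) \<in> composable \<Gamma> \<longrightarrow> gmult \<Gamma>' (\<phi> a) (\<phi> b) = \<phi> (gmult \<Gamma> a b)) \<and>
    (\<forall>a \<in> arrows \<Gamma>. ginv \<Gamma>' (\<phi> a) = \<phi> (ginv \<Gamma> a))"

locale gpd_iso =
  fixes \<Gamma> :: "'a groupoid" and \<Gamma>' :: "'b groupoid" and \<phi> :: "'a \<Rightarrow> 'b"
  assumes iso: "groupoid_isomorphism \<Gamma> \<Gamma>' \<phi>"
begin

lemma homeo: "homeomorphic_map (arrow_topology \<Gamma>) (arrow_topology \<Gamma>') \<phi>"
  and comp_arrows: "(a, b) \<in> composable \<Gamma> \<Longrightarrow> a \<in> arrows \<Gamma> \<and> b \<in> arrows \<Gamma>"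
  and comp_inv: "a \<in> arrows \<Gamma> \<Longrightarrow> (a, ginv \<Gamma> a) \<in> composable \<Gamma>" "a \<in> arrows \<Gamma> \<Longrightarrow> (ginv \<Gamma> a, a) \<in> composable \<Gamma>"
    "a \<in> arrows \<Gamma> \<Longrightarrow> ginv \<Gamma> (ginv \<Gamma> a) = a"
  and comp_image: "composable \<Gamma>' = (\<lambda>(a, b). (\<phi> a, \<phi> b)) ` composable \<Gamma>"
  and mult_image: "(a, b) \<in> composable \<Gamma> \<Longrightarrow> gmult \<Gamma>' (\<phi> a) (\<phi> b) = \<phi> (gmult \<Gamma> a b)"
  and inv_image: "a \<in> arrows \<Gamma> \<Longrightarrow> ginv \<Gamma>' (\<phi> a) = \<phi> (ginv \<Gamma> a)"
  using iso unfolding groupoid_isomorphism_def by blast+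

lemma arrows_image: "arrows \<Gamma>' = \<phi> ` arrows \<Gamma>"
  using homeomorphic_imp_surjective_map[OF homeo] by simp

lemma inj: "inj_on \<phi> (arrows \<Gamma>)"
  by (rule homeomorphic_imp_injective_map[OF homeo])

lemma inj_iff: "a \<in> arrows \<Gamma> \<Longrightarrow> b \<in> arrows \<Gamma> \<Longrightarrow> \<phi> a = \<phi> b \<longleftrightarrow> a = b"
  by (rule inj_on_eq_iff[OF inj])

lemma arrow: "a \<in> arrows \<Gamma> \<Longrightarrow> \<phi> a \<in> arrows \<Gamma>'"
  by (simp add: arrows_image)

lemma comp_iff: assumes "a \<in> arrows \<Gamma>" "b \<in> arrows \<Gamma>"
  shows "(\<phi> a, \<phi> b) \<in> composable \<Gamma>' \<longleftrightarrow> (a, b) \<in> composable \<Gamma>"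
proof
  assume "(\<phi> a, \<phi> b) \<in> composable \<Gamma>'"
  then obtain c d where c: "(c, d) \<in> composable \<Gamma>" "\<phi> a = \<phi> c" "\<phi> b = \<phi> d" unfolding comp_image by auto
  then have "a = c" "b = d" using assms comp_arrows[OF c(1)] inj_iff by auto
  then show "(a, b) \<in> composable \<Gamma>" using c by simp
qed (auto simp: comp_image)

lemma comp_cases:
  assumes "(a', b') \<in> composable \<Gamma>'"
  obtains a b where "a' = \<phi> a" "b' = \<phi> b" "(a, b) \<in> composable \<Gamma>" "a \<in> arrows \<Gamma>" "b \<in> arrows \<Gamma>"
proof -
  obtain a b where "(a, b) \<in> composable \<Gamma>" "a' = \<phi> a" "b' = \<phi> b"
    using assms unfolding comp_image by auto
  then show thesis using that comp_arrows by blast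
qed

lemma rng_image: "a \<in> arrows \<Gamma> \<Longrightarrow> rng \<Gamma>' (\<phi> a) = \<phi> (rng \<Gamma> a)"
  and src_image: "a \<in> arrows \<Gamma> \<Longrightarrow> src \<Gamma>' (\<phi> a) = \<phi> (src \<Gamma> a)"
  using mult_image comp_inv inv_image by (simp_all add: rng_def src_def)

lemma units_image: "units \<Gamma>' = \<phi> ` units \<Gamma>"
  unfolding units_def arrows_image image_image by (rule image_cong) (simp_all add: rng_image)

lemma homeo_units:
  assumes "units \<Gamma> \<subseteq> arrows \<Gamma>"
  shows "homeomorphic_map (unit_space \<Gamma>) (unit_space \<Gamma>') \<phi>"
proof (rule homeomorphic_map_subtopologies[OF homeo])
  have "arrows \<Gamma> \<inter> units \<Gamma> = units \<Gamma>" "arrows \<Gamma>' \<inter> units \<Gamma>' = units \<Gamma>'"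
    using assms unfolding units_image arrows_image by auto
  then show "\<phi> ` (arrows \<Gamma> \<inter> units \<Gamma>) = arrows \<Gamma>' \<inter> units \<Gamma>'" by (simp add: units_image)
qed

lemma topological_groupoid_iso:
  assumes "\<And>a b. (a, b) \<in> composable \<Gamma> \<Longrightarrow> gmult \<Gamma> a b \<in> arrows \<Gamma>"
  shows "topological_groupoid_iso \<Gamma> \<Gamma>' \<phi>"
  unfolding topological_groupoid_iso_def groupoid_hom_def
  using homeo arrow comp_iff comp_arrows mult_image by (auto simp: comp_image)

lemma algebraic_image:
  assumes "algebraic_groupoid \<Gamma>" shows "algebraic_groupoid \<Gamma>'"
proof -
  interpret g: gpd \<Gamma> by unfold_locales fact
  show ?thesis unfolding algebraic_groupoid_def
  proof (intro conjI)
    show "composable \<Gamma>' \<subseteq> arrows \<Gamma>' \<times> arrows \<Gamma>'"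
      using comp_arrows arrow by (auto simp: comp_image)
    show "\<forall>(a, b)\<in>composable \<Gamma>'. gmult \<Gamma>' a b \<in> arrows \<Gamma>'"
      using g.composableD mult_image arrow by (auto simp: comp_image)
    show "\<forall>a\<in>arrows \<Gamma>'. ginv \<Gamma>' a \<in> arrows \<Gamma>' \<and> ginv \<Gamma>' (ginv \<Gamma>' a) = a \<and>
       (ginv \<Gamma>' a, a) \<in> composable \<Gamma>' \<and> (a, ginv \<Gamma>' a) \<in> composable \<Gamma>'"
      unfolding arrows_image by (auto simp: inv_image comp_iff comp_inv)
    show "\<forall>a b c. (a, b) \<in> composable \<Gamma>' \<and> (b, c) \<in> composable \<Gamma>' \<longrightarrow>
       (gmult \<Gamma>' a b, c) \<in> composable \<Gamma>' \<and> (a, gmult \<Gamma>' b c) \<in> composable \<Gamma>' \<and>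
       gmult \<Gamma>' (gmult \<Gamma>' a b) c = gmult \<Gamma>' a (gmult \<Gamma>' b c)"
    proof (intro allI impI, elim conjE)
      fix a' b' c' assume ab: "(a', b') \<in> composable \<Gamma>'" and bc: "(b', c') \<in> composable \<Gamma>'"
      obtain a b where a: "a' = \<phi> a" "b' = \<phi> b" "(a, b) \<in> composable \<Gamma>" "a \<in> arrows \<Gamma>" "b \<in> arrows \<Gamma>"
        by (rule comp_cases[OF ab])
      obtain b1 c where c: "b' = \<phi> b1" "c' = \<phi> c" "(b1, c) \<in> composable \<Gamma>" "b1 \<in> arrows \<Gamma>" "c \<in> arrows \<Gamma>"
        by (rule comp_cases[OF bc])
      have "b1 = b" using inj_iff[OF c(4) a(5)] a(2) c(1) by simp
      then have bc: "(b, c) \<in> composable \<Gamma>" using c by simp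
      note as = g.composable_assoc[OF a(3) bc]
      have m: "gmult \<Gamma> a b \<in> arrows \<Gamma>" "gmult \<Gamma> b c \<in> arrows \<Gamma>" using g.composableD[OF a(3)] g.composableD[OF bc] by auto
      show "(gmult \<Gamma>' a' b', c') \<in> composable \<Gamma>' \<and> (a', gmult \<Gamma>' b' c') \<in> composable \<Gamma>' \<and>
        gmult \<Gamma>' (gmult \<Gamma>' a' b') c' = gmult \<Gamma>' a' (gmult \<Gamma>' b' c')"
        unfolding a(1,2) c(2) mult_image[OF a(3)] mult_image[OF bc]
        using comp_iff[OF m(1) c(5)] comp_iff[OF a(4) m(2)] as mult_image[OF as(1)] mult_image[OF as(2)] by simp
    qed
    show "\<forall>(a, b)\<in>composable \<Gamma>'. gmult \<Gamma>' (ginv \<Gamma>' a) (gmult \<Gamma>' a b) = b \<and> gmult \<Gamma>' (gmult \<Gamma>' a b) (ginv \<Gamma>' b) = a"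
    proof clarify
      fix a' b' assume ab: "(a', b') \<in> composable \<Gamma>'"
      obtain a b where a: "a' = \<phi> a" "b' = \<phi> b" "(a, b) \<in> composable \<Gamma>" "a \<in> arrows \<Gamma>" "b \<in> arrows \<Gamma>"
        by (rule comp_cases[OF ab])
      have "(ginv \<Gamma> a, gmult \<Gamma> a b) \<in> composable \<Gamma>" "(gmult \<Gamma> a b, ginv \<Gamma> b) \<in> composable \<Gamma>"
        using g.composable_assoc(2)[OF comp_inv(2)[OF a(4)] a(3)] g.composable_assoc(1)[OF a(3) comp_inv(1)[OF a(5)]] by auto
      then show "gmult \<Gamma>' (ginv \<Gamma>' a') (gmult \<Gamma>' a' b') = b' \<and> gmult \<Gamma>' (gmult \<Gamma>' a' b') (ginv \<Gamma>' b') = a'"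
        unfolding a(1,2) mult_image[OF a(3)] inv_image[OF a(4)] inv_image[OF a(5)]
        using mult_image g.composable_cancel[OF a(3)] by simp
    qed
  qed
qed

lemma inverse_map:
  obtains \<psi> where "homeomorphic_maps (arrow_topology \<Gamma>) (arrow_topology \<Gamma>') \<phi> \<psi>"
    "\<And>a. a \<in> arrows \<Gamma> \<Longrightarrow> \<psi> (\<phi> a) = a" "\<And>a. a \<in> arrows \<Gamma>' \<Longrightarrow> \<phi> (\<psi> a) = a \<and> \<psi> a \<in> arrows \<Gamma>"
    "continuous_map (arrow_topology \<Gamma>') (arrow_topology \<Gamma>) \<psi>"
proof -
  obtain \<psi> where h: "homeomorphic_maps (arrow_topology \<Gamma>) (arrow_topology \<Gamma>') \<phi> \<psi>"
    using homeo unfolding homeomorphic_map_maps by (rule exE)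
  have 1: "\<psi> (\<phi> a) = a" if "a \<in> arrows \<Gamma>" for a using h that by (simp add: homeomorphic_maps_def)
  have 2: "\<phi> (\<psi> a) = a \<and> \<psi> a \<in> arrows \<Gamma>" if "a \<in> arrows \<Gamma>'" for a using that 1 by (auto simp: arrows_image)
  show thesis using that[OF h 1 2] h by (simp add: homeomorphic_maps_def)
qed

lemma continuous_phi: "continuous_map (arrow_topology \<Gamma>) (arrow_topology \<Gamma>') \<phi>"
  by (rule homeomorphic_imp_continuous_map[OF homeo])

text \<open>Each operation of the target is \<open>\<phi>\<close> after the corresponding operation
  of the source after the inverse of \<open>\<phi>\<close>.\<close>

lemma topological_image:
  assumes "topological_groupoid \<Gamma>" shows "topological_groupoid \<Gamma>'"
proof -
  interpret g: top_gpd \<Gamma> using assms by unfold_locales (auto simp: topological_groupoid_def)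
  obtain \<psi> where \<psi>: "\<And>a. a \<in> arrows \<Gamma> \<Longrightarrow> \<psi> (\<phi> a) = a" "\<And>a. a \<in> arrows \<Gamma>' \<Longrightarrow> \<phi> (\<psi> a) = a \<and> \<psi> a \<in> arrows \<Gamma>"
    "continuous_map (arrow_topology \<Gamma>') (arrow_topology \<Gamma>) \<psi>" using inverse_map by metis
  let ?P = "subtopology (prod_topology (arrow_topology \<Gamma>') (arrow_topology \<Gamma>')) (composable \<Gamma>')"
  have comp: "\<psi> (fst p) \<in> arrows \<Gamma>" "\<psi> (snd p) \<in> arrows \<Gamma>" "(\<psi> (fst p), \<psi> (snd p)) \<in> composable \<Gamma>"
    "\<phi> (\<psi> (fst p)) = fst p" "\<phi> (\<psi> (snd p)) = snd p" if "p \<in> topspace ?P" for p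
  proof -
    have "(fst p, snd p) \<in> composable \<Gamma>'" using that by simp
    then obtain a b where a: "fst p = \<phi> a" "snd p = \<phi> b" "(a, b) \<in> composable \<Gamma>" "a \<in> arrows \<Gamma>" "b \<in> arrows \<Gamma>"
      by (rule comp_cases)
    then show "\<psi> (fst p) \<in> arrows \<Gamma>" "\<psi> (snd p) \<in> arrows \<Gamma>" "(\<psi> (fst p), \<psi> (snd p)) \<in> composable \<Gamma>"
      "\<phi> (\<psi> (fst p)) = fst p" "\<phi> (\<psi> (snd p)) = snd p" by (simp_all add: \<psi>(1))
  qed
  have c1: "continuous_map ?P (arrow_topology \<Gamma>) (\<lambda>p. \<psi> (fst p))" "continuous_map ?P (arrow_topology \<Gamma>) (\<lambda>p. \<psi> (snd p))"
    using continuous_map_compose[OF continuous_map_from_subtopology[OF continuous_map_fst] \<psi>(3)]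
      continuous_map_compose[OF continuous_map_from_subtopology[OF continuous_map_snd] \<psi>(3)] by (simp_all add: o_def)
  have "continuous_map ?P (arrow_topology \<Gamma>) (\<lambda>p. gmult \<Gamma> (\<psi> (fst p)) (\<psi> (snd p)))"
    by (rule g.continuous_mul'[OF c1]) (use comp g.composable_iff in blast)
  from continuous_map_compose[OF this continuous_phi]
  have "continuous_map ?P (arrow_topology \<Gamma>') (\<lambda>p. \<phi> (gmult \<Gamma> (\<psi> (fst p)) (\<psi> (snd p))))" by (simp add: o_def)
  then have mul: "continuous_map ?P (arrow_topology \<Gamma>') (\<lambda>(a, b). gmult \<Gamma>' a b)"
  proof (rule continuous_map_eq)
    fix p assume p: "p \<in> topspace ?P"
    show "\<phi> (gmult \<Gamma> (\<psi> (fst p)) (\<psi> (snd p))) = (case p of (a, b) \<Rightarrow> gmult \<Gamma>' a b)"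
      unfolding mult_image[OF comp(3)[OF p], symmetric] comp(4,5)[OF p] by (simp add: case_prod_unfold)
  qed
  have "continuous_map (arrow_topology \<Gamma>') (arrow_topology \<Gamma>') (\<lambda>a. \<phi> (ginv \<Gamma> (\<psi> a)))"
    using continuous_map_compose[OF continuous_map_compose[OF \<psi>(3) g.continuous_inv] continuous_phi] by (simp add: o_def)
  then have inv: "continuous_map (arrow_topology \<Gamma>') (arrow_topology \<Gamma>') (ginv \<Gamma>')"
    by (rule continuous_map_eq) (metis \<psi>(2) inv_image)
  have "locally_compact_space (arrow_topology \<Gamma>')"
    using homeomorphic_locally_compact_space[OF homeomorphic_map_imp_homeomorphic_space[OF homeo]] assms
    by (simp add: topological_groupoid_def)
  moreover have "Hausdorff_space (unit_space \<Gamma>')"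
    using homeomorphic_Hausdorff_space[OF homeomorphic_map_imp_homeomorphic_space[OF homeo_units[OF g.units_arrows]]]
      g.Hausdorff_units by simp
  ultimately show ?thesis unfolding topological_groupoid_def
    using algebraic_image[OF g.algebraic] mul inv by simp
qed

text \<open>The range map of the target is conjugate to an open map, and sets with injective range
  map are carried along.\<close>

lemma etale_image:
  assumes "etale_groupoid \<Gamma>" shows "etale_groupoid \<Gamma>'"
proof -
  interpret g: etale_gpd \<Gamma> by (rule etale_gpdI[OF assms])
  have t: "topological_groupoid \<Gamma>'" by (rule topological_image[OF g.topological])
  interpret g': top_gpd \<Gamma>' using t by unfold_locales (auto simp: topological_groupoid_def)
  obtain \<psi> where \<psi>: "homeomorphic_maps (arrow_topology \<Gamma>) (arrow_topology \<Gamma>') \<phi> \<psi>"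
    "\<And>a. a \<in> arrows \<Gamma> \<Longrightarrow> \<psi> (\<phi> a) = a" "\<And>a. a \<in> arrows \<Gamma>' \<Longrightarrow> \<phi> (\<psi> a) = a \<and> \<psi> a \<in> arrows \<Gamma>" using inverse_map by metis
  have \<psi>h: "homeomorphic_map (arrow_topology \<Gamma>') (arrow_topology \<Gamma>) \<psi>"
    using \<psi>(1) by (simp add: homeomorphic_maps_map)
  have "open_map (arrow_topology \<Gamma>') (unit_space \<Gamma>') (\<phi> \<circ> (rng \<Gamma> \<circ> \<psi>))"
    by (intro open_map_compose[OF open_map_compose[OF homeomorphic_imp_open_map[OF \<psi>h] g.open_ran]]
        homeomorphic_imp_open_map[OF homeo_units[OF g.units_arrows]])
  then have o: "open_map (arrow_topology \<Gamma>') (unit_space \<Gamma>') (rng \<Gamma>')"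
    by (rule open_map_eq) (simp, metis \<psi>(3) rng_image)
  show ?thesis unfolding etale_groupoid_def
  proof (intro conjI t ballI)
    fix a' assume "a' \<in> arrows \<Gamma>'"
    then obtain a where a: "a \<in> arrows \<Gamma>" "a' = \<phi> a" unfolding arrows_image by auto
    obtain W where W: "a \<in> W" "openin (arrow_topology \<Gamma>) W" "W \<subseteq> arrows \<Gamma>" "inj_on (rng \<Gamma>) W" "inj_on (src \<Gamma>) W"
      by (rule g.locally_injective[OF a(1) openin_topspace])
    have "homeo_onto_open_units \<Gamma>' (\<phi> ` W) (rng \<Gamma>')"
    proof (rule homeo_onto_open_unitsI[OF _ g'.continuous_ran o])
      show "openin (arrow_topology \<Gamma>') (\<phi> ` W)" using homeomorphic_imp_open_map[OF homeo] W(2) by (simp add: open_map_def)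
      show "inj_on (rng \<Gamma>') (\<phi> ` W)"
      proof (rule inj_onI)
        fix u v assume "u \<in> \<phi> ` W" "v \<in> \<phi> ` W" and e: "rng \<Gamma>' u = rng \<Gamma>' v"
        then obtain x y where x: "x \<in> W" "u = \<phi> x" and y: "y \<in> W" "v = \<phi> y" by auto
        have xy: "x \<in> arrows \<Gamma>" "y \<in> arrows \<Gamma>" using x y W(3) by auto
        have "rng \<Gamma> x = rng \<Gamma> y" using e xy x y rng_image inj_iff[of "rng \<Gamma> x" "rng \<Gamma> y"] by simp
        then have "x = y" using inj_onD[OF W(4) _ x(1) y(1)] by simp
        then show "u = v" using x y by simp
      qed
    qed
    then show "\<exists>W. a' \<in> W \<and> homeo_onto_open_units \<Gamma>' W (rng \<Gamma>')" using a W by blast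
  qed
qed

lemma bisection_image:
  assumes e: "etale_groupoid \<Gamma>" and D: "bisection \<Gamma> D" shows "bisection \<Gamma>' (\<phi> ` D)"
proof -
  interpret g: etale_gpd \<Gamma> by (rule etale_gpdI[OF e])
  interpret g': etale_gpd \<Gamma>' by (rule etale_gpdI[OF etale_image[OF e]])
  obtain W where W: "D \<subseteq> W" "openin (arrow_topology \<Gamma>) W" "inj_on (rng \<Gamma>) W" "inj_on (src \<Gamma>) W"
    using D unfolding bisection_def g.homeo_onto_open_units_iff by blast
  have WA: "W \<subseteq> arrows \<Gamma>" using W(2) openin_subset by blast
  have "inj_on (rng \<Gamma>') (\<phi> ` W)" "inj_on (src \<Gamma>') (\<phi> ` W)"
  proof -
    have "inj_on f (\<phi> ` W)" if f: "inj_on h W" "\<And>x. x \<in> arrows \<Gamma> \<Longrightarrow> h x \<in> arrows \<Gamma> \<and> f (\<phi> x) = \<phi> (h x)" for f h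
    proof (rule inj_onI)
      fix u v assume "u \<in> \<phi> ` W" "v \<in> \<phi> ` W" and e: "f u = f v"
      then obtain x y where x: "x \<in> W" "u = \<phi> x" and y: "y \<in> W" "v = \<phi> y" by auto
      have xy: "x \<in> arrows \<Gamma>" "y \<in> arrows \<Gamma>" using x y WA by auto
      have "h x = h y" using e f(2)[OF xy(1)] f(2)[OF xy(2)] x y inj_iff[of "h x" "h y"] by simp
      then have "x = y" using inj_onD[OF f(1) _ x(1) y(1)] by simp
      then show "u = v" using x y by simp
    qed
    from this[OF W(3)] this[OF W(4)] show "inj_on (rng \<Gamma>') (\<phi> ` W)" "inj_on (src \<Gamma>') (\<phi> ` W)"
      by (simp_all add: rng_image src_image)
  qed
  moreover have "openin (arrow_topology \<Gamma>') (\<phi> ` W)"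
    using homeomorphic_imp_open_map[OF homeo] W(2) by (simp add: open_map_def)
  ultimately show ?thesis unfolding bisection_def g'.homeo_onto_open_units_iff using W(1) by blast
qed

end

section \<open>Maps intertwined by homeomorphisms\<close>

lemma homeomorphic_map_prod_id:
  assumes "homeomorphic_map X Y f"
  shows "homeomorphic_map (prod_topology X Z) (prod_topology Y Z) (\<lambda>(x, z). (f x, z))"
proof -
  obtain g where g: "homeomorphic_maps X Y f g" using assms unfolding homeomorphic_map_maps by (rule exE)
  have c: "continuous_map (prod_topology X' Z) (prod_topology Y' Z) (\<lambda>(x, z). (h x, z))"
    if "continuous_map X' Y' h" for X' :: "'x topology" and Y' :: "'y topology" and h
    unfolding case_prod_unfold
    using continuous_map_compose[OF continuous_map_fst that, of Z]
    by (intro continuous_map_pairedI) (simp_all add: o_def continuous_map_snd)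
  have "homeomorphic_maps (prod_topology X Z) (prod_topology Y Z) (\<lambda>(x, z). (f x, z)) (\<lambda>(y, z). (g y, z))"
    using g c[of X Y f] c[of Y X g] by (auto simp: homeomorphic_maps_def)
  then show ?thesis by (auto simp: homeomorphic_map_maps)
qed

lemma continuous_intertwined:
  assumes "homeomorphic_map X X' h" "continuous_map Y Y' k" "continuous_map X Y f"
    "\<And>x. x \<in> topspace X \<Longrightarrow> f' (h x) = k (f x)"
  shows "continuous_map X' Y' f'"
proof -
  obtain g where g: "homeomorphic_maps X X' h g" using assms(1) unfolding homeomorphic_map_maps by (rule exE)
  have "continuous_map X' Y' (k \<circ> (f \<circ> g))"
    using g assms by (intro continuous_map_compose) (auto simp: homeomorphic_maps_def)
  then show ?thesis
  proof (rule continuous_map_eq)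
    fix x' assume "x' \<in> topspace X'"
    then obtain x where x: "x \<in> topspace X" "x' = h x" using homeomorphic_imp_surjective_map[OF assms(1)] by auto
    have "g (h x) = x" using g x by (simp add: homeomorphic_maps_def)
    then show "(k \<circ> (f \<circ> g)) x' = f' x'" using x assms(4) by simp
  qed
qed

lemma homeomorphic_intertwined:
  assumes "homeomorphic_map X X' h" "homeomorphic_map Y Y' k" "homeomorphic_map X Y f"
    "\<And>x. x \<in> topspace X \<Longrightarrow> f' (h x) = k (f x)"
  shows "homeomorphic_map X' Y' f'"
proof -
  obtain g where g: "homeomorphic_maps X X' h g" using assms(1) unfolding homeomorphic_map_maps by (rule exE)
  have gh: "homeomorphic_map X' X g" using g by (simp add: homeomorphic_maps_map)
  have "homeomorphic_map X' Y' (k \<circ> (f \<circ> g))"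
    by (rule homeomorphic_map_compose[OF homeomorphic_map_compose[OF gh assms(3)] assms(2)])
  then show ?thesis
  proof (rule homeomorphic_map_eq)
    fix x' assume "x' \<in> topspace X'"
    then obtain x where x: "x \<in> topspace X" "x' = h x" using homeomorphic_imp_surjective_map[OF assms(1)] by auto
    have "g (h x) = x" using g x by (simp add: homeomorphic_maps_def)
    then show "(k \<circ> (f \<circ> g)) x' = f' x'" using x assms(4) by simp
  qed
qed

lemma groupoid_isomorphismI:
  assumes "algebraic_groupoid \<Gamma>" "homeomorphic_map (arrow_topology \<Gamma>) (arrow_topology \<Gamma>') \<phi>"
    "composable \<Gamma>' = (\<lambda>(a, b). (\<phi> a, \<phi> b)) ` composable \<Gamma>"
    "\<And>a b. (a, b) \<in> composable \<Gamma> \<Longrightarrow> gmult \<Gamma>' (\<phi> a) (\<phi> b) = \<phi> (gmult \<Gamma> a b)"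
    "\<And>a. a \<in> arrows \<Gamma> \<Longrightarrow> ginv \<Gamma>' (\<phi> a) = \<phi> (ginv \<Gamma> a)"
  shows "groupoid_isomorphism \<Gamma> \<Gamma>' \<phi>"
proof -
  interpret g: gpd \<Gamma> by unfold_locales fact
  show ?thesis unfolding groupoid_isomorphism_def
    using assms(2-5) g.composableD g.composable_inv by (auto simp del: g.inv_inv) (simp_all)
qed

lemma trivial_bundle_simps [simp]:
  "arrow_topology (trivial_bundle G) = prod_topology (unit_space G) (discrete_topology ring_units)"
  "gmult (trivial_bundle G) (x, t) (y, u) = (x, t * u)"
  "ginv (trivial_bundle G) (x, t) = (x, unit_inverse t)"
  "((x, t), (y, u)) \<in> composable (trivial_bundle G) \<longleftrightarrow> x = y \<and> x \<in> units G \<and> t \<in> ring_units \<and> u \<in> ring_units"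
  by (simp_all add: trivial_bundle_def)

section \<open>Transport of a twist along isomorphisms of total space and base\<close>

locale twist_transport = twist \<Sigma> i q G
  for \<Sigma> :: "'s groupoid" (structure) and i :: "'g \<times> 'r::comm_ring_1 \<Rightarrow> 's"
    and q :: "'s \<Rightarrow> 'g" and G :: "'g groupoid" +
  fixes \<Sigma>' :: "'t groupoid" and i' :: "'h \<times> 'r \<Rightarrow> 't" and q' :: "'t \<Rightarrow> 'h" and G' :: "'h groupoid"
    and \<phi> :: "'s \<Rightarrow> 't" and \<theta> :: "'g \<Rightarrow> 'h"
  assumes iso_total: "groupoid_isomorphism \<Sigma> \<Sigma>' \<phi>" and iso_base: "groupoid_isomorphism G G' \<theta>"
    and i'_eq: "\<And>x t. x \<in> units G \<Longrightarrow> t \<in> ring_units \<Longrightarrow> i' (\<theta> x, t) = \<phi> (i (x, t))"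
    and q'_eq: "\<And>\<sigma>. \<sigma> \<in> arrows \<Sigma> \<Longrightarrow> q' (\<phi> \<sigma>) = \<theta> (q \<sigma>)"
begin

sublocale P: gpd_iso \<Sigma> \<Sigma>' \<phi> by unfold_locales (rule iso_total)
sublocale Q: gpd_iso G G' \<theta> by unfold_locales (rule iso_base)

lemma topspace_units: "topspace (unit_space G) = units G" "topspace (unit_space \<Sigma>) = units \<Sigma>"
  "topspace (unit_space G') = \<theta> ` units G"
  using topspace_subtopology_subset[OF G.units_arrows] topspace_subtopology_subset[OF S.units_arrows]
    homeomorphic_imp_surjective_map[OF Q.homeo_units[OF G.units_arrows]] by simp_all

lemma arrows_bundle: "arrows (trivial_bundle G) = units G \<times> ring_units"
  by (simp only: trivial_bundle_simps(1) topspace_prod_topology topspace_units topspace_discrete_topology)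

lemma iso_bundle: "groupoid_isomorphism (trivial_bundle G :: ('g \<times> 'r) groupoid) (trivial_bundle G') (\<lambda>(x, t). (\<theta> x, t))"
  unfolding groupoid_isomorphism_def
proof (intro conjI ballI allI impI)
  show "homeomorphic_map (arrow_topology (trivial_bundle G :: ('g \<times> 'r) groupoid)) (arrow_topology (trivial_bundle G')) (\<lambda>(x, t). (\<theta> x, t))"
    unfolding trivial_bundle_simps by (rule homeomorphic_map_prod_id[OF Q.homeo_units[OF G.units_arrows]])
  show "composable (trivial_bundle G :: ('g \<times> 'r) groupoid) \<subseteq> arrows (trivial_bundle G) \<times> arrows (trivial_bundle G)"
    unfolding arrows_bundle by (auto simp: trivial_bundle_def)
  show "composable (trivial_bundle G') = (\<lambda>(a, b). (case a of (x, t) \<Rightarrow> (\<theta> x, t), case b of (x, t) \<Rightarrow> (\<theta> x, t))) `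
    composable (trivial_bundle G :: ('g \<times> 'r) groupoid)" (is "?L = ?R")
  proof (intro equalityI subsetI)
    fix p assume "p \<in> ?L"
    then obtain x t u where p: "p = ((\<theta> x, t), (\<theta> x, u))" "x \<in> units G" "t \<in> ring_units" "u \<in> ring_units"
      by (auto simp: trivial_bundle_def Q.units_image)
    then have "((x, t), (x, u)) \<in> composable (trivial_bundle G)" by simp
    then show "p \<in> ?R" using p(1) by (intro image_eqI[of _ _ "((x, t), (x, u))"]) simp_all
  next
    fix p assume "p \<in> ?R"
    then show "p \<in> ?L" by (auto simp: trivial_bundle_def Q.units_image)
  qed
qed (auto simp: arrows_bundle trivial_bundle_def)

lemma units_bundle: "units (trivial_bundle G :: ('g \<times> 'r) groupoid) = units G \<times> {1}"
proof -
  have r: "\<forall>p \<in> units G \<times> ring_units. rng (trivial_bundle G :: ('g \<times> 'r) groupoid) p = (fst p, 1)"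
    by (auto simp: rng_def)
  have "units (trivial_bundle G :: ('g \<times> 'r) groupoid) = rng (trivial_bundle G) ` (units G \<times> (ring_units :: 'r set))"
    by (simp only: units_def[of "trivial_bundle G"] arrows_bundle)
  also have "\<dots> = (\<lambda>p. (fst p, 1)) ` (units G \<times> (ring_units :: 'r set))"
    by (rule image_cong[OF refl]) (use r in blast)
  also have "\<dots> = units G \<times> {1 :: 'r}"
  proof (intro equalityI subsetI)
    fix p :: "'g \<times> 'r" assume "p \<in> units G \<times> {1}"
    then show "p \<in> (\<lambda>p. (fst p, 1)) ` (units G \<times> (ring_units :: 'r set))" by (intro image_eqI[of _ _ p]) auto
  qed auto
  finally show ?thesis .
qed

sublocale B: gpd_iso "trivial_bundle G :: ('g \<times> 'r) groupoid" "trivial_bundle G'" "\<lambda>(x, t). (\<theta> x, t)"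
  by unfold_locales (rule iso_bundle)

lemma units_bundle_arrows: "units (trivial_bundle G :: ('g \<times> 'r) groupoid) \<subseteq> arrows (trivial_bundle G)"
  unfolding units_bundle arrows_bundle by auto

lemma i'_bundle: "p \<in> arrows (trivial_bundle G) \<Longrightarrow> i' (case p of (x, t) \<Rightarrow> (\<theta> x, t)) = \<phi> (i p)"
  unfolding arrows_bundle using i'_eq by auto

text \<open>Section and trivialisation are conjugated by \<open>\<phi>\<close> and
  \<open>\<theta>\<close>; \<open>\<eta>\<close> inverts \<open>\<theta>\<close> on \<open>G\<close>
  so that the section \<open>P\<close> can be evaluated on the transported domain.\<close>

lemma trivialisation_image:
  assumes "\<alpha>' \<in> arrows G'"
  shows "\<exists>D P. \<alpha>' \<in> D \<and> openin (arrow_topology G') D \<and> bisection G' D \<and>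
       continuous_map (subtopology (arrow_topology G') D) (arrow_topology \<Sigma>') P \<and>
       (\<forall>\<beta> \<in> D. q' (P \<beta>) = \<beta>) \<and>
       homeomorphic_map
         (prod_topology (subtopology (arrow_topology G') D) (discrete_topology ring_units))
         (subtopology (arrow_topology \<Sigma>') {\<sigma> \<in> arrows \<Sigma>'. q' \<sigma> \<in> D})
         (\<lambda>(\<beta>, t). gmult \<Sigma>' (i' (rng G' \<beta>, t)) (P \<beta>))"
proof -
  obtain \<alpha> where \<alpha>: "\<alpha> \<in> arrows G" "\<alpha>' = \<theta> \<alpha>" using assms unfolding Q.arrows_image by auto
  obtain D P where D: "\<alpha> \<in> D" "openin (arrow_topology G) D" "bisection G D"
    and P: "continuous_map (subtopology (arrow_topology G) D) (arrow_topology \<Sigma>) P" "\<forall>\<beta> \<in> D. q (P \<beta>) = \<beta>"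
    and h: "homeomorphic_map
         (prod_topology (subtopology (arrow_topology G) D) (discrete_topology ring_units))
         (subtopology (arrow_topology \<Sigma>) {\<sigma> \<in> arrows \<Sigma>. q \<sigma> \<in> D})
         (\<lambda>(\<beta>, t). gmult \<Sigma> (i (rng G \<beta>, t)) (P \<beta>))"
    using trivialisation[OF \<alpha>(1)] by (elim exE conjE)
  obtain \<eta> where \<eta>: "\<And>a. a \<in> arrows G \<Longrightarrow> \<eta> (\<theta> a) = a" using Q.inverse_map by metis
  have DG: "D \<subseteq> arrows G" by (rule openin_subset[OF D(2)])
  have topD: "topspace (subtopology (arrow_topology G) D) = D" by (rule topspace_subtopology_subset[OF DG])
  have PS: "P \<beta> \<in> arrows \<Sigma>" if "\<beta> \<in> D" for \<beta>
    using continuous_map_funspace[OF P(1)] that unfolding topD by auto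
  let ?D = "\<theta> ` D" and ?P = "\<lambda>\<beta>. \<phi> (P (\<eta> \<beta>))"
  have oD: "openin (arrow_topology G') ?D" using homeomorphic_imp_open_map[OF Q.homeo] D(2) by (simp add: open_map_def)
  have hD: "homeomorphic_map (subtopology (arrow_topology G) D) (subtopology (arrow_topology G') ?D) \<theta>"
  proof (rule homeomorphic_map_subtopologies[OF Q.homeo])
    have "arrows G \<inter> D = D" "arrows G' \<inter> ?D = ?D" using DG unfolding Q.arrows_image by auto
    then show "\<theta> ` (arrows G \<inter> D) = arrows G' \<inter> ?D" by simp
  qed
  have hS: "homeomorphic_map (subtopology (arrow_topology \<Sigma>) {\<sigma> \<in> arrows \<Sigma>. q \<sigma> \<in> D})
      (subtopology (arrow_topology \<Sigma>') {\<sigma> \<in> arrows \<Sigma>'. q' \<sigma> \<in> ?D}) \<phi>"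
  proof (rule homeomorphic_map_subtopologies[OF P.homeo])
    have "q' (\<phi> \<sigma>) \<in> ?D \<longleftrightarrow> q \<sigma> \<in> D" if "\<sigma> \<in> arrows \<Sigma>" for \<sigma>
      unfolding q'_eq[OF that] using inj_on_image_mem_iff[OF Q.inj q_arrow[OF that] DG] .
    then show "\<phi> ` (arrows \<Sigma> \<inter> {\<sigma> \<in> arrows \<Sigma>. q \<sigma> \<in> D}) = arrows \<Sigma>' \<inter> {\<sigma> \<in> arrows \<Sigma>'. q' \<sigma> \<in> ?D}"
      unfolding P.arrows_image by auto
  qed
  show ?thesis
  proof (intro exI[of _ ?D] exI[of _ ?P] conjI ballI)
    show "\<alpha>' \<in> ?D" using D(1) \<alpha>(2) by simp
    show "openin (arrow_topology G') ?D" by (rule oD)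
    show "bisection G' ?D" by (rule Q.bisection_image[OF etale_base D(3)])
    show "continuous_map (subtopology (arrow_topology G') ?D) (arrow_topology \<Sigma>') ?P"
      by (rule continuous_intertwined[OF hD P.continuous_phi P(1)]) (use topD DG \<eta> in auto)
    show "q' (?P \<beta>) = \<beta>" if "\<beta> \<in> ?D" for \<beta>
      using that DG \<eta> P(2) PS q'_eq by auto
    show "homeomorphic_map (prod_topology (subtopology (arrow_topology G') ?D) (discrete_topology ring_units))
         (subtopology (arrow_topology \<Sigma>') {\<sigma> \<in> arrows \<Sigma>'. q' \<sigma> \<in> ?D})
         (\<lambda>(\<beta>, t). gmult \<Sigma>' (i' (rng G' \<beta>, t)) (?P \<beta>))"
    proof (rule homeomorphic_intertwined[OF homeomorphic_map_prod_id[OF hD] hS h])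
      fix p assume "p \<in> topspace (prod_topology (subtopology (arrow_topology G) D) (discrete_topology (ring_units :: 'r set)))"
      then obtain \<beta> t where p: "p = (\<beta>, t)" "\<beta> \<in> D" "t \<in> ring_units"
        unfolding topspace_prod_topology topD by auto
      have \<beta>: "\<beta> \<in> arrows G" using p DG by auto
      have c: "(i (G.ran \<beta>, t), P \<beta>) \<in> composable \<Sigma>"
        using p \<beta> PS[OF p(2)] bspec[OF P(2) p(2)] by (simp add: S.composable_iff ran_eq)
      show "(case (case p of (x, z) \<Rightarrow> (\<theta> x, z)) of (\<beta>, t) \<Rightarrow> gmult \<Sigma>' (i' (rng G' \<beta>, t)) (?P \<beta>)) =
        \<phi> (case p of (\<beta>, t) \<Rightarrow> gmult \<Sigma> (i (rng G \<beta>, t)) (P \<beta>))"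
        unfolding p(1) prod.case Q.rng_image[OF \<beta>] \<eta>[OF \<beta>] i'_eq[OF G.ran_units[OF \<beta>] p(3)] P.mult_image[OF c] ..
    qed
  qed
qed

lemma twist_image: "discrete_twist \<Sigma>' i' q' G'"
  unfolding discrete_twist_def
proof (intro conjI ballI)
  show "etale_groupoid G'" by (rule Q.etale_image[OF etale_base])
  show "topological_groupoid \<Sigma>'" by (rule P.topological_image[OF topological_total])
  show "units \<Sigma>' = i' ` (units G' \<times> {1})"
  proof -
    have "units \<Sigma>' = (\<lambda>x. \<phi> (i (x, 1))) ` units G" unfolding P.units_image units_total by (auto simp: image_image)
    also have "\<dots> = (\<lambda>x. i' (\<theta> x, 1)) ` units G" by (rule image_cong[OF refl]) (simp add: i'_eq)
    also have "\<dots> = i' ` (units G' \<times> {1})" unfolding Q.units_image by (auto simp: image_image)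
    finally show ?thesis .
  qed
  show "continuous_map (arrow_topology (trivial_bundle G')) (arrow_topology \<Sigma>') i'"
    by (rule continuous_intertwined[OF B.homeo P.continuous_phi i_continuous i'_bundle])
  show "groupoid_hom (trivial_bundle G') \<Sigma>' i'"
    unfolding groupoid_hom_def
  proof (intro conjI ballI)
    show "i' \<in> arrows (trivial_bundle G') \<rightarrow> arrows \<Sigma>'"
    proof
      fix p :: "'h \<times> 'r" assume "p \<in> arrows (trivial_bundle G')"
      then obtain x t where p: "p = (\<theta> x, t)" "x \<in> units G" "t \<in> ring_units"
        unfolding B.arrows_image unfolding arrows_bundle by auto
      then show "i' p \<in> arrows \<Sigma>'" using i'_eq P.arrow by simp
    qed
    fix p :: "('h \<times> 'r) \<times> 'h \<times> 'r" assume "p \<in> composable (trivial_bundle G')"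
    then obtain x t u where p: "p = ((\<theta> x, t), (\<theta> x, u))" "x \<in> units G" "t \<in> ring_units" "u \<in> ring_units"
      by (auto simp: trivial_bundle_def Q.units_image)
    have c: "(i (x, t), i (x, u)) \<in> composable \<Sigma>" using p by (simp add: S.composable_iff)
    then have "(\<phi> (i (x, t)), \<phi> (i (x, u))) \<in> composable \<Sigma>'" by (auto simp: P.comp_image)
    then show "case p of (a, b) \<Rightarrow> (i' a, i' b) \<in> composable \<Sigma>' \<and>
      i' (gmult (trivial_bundle G') a b) = gmult \<Sigma>' (i' a) (i' b)"
      using p P.mult_image[OF c] by (simp add: i'_eq i_mul)
  qed
  show "homeomorphic_map (unit_space (trivial_bundle G')) (unit_space \<Sigma>') i'"
  proof (rule homeomorphic_intertwined[OF B.homeo_units[OF units_bundle_arrows] P.homeo_units[OF S.units_arrows]])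
    show "homeomorphic_map (unit_space (trivial_bundle G)) (unit_space \<Sigma>) i"
      using twist unfolding discrete_twist_def by (elim conjE)
    fix p assume "p \<in> topspace (unit_space (trivial_bundle G :: ('g \<times> 'r) groupoid))"
    then show "i' (case p of (x, t) \<Rightarrow> (\<theta> x, t)) = \<phi> (i p)" by (intro i'_bundle) simp
  qed
  show "continuous_map (arrow_topology \<Sigma>') (arrow_topology G') q'"
    by (rule continuous_intertwined[OF P.homeo Q.continuous_phi q_continuous q'_eq])
  show "groupoid_hom \<Sigma>' G' q'"
    unfolding groupoid_hom_def
  proof (intro conjI ballI)
    show "q' \<in> arrows \<Sigma>' \<rightarrow> arrows G'" unfolding P.arrows_image using q'_eq Q.arrow by auto
    fix p assume "p \<in> composable \<Sigma>'"
    then obtain a b where p: "p = (\<phi> a, \<phi> b)" "(a, b) \<in> composable \<Sigma>" unfolding P.comp_image by auto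
    have ab: "a \<in> arrows \<Sigma>" "b \<in> arrows \<Sigma>" "a \<cdot> b \<in> arrows \<Sigma>" "G.sou (q a) = G.ran (q b)"
      using p(2) S.composableD[OF p(2)] by (auto simp: S.composable_iff composable_eq)
    have c: "(q a, q b) \<in> composable G" using ab by (simp add: G.composable_iff)
    have "(\<theta> (q a), \<theta> (q b)) \<in> composable G'" using c unfolding Q.comp_image by auto
    then show "case p of (a, b) \<Rightarrow> (q' a, q' b) \<in> composable G' \<and> q' (gmult \<Sigma>' a b) = gmult G' (q' a) (q' b)"
      using p ab P.mult_image[OF p(2)] Q.mult_image[OF c] by (simp add: q'_eq)
  qed
  show "homeomorphic_map (unit_space \<Sigma>') (unit_space G') q'"
    by (rule homeomorphic_intertwined[OF P.homeo_units[OF S.units_arrows] Q.homeo_units[OF G.units_arrows] q_units])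
      (simp add: q'_eq)
  show "i' ` ({x'} \<times> ring_units) = {\<sigma> \<in> arrows \<Sigma>'. q' \<sigma> = x'}" if "x' \<in> units G'" for x'
  proof -
    obtain x where x: "x \<in> units G" "x' = \<theta> x" using \<open>x' \<in> units G'\<close> unfolding Q.units_image by auto
    have "i' ` ({x'} \<times> ring_units) = \<phi> ` (i ` ({x} \<times> ring_units))"
      unfolding image_image x(2) using i'_eq[OF x(1)] by force
    also have "\<dots> = \<phi> ` {\<sigma> \<in> arrows \<Sigma>. q \<sigma> = x}" using q_fibre[OF x(1)] by simp
    also have "\<dots> = {\<sigma> \<in> arrows \<Sigma>'. q' \<sigma> = x'}"
    proof -
      have "q' (\<phi> \<sigma>) = x' \<longleftrightarrow> q \<sigma> = x" if "\<sigma> \<in> arrows \<Sigma>" for \<sigma>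
        unfolding q'_eq[OF that] x(2) using Q.inj_iff[of "q \<sigma>" x] that x(1) G.unit_arrow by simp
      then show ?thesis unfolding P.arrows_image by auto
    qed
    finally show ?thesis .
  qed
  show "inj_on i' (units G' \<times> ring_units)"
  proof (rule inj_onI)
    fix p p' assume "p \<in> units G' \<times> ring_units" "p' \<in> units G' \<times> ring_units" and e: "i' p = i' p'"
    then obtain x t y u where p: "p = (\<theta> x, t)" "x \<in> units G" "t \<in> ring_units" "p' = (\<theta> y, u)" "y \<in> units G" "u \<in> ring_units"
      unfolding Q.units_image by auto
    then have "i (x, t) = i (y, u)" using e i'_eq P.inj_iff[of "i (x, t)" "i (y, u)"] by simp
    then show "p = p'" using p by simp
  qed
  show "q' ` arrows \<Sigma>' = arrows G'"
  proof -
    have "q' ` arrows \<Sigma>' = \<theta> ` (q ` arrows \<Sigma>)" unfolding P.arrows_image image_image by (rule image_cong) (simp_all add: q'_eq)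
    then show ?thesis by (simp add: q_surj Q.arrows_image)
  qed
  show "\<exists>D P. \<alpha>' \<in> D \<and> openin (arrow_topology G') D \<and> bisection G' D \<and>
       continuous_map (subtopology (arrow_topology G') D) (arrow_topology \<Sigma>') P \<and>
       (\<forall>\<beta> \<in> D. q' (P \<beta>) = \<beta>) \<and>
       homeomorphic_map
         (prod_topology (subtopology (arrow_topology G') D) (discrete_topology ring_units))
         (subtopology (arrow_topology \<Sigma>') {\<sigma> \<in> arrows \<Sigma>'. q' \<sigma> \<in> D})
         (\<lambda>(\<beta>, t). gmult \<Sigma>' (i' (rng G' \<beta>, t)) (P \<beta>))" if "\<alpha>' \<in> arrows G'" for \<alpha>'
    by (rule trivialisation_image[OF that])
  fix \<sigma>' t assume s: "\<sigma>' \<in> arrows \<Sigma>'" and t: "(t::'r) \<in> ring_units"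
  obtain \<sigma> where \<sigma>: "\<sigma> \<in> arrows \<Sigma>" "\<sigma>' = \<phi> \<sigma>" using s unfolding P.arrows_image by auto
  have c: "(i (G.ran (q \<sigma>), t), \<sigma>) \<in> composable \<Sigma>" "(\<sigma>, i (G.sou (q \<sigma>), t)) \<in> composable \<Sigma>"
    using \<sigma> t by (simp_all add: S.composable_iff ran_eq sou_eq)
  have "i (G.ran (q \<sigma>), t) \<cdot> \<sigma> = \<sigma> \<cdot> i (G.sou (q \<sigma>), t)" using i_central[OF \<sigma>(1) t] \<sigma> by simp
  then show "gmult \<Sigma>' (i' (q' (rng \<Sigma>' \<sigma>'), t)) \<sigma>' = gmult \<Sigma>' \<sigma>' (i' (q' (src \<Sigma>' \<sigma>'), t))"
    unfolding \<sigma>(2) P.rng_image[OF \<sigma>(1)] P.src_image[OF \<sigma>(1)]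
    using \<sigma>(1) t P.mult_image[OF c(1)] P.mult_image[OF c(2)] by (simp add: q'_eq i'_eq)
qed

lemma twist_isomorphism: "twist_isomorphism \<Sigma> i q G \<Sigma>' i' q' G' \<phi>"
  unfolding twist_isomorphism_def
proof (intro conjI exI[of _ \<theta>] ballI)
  show "topological_groupoid_iso \<Sigma> \<Sigma>' \<phi>" by (rule P.topological_groupoid_iso) (use S.composableD in blast)
  show "topological_groupoid_iso G G' \<theta>" by (rule Q.topological_groupoid_iso) (use G.composableD in blast)
qed (use twist twist_image q'_eq i'_eq in auto)

end

section \<open>The twist of ultrafilters\<close>

context upp_twist
begin

abbreviation um where "um \<equiv> ultrafilter_map \<Sigma> i q G"
abbreviation ufb where "ufb \<equiv> ultrafilter_base_groupoid alg dia"

lemma arrows_ufg: "arrows ufg = uf ` arrows \<Sigma>"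
  by (simp add: topspace_ultrafilter_topology ultrafilters_eq)

lemma um_iso: "groupoid_isomorphism \<Sigma> ufg um"
proof (rule groupoid_isomorphismI[OF S.algebraic])
  show "homeomorphic_map (arrow_topology \<Sigma>) (arrow_topology ufg) um"
    unfolding ufg_simps by (rule homeomorphic_map_eq[OF uf_homeomorphic]) (simp add: ultrafilter_map_eq)
  show "composable ufg = (\<lambda>(a, b). (um a, um b)) ` composable \<Sigma>"
    unfolding ufg_composable by (rule image_cong[OF refl]) (auto simp: S.composable_iff ultrafilter_map_eq)
  show "gmult ufg (um a) (um b) = um (a \<cdot> b)" if "(a, b) \<in> composable \<Sigma>" for a b
    using ufg_mult[OF that] S.composableD[OF that] by (simp only: ultrafilter_map_eq)
  show "ginv ufg (um a) = um (S.inv_of a)" if "a \<in> arrows \<Sigma>" for a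
    using ufg_inv[OF that] S.inv_closed[OF that] that by (simp only: ultrafilter_map_eq)
qed

section \<open>The base groupoid of the ultrafilter twist\<close>

definition base_map :: "'g \<Rightarrow> ('s \<Rightarrow> 'r) set set" where
  "base_map \<alpha> = ufq (uf (sec \<alpha>))"

lemma ufq_base: "\<sigma> \<in> arrows \<Sigma> \<Longrightarrow> ufq (uf \<sigma>) = base_map (q \<sigma>)"
  unfolding base_map_def by (subst ufq_eq_iff) simp_all

lemma base_map_inj: "inj_on base_map (arrows G)"
  unfolding base_map_def by (rule inj_onI) (metis ufq_eq_iff sec)

abbreviation rep where "rep \<equiv> \<lambda>g. SOME a. a \<in> arrows ufg \<and> ufq a = g"

lemma ufb_simps:
  "arrow_topology ufb = quotient_topology (ultrafilter_topology alg dia) ufq"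
  "composable ufb = {(ufq a, ufq b) | a b. (a, b) \<in> composable ufg}"
  "gmult ufb g h = ufq (gmult ufg (rep g) (rep h))"
  "ginv ufb g = ufq (ginv ufg (rep g))"
  by (simp_all add: ultrafilter_base_groupoid_def quotient_groupoid_def Let_def del: ufg_simps(2,3))

text \<open>The quotient operations use an unspecified representative of each class. It is
  \<open>uf\<close> of some lift of \<open>\<alpha>\<close>, possibly other than
  \<open>sec \<alpha>\<close>, and any lift serves.\<close>

lemma rep_base:
  assumes "\<alpha> \<in> arrows G"
  obtains \<sigma> where "\<sigma> \<in> arrows \<Sigma>" "q \<sigma> = \<alpha>" "rep (base_map \<alpha>) = uf \<sigma>"
proof -
  have "uf (sec \<alpha>) \<in> arrows ufg \<and> ufq (uf (sec \<alpha>)) = base_map \<alpha>"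
    unfolding arrows_ufg using assms by (simp add: base_map_def)
  then have r: "rep (base_map \<alpha>) \<in> arrows ufg \<and> ufq (rep (base_map \<alpha>)) = base_map \<alpha>" by (rule someI)
  then obtain \<sigma> where s: "\<sigma> \<in> arrows \<Sigma>" "rep (base_map \<alpha>) = uf \<sigma>" unfolding arrows_ufg by auto
  then have "base_map (q \<sigma>) = base_map \<alpha>" using r ufq_base by simp
  then have "q \<sigma> = \<alpha>" using inj_onD[OF base_map_inj] s assms by simp
  then show thesis using that s by blast
qed

text \<open>\<open>G\<close> also carries the quotient topology, because \<open>q\<close> is open,
  continuous and surjective, and under \<open>uf\<close> the two quotient maps have the same
  fibres.\<close>

lemma base_homeomorphic: "homeomorphic_map (arrow_topology G) (arrow_topology ufb) base_map"
  unfolding ufb_simps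
proof (rule bijective_open_imp_homeomorphic_map)
  let ?T = "ultrafilter_topology alg dia"
  have T: "topspace ?T = uf ` arrows \<Sigma>" using arrows_ufg by simp
  have "topspace (quotient_topology ?T ufq) = ufq ` uf ` arrows \<Sigma>"
    using quotient_imp_surjective_map[OF quotient_map_quotient_topology[of ?T ufq]] T by simp
  also have "\<dots> = base_map ` q ` arrows \<Sigma>" unfolding image_image by (rule image_cong[OF refl ufq_base])
  finally have im: "topspace (quotient_topology ?T ufq) = base_map ` arrows G" by (simp add: q_surj)
  then show "base_map ` arrows G = topspace (quotient_topology ?T ufq)" by simp
  show "inj_on base_map (arrows G)" by (rule base_map_inj)
  show "continuous_map (arrow_topology G) (quotient_topology ?T ufq) base_map"
    unfolding continuous_map_def
  proof (intro conjI allI impI)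
    show "base_map \<in> arrows G \<rightarrow> topspace (quotient_topology ?T ufq)" unfolding im by auto
    fix V assume "openin (quotient_topology ?T ufq) V"
    then have "openin ?T {x \<in> topspace ?T. ufq x \<in> V}" by (simp add: openin_quotient_topology)
    from openin_continuous_map_preimage[OF homeomorphic_imp_continuous_map[OF uf_homeomorphic] this]
    have "openin (arrow_topology G) (q ` {\<sigma> \<in> arrows \<Sigma>. uf \<sigma> \<in> {x \<in> topspace ?T. ufq x \<in> V}})"
      by (rule open_q_image)
    moreover have "q ` {\<sigma> \<in> arrows \<Sigma>. uf \<sigma> \<in> {x \<in> topspace ?T. ufq x \<in> V}} = {\<alpha> \<in> arrows G. base_map \<alpha> \<in> V}" (is "?L = ?R")
    proof (intro equalityI subsetI)
      fix \<alpha> assume "\<alpha> \<in> ?L"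
      then obtain \<sigma> where "\<sigma> \<in> arrows \<Sigma>" "ufq (uf \<sigma>) \<in> V" "\<alpha> = q \<sigma>" by auto
      then show "\<alpha> \<in> ?R" using ufq_base by simp
    next
      fix \<alpha> assume a: "\<alpha> \<in> ?R"
      then have "sec \<alpha> \<in> {\<sigma> \<in> arrows \<Sigma>. uf \<sigma> \<in> {x \<in> topspace ?T. ufq x \<in> V}}" unfolding T by (simp add: base_map_def)
      then have "q (sec \<alpha>) \<in> ?L" by (rule imageI)
      then show "\<alpha> \<in> ?L" using a by simp
    qed
    ultimately show "openin (arrow_topology G) {\<alpha> \<in> arrows G. base_map \<alpha> \<in> V}" by simp
  qed
  show "open_map (arrow_topology G) (quotient_topology ?T ufq) base_map"
    unfolding open_map_def
  proof (intro allI impI)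
    fix A assume A: "openin (arrow_topology G) A"
    have AG: "A \<subseteq> arrows G" by (rule openin_subset[OF A])
    have "openin ?T (uf ` {\<sigma> \<in> arrows \<Sigma>. q \<sigma> \<in> A})"
      using homeomorphic_imp_open_map[OF uf_homeomorphic] openin_continuous_map_preimage[OF q_continuous A]
      unfolding open_map_def by blast
    moreover have "{x \<in> topspace ?T. ufq x \<in> base_map ` A} = uf ` {\<sigma> \<in> arrows \<Sigma>. q \<sigma> \<in> A}"
    proof -
      have "ufq (uf \<sigma>) \<in> base_map ` A \<longleftrightarrow> q \<sigma> \<in> A" if "\<sigma> \<in> arrows \<Sigma>" for \<sigma>
        unfolding ufq_base[OF that] by (rule inj_on_image_mem_iff[OF base_map_inj q_arrow[OF that] AG])
      then show ?thesis unfolding T by auto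
    qed
    moreover have "base_map ` A \<subseteq> ufq ` topspace ?T"
    proof -
      have "base_map ` A \<subseteq> base_map ` arrows G" using AG by (rule image_mono)
      then show ?thesis unfolding im[symmetric]
        using quotient_imp_surjective_map[OF quotient_map_quotient_topology[of ?T ufq]] by simp
    qed
    ultimately show "openin (quotient_topology ?T ufq) (base_map ` A)" by (simp add: openin_quotient_topology)
  qed
qed

lemma base_iso: "groupoid_isomorphism G ufb base_map"
proof (rule groupoid_isomorphismI[OF G.algebraic base_homeomorphic])
  show "composable ufb = (\<lambda>(a, b). (base_map a, base_map b)) ` composable G"
  proof (intro equalityI subsetI)
    fix p assume "p \<in> composable ufb"
    then obtain a b where ab: "p = (ufq a, ufq b)" "(a, b) \<in> composable ufg" unfolding ufb_simps by blast
    then obtain \<sigma> \<tau> where s: "(\<sigma>, \<tau>) \<in> composable \<Sigma>" "a = uf \<sigma>" "b = uf \<tau>" unfolding ufg_composable by auto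
    then have S: "\<sigma> \<in> arrows \<Sigma>" "\<tau> \<in> arrows \<Sigma>" "G.sou (q \<sigma>) = G.ran (q \<tau>)" by (auto simp: S.composable_iff composable_eq)
    then have "(q \<sigma>, q \<tau>) \<in> composable G" by (simp add: G.composable_iff)
    moreover have "p = (base_map (q \<sigma>), base_map (q \<tau>))" using ab s S ufq_base by simp
    ultimately show "p \<in> (\<lambda>(a, b). (base_map a, base_map b)) ` composable G" by auto
  next
    fix p assume "p \<in> (\<lambda>(a, b). (base_map a, base_map b)) ` composable G"
    then obtain \<alpha> \<beta> where p: "p = (base_map \<alpha>, base_map \<beta>)" "(\<alpha>, \<beta>) \<in> composable G" by auto
    then have "(sec \<alpha>, sec \<beta>) \<in> composable \<Sigma>" by (simp add: G.composable_iff S.composable_iff composable_eq)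
    then have "(uf (sec \<alpha>), uf (sec \<beta>)) \<in> composable ufg" unfolding ufg_composable by auto
    then show "p \<in> composable ufb" unfolding ufb_simps using p(1) by (auto simp: base_map_def)
  qed
  show "gmult ufb (base_map \<alpha>) (base_map \<beta>) = base_map (\<alpha> \<cdot>\<^bsub>G\<^esub> \<beta>)" if ab: "(\<alpha>, \<beta>) \<in> composable G" for \<alpha> \<beta>
  proof -
    have A: "\<alpha> \<in> arrows G" "\<beta> \<in> arrows G" "G.sou \<alpha> = G.ran \<beta>" using ab by (auto simp: G.composable_iff)
    obtain \<sigma> where s: "\<sigma> \<in> arrows \<Sigma>" "q \<sigma> = \<alpha>" "rep (base_map \<alpha>) = uf \<sigma>" by (rule rep_base[OF A(1)])
    obtain \<tau> where t: "\<tau> \<in> arrows \<Sigma>" "q \<tau> = \<beta>" "rep (base_map \<beta>) = uf \<tau>" by (rule rep_base[OF A(2)])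
    have c: "(\<sigma>, \<tau>) \<in> composable \<Sigma>" using s t A by (simp add: S.composable_iff composable_eq)
    have "gmult ufb (base_map \<alpha>) (base_map \<beta>) = ufq (uf (\<sigma> \<cdot> \<tau>))"
      unfolding ufb_simps s(3) t(3) ufg_mult[OF c] ..
    also have "\<dots> = base_map (\<alpha> \<cdot>\<^bsub>G\<^esub> \<beta>)" using s t A ufq_base[of "\<sigma> \<cdot> \<tau>"] by simp
    finally show ?thesis .
  qed
  show "ginv ufb (base_map \<alpha>) = base_map (G.inv_of \<alpha>)" if a: "\<alpha> \<in> arrows G" for \<alpha>
  proof -
    obtain \<sigma> where s: "\<sigma> \<in> arrows \<Sigma>" "q \<sigma> = \<alpha>" "rep (base_map \<alpha>) = uf \<sigma>" by (rule rep_base[OF a])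
    have "ginv ufb (base_map \<alpha>) = ufq (uf (S.inv_of \<sigma>))" unfolding ufb_simps s(3) ufg_inv[OF s(1)] ..
    also have "\<dots> = base_map (G.inv_of \<alpha>)" using s ufq_base[of "S.inv_of \<sigma>"] by simp
    finally show ?thesis .
  qed
qed

lemma units_ufg: "units ufg = uf ` units \<Sigma>"
proof -
  interpret P: gpd_iso \<Sigma> ufg um by unfold_locales (rule um_iso)
  show ?thesis unfolding P.units_image by (rule image_cong[OF refl]) (rule ultrafilter_map_eq[OF S.unit_arrow])
qed

text \<open>The definite description has a unique solution because \<open>q\<close> is injective on
  units: a class contains at most one unit ultrafilter.\<close>

lemma inclusion_eq:
  assumes x: "x \<in> units G" and t: "t \<in> ring_units"
  shows "ultrafilter_inclusion alg dia (base_map x, t) = uf (i (x, t))"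
proof -
  have "(THE U. U \<in> units ufg \<and> ufq U = base_map x) = uf (i (x, 1))"
  proof (rule the_equality)
    show "uf (i (x, 1)) \<in> units ufg \<and> ufq (uf (i (x, 1))) = base_map x"
      unfolding units_ufg using x ufq_base[of "i (x, 1)"] by simp
    fix U assume "U \<in> units ufg \<and> ufq U = base_map x"
    then obtain y where y: "y \<in> units \<Sigma>" "U = uf y" "ufq (uf y) = base_map x" unfolding units_ufg by auto
    have "y \<in> arrows \<Sigma>" by (rule S.unit_arrow[OF y(1)])
    then have "q y = x" using y(3) ufq_base inj_onD[OF base_map_inj, of "q y" x] G.unit_arrow[OF x] by simp
    then show "U = uf (i (x, 1))" using unit_total[OF y(1)] y(2) by simp
  qed
  then show ?thesis unfolding ultrafilter_inclusion_def using scale_uf[of "i (x, 1)" t] x t by simp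
qed

lemma um_twist_isomorphism:
  "twist_isomorphism \<Sigma> i q G ufg (ultrafilter_inclusion alg dia) ufq ufb um"
proof -
  interpret twist_transport \<Sigma> i q G ufg "ultrafilter_inclusion alg dia" ufq ufb um base_map
  proof unfold_locales
    show "groupoid_isomorphism \<Sigma> ufg um" by (rule um_iso)
    show "groupoid_isomorphism G ufb base_map" by (rule base_iso)
    show "ultrafilter_inclusion alg dia (base_map x, t) = um (i (x, t))" if "x \<in> units G" "t \<in> ring_units" for x t
      using inclusion_eq[OF that] ultrafilter_map_eq that by simp
    show "ufq (um \<sigma>) = base_map (q \<sigma>)" if "\<sigma> \<in> arrows \<Sigma>" for \<sigma>
      using ufq_base[OF that] ultrafilter_map_eq[OF that] by simp
  qed
  show ?thesis by (rule twist_isomorphism)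
qed

end

text \<open>Since \<open>ultrafilter_map\<close> selects \<open>Y\<close> by a choice operator, the
  middle conjunct records that a suitable \<open>Y\<close> exists and that every \<open>Y\<close>
  gives the same ultrafilter.\<close>

theorem corollary9p3:
  fixes G :: "'g groupoid" and \<Sigma> :: "'s groupoid"
    and i :: "'g \<times> 'r::comm_ring_1 \<Rightarrow> 's" and q :: "'s \<Rightarrow> 'g" and X :: "'g set"
  assumes "reduced_ring TYPE('r)" and "indecomposable_ring TYPE('r)"
    and "ample_groupoid G" and "Hausdorff_space (arrow_topology G)"
    and "discrete_twist \<Sigma> i q G"
    and "X \<subseteq> units G" and "unit_space G closure_of X = units G"
    and "\<And>x. x \<in> X \<Longrightarrow> unique_product_property (interior_isotropy_group G x)"
  defines "A \<equiv> steinberg_algebra \<Sigma> i q G" and "B \<equiv> steinberg_diagonal \<Sigma> i q G"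
  shows "quasi_cartan_pair A B \<and>
    (\<forall>\<sigma> \<in> arrows \<Sigma>. (\<exists>Y. compact_open_bisection \<Sigma> Y \<and> \<sigma> \<in> Y) \<and>
      (\<forall>Y. compact_open_bisection \<Sigma> Y \<and> \<sigma> \<in> Y \<longrightarrow>
        ultrafilter_map \<Sigma> i q G \<sigma> = point_ultrafilter \<Sigma> i q G Y \<sigma>)) \<and>
    twist_isomorphism \<Sigma> i q G
      (ultrafilter_groupoid A B) (ultrafilter_inclusion A B) (ultrafilter_quotient A B)
      (ultrafilter_base_groupoid A B) (ultrafilter_map \<Sigma> i q G)"
proof -
  interpret upp_twist \<Sigma> i q G X by unfold_locales fact+
  have "\<exists>Y. compact_open_bisection \<Sigma> Y \<and> \<sigma> \<in> Y" if "\<sigma> \<in> arrows \<Sigma>" for \<sigma>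
    using uf_base[OF openin_topspace that] by metis
  then show ?thesis unfolding A_def B_def
    using quasi_cartan_pair_alg[OF indecomposable normaliser_nbis] um_twist_isomorphism
      ultrafilter_map_eq point_ultrafilter_eq by simp
qed

end
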